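(* The Leary-Minasyan group given by the finite presentation \[L=\langle t,a,b\,|\,[a,b],\ ta^2b^{-1}t^{-1}=a^2b,\ tab^2t^{-1}=a^{-1}b^2\rangle\] is a $GBS_2$ group which is not virtually a hierarchically hyperbolic group (no finite index subgroup of $L$ is a hierarchically hyperbolic group) but which is quasi-isometric to a hierarchically hyperbolic group.
   Context: A $GBS_2$ group is a group which is the fundamental group of a finite (connected) graph of groups in which all vertex and edge groups are isomorphic to $\mathbb{Z}^2$. Finitely generated groups are regarded as metric spaces via word metrics from finite generating sets when speaking of quasi-isometry. Hierarchically hyperbolic spaces (Behrstock-Hagen-Sisto). A quasigeodesic metric space $(X,d)$ is a hierarchically hyperbolic space (HHS) if there are $\delta\ge0$, an index set $\mathfrak{S}$ (its elements are called domains) and $\delta$-hyperbolic geodesic spaces $\{\mathcal{C}W: W\in\mathfrak{S}\}$ satisfying the following, where $d_W$ denotes distance in $\mathcal{C}W$ and $d_W(x,y)$ abbreviates $d_W(\pi_W(x),\pi_W(y))$ for $x,y \in X$ (similarly $d_W(x,p)$ abbreviates $d_W(\pi_W(x),p)$). (1) Projections: there are $\xi\ge 0$, $K$ and maps $\pi_W:X\to 2^{\mathcal{C}W}$ sending points to nonempty sets of diameter at most $\xi$, each $(K,K)$-coarsely Lipschitz, with $\pi_W(X)$ $K$-quasiconvex in $\mathcal{C}W$. (2) Nesting: $\mathfrak{S}$ has a partial order $\sqsubseteq$, and either $\mathfrak{S}=\emptyset$ or there is a unique $\sqsubseteq$-maximal element. Put $\mathfrak{S}_W=\{V: V\sqsubseteq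 W\}$. For $V\sqsubsetneq W$ there are a specified nonempty subset $\rho^V_W\subseteq\mathcal{C}W$ of diameter at most $\xi$ and a map $\rho^W_V:\mathcal{C}W\to 2^{\mathcal{C}V}$. (3) Orthogonality: $\mathfrak{S}$ has a symmetric anti-reflexive relation $\perp$; if $V\sqsubseteq W$ and $W\perp U$ then $V\perp U$; for each $T\in\mathfrak{S}$ and $U\in\mathfrak{S}_T$ with $\{V\in\mathfrak{S}_T: V\perp U\}\neq\emptyset$ there is $W\in\mathfrak{S}_T\setminus\{T\}$ such that $V\sqsubseteq W$ whenever $V\perp U$ and $V\sqsubseteq T$; if $V\perp W$ then $V,W$ are not $\sqsubseteq$-comparable. (4) Transversality and consistency: $V,W$ are transverse, $V\pitchfork W$, if they are not orthogonal and neither is nested in the other. There is $\kappa_0\ge0$ such that if $V\pitchfork W$ there are nonempty sets $\rho^V_W\subseteq\mathcal{C}W$, $\rho^W_V\subseteq\mathcal{C}V$ of diameter at most $\xi$ with $\min\{d_W(\pi_W(x),\rho^V_W),d_V(\pi_V(x),\rho^W_V)\}\le\kappa_0$ for all $x\in X$; if $V\sqsubsetneq W$ then $\min\{d_W(\pi_W(x),\rho^V_W),\mathrm{diam}_{\mathcal{C}V}(\pi_V(x)\cup\rho^W_V(\pi_W(x)))\}\le\kappa_0$ for all $x\in X$; and if $U\sqsubseteq V$ then $d_W(\rho^U_W,\rho^V_W)\le\kappa_0$ whenever $V\sqsubsetneq W$, or $V\pitchfork W$ and $W\not\perp U$. (5) Finite complexity: there is a bound on the cardinality of sets of pairwise $\sqsubseteq$-comparable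 elements. (6) Large links: there are $\lambda\ge1$ and $E\ge\max\{\xi,\kappa_0\}$ such that for $W\in\mathfrak{S}$, $x,x'\in X$ and $N=\lambda d_W(\pi_W(x),\pi_W(x'))+\lambda$, there are $T_1,\ldots,T_{\lfloor N\rfloor}\in\mathfrak{S}_W\setminus\{W\}$ such that every $T\in\mathfrak{S}_W\setminus\{W\}$ satisfies $T\in\mathfrak{S}_{T_i}$ for some $i$ or $d_T(\pi_T(x),\pi_T(x'))<E$; also $d_W(\pi_W(x),\rho^{T_i}_W)\le N$ for each $i$. (7) Bounded geodesic image: there is $E>0$ such that for all $W$, all $V\in\mathfrak{S}_W\setminus\{W\}$ and all geodesics $\gamma$ of $\mathcal{C}W$, either $\mathrm{diam}_{\mathcal{C}V}(\rho^W_V(\gamma))\le E$ or $\gamma$ meets the $E$-neighbourhood of $\rho^V_W$. (8) Partial realization: there is $\alpha$ such that for any family $\{V_j\}$ of pairwise orthogonal elements of $\mathfrak{S}$ and any $p_j\in\pi_{V_j}(X)$ there is $x\in X$ with $d_{V_j}(x,p_j)\le\alpha$ for all $j$; $d_V(x,\rho^{V_j}_V)\le\alpha$ for each $j$ and each $V$ with $V_j\sqsubsetneq V$; and $d_W(x,\rho^{V_j}_W)\le\alpha$ whenever $W\pitchfork V_j$ for some $j$. (9) Uniqueness: for each $\kappa\ge0$ there is $\theta(\kappa)$ such that if $x,y\in X$ and $d(x,y)\ge\theta(\kappa)$ then $d_V(x,y)\ge\kappa$ for some $V\in\mathfrak{S}$. Hierarchically hyperbolic groups. A finitely generated group $G$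 is a hierarchically hyperbolic group (HHG) if $X=G$ with a word metric from a finite generating set has an HHS structure $\mathfrak{S}$ (that is, $X=G$ with this word metric is a hierarchically hyperbolic space with index set $\mathfrak{S}$, hyperbolic spaces $\mathcal{C}W$, projections $\pi_W$, relations $\sqsubseteq$, $\perp$, $\pitchfork$ and sets and maps $\rho^V_W$ having all the properties required in the definition of a hierarchically hyperbolic space) such that: $G$ acts on $\mathfrak{S}$ with finitely many orbits, preserving $\sqsubseteq$, $\perp$ and $\pitchfork$; for each $g\in G$ and $U\in\mathfrak{S}$ there is an isometry $g:\mathcal{C}U\to\mathcal{C}(gU)$, and these satisfy that the isometry for $gh$ is the composition of those for $h$ and $g$; and $g(\pi_U(x))=\pi_{gU}(gx)$ for all $x\in G$, and $g(\rho^U_V)=\rho^{gU}_{gV}$ whenever $U\pitchfork V$ or $U\sqsubsetneq V$. *)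

theory Defs
  imports
    "HOL-Analysis.Abstract_Metric_Spaces"
    "HOL-Algebra.Elementary_Groups"
    "HOL-Algebra.Generated_Groups"
    "HOL-Algebra.Group_Action"
    "Graph_Theory.Bidirected_Digraph"
    "Graph_Theory.Digraph_Component"
begin

section \<open>Groups given by presentations\<close>

text \<open>
  A letter is a generator together with a sign: \<open>(x, True)\<close> stands for \<open>x\<close> and \<open>(x, False)\<close> for
  its formal inverse. A presentation is a set \<open>S\<close> of generators and a set \<open>R\<close> of pairs \<open>(l, r)\<close>
  of words, each standing for the relation \<open>l = r\<close>. The group is the set of all words over \<open>S\<close> modulo
  the least congruence that contains free cancellation and the relations; this is the quotient of
  the free group on \<open>S\<close> by the normal closure of all \<open>l r\<^sup>-\<^sup>1\<close>.
\<close>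

type_synonym 'g word = "('g \<times> bool) list"

abbreviation words_over :: "'g set \<Rightarrow> 'g word set" where
  "words_over S \<equiv> lists (S \<times> UNIV)"

inductive_set pres_rel :: "'g set \<Rightarrow> ('g word \<times> 'g word) set \<Rightarrow> ('g word \<times> 'g word) set"
  for S R where
    refl: "w \<in> words_over S \<Longrightarrow> (w, w) \<in> pres_rel S R"
  | sym: "(v, w) \<in> pres_rel S R \<Longrightarrow> (w, v) \<in> pres_rel S R"
  | trans: "(u, v) \<in> pres_rel S R \<Longrightarrow> (v, w) \<in> pres_rel S R \<Longrightarrow> (u, w) \<in> pres_rel S R"
  | cancel: "x \<in> S \<Longrightarrow> u \<in> words_over S \<Longrightarrow> v \<in> words_over S \<Longrightarrow>
      (u @ [(x, b), (x, \<not> b)] @ v, u @ v) \<in> pres_rel S R"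
  | relation: "(l, r) \<in> R \<Longrightarrow> l \<in> words_over S \<Longrightarrow> r \<in> words_over S \<Longrightarrow>
      u \<in> words_over S \<Longrightarrow> v \<in> words_over S \<Longrightarrow>
      (u @ l @ v, u @ r @ v) \<in> pres_rel S R"

definition presented_group :: "'g set \<Rightarrow> ('g word \<times> 'g word) set \<Rightarrow> 'g word set monoid" where
  "presented_group S R =
    \<lparr>carrier = words_over S // pres_rel S R,
     monoid.mult = (\<lambda>P Q. pres_rel S R `` {u @ v | u v. u \<in> P \<and> v \<in> Q}),
     one = pres_rel S R `` {[]}\<rparr>"

lemma pres_rel_words:
  "(u, v) \<in> pres_rel S R \<Longrightarrow> u \<in> words_over S \<and> v \<in> words_over S"
  by (induction rule: pres_rel.induct) auto

lemma equiv_pres_rel: "equiv (words_over S) (pres_rel S R)"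
  by (intro equivI refl_onI symI transI)
    (auto intro: pres_rel.intros dest: pres_rel_words simp del: in_lists_conv_set)

lemma pres_rel_context:
  assumes "(l, r) \<in> pres_rel S R" "u \<in> words_over S" "v \<in> words_over S"
  shows "(u @ l @ v, u @ r @ v) \<in> pres_rel S R"
  using assms(1)
proof induction
  case (refl w)
  then show ?case using assms(2,3) by (intro pres_rel.refl) auto
next
  case (cancel x u' v' b)
  then show ?case
    using pres_rel.cancel[of x S "u @ u'" "v' @ v" b R] assms(2,3) by simp
next
  case (relation l r u' v')
  then show ?case
    using pres_rel.relation[of l r R S "u @ u'" "v' @ v"] assms(2,3) by simp
qed (blast intro: pres_rel.sym pres_rel.trans)+

lemma pres_rel_append:
  assumes "(u, u') \<in> pres_rel S R" "(v, v') \<in> pres_rel S R"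
  shows "(u @ v, u' @ v') \<in> pres_rel S R"
proof -
  have "(u @ v, u' @ v) \<in> pres_rel S R"
    using pres_rel_context[OF assms(1), of "[]" v] pres_rel_words[OF assms(2)] by simp
  moreover have "(u' @ v, u' @ v') \<in> pres_rel S R"
    using pres_rel_context[OF assms(2), of u' "[]"] pres_rel_words[OF assms(1)] by simp
  ultimately show ?thesis by (rule pres_rel.trans)
qed

lemma presented_group_mult:
  assumes "u \<in> words_over S" "v \<in> words_over S"
  shows "pres_rel S R `` {u} \<otimes>\<^bsub>presented_group S R\<^esub> pres_rel S R `` {v} = pres_rel S R `` {u @ v}"
proof -
  have "(u, u) \<in> pres_rel S R" "(v, v) \<in> pres_rel S R"
    using assms by (auto intro: pres_rel.refl)
  then show ?thesis
    unfolding presented_group_def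
    by (auto intro: pres_rel.trans pres_rel_append)
qed

lemma words_over_inverse:
  "w \<in> words_over S \<Longrightarrow> rev (map (\<lambda>(x, b). (x, \<not> b)) w) \<in> words_over S"
  by (induction w) auto

lemma pres_rel_inverse:
  assumes "w \<in> words_over S"
  shows "(rev (map (\<lambda>(x, b). (x, \<not> b)) w) @ w, []) \<in> pres_rel S R"
  using assms
proof (induction w)
  case Nil
  then show ?case by (auto intro: pres_rel.refl)
next
  case (Cons a w)
  obtain x b where a: "a = (x, b)" by (cases a)
  let ?i = "rev (map (\<lambda>(x, b). (x, \<not> b)) w)"
  have "?i \<in> words_over S" using words_over_inverse[OF Cons.hyps(2)] .
  then have "(?i @ [(x, \<not> b), (x, \<not> \<not> b)] @ w, ?i @ w) \<in> pres_rel S R"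
    using Cons.hyps a by (intro pres_rel.cancel) auto
  moreover have "(?i @ w, []) \<in> pres_rel S R"
    using Cons.IH .
  ultimately show ?case using a by (auto intro: pres_rel.trans)
qed

lemma group_presented_group: "group (presented_group S R)"
proof (rule groupI)
  let ?G = "presented_group S R" and ?E = "pres_rel S R"
  have car: "x \<in> carrier ?G \<longleftrightarrow> (\<exists>w \<in> words_over S. x = ?E `` {w})" for x
    by (auto simp: presented_group_def quotient_def)
  have one: "\<one>\<^bsub>?G\<^esub> = ?E `` {[]}" by (simp add: presented_group_def)
  note mult = presented_group_mult[of _ S _ R]
  show "\<one>\<^bsub>?G\<^esub> \<in> carrier ?G" unfolding car one by (rule bexI[of _ "[]"]) auto
  fix x assume "x \<in> carrier ?G"
  then obtain u where u: "u \<in> words_over S" "x = ?E `` {u}" unfolding car by blast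
  show "\<one>\<^bsub>?G\<^esub> \<otimes>\<^bsub>?G\<^esub> x = x" using u by (simp add: one mult del: in_lists_conv_set)
  let ?i = "rev (map (\<lambda>(x, b). (x, \<not> b)) u)"
  have i: "?i \<in> words_over S" using words_over_inverse[OF u(1)] .
  show "\<exists>y\<in>carrier ?G. y \<otimes>\<^bsub>?G\<^esub> x = \<one>\<^bsub>?G\<^esub>"
  proof (rule bexI[of _ "?E `` {?i}"])
    show "?E `` {?i} \<otimes>\<^bsub>?G\<^esub> x = \<one>\<^bsub>?G\<^esub>"
      unfolding u(2) one mult[OF i u(1)]
      by (rule equiv_class_eq[OF equiv_pres_rel pres_rel_inverse[OF u(1)]])
    show "?E `` {?i} \<in> carrier ?G" unfolding car using i by blast
  qed
  fix y assume "y \<in> carrier ?G"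
  then obtain v where v: "v \<in> words_over S" "y = ?E `` {v}" unfolding car by blast
  have uv: "u @ v \<in> words_over S" using u(1) v(1) by auto
  show "x \<otimes>\<^bsub>?G\<^esub> y \<in> carrier ?G"
    unfolding u(2) v(2) mult[OF u(1) v(1)] car using uv by blast
  fix z assume "z \<in> carrier ?G"
  then obtain w where w: "w \<in> words_over S" "z = ?E `` {w}" unfolding car by blast
  have vw: "v @ w \<in> words_over S" using w(1) v(1) by auto
  show "x \<otimes>\<^bsub>?G\<^esub> y \<otimes>\<^bsub>?G\<^esub> z = x \<otimes>\<^bsub>?G\<^esub> (y \<otimes>\<^bsub>?G\<^esub> z)"
    unfolding u(2) v(2) w(2) mult[OF u(1) v(1)] mult[OF v(1) w(1)] mult[OF uv w(1)]
      mult[OF u(1) vw] by simp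
qed


section \<open>The Leary-Minasyan group\<close>

datatype lm_gen = GT | GA | GB

definition lm_relations :: "(lm_gen word \<times> lm_gen word) set" where
  "lm_relations = (let
      t = (GT, True); a = (GA, True); b = (GB, True);
      t' = (GT, False); a' = (GA, False); b' = (GB, False)
    in {([a, b, a', b'], []),
        ([t, a, a, b', t'], [a, a, b]),
        ([t, a, b, b, t'], [a', b, b])})"

definition leary_minasyan :: "lm_gen word set monoid" where
  "leary_minasyan = presented_group UNIV lm_relations"


section \<open>Graphs of groups and generalised Baumslag-Solitar groups of rank two\<close>

text \<open>
  Graphs are in the sense of Serre: every geometric edge is represented by two oriented arcs
  that are exchanged by the fixed-point-free involution \<open>edge_rev\<close>. The two arcs carry the same
  group, and \<open>edge_emb e\<close> embeds the group of \<open>e\<close> into the vertex group at the head of \<open>e\<close>.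
\<close>

record ('v, 'e, 'a, 'c) graph_of_groups =
  base_graph :: "('v, 'e) pre_digraph"
  edge_rev :: "'e \<Rightarrow> 'e"
  vertex_group :: "'v \<Rightarrow> 'a monoid"
  edge_group :: "'e \<Rightarrow> 'c monoid"
  edge_emb :: "'e \<Rightarrow> 'c \<Rightarrow> 'a"

text \<open>In a graph with edge reversal, strong connectedness is connectedness.\<close>

definition connected_graph_of_groups :: "('v, 'e, 'a, 'c) graph_of_groups \<Rightarrow> bool" where
  "connected_graph_of_groups \<G> \<longleftrightarrow>
    bidirected_digraph (base_graph \<G>) (edge_rev \<G>) \<and>
    strongly_connected (base_graph \<G>) \<and>
    (\<forall>v \<in> verts (base_graph \<G>). group (vertex_group \<G> v)) \<and>
    (\<forall>e \<in> arcs (base_graph \<G>).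
       group (edge_group \<G> e) \<and>
       edge_group \<G> (edge_rev \<G> e) = edge_group \<G> e \<and>
       edge_emb \<G> e \<in> mon (edge_group \<G> e) (vertex_group \<G> (head (base_graph \<G>) e)))"

text \<open>
  Serre's group \<open>F(\<G>)\<close>, generated by the vertex groups and the arcs subject to
  \<open>rev e = e\<^sup>-\<^sup>1\<close> and \<open>e (emb e c) e\<^sup>-\<^sup>1 = emb (rev e) c\<close> for \<open>c\<close> in the group of \<open>e\<close>.
\<close>

definition path_group_gens :: "('v, 'e, 'a, 'c) graph_of_groups \<Rightarrow> ('v \<times> 'a + 'e) set" where
  "path_group_gens \<G> =
    {Inl (v, g) | v g. v \<in> verts (base_graph \<G>) \<and> g \<in> carrier (vertex_group \<G> v)} \<union>
    {Inr e | e. e \<in> arcs (base_graph \<G>)}"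

definition path_group_rels ::
  "('v, 'e, 'a, 'c) graph_of_groups \<Rightarrow> (('v \<times> 'a + 'e) word \<times> ('v \<times> 'a + 'e) word) set" where
  "path_group_rels \<G> =
    {([(Inl (v, g), True), (Inl (v, h), True)], [(Inl (v, g \<otimes>\<^bsub>vertex_group \<G> v\<^esub> h), True)]) | v g h.
       v \<in> verts (base_graph \<G>) \<and> g \<in> carrier (vertex_group \<G> v) \<and> h \<in> carrier (vertex_group \<G> v)} \<union>
    {([(Inr (edge_rev \<G> e), True)], [(Inr e, False)]) | e. e \<in> arcs (base_graph \<G>)} \<union>
    {([(Inr e, True), (Inl (head (base_graph \<G>) e, edge_emb \<G> e c), True), (Inr e, False)],
      [(Inl (tail (base_graph \<G>) e, edge_emb \<G> (edge_rev \<G> e) c), True)]) | e c.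
       e \<in> arcs (base_graph \<G>) \<and> c \<in> carrier (edge_group \<G> e)}"

text \<open>
  \<open>gog_path \<G> v w u\<close>: the word \<open>w\<close> has the form \<open>g\<^sub>0 e\<^sub>1 g\<^sub>1 \<dots> e\<^sub>n g\<^sub>n\<close> where \<open>e\<^sub>1, \<dots>, e\<^sub>n\<close> is an
  edge path from \<open>v\<close> to \<open>u\<close> and each \<open>g\<^sub>i\<close> lies in the group of the \<open>i\<close>-th vertex of that path.
\<close>

inductive gog_path :: "('v, 'e, 'a, 'c) graph_of_groups \<Rightarrow> 'v \<Rightarrow> ('v \<times> 'a + 'e) word \<Rightarrow> 'v \<Rightarrow> bool"
  for \<G> where
    base: "v \<in> verts (base_graph \<G>) \<Longrightarrow> g \<in> carrier (vertex_group \<G> v) \<Longrightarrow>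
      gog_path \<G> v [(Inl (v, g), True)] v"
  | step: "e \<in> arcs (base_graph \<G>) \<Longrightarrow> g \<in> carrier (vertex_group \<G> (tail (base_graph \<G>) e)) \<Longrightarrow>
      gog_path \<G> (head (base_graph \<G>) e) w u \<Longrightarrow>
      gog_path \<G> (tail (base_graph \<G>) e)
        ([(Inl (tail (base_graph \<G>) e, g), True), (Inr e, True)] @ w) u"

definition gog_fundamental_group ::
  "('v, 'e, 'a, 'c) graph_of_groups \<Rightarrow> 'v \<Rightarrow> ('v \<times> 'a + 'e) word set monoid" where
  "gog_fundamental_group \<G> v =
    (presented_group (path_group_gens \<G>) (path_group_rels \<G>))
      \<lparr>carrier := {pres_rel (path_group_gens \<G>) (path_group_rels \<G>) `` {w} | w. gog_path \<G> v w v}\<rparr>"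

abbreviation Z2_group :: "(int \<times> int) monoid" where
  "Z2_group \<equiv> integer_group \<times>\<times> integer_group"

text \<open>
  The graph is finite and the vertex and edge groups are countable, so up to isomorphism nothing
  is lost by taking vertices and arcs to be natural numbers and the groups to live on \<open>int \<times> int\<close>.
\<close>

definition GBS2 :: "('a, 'b) monoid_scheme \<Rightarrow> bool" where
  "GBS2 G \<longleftrightarrow> group G \<and>
    (\<exists>(\<G> :: (nat, nat, int \<times> int, int \<times> int) graph_of_groups) v.
       connected_graph_of_groups \<G> \<and> fin_digraph (base_graph \<G>) \<and>
       (\<forall>u \<in> verts (base_graph \<G>). vertex_group \<G> u \<cong> Z2_group) \<and>
       (\<forall>e \<in> arcs (base_graph \<G>). edge_group \<G> e \<cong> Z2_group) \<and>
       v \<in> verts (base_graph \<G>) \<and>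
       G \<cong> gog_fundamental_group \<G> v)"


section \<open>Word metrics and quasi-isometry\<close>

definition word_norm :: "('a, 'b) monoid_scheme \<Rightarrow> 'a set \<Rightarrow> 'a \<Rightarrow> nat" where
  "word_norm G A g =
    (LEAST n. \<exists>ws. length ws = n \<and> set ws \<subseteq> A \<union> m_inv G ` A \<and> foldr (monoid.mult G) ws \<one>\<^bsub>G\<^esub> = g)"

text \<open>
  The value outside the carrier is immaterial, but \<^locale>\<open>Metric_space\<close> wants a total function
  that is nonnegative and symmetric everywhere.
\<close>

definition word_dist :: "('a, 'b) monoid_scheme \<Rightarrow> 'a set \<Rightarrow> 'a \<Rightarrow> 'a \<Rightarrow> real" where
  "word_dist G A g h =
    (if g \<in> carrier G \<and> h \<in> carrier G then real (word_norm G A (inv\<^bsub>G\<^esub> g \<otimes>\<^bsub>G\<^esub> h)) else 0)"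

definition word_metric :: "('a, 'b) monoid_scheme \<Rightarrow> 'a set \<Rightarrow> 'a metric" where
  "word_metric G A = metric (carrier G, word_dist G A)"

definition finite_generating_set :: "('a, 'b) monoid_scheme \<Rightarrow> 'a set \<Rightarrow> bool" where
  "finite_generating_set G A \<longleftrightarrow> finite A \<and> A \<subseteq> carrier G \<and> generate G A = carrier G"

context group
begin

lemma foldr_mult_append:
  assumes "set us \<subseteq> carrier G" "set vs \<subseteq> carrier G"
  shows "foldr (\<otimes>) us \<one> \<in> carrier G"
    and "foldr (\<otimes>) (us @ vs) \<one> = foldr (\<otimes>) us \<one> \<otimes> foldr (\<otimes>) vs \<one>"
proof -
  have closed: "set ws \<subseteq> carrier G \<Longrightarrow> foldr (\<otimes>) ws \<one> \<in> carrier G" for ws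
    by (induction ws) auto
  then show "foldr (\<otimes>) us \<one> \<in> carrier G" using assms(1) .
  show "foldr (\<otimes>) (us @ vs) \<one> = foldr (\<otimes>) us \<one> \<otimes> foldr (\<otimes>) vs \<one>"
    using assms by (induction us) (auto simp: m_assoc closed simp del: foldr_append)
qed

lemma word_norm_le:
  assumes "set ws \<subseteq> A \<union> m_inv G ` A" "foldr (\<otimes>) ws \<one> = g"
  shows "word_norm G A g \<le> length ws"
  unfolding word_norm_def using assms by (intro Least_le) blast

lemma word_norm_ex:
  assumes "A \<subseteq> carrier G" "g \<in> generate G A"
  obtains ws where "set ws \<subseteq> A \<union> m_inv G ` A" "foldr (\<otimes>) ws \<one> = g" "length ws = word_norm G A g"
proof -
  have sub: "A \<union> m_inv G ` A \<subseteq> carrier G" using assms(1) by auto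
  have "\<exists>ws. set ws \<subseteq> A \<union> m_inv G ` A \<and> foldr (\<otimes>) ws \<one> = g"
    using assms(2)
  proof induction
    case one
    then show ?case by (intro exI[of _ "[]"]) auto
  next
    case (incl h)
    then show ?case using assms(1) by (intro exI[of _ "[h]"]) auto
  next
    case (inv h)
    then show ?case using assms(1) by (intro exI[of _ "[inv h]"]) auto
  next
    case (eng h1 h2)
    then obtain us vs where "set us \<subseteq> A \<union> m_inv G ` A" "foldr (\<otimes>) us \<one> = h1"
      "set vs \<subseteq> A \<union> m_inv G ` A" "foldr (\<otimes>) vs \<one> = h2" by blast
    then show ?case
      using foldr_mult_append(2)[of us vs] sub by (intro exI[of _ "us @ vs"]) auto
  qed
  then have "\<exists>n ws. length ws = n \<and> set ws \<subseteq> A \<union> m_inv G ` A \<and> foldr (\<otimes>) ws \<one> = g" by blast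
  from LeastI_ex[OF this] show ?thesis
    using that unfolding word_norm_def by blast
qed

lemma word_norm_inv_le:
  assumes "A \<subseteq> carrier G" "g \<in> generate G A"
  shows "word_norm G A (inv g) \<le> word_norm G A g"
proof -
  obtain ws where ws: "set ws \<subseteq> A \<union> m_inv G ` A" "foldr (\<otimes>) ws \<one> = g"
    "length ws = word_norm G A g"
    using word_norm_ex[OF assms] .
  have sub: "A \<union> m_inv G ` A \<subseteq> carrier G" using assms(1) by auto
  have "set us \<subseteq> A \<union> m_inv G ` A \<Longrightarrow>
      set (rev (map (m_inv G) us)) \<subseteq> A \<union> m_inv G ` A \<and>
      foldr (\<otimes>) (rev (map (m_inv G) us)) \<one> = inv (foldr (\<otimes>) us \<one>)" for us
  proof (induction us)
    case (Cons a us)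
    have a: "a \<in> carrier G" and us: "set us \<subseteq> carrier G" using Cons.prems sub by auto
    have "inv a \<in> A \<union> m_inv G ` A" using Cons.prems assms(1) by auto
    then show ?case
      using Cons a foldr_mult_append(1)[OF us us]
        foldr_mult_append(2)[of "rev (map (m_inv G) us)" "[inv a]"] us
      by (auto simp: inv_mult_group simp del: foldr_append)
  qed simp
  from word_norm_le[of "rev (map (m_inv G) ws)"] this[OF ws(1)] ws show ?thesis by auto
qed

lemma Metric_space_word_dist:
  assumes "finite_generating_set G A"
  shows "Metric_space (carrier G) (word_dist G A)"
proof -
  have A: "A \<subseteq> carrier G" "generate G A = carrier G"
    using assms by (auto simp: finite_generating_set_def)
  have sub: "A \<union> m_inv G ` A \<subseteq> carrier G" using A(1) by auto
  show ?thesis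
  proof
    fix x y
    show "0 \<le> word_dist G A x y" by (simp add: word_dist_def)
    show "word_dist G A x y = word_dist G A y x"
    proof (cases "x \<in> carrier G \<and> y \<in> carrier G")
      case True
      then have "inv (inv x \<otimes> y) = inv y \<otimes> x" "inv (inv y \<otimes> x) = inv x \<otimes> y"
        by (simp_all add: inv_mult_group)
      then have "word_norm G A (inv x \<otimes> y) = word_norm G A (inv y \<otimes> x)"
        using word_norm_inv_le[OF A(1), of "inv x \<otimes> y"] word_norm_inv_le[OF A(1), of "inv y \<otimes> x"]
          True A(2) by auto
      then show ?thesis using True by (simp add: word_dist_def)
    qed (auto simp: word_dist_def)
  next
    fix x y assume xy: "x \<in> carrier G" "y \<in> carrier G"
    obtain ws where ws: "set ws \<subseteq> A \<union> m_inv G ` A" "foldr (\<otimes>) ws \<one> = inv x \<otimes> y"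
      "length ws = word_norm G A (inv x \<otimes> y)"
      using word_norm_ex[OF A(1), of "inv x \<otimes> y"] xy A(2) by auto
    have "word_norm G A \<one> = 0" using word_norm_le[of "[]" A \<one>] by simp
    moreover have "inv x \<otimes> y = \<one> \<Longrightarrow> x = y" using xy by (metis inv_equality inv_inv inv_closed)
    ultimately show "word_dist G A x y = 0 \<longleftrightarrow> x = y"
      using ws xy by (auto simp: word_dist_def)
  next
    fix x y z assume xyz: "x \<in> carrier G" "y \<in> carrier G" "z \<in> carrier G"
    obtain us where us: "set us \<subseteq> A \<union> m_inv G ` A" "foldr (\<otimes>) us \<one> = inv x \<otimes> y"
      "length us = word_norm G A (inv x \<otimes> y)"
      using word_norm_ex[OF A(1), of "inv x \<otimes> y"] xyz A(2) by auto
    obtain vs where vs: "set vs \<subseteq> A \<union> m_inv G ` A" "foldr (\<otimes>) vs \<one> = inv y \<otimes> z"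
      "length vs = word_norm G A (inv y \<otimes> z)"
      using word_norm_ex[OF A(1), of "inv y \<otimes> z"] xyz A(2) by auto
    have "foldr (\<otimes>) (us @ vs) \<one> = (inv x \<otimes> y) \<otimes> (inv y \<otimes> z)"
      using foldr_mult_append(2)[of us vs] us vs sub by auto
    also have "\<dots> = inv x \<otimes> (y \<otimes> inv y) \<otimes> z" using xyz by (simp only: m_assoc m_closed inv_closed)
    also have "\<dots> = inv x \<otimes> z" using xyz by simp
    finally have "word_norm G A (inv x \<otimes> z) \<le> length (us @ vs)"
      using word_norm_le[of "us @ vs" A] us vs by auto
    then show "word_dist G A x z \<le> word_dist G A x y + word_dist G A y z"
      using us vs xyz by (simp add: word_dist_def)
  qed
qed

lemma word_metric_simps:
  assumes "finite_generating_set G A"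
  shows "mspace (word_metric G A) = carrier G" "mdist (word_metric G A) = word_dist G A"
  using Metric_space_word_dist[OF assms] Metric_space.mspace_metric Metric_space.mdist_metric
  by (auto simp: word_metric_def)

end

definition quasi_isometric :: "'x metric \<Rightarrow> 'y metric \<Rightarrow> bool" where
  "quasi_isometric X Y \<longleftrightarrow>
    (\<exists>f K C. K \<ge> 1 \<and> C \<ge> 0 \<and> f \<in> mspace X \<rightarrow> mspace Y \<and>
       (\<forall>x \<in> mspace X. \<forall>x' \<in> mspace X.
          mdist X x x' / K - C \<le> mdist Y (f x) (f x') \<and>
          mdist Y (f x) (f x') \<le> K * mdist X x x' + C) \<and>
       (\<forall>y \<in> mspace Y. \<exists>x \<in> mspace X. mdist Y (f x) y \<le> C))"

definition quasi_isometric_groups ::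
  "('a, 'b) monoid_scheme \<Rightarrow> ('c, 'd) monoid_scheme \<Rightarrow> bool" where
  "quasi_isometric_groups G H \<longleftrightarrow>
    (\<exists>A B. finite_generating_set G A \<and> finite_generating_set H B \<and>
       quasi_isometric (word_metric G A) (word_metric H B))"

definition quasigeodesic_space :: "'x metric \<Rightarrow> bool" where
  "quasigeodesic_space X \<longleftrightarrow>
    (\<exists>K c. K \<ge> 1 \<and> c \<ge> 0 \<and>
       (\<forall>x \<in> mspace X. \<forall>y \<in> mspace X. \<exists>\<gamma> l. l \<ge> 0 \<and> \<gamma> \<in> {0..l} \<rightarrow> mspace X \<and> \<gamma> 0 = x \<and> \<gamma> l = y \<and>
          (\<forall>s \<in> {0..l}. \<forall>t \<in> {0..l :: real}.
             \<bar>s - t\<bar> / K - c \<le> mdist X (\<gamma> s) (\<gamma> t) \<and>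
             mdist X (\<gamma> s) (\<gamma> t) \<le> K * \<bar>s - t\<bar> + c)))"


section \<open>Hyperbolic geodesic spaces\<close>

definition geodesic_segment :: "'p metric \<Rightarrow> 'p set \<Rightarrow> 'p \<Rightarrow> 'p \<Rightarrow> bool" where
  "geodesic_segment C S x y \<longleftrightarrow>
    (\<exists>\<gamma> l. l \<ge> 0 \<and> \<gamma> \<in> {0..l} \<rightarrow> mspace C \<and>
       (\<forall>s \<in> {0..l}. \<forall>t \<in> {0..l :: real}. mdist C (\<gamma> s) (\<gamma> t) = \<bar>s - t\<bar>) \<and>
       \<gamma> 0 = x \<and> \<gamma> l = y \<and> S = \<gamma> ` {0..l})"

definition geodesic_space :: "'p metric \<Rightarrow> bool" where
  "geodesic_space C \<longleftrightarrow> (\<forall>x \<in> mspace C. \<forall>y \<in> mspace C. \<exists>S. geodesic_segment C S x y)"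

definition cnbhd :: "'p metric \<Rightarrow> real \<Rightarrow> 'p set \<Rightarrow> 'p set" where
  "cnbhd C r S = {p \<in> mspace C. \<exists>q \<in> S. mdist C p q \<le> r}"

text \<open>Gromov hyperbolicity: every geodesic triangle is \<open>\<delta>\<close>-slim.\<close>

definition hyperbolic :: "real \<Rightarrow> 'p metric \<Rightarrow> bool" where
  "hyperbolic \<delta> C \<longleftrightarrow>
    (\<forall>x y z S1 S2 S3.
       geodesic_segment C S1 x y \<and> geodesic_segment C S2 y z \<and> geodesic_segment C S3 z x \<longrightarrow>
       S1 \<subseteq> cnbhd C \<delta> (S2 \<union> S3))"

definition quasiconvex :: "real \<Rightarrow> 'p metric \<Rightarrow> 'p set \<Rightarrow> bool" where
  "quasiconvex k C Y \<longleftrightarrow>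
    (\<forall>x \<in> Y. \<forall>y \<in> Y. \<forall>S. geodesic_segment C S x y \<longrightarrow> S \<subseteq> cnbhd C k Y)"

text \<open>\<open>diam_le C S r\<close> says that the diameter of \<open>S\<close>, possibly infinite, is at most \<open>r\<close>.\<close>

definition diam_le :: "'p metric \<Rightarrow> 'p set \<Rightarrow> real \<Rightarrow> bool" where
  "diam_le C S r \<longleftrightarrow> (\<forall>x \<in> S. \<forall>y \<in> S. mdist C x y \<le> r)"

text \<open>The distance between two nonempty sets is the infimum of the distances of their points.\<close>

definition set_mdist :: "'p metric \<Rightarrow> 'p set \<Rightarrow> 'p set \<Rightarrow> real" where
  "set_mdist C S S' = Inf {mdist C x y | x y. x \<in> S \<and> y \<in> S'}"


section \<open>Hierarchically hyperbolic spaces\<close>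

text \<open>
  \<open>rho \<HH> V W\<close> is the set \<open>\<rho>\<^sup>V\<^sub>W \<subseteq> CW\<close>, meaningful when \<open>V\<close> is properly nested in or transverse
  to \<open>W\<close>; \<open>rho_map \<HH> W V\<close> is the map \<open>\<rho>\<^sup>W\<^sub>V\<close> from \<open>CW\<close> to subsets of \<open>CV\<close>, meaningful when \<open>V\<close>
  is properly nested in \<open>W\<close>.
\<close>

record ('x, 'i, 'p) hhs_data =
  domains :: "'i set"
  hspace :: "'i \<Rightarrow> 'p metric"
  proj :: "'i \<Rightarrow> 'x \<Rightarrow> 'p set"
  nest :: "'i \<Rightarrow> 'i \<Rightarrow> bool"
  orth :: "'i \<Rightarrow> 'i \<Rightarrow> bool"
  rho :: "'i \<Rightarrow> 'i \<Rightarrow> 'p set"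
  rho_map :: "'i \<Rightarrow> 'i \<Rightarrow> 'p \<Rightarrow> 'p set"

definition pnest :: "('x, 'i, 'p) hhs_data \<Rightarrow> 'i \<Rightarrow> 'i \<Rightarrow> bool" where
  "pnest \<HH> V W \<longleftrightarrow> nest \<HH> V W \<and> V \<noteq> W"

definition transverse :: "('x, 'i, 'p) hhs_data \<Rightarrow> 'i \<Rightarrow> 'i \<Rightarrow> bool" where
  "transverse \<HH> V W \<longleftrightarrow> \<not> orth \<HH> V W \<and> \<not> nest \<HH> V W \<and> \<not> nest \<HH> W V"

text \<open>\<open>below \<HH> W\<close> is \<open>\<SS>\<^sub>W\<close>.\<close>

definition below :: "('x, 'i, 'p) hhs_data \<Rightarrow> 'i \<Rightarrow> 'i set" where
  "below \<HH> W = {V \<in> domains \<HH>. nest \<HH> V W}"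

abbreviation dW :: "('x, 'i, 'p) hhs_data \<Rightarrow> 'i \<Rightarrow> 'p set \<Rightarrow> 'p set \<Rightarrow> real" where
  "dW \<HH> W \<equiv> set_mdist (hspace \<HH> W)"

definition hhs_projections :: "'x metric \<Rightarrow> ('x, 'i, 'p) hhs_data \<Rightarrow> real \<Rightarrow> real \<Rightarrow> bool" where
  "hhs_projections X \<HH> \<xi> K \<longleftrightarrow>
    (\<forall>W \<in> domains \<HH>.
       (\<forall>x \<in> mspace X. proj \<HH> W x \<subseteq> mspace (hspace \<HH> W) \<and> proj \<HH> W x \<noteq> {} \<and>
          diam_le (hspace \<HH> W) (proj \<HH> W x) \<xi>) \<and>
       (\<forall>x \<in> mspace X. \<forall>y \<in> mspace X. dW \<HH> W (proj \<HH> W x) (proj \<HH> W y) \<le> K * mdist X x y + K) \<and>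
       quasiconvex K (hspace \<HH> W) (\<Union>x \<in> mspace X. proj \<HH> W x))"

definition hhs_nesting :: "('x, 'i, 'p) hhs_data \<Rightarrow> real \<Rightarrow> bool" where
  "hhs_nesting \<HH> \<xi> \<longleftrightarrow>
    reflp_on (domains \<HH>) (nest \<HH>) \<and> transp_on (domains \<HH>) (nest \<HH>) \<and>
    antisymp_on (domains \<HH>) (nest \<HH>) \<and>
    (domains \<HH> = {} \<or> (\<exists>!S. S \<in> domains \<HH> \<and> (\<forall>W \<in> domains \<HH>. nest \<HH> S W \<longrightarrow> W = S))) \<and>
    (\<forall>V \<in> domains \<HH>. \<forall>W \<in> domains \<HH>. pnest \<HH> V W \<longrightarrow>
       rho \<HH> V W \<noteq> {} \<and> rho \<HH> V W \<subseteq> mspace (hspace \<HH> W) \<and> diam_le (hspace \<HH> W) (rho \<HH> V W) \<xi> \<and>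
       (\<forall>p \<in> mspace (hspace \<HH> W). rho_map \<HH> W V p \<subseteq> mspace (hspace \<HH> V)))"

definition hhs_orthogonality :: "('x, 'i, 'p) hhs_data \<Rightarrow> bool" where
  "hhs_orthogonality \<HH> \<longleftrightarrow>
    symp_on (domains \<HH>) (orth \<HH>) \<and> irreflp_on (domains \<HH>) (orth \<HH>) \<and>
    (\<forall>U \<in> domains \<HH>. \<forall>V \<in> domains \<HH>. \<forall>W \<in> domains \<HH>.
       nest \<HH> V W \<and> orth \<HH> W U \<longrightarrow> orth \<HH> V U) \<and>
    (\<forall>T \<in> domains \<HH>. \<forall>U \<in> below \<HH> T. {V \<in> below \<HH> T. orth \<HH> V U} \<noteq> {} \<longrightarrow>
       (\<exists>W \<in> below \<HH> T - {T}. \<forall>V \<in> domains \<HH>. orth \<HH> V U \<and> nest \<HH> V T \<longrightarrow> nest \<HH> V W)) \<and>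
    (\<forall>V \<in> domains \<HH>. \<forall>W \<in> domains \<HH>. orth \<HH> V W \<longrightarrow> \<not> nest \<HH> V W \<and> \<not> nest \<HH> W V)"

definition hhs_consistency :: "'x metric \<Rightarrow> ('x, 'i, 'p) hhs_data \<Rightarrow> real \<Rightarrow> real \<Rightarrow> bool" where
  "hhs_consistency X \<HH> \<xi> \<kappa>\<^sub>0 \<longleftrightarrow>
    (\<forall>V \<in> domains \<HH>. \<forall>W \<in> domains \<HH>. transverse \<HH> V W \<longrightarrow>
       rho \<HH> V W \<noteq> {} \<and> rho \<HH> V W \<subseteq> mspace (hspace \<HH> W) \<and> diam_le (hspace \<HH> W) (rho \<HH> V W) \<xi> \<and>
       rho \<HH> W V \<noteq> {} \<and> rho \<HH> W V \<subseteq> mspace (hspace \<HH> V) \<and> diam_le (hspace \<HH> V) (rho \<HH> W V) \<xi> \<and>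
       (\<forall>x \<in> mspace X. min (dW \<HH> W (proj \<HH> W x) (rho \<HH> V W)) (dW \<HH> V (proj \<HH> V x) (rho \<HH> W V)) \<le> \<kappa>\<^sub>0)) \<and>
    (\<forall>V \<in> domains \<HH>. \<forall>W \<in> domains \<HH>. pnest \<HH> V W \<longrightarrow>
       (\<forall>x \<in> mspace X. dW \<HH> W (proj \<HH> W x) (rho \<HH> V W) \<le> \<kappa>\<^sub>0 \<or>
          diam_le (hspace \<HH> V) (proj \<HH> V x \<union> (\<Union>p \<in> proj \<HH> W x. rho_map \<HH> W V p)) \<kappa>\<^sub>0)) \<and>
    (\<forall>U \<in> domains \<HH>. \<forall>V \<in> domains \<HH>. \<forall>W \<in> domains \<HH>.
       nest \<HH> U V \<and> (pnest \<HH> V W \<or> (transverse \<HH> V W \<and> \<not> orth \<HH> W U)) \<longrightarrow>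
       dW \<HH> W (rho \<HH> U W) (rho \<HH> V W) \<le> \<kappa>\<^sub>0)"

definition hhs_finite_complexity :: "('x, 'i, 'p) hhs_data \<Rightarrow> bool" where
  "hhs_finite_complexity \<HH> \<longleftrightarrow>
    (\<exists>n :: nat. \<forall>F \<subseteq> domains \<HH>. (\<forall>V \<in> F. \<forall>W \<in> F. nest \<HH> V W \<or> nest \<HH> W V) \<longrightarrow>
       finite F \<and> card F \<le> n)"

text \<open>
  The list \<open>T\<^sub>1, \<dots>, T\<^bsub>\<lfloor>N\<rfloor>\<^esub>\<close> is read as a set of at most \<open>\<lfloor>N\<rfloor>\<close> domains: since \<open>N \<ge> 1\<close>,
  insisting on actual members would rule out \<open>\<sqsubseteq>\<close>-minimal domains \<open>W\<close>, for which \<open>\<SS>\<^sub>W - {W}\<close> is empty.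
\<close>

definition hhs_large_links :: "'x metric \<Rightarrow> ('x, 'i, 'p) hhs_data \<Rightarrow> real \<Rightarrow> real \<Rightarrow> bool" where
  "hhs_large_links X \<HH> \<xi> \<kappa>\<^sub>0 \<longleftrightarrow>
    (\<exists>\<Lambda> E. \<Lambda> \<ge> 1 \<and> E \<ge> max \<xi> \<kappa>\<^sub>0 \<and>
       (\<forall>W \<in> domains \<HH>. \<forall>x \<in> mspace X. \<forall>x' \<in> mspace X.
          let N = \<Lambda> * dW \<HH> W (proj \<HH> W x) (proj \<HH> W x') + \<Lambda> in
          \<exists>\<T> \<subseteq> below \<HH> W - {W}. finite \<T> \<and> int (card \<T>) \<le> \<lfloor>N\<rfloor> \<and>
            (\<forall>T \<in> below \<HH> W - {W}.
               (\<exists>T' \<in> \<T>. T \<in> below \<HH> T') \<or> dW \<HH> T (proj \<HH> T x) (proj \<HH> T x') < E) \<and>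
            (\<forall>T' \<in> \<T>. dW \<HH> W (proj \<HH> W x) (rho \<HH> T' W) \<le> N)))"

definition hhs_bounded_geodesic_image :: "('x, 'i, 'p) hhs_data \<Rightarrow> bool" where
  "hhs_bounded_geodesic_image \<HH> \<longleftrightarrow>
    (\<exists>E > 0. \<forall>W \<in> domains \<HH>. \<forall>V \<in> below \<HH> W - {W}. \<forall>\<gamma> x y.
       geodesic_segment (hspace \<HH> W) \<gamma> x y \<longrightarrow>
       diam_le (hspace \<HH> V) (\<Union>p \<in> \<gamma>. rho_map \<HH> W V p) E \<or>
       \<gamma> \<inter> cnbhd (hspace \<HH> W) E (rho \<HH> V W) \<noteq> {})"

definition hhs_partial_realization :: "'x metric \<Rightarrow> ('x, 'i, 'p) hhs_data \<Rightarrow> bool" where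
  "hhs_partial_realization X \<HH> \<longleftrightarrow>
    (\<exists>\<alpha>. \<forall>F p. F \<subseteq> domains \<HH> \<and> pairwise (orth \<HH>) F \<and>
       (\<forall>V \<in> F. p V \<in> (\<Union>x \<in> mspace X. proj \<HH> V x)) \<longrightarrow>
       (\<exists>x \<in> mspace X.
          (\<forall>V \<in> F. dW \<HH> V (proj \<HH> V x) {p V} \<le> \<alpha>) \<and>
          (\<forall>V \<in> F. \<forall>W \<in> domains \<HH>. pnest \<HH> V W \<or> transverse \<HH> W V \<longrightarrow>
             dW \<HH> W (proj \<HH> W x) (rho \<HH> V W) \<le> \<alpha>)))"

definition hhs_uniqueness :: "'x metric \<Rightarrow> ('x, 'i, 'p) hhs_data \<Rightarrow> bool" where
  "hhs_uniqueness X \<HH> \<longleftrightarrow>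
    (\<forall>\<kappa> \<ge> 0. \<exists>\<theta>. \<forall>x \<in> mspace X. \<forall>y \<in> mspace X. mdist X x y \<ge> \<theta> \<longrightarrow>
       (\<exists>V \<in> domains \<HH>. dW \<HH> V (proj \<HH> V x) (proj \<HH> V y) \<ge> \<kappa>))"

definition hhs_structure :: "'x metric \<Rightarrow> ('x, 'i, 'p) hhs_data \<Rightarrow> bool" where
  "hhs_structure X \<HH> \<longleftrightarrow>
    quasigeodesic_space X \<and>
    (\<exists>\<delta> \<ge> 0. \<forall>W \<in> domains \<HH>. geodesic_space (hspace \<HH> W) \<and> hyperbolic \<delta> (hspace \<HH> W)) \<and>
    (\<exists>\<xi> \<ge> 0. \<exists>K. \<exists>\<kappa>\<^sub>0 \<ge> 0.
       hhs_projections X \<HH> \<xi> K \<and> hhs_nesting \<HH> \<xi> \<and> hhs_orthogonality \<HH> \<and>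
       hhs_consistency X \<HH> \<xi> \<kappa>\<^sub>0 \<and> hhs_finite_complexity \<HH> \<and> hhs_large_links X \<HH> \<xi> \<kappa>\<^sub>0 \<and>
       hhs_bounded_geodesic_image \<HH> \<and> hhs_partial_realization X \<HH> \<and> hhs_uniqueness X \<HH>)"


section \<open>Hierarchically hyperbolic groups\<close>

text \<open>
  \<open>\<sigma> g\<close> is the permutation of the domains induced by \<open>g\<close>, and \<open>\<tau> g U\<close> is the isometry
  from \<open>CU\<close> to \<open>C(gU)\<close>.
\<close>

definition hhg_structure ::
  "('a, 'b) monoid_scheme \<Rightarrow> 'a set \<Rightarrow> ('a, 'i, 'p) hhs_data \<Rightarrow>
   ('a \<Rightarrow> 'i \<Rightarrow> 'i) \<Rightarrow> ('a \<Rightarrow> 'i \<Rightarrow> 'p \<Rightarrow> 'p) \<Rightarrow> bool" where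
  "hhg_structure G A \<HH> \<sigma> \<tau> \<longleftrightarrow>
    hhs_structure (word_metric G A) \<HH> \<and>
    group_action G (domains \<HH>) \<sigma> \<and> finite (orbits G (domains \<HH>) \<sigma>) \<and>
    (\<forall>g \<in> carrier G. \<forall>U \<in> domains \<HH>. \<forall>V \<in> domains \<HH>.
       (nest \<HH> (\<sigma> g U) (\<sigma> g V) \<longleftrightarrow> nest \<HH> U V) \<and>
       (orth \<HH> (\<sigma> g U) (\<sigma> g V) \<longleftrightarrow> orth \<HH> U V) \<and>
       (transverse \<HH> (\<sigma> g U) (\<sigma> g V) \<longleftrightarrow> transverse \<HH> U V)) \<and>
    (\<forall>g \<in> carrier G. \<forall>U \<in> domains \<HH>.
       bij_betw (\<tau> g U) (mspace (hspace \<HH> U)) (mspace (hspace \<HH> (\<sigma> g U))) \<and>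
       (\<forall>p \<in> mspace (hspace \<HH> U). \<forall>q \<in> mspace (hspace \<HH> U).
          mdist (hspace \<HH> (\<sigma> g U)) (\<tau> g U p) (\<tau> g U q) = mdist (hspace \<HH> U) p q)) \<and>
    (\<forall>g \<in> carrier G. \<forall>h \<in> carrier G. \<forall>U \<in> domains \<HH>. \<forall>p \<in> mspace (hspace \<HH> U).
       \<tau> (g \<otimes>\<^bsub>G\<^esub> h) U p = \<tau> g (\<sigma> h U) (\<tau> h U p)) \<and>
    (\<forall>g \<in> carrier G. \<forall>U \<in> domains \<HH>. \<forall>x \<in> carrier G.
       \<tau> g U ` proj \<HH> U x = proj \<HH> (\<sigma> g U) (g \<otimes>\<^bsub>G\<^esub> x)) \<and>
    (\<forall>g \<in> carrier G. \<forall>U \<in> domains \<HH>. \<forall>V \<in> domains \<HH>. transverse \<HH> U V \<or> pnest \<HH> U V \<longrightarrow>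
       \<tau> g V ` rho \<HH> U V = rho \<HH> (\<sigma> g U) (\<sigma> g V))"

text \<open>
  HOL cannot quantify over types inside a formula, so the types \<open>'i\<close> of domains and \<open>'p\<close> of points
  of the hyperbolic spaces are parameters.

  Taking \<open>'i = nat\<close> and \<open>'p = real\<close> is no restriction: a finitely generated group is countable, so
  finitely many orbits give countably many domains; and closing up equivariantly under the choice of
  geodesics, one may replace each hyperbolic space by an isometrically embedded geodesic subspace
  of at most continuum many points.
\<close>

definition HHG :: "'i itself \<Rightarrow> 'p itself \<Rightarrow> ('a, 'b) monoid_scheme \<Rightarrow> bool" where
  "HHG (ti :: 'i itself) (tp :: 'p itself) G \<longleftrightarrow> group G \<and>
    (\<exists>A (\<HH> :: ('a, 'i, 'p) hhs_data) \<sigma> \<tau>.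
       finite_generating_set G A \<and> hhg_structure G A \<HH> \<sigma> \<tau>)"

definition virtually_HHG :: "'i itself \<Rightarrow> 'p itself \<Rightarrow> ('a, 'b) monoid_scheme \<Rightarrow> bool" where
  "virtually_HHG ti tp G \<longleftrightarrow>
    (\<exists>H. subgroup H G \<and> finite (rcosets\<^bsub>G\<^esub> H) \<and> HHG ti tp (G\<lparr>carrier := H\<rparr>))"

end

theory Submission
  imports Defs "HOL-Algebra.Weak_Morphisms" "HOL-Library.Nat_Bijection"
begin

text \<open>
  Identify \<open>\<langle>a, b\<rangle>\<close> with the Gaussian integers; \<open>t\<close> conjugates \<open>(2 - i) z\<close> to \<open>(2 + i) z\<close>, so it commensurates
  the lattice by a rotation of infinite order. Suppose that a finite index subgroup is hierarchically
  hyperbolic. Large links and finite complexity give a domain \<open>U\<close> of finite orbit to which the lattice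
  has unbounded projection. The displacement of the base point of \<open>CU\<close> satisfies the four-point inequality;
  its stable version satisfies \<open>\<parallel>x + y\<parallel> + \<parallel>x - y\<parallel> \<le> 2 max \<parallel>x\<parallel> \<parallel>y\<parallel>\<close> and is invariant under an infinite
  order rotation, hence vanishes. So the displacement is ultrametric up to a constant, as for a parabolic
  subgroup, and an element \<open>h\<close> that moves the base point towards the fixed point at infinity lowers all
  large displacements. But conjugation by \<open>h\<close> only rotates the lattice, so the displacement is bounded
  on discs uniformly, a contradiction.

  Replacing the rotation by the identity gives a group with the same normal forms, which acts on the
  product of the same tree with the plane by translations of the plane. Equality of normal forms is
  a quasi-isometry up to rounding, and the product of the tree with two lines makes the second group
  hierarchically hyperbolic.
\<close>

section \<open>Gaussian integers\<close>

text \<open>Every element commensurates the lattice by a map \<open>B / gcnj B\<close> of absolute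
  value 1, and this survives passage to finite index, as does the infinite order of the rotation
  \<open>(3 + 4 i) / 5\<close> induced by \<open>t\<close>. This is why subgroups, sublattices and
  powers of \<open>t\<close> are carried along throughout. Rotations preserve discs, whereas moving
  the base point towards the fixed point of a parabolic lattice lowers all large displacements;
  comparing maxima over a single disc exposes the conflict. The hierarchy enters by supplying one
  hyperbolic space with finite orbit on which the lattice is unbounded.

  For the positive half the rotation is again the obstruction: it gives the directions of the
  coordinate lines infinite orbits, so the lines cannot serve as domains. Once it is removed, the
  plane splits into two lines on which the model group acts by translations. The number 5 is the
  norm of \<open>2 + i\<close> and of \<open>2 - i\<close>, hence the index of both associated
  sublattices and the number of digits at each letter of a normal form.\<close>

datatype gint = GI (gre: int) (gim: int)

instantiation gint :: comm_ring_1
begin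

definition "0 = GI 0 0"
definition "1 = GI 1 0"
definition "x + y = GI (gre x + gre y) (gim x + gim y)"
definition "x - y = GI (gre x - gre y) (gim x - gim y)"
definition "- x = GI (- gre x) (- gim x)"
definition "x * y = GI (gre x * gre y - gim x * gim y) (gre x * gim y + gim x * gre y)"

instance
  by standard
    (auto simp: zero_gint_def one_gint_def plus_gint_def minus_gint_def uminus_gint_def
      times_gint_def algebra_simps intro: gint.expand)

end

lemma gre_simps [simp]:
  "gre 0 = 0" "gre 1 = 1" "gre (x + y) = gre x + gre y" "gre (x - y) = gre x - gre y"
  "gre (- x) = - gre x" "gre (x * y) = gre x * gre y - gim x * gim y"
  by (simp_all add: zero_gint_def one_gint_def plus_gint_def minus_gint_def uminus_gint_def
      times_gint_def)

lemma gim_simps [simp]: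
  "gim 0 = 0" "gim 1 = 0" "gim (x + y) = gim x + gim y" "gim (x - y) = gim x - gim y"
  "gim (- x) = - gim x" "gim (x * y) = gre x * gim y + gim x * gre y"
  by (simp_all add: zero_gint_def one_gint_def plus_gint_def minus_gint_def uminus_gint_def
      times_gint_def)

lemma gint_eq_iff: "x = y \<longleftrightarrow> gre x = gre y \<and> gim x = gim y"
  by (auto intro: gint.expand)

lemma of_nat_gint: "of_nat n = GI (int n) 0"
  by (induction n) (auto simp: gint_eq_iff)

lemma of_int_gint: "of_int n = GI n 0"
  by (cases n) (auto simp: of_nat_gint gint_eq_iff)

lemma of_int_gint_simps [simp]: "gre (of_int n) = n" "gim (of_int n) = 0"
  by (simp_all add: of_int_gint)

definition gcnj :: "gint \<Rightarrow> gint" where "gcnj z = GI (gre z) (- gim z)"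

definition gnorm :: "gint \<Rightarrow> int" where "gnorm z = (gre z)\<^sup>2 + (gim z)\<^sup>2"

lemma gcnj_simps [simp]: "gre (gcnj z) = gre z" "gim (gcnj z) = - gim z"
  by (simp_all add: gcnj_def)

lemma gcnj_mult: "gcnj (x * y) = gcnj x * gcnj y"
  by (auto simp: gint_eq_iff)

lemma mult_gcnj: "z * gcnj z = of_int (gnorm z)"
  by (auto simp: gint_eq_iff gnorm_def power2_eq_square)

lemma gnorm_mult: "gnorm (x * y) = gnorm x * gnorm y"
  by (simp add: gnorm_def power2_eq_square algebra_simps)

lemma gnorm_of_int [simp]: "gnorm (of_int n) = n\<^sup>2"
  by (simp add: gnorm_def)

lemma gnorm_one [simp]: "gnorm 1 = 1"
  by (simp add: gnorm_def)

lemma gnorm_power: "gnorm (x ^ n) = gnorm x ^ n"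
  by (induction n) (auto simp: gnorm_mult)

lemma gnorm_gcnj [simp]: "gnorm (gcnj z) = gnorm z"
  by (simp add: gnorm_def)

lemma finite_gnorm_le: "finite {z. gnorm z \<le> m}"
proof (rule finite_subset)
  show "{z. gnorm z \<le> m} \<subseteq> (\<lambda>(x, y). GI x y) ` ({-m..m} \<times> {-m..m})"
  proof
    fix z assume z: "z \<in> {z. gnorm z \<le> m}"
    have sq: "\<bar>x\<bar> \<le> x\<^sup>2" for x :: int
      using mult_left_mono[of 1 "\<bar>x\<bar>" "\<bar>x\<bar>"] by (cases "x = 0") (auto simp: power2_eq_square abs_mult[symmetric])
    have "(gre z)\<^sup>2 \<le> m" "(gim z)\<^sup>2 \<le> m"
      using z zero_le_power2[of "gre z"] zero_le_power2[of "gim z"]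
      unfolding gnorm_def mem_Collect_eq by linarith+
    then have "\<bar>gre z\<bar> \<le> m" "\<bar>gim z\<bar> \<le> m" using sq[of "gre z"] sq[of "gim z"] by linarith+
    then show "z \<in> (\<lambda>(x, y). GI x y) ` ({-m..m} \<times> {-m..m})"
      by (intro image_eqI[of _ _ "(gre z, gim z)"]) (auto simp: abs_le_iff)
  qed
qed auto

text \<open>Each coordinate is rounded towards zero rather than to the nearest multiple, so that
  \<open>of_int n * q\<close> stays in the disc of \<open>z\<close>; the maximality argument of
  \<open>ultrametric_contraction_bounded\<close> rests on this.\<close>

lemma gint_trunc_div:
  assumes "n > 0"
  obtains q d where "z = of_int n * q + d" "gnorm (of_int n * q) \<le> gnorm z"
    "gnorm d \<le> 2 * n\<^sup>2"
proof -
  have t: "\<exists>q. \<bar>n * q\<bar> \<le> \<bar>x\<bar> \<and> \<bar>x - n * q\<bar> \<le> n" for x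
  proof (cases "x \<ge> 0")
    case True
    have "x = n * (x div n) + x mod n" by simp
    moreover have "0 \<le> x mod n" "x mod n < n" "0 \<le> n * (x div n)"
      using assms True by (simp_all add: pos_imp_zdiv_nonneg_iff)
    ultimately have "\<bar>n * (x div n)\<bar> \<le> \<bar>x\<bar> \<and> \<bar>x - n * (x div n)\<bar> \<le> n" using True by linarith
    then show ?thesis by blast
  next
    case False
    let ?y = "-x"
    have "?y = n * (?y div n) + ?y mod n" by simp
    moreover have "0 \<le> ?y mod n" "?y mod n < n" "0 \<le> n * (?y div n)"
      using assms False by (simp_all add: pos_imp_zdiv_nonneg_iff)
    ultimately have "\<bar>n * (- (?y div n))\<bar> \<le> \<bar>x\<bar> \<and> \<bar>x - n * (- (?y div n))\<bar> \<le> n"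
      using False by (simp only: mult_minus_right) linarith
    then show ?thesis by blast
  qed
  obtain a where a: "\<bar>n * a\<bar> \<le> \<bar>gre z\<bar>" "\<bar>gre z - n * a\<bar> \<le> n" using t[of "gre z"] by blast
  obtain b where b: "\<bar>n * b\<bar> \<le> \<bar>gim z\<bar>" "\<bar>gim z - n * b\<bar> \<le> n" using t[of "gim z"] by blast
  show ?thesis
  proof (rule that[of "GI a b" "z - of_int n * GI a b"])
    show "gnorm (of_int n * GI a b) \<le> gnorm z"
      using a(1) b(1) by (simp add: gnorm_def abs_le_square_iff add_mono)
    have "n\<^sup>2 = \<bar>n\<bar>\<^sup>2" by simp
    have "(gre z - n * a)\<^sup>2 \<le> n\<^sup>2" "(gim z - n * b)\<^sup>2 \<le> n\<^sup>2"
      using a(2) b(2) assms by (auto simp: abs_le_square_iff[symmetric])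
    then show "gnorm (z - of_int n * GI a b) \<le> 2 * n\<^sup>2" by (simp add: gnorm_def)
  qed simp
qed


section \<open>Hyperbolic norms on the Gaussian integers\<close>

text \<open>\<open>\<phi> x\<close> models the displacement of a base point by the lattice element
  \<open>x\<close>. Then \<open>\<phi> (x - y)\<close> is the distance of two orbit points, and
  \<open>four_point\<close> is Gromov's inequality with defect \<open>k\<close>.\<close>

locale hyperbolic_norm =
  fixes \<phi> :: "gint \<Rightarrow> real" and k :: real
  assumes nonneg: "0 \<le> \<phi> x"
    and minus: "\<phi> (- x) = \<phi> x"
    and add_le: "\<phi> (x + y) \<le> \<phi> x + \<phi> y"
    and four_point: "\<phi> (x - y) + \<phi> (z - w) \<le> max (\<phi> (x - z) + \<phi> (y - w)) (\<phi> (x - w) + \<phi> (y - z)) + k"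
    and k_nonneg: "0 \<le> k"
begin

text \<open>In the parallelogram \<open>0\<close>, \<open>x\<close>, \<open>x + y\<close>,
  \<open>y\<close> the two diagonals are compared with the two pairs of opposite sides.\<close>

lemma parallelogram: "\<phi> (x + y) + \<phi> (x - y) \<le> 2 * max (\<phi> x) (\<phi> y) + k"
  using four_point[of "x + y" 0 x y] minus[of x] minus[of y] by simp

text \<open>The same parallelogram: one pair of opposite sides is compared with the other pair and
  with the diagonals.\<close>

lemma parallelogram': "2 * \<phi> x \<le> max (2 * \<phi> y) (\<phi> (x + y) + \<phi> (x - y)) + k"
  using four_point[of "x + y" y x 0] minus[of "x - y"] by (simp add: max_def split: if_splits)

text \<open>Along powers of two the quotients decrease by subadditivity, so the limit exists at
  once; dividing by \<open>2 ^ n\<close> also removes the defect \<open>k\<close>.\<close>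

definition stable :: "gint \<Rightarrow> real" where
  "stable x = lim (\<lambda>n. \<phi> (2 ^ n * x) / 2 ^ n)"

lemma stable_limit: "(\<lambda>n. \<phi> (2 ^ n * x) / 2 ^ n) \<longlonglongrightarrow> stable x"
proof -
  have "decseq (\<lambda>n. \<phi> (2 ^ n * x) / 2 ^ n)"
  proof (rule decseq_SucI)
    fix n
    have "\<phi> (2 ^ n * x + 2 ^ n * x) \<le> 2 * \<phi> (2 ^ n * x)" using add_le[of "2 ^ n * x" "2 ^ n * x"] by simp
    then show "\<phi> (2 ^ Suc n * x) / 2 ^ Suc n \<le> \<phi> (2 ^ n * x) / 2 ^ n"
      by (simp add: field_simps)
  qed
  then have "convergent (\<lambda>n. \<phi> (2 ^ n * x) / 2 ^ n)"
    by (rule decseq_convergent[where B = 0]) (auto simp: nonneg convergentI)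
  then show ?thesis unfolding stable_def convergent_LIMSEQ_iff .
qed

lemma stable_nonneg: "0 \<le> stable x"
  by (rule LIMSEQ_le_const[OF stable_limit]) (auto simp: nonneg)

lemma stable_minus: "stable (- x) = stable x"
  by (simp add: stable_def minus)

lemma stable_zero: "stable 0 = 0"
proof -
  have "(\<lambda>n. \<phi> 0 / 2 ^ n) \<longlonglongrightarrow> 0" by (rule LIMSEQ_divide_realpow_zero) simp
  then show ?thesis using stable_limit[of 0] by (simp add: LIMSEQ_unique)
qed

lemma k_limit: "(\<lambda>n. k / 2 ^ n) \<longlonglongrightarrow> 0"
  by (rule LIMSEQ_divide_realpow_zero) simp

lemma stable_add_le: "stable (x + y) \<le> stable x + stable y"
proof (rule LIMSEQ_le[OF stable_limit tendsto_add[OF stable_limit stable_limit]], intro exI allI impI)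
  fix n
  show "\<phi> (2 ^ n * (x + y)) / 2 ^ n \<le> \<phi> (2 ^ n * x) / 2 ^ n + \<phi> (2 ^ n * y) / 2 ^ n"
    using add_le[of "2 ^ n * x" "2 ^ n * y"] by (simp add: field_simps)
qed

lemma stable_parallelogram: "stable (x + y) + stable (x - y) \<le> 2 * max (stable x) (stable y)"
proof -
  let ?f = "\<lambda>x n. \<phi> (2 ^ n * x) / 2 ^ n"
  have "(\<lambda>n. ?f (x + y) n + ?f (x - y) n) \<longlonglongrightarrow> stable (x + y) + stable (x - y)"
    by (intro tendsto_add stable_limit)
  moreover have "(\<lambda>n. 2 * max (?f x n) (?f y n) + k / 2 ^ n) \<longlonglongrightarrow> 2 * max (stable x) (stable y) + 0"
    by (intro tendsto_add tendsto_mult tendsto_const tendsto_max stable_limit k_limit)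
  ultimately show ?thesis
  proof (rule LIMSEQ_le[where X = "\<lambda>n. ?f (x + y) n + ?f (x - y) n", THEN order_trans])
    show "\<exists>N. \<forall>n\<ge>N. ?f (x + y) n + ?f (x - y) n \<le> 2 * max (?f x n) (?f y n) + k / 2 ^ n"
    proof (intro exI allI impI)
      fix n
      have "max (?f x n) (?f y n) = max (\<phi> (2 ^ n * x)) (\<phi> (2 ^ n * y)) / 2 ^ n"
        by (simp add: max_def divide_le_cancel)
      then show "?f (x + y) n + ?f (x - y) n \<le> 2 * max (?f x n) (?f y n) + k / 2 ^ n"
        using divide_right_mono[OF parallelogram[of "2 ^ n * x" "2 ^ n * y"], of "2 ^ n"]
        by (simp add: add_divide_distrib distrib_left right_diff_distrib)
    qed
  qed simp
qed

lemma stable_parallelogram': "2 * stable x \<le> max (2 * stable y) (stable (x + y) + stable (x - y))"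
proof -
  let ?f = "\<lambda>x n. \<phi> (2 ^ n * x) / 2 ^ n"
  have "(\<lambda>n. 2 * ?f x n) \<longlonglongrightarrow> 2 * stable x"
    by (intro tendsto_mult tendsto_const stable_limit)
  moreover have "(\<lambda>n. max (2 * ?f y n) (?f (x + y) n + ?f (x - y) n) + k / 2 ^ n)
      \<longlonglongrightarrow> max (2 * stable y) (stable (x + y) + stable (x - y)) + 0"
    by (intro tendsto_add tendsto_mult tendsto_const tendsto_max stable_limit k_limit)
  ultimately show ?thesis
  proof (rule LIMSEQ_le[where X = "\<lambda>n. 2 * ?f x n", THEN order_trans])
    show "\<exists>N. \<forall>n\<ge>N. 2 * ?f x n \<le> max (2 * ?f y n) (?f (x + y) n + ?f (x - y) n) + k / 2 ^ n"
    proof (intro exI allI impI)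
      fix n
      have "max (2 * ?f y n) (?f (x + y) n + ?f (x - y) n) =
          max (2 * \<phi> (2 ^ n * y)) (\<phi> (2 ^ n * (x + y)) + \<phi> (2 ^ n * (x - y))) / 2 ^ n"
        by (simp add: max_def divide_le_cancel add_divide_distrib[symmetric])
      then show "2 * ?f x n \<le> max (2 * ?f y n) (?f (x + y) n + ?f (x - y) n) + k / 2 ^ n"
        using divide_right_mono[OF parallelogram'[of "2 ^ n * x" "2 ^ n * y"], of "2 ^ n"]
        by (simp add: add_divide_distrib distrib_left right_diff_distrib)
    qed
  qed simp
qed

text \<open>Doubling is immediate from the dyadic definition. In the step from \<open>m + 1\<close>
  to \<open>m + 2\<close> the two parallelogram inequalities for \<open>(m + 1) x\<close> and
  \<open>x\<close> pinch to an equality: if \<open>stable x > 0\<close>, then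
  \<open>stable ((m + 1) x)\<close> exceeds \<open>stable x\<close>.\<close>

lemma stable_of_nat: "stable (of_nat n * x) = n * stable x"
proof (induction n rule: less_induct)
  case (less n)
  consider "n = 0" | "n = 1" | "n = 2" | m where "n = m + 2" "m \<ge> 1"
    by (metis One_nat_def Suc_leI add.commute add_2_eq_Suc' gr0I not0_implies_Suc numeral_2_eq_2)
  then show ?case
  proof cases
    case 3
    have "(\<lambda>n. 2 * (\<phi> (2 ^ Suc n * x) / 2 ^ Suc n)) \<longlonglongrightarrow> 2 * stable x"
      by (intro tendsto_mult tendsto_const LIMSEQ_Suc stable_limit)
    moreover have "2 * (\<phi> (2 ^ Suc n * x) / 2 ^ Suc n) = \<phi> (2 ^ n * (2 * x)) / 2 ^ n" for n
      by (simp add: mult_ac)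
    ultimately show ?thesis using stable_limit[of "2 * x"] 3
      by (simp add: LIMSEQ_unique)
  next
    case 4
    have IH: "stable (of_nat (m + 1) * x) = (m + 1) * stable x" "stable (of_nat m * x) = m * stable x"
      using 4 by (intro less.IH, simp)+
    let ?y = "of_nat (m + 1) * x"
    have s: "?y + x = of_nat n * x" "?y - x = of_nat m * x"
      using 4 by (simp_all add: algebra_simps)
    show ?thesis
    proof (cases "stable x = 0")
      case True
      then show ?thesis using stable_add_le[of ?y x] IH stable_nonneg[of "of_nat n * x"]
        unfolding s by simp
    next
      case False
      then have pos: "stable x > 0" using stable_nonneg[of x] by simp
      have "stable x \<le> stable ?y" unfolding IH using pos by (simp add: algebra_simps)
      then have "stable (of_nat n * x) + stable (of_nat m * x) \<le> 2 * stable ?y"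
        using stable_parallelogram[of ?y x] unfolding s by simp
      moreover have "2 * stable ?y \<le> max (2 * stable x) (stable (of_nat n * x) + stable (of_nat m * x))"
        using stable_parallelogram'[of ?y x] unfolding s by simp
      moreover have "2 * stable ?y > 2 * stable x" unfolding IH using pos 4(2) by simp
      ultimately have "stable (of_nat n * x) + stable (of_nat m * x) = 2 * stable ?y" by simp
      then show ?thesis unfolding IH using 4 by (simp add: algebra_simps)
    qed
  qed (simp_all add: stable_zero)
qed

lemma stable_of_int: "stable (of_int n * x) = \<bar>n\<bar> * stable x"
proof (cases "n \<ge> 0")
  case True
  then show ?thesis using stable_of_nat[of "nat n" x] by simp
next
  case False
  then show ?thesis using stable_of_nat[of "nat (- n)" x] stable_minus[of "of_int n * x"] by simp
qed

text \<open>
  If \<open>w = K + J i\<close> acts on the stable norm like its absolute value \<open>n\<close>, the parallelogram inequality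
  for \<open>w x\<close> and \<open>cnj w x\<close> relates \<open>stable x\<close> to \<open>stable (i x)\<close>: summing over \<open>x\<close> and \<open>i x\<close> gives
  \<open>(\<bar>K\<bar> + \<bar>J\<bar>) S \<le> n S\<close> where \<open>S = stable x + stable (i x)\<close>.
\<close>

lemma stable_eq_zero:
  assumes w: "gnorm w = n\<^sup>2" "n > 0" "gre w \<noteq> 0" "gim w \<noteq> 0"
    and c: "\<And>z. \<bar>\<phi> (w * z) - \<phi> (of_int n * z)\<bar> \<le> c"
  shows "stable x = 0"
proof -
  have st: "stable (w * z) = n * stable z" for z
  proof -
    let ?f = "\<lambda>x j. \<phi> (2 ^ j * x) / 2 ^ j"
    have "(\<lambda>j. ?f (w * z) j - ?f (of_int n * z) j) \<longlonglongrightarrow> stable (w * z) - stable (of_int n * z)"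
      by (intro tendsto_diff stable_limit)
    moreover have "(\<lambda>j. ?f (w * z) j - ?f (of_int n * z) j) \<longlonglongrightarrow> 0"
    proof (rule Lim_null_comparison[where g = "\<lambda>j. c / 2 ^ j"])
      show "\<forall>\<^sub>F j in sequentially. norm (?f (w * z) j - ?f (of_int n * z) j) \<le> c / 2 ^ j"
      proof (intro always_eventually allI)
        fix j
        have "norm (?f (w * z) j - ?f (of_int n * z) j) =
            \<bar>\<phi> (w * (2 ^ j * z)) - \<phi> (of_int n * (2 ^ j * z))\<bar> / 2 ^ j"
          by (simp add: diff_divide_distrib[symmetric] mult_ac)
        then show "norm (?f (w * z) j - ?f (of_int n * z) j) \<le> c / 2 ^ j"
          using c[of "2 ^ j * z"] by (simp add: divide_right_mono)
      qed
      show "(\<lambda>j. c / 2 ^ j) \<longlonglongrightarrow> 0"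
        by (rule LIMSEQ_divide_realpow_zero) simp
    qed
    ultimately have "stable (w * z) = stable (of_int n * z)"
      using LIMSEQ_unique by fastforce
    then show ?thesis using w(2) by (simp add: stable_of_int)
  qed
  have st': "stable (gcnj w * z) = n * stable z" for z
  proof -
    have "w * (gcnj w * z) = of_int (n\<^sup>2) * z"
      unfolding mult.assoc[symmetric] mult_gcnj w(1) ..
    then have "n * stable (gcnj w * z) = n\<^sup>2 * stable z"
      using st[of "gcnj w * z"] by (simp add: stable_of_int del: of_int_power)
    then show ?thesis using w(2) by (simp add: power2_eq_square)
  qed
  have key: "\<bar>gre w\<bar> * stable z + \<bar>gim w\<bar> * stable (GI 0 1 * z) \<le> n * stable z" for z
  proof -
    have "w * z + gcnj w * z = of_int (2 * gre w) * z"
      "w * z - gcnj w * z = of_int (2 * gim w) * (GI 0 1 * z)"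
      by (auto simp: gint_eq_iff algebra_simps simp del: of_int_mult)
    then have "2 * \<bar>gre w\<bar> * stable z + 2 * \<bar>gim w\<bar> * stable (GI 0 1 * z) \<le> 2 * (n * stable z)"
      using stable_parallelogram[of "w * z" "gcnj w * z"]
      by (simp add: st st' stable_of_int abs_mult del: of_int_mult)
    then show ?thesis by simp
  qed
  have ii: "stable (GI 0 1 * (GI 0 1 * z)) = stable z" for z
  proof -
    have "GI 0 1 * (GI 0 1 * z) = - z" by (auto simp: gint_eq_iff)
    then show ?thesis by (simp add: stable_minus)
  qed
  define S where "S = stable x + stable (GI 0 1 * x)"
  have "(\<bar>gre w\<bar> + \<bar>gim w\<bar>) * S \<le> n * S"
    using key[of x] key[of "GI 0 1 * x"] unfolding ii S_def by (simp add: algebra_simps)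
  moreover have "n < \<bar>gre w\<bar> + \<bar>gim w\<bar>"
  proof -
    have "n\<^sup>2 < (\<bar>gre w\<bar> + \<bar>gim w\<bar>)\<^sup>2"
      using w unfolding gnorm_def by (simp add: power2_sum mult_pos_pos)
    then show ?thesis by (rule power_less_imp_less_base) simp
  qed
  then have "real_of_int n < real_of_int (\<bar>gre w\<bar> + \<bar>gim w\<bar>)" by (simp only: of_int_less_iff)
  ultimately have "\<not> 0 < S"
    using mult_strict_right_mono[of "real_of_int n" "real_of_int (\<bar>gre w\<bar> + \<bar>gim w\<bar>)" S] not_less by blast
  then show ?thesis using stable_nonneg[of x] stable_nonneg[of "GI 0 1 * x"] by (simp add: S_def)
qed

text \<open>An excess \<open>e\<close> in doubling propagates: every further multiple of
  \<open>x\<close> gains at least \<open>e\<close>, so the displacement grows linearly and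
  \<open>stable x\<close> is at least \<open>e / 2\<close>.\<close>

lemma double_le:
  assumes "stable x = 0"
  shows "\<phi> (2 * x) \<le> \<phi> x + k"
proof (rule ccontr)
  assume "\<not> ?thesis"
  then obtain e where e: "e > 0" "\<phi> (2 * x) = \<phi> x + k + e"
    by (metis add_diff_cancel_left' add_diff_eq diff_gt_0_iff_gt diff_add_cancel not_le)
  have grow: "\<phi> (of_nat n * x) + e \<le> \<phi> (of_nat (n + 1) * x)" if "n \<ge> 1" for n
    using that
  proof (induction n rule: nat_induct_at_least)
    case base
    then show ?case using e k_nonneg by simp
  next
    case (Suc n)
    have "2 * x - 0 = 2 * x" "of_nat (n + 2) * x - x = of_nat (Suc n) * x" "0 - x = - x"
      "2 * x - of_nat (n + 2) * x = - (of_nat n * x)"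
      "0 - of_nat (n + 2) * x = - (of_nat (n + 2) * x)" "2 * x - x = x"
      by (simp_all add: algebra_simps)
    then have "\<phi> (2 * x) + \<phi> (of_nat (Suc n) * x) \<le>
        max (\<phi> (of_nat n * x) + \<phi> x) (\<phi> x + \<phi> (of_nat (n + 2) * x)) + k"
      using four_point[of "2 * x" 0 "of_nat (n + 2) * x" x] minus by simp
    then show ?case using e Suc.IH by (simp add: max_def split: if_splits)
  qed
  have lin: "n * e \<le> \<phi> (of_nat (n + 1) * x)" for n
  proof (induction n)
    case (Suc n)
    then show ?case using grow[of "n + 1"] by (simp add: algebra_simps)
  qed (simp add: nonneg)
  have "e / 2 \<le> stable x"
  proof (rule LIMSEQ_le_const[OF LIMSEQ_Suc[OF stable_limit]], intro exI allI impI)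
    fix n
    have "(2 ^ Suc n - 1) * e \<le> \<phi> (2 ^ Suc n * x)"
      using lin[of "2 ^ Suc n - 1"] by (simp add: of_nat_diff del: power_Suc)
    moreover have "e * 2 ^ n \<le> (2 ^ Suc n - 1) * e"
      using e(1) by (simp add: algebra_simps)
    ultimately show "e / 2 \<le> \<phi> (2 ^ Suc n * x) / 2 ^ Suc n"
      by (simp add: field_simps)
  qed
  then show False using assms e(1) by simp
qed

text \<open>The sum and difference of \<open>x + y\<close> and \<open>x - y\<close> are
  \<open>2 x\<close> and \<open>2 y\<close>, whose displacements \<open>double_le\<close> controls.
  The alternative, that \<open>\<phi> (x + y)\<close> is at most
  \<open>\<phi> (x - y) + k / 2\<close>, is settled by \<open>parallelogram\<close>.\<close>

lemma ultrametric:
  assumes "\<And>x. stable x = 0"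
  shows "\<phi> (x + y) \<le> max (\<phi> x) (\<phi> y) + 2 * k"
proof -
  have "2 * \<phi> (x + y) \<le> max (2 * \<phi> (x - y)) (\<phi> (2 * x) + \<phi> (2 * y)) + k"
    using parallelogram'[of "x + y" "x - y"] by (simp add: algebra_simps)
  then show ?thesis
    using parallelogram[of x y] double_le[OF assms, of x] double_le[OF assms, of y] k_nonneg
    by (simp add: max_def split: if_splits)
qed

end

text \<open>
  Division by \<open>of_int n = B * gcnj B\<close> turns an element of maximal \<open>\<phi>\<close>-value of some disc into
  another element of the same disc, up to a bounded remainder, and \<open>\<phi>\<close> would have to drop.
\<close>

lemma ultrametric_contraction_bounded:
  fixes \<phi> :: "gint \<Rightarrow> real"
  assumes ultra: "\<And>x y. \<phi> (x + y) \<le> max (\<phi> x) (\<phi> y) + u"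
    and B: "gnorm B = n" "n > 0"
    and M: "M > 0"
    and shrink: "\<And>z. \<phi> (of_int M * (B * z)) \<le> max (\<phi> (of_int M * (gcnj B * z)) - D) 0 + c"
    and D: "D > u + c"
  shows "\<exists>b. \<forall>z. \<phi> z \<le> b"
proof -
  \<comment> \<open>\<open>shrink\<close> speaks only of multiples of \<open>M\<close>, so the disc
    argument is run for \<open>\<psi>\<close>.\<close>
  define \<psi> where "\<psi> z = \<phi> (of_int M * z)" for z
  have ultra': "\<psi> (x + y) \<le> max (\<psi> x) (\<psi> y) + u" for x y
    unfolding \<psi>_def by (simp add: distrib_left ultra)
  define b where "b = Max (\<psi> ` {z. gnorm z \<le> 2 * n\<^sup>2}) + u"
  have b: "\<psi> d + u \<le> b" if "gnorm d \<le> 2 * n\<^sup>2" for d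
    unfolding b_def using that by (auto intro!: Max_ge finite_imageI finite_gnorm_le)
  have bounded: "\<psi> z \<le> max b (c + u)" for z
  proof -
    let ?S = "{y. gnorm y \<le> gnorm z}"
    have ne: "finite (\<psi> ` ?S)" "\<psi> ` ?S \<noteq> {}" by (auto intro: finite_gnorm_le)
    obtain y where y: "gnorm y \<le> gnorm z" "\<psi> y = Max (\<psi> ` ?S)"
      using Max_in[OF ne] by auto
    have max: "\<psi> x \<le> \<psi> y" if "gnorm x \<le> gnorm z" for x
      unfolding y(2) using that by (intro Max_ge ne) auto
    obtain q d where qd: "y = of_int n * q + d" "gnorm (of_int n * q) \<le> gnorm y" "gnorm d \<le> 2 * n\<^sup>2"
      using gint_trunc_div[OF B(2)] .
    let ?v = "gcnj B * (gcnj B * q)"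
    have nq: "of_int n * q = B * (gcnj B * q)"
      using mult_gcnj[of B] B(1) by (metis mult.assoc)
    have "gnorm ?v = gnorm (of_int n * q)"
      unfolding nq by (simp add: gnorm_mult)
    then have "\<psi> ?v \<le> \<psi> y" using max qd(2) y(1) by simp
    moreover have "\<psi> (of_int n * q) \<le> max (\<psi> ?v - D) 0 + c"
      unfolding nq \<psi>_def by (rule shrink)
    moreover have "\<psi> y \<le> max (\<psi> (of_int n * q)) (\<psi> d) + u"
      unfolding qd(1) by (rule ultra')
    ultimately have "\<psi> y \<le> max b (c + u)" using b[OF qd(3)] D by (simp add: max_def split: if_splits)
    then show ?thesis using max[of z] by simp
  qed
  \<comment> \<open>A second truncation, now by \<open>M\<close>, returns from \<open>\<psi>\<close>
    to \<open>\<phi>\<close>.\<close>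
  define b' where "b' = Max (\<phi> ` {z. gnorm z \<le> 2 * M\<^sup>2})"
  have "\<phi> z \<le> max (max b (c + u)) b' + u" for z
  proof -
    obtain q d where qd: "z = of_int M * q + d" "gnorm d \<le> 2 * M\<^sup>2"
      using gint_trunc_div[OF M] by metis
    have "\<phi> d \<le> b'" unfolding b'_def using qd(2) by (auto intro!: Max_ge finite_imageI finite_gnorm_le)
    then show ?thesis using ultra[of "of_int M * q" d] bounded[of q]
      unfolding qd(1)[symmetric] \<psi>_def by (simp add: max_def split: if_splits)
  qed
  then show ?thesis by blast
qed


section \<open>Commensurated lattices in groups acting on hyperbolic spaces\<close>

text \<open>\<open>D\<close> is the metric of a hyperbolic space pulled back along an orbit map,
  hence only a pseudometric.\<close>

locale hyperbolic_length = group G for G (structure) +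
  fixes D :: "'a \<Rightarrow> 'a \<Rightarrow> real" and k :: real
  assumes D_nonneg: "x \<in> carrier G \<Longrightarrow> y \<in> carrier G \<Longrightarrow> 0 \<le> D x y"
    and D_sym: "x \<in> carrier G \<Longrightarrow> y \<in> carrier G \<Longrightarrow> D x y = D y x"
    and D_tri: "x \<in> carrier G \<Longrightarrow> y \<in> carrier G \<Longrightarrow> z \<in> carrier G \<Longrightarrow> D x z \<le> D x y + D y z"
    and D_inv: "g \<in> carrier G \<Longrightarrow> x \<in> carrier G \<Longrightarrow> y \<in> carrier G \<Longrightarrow> D (g \<otimes> x) (g \<otimes> y) = D x y"
    and D_four: "x \<in> carrier G \<Longrightarrow> y \<in> carrier G \<Longrightarrow> z \<in> carrier G \<Longrightarrow> w \<in> carrier G \<Longrightarrow>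
      D x y + D z w \<le> max (D x z + D y w) (D x w + D y z) + k"
    and k_nonneg: "0 \<le> k"
begin

lemma hyperbolic_norm_restrict:
  assumes j: "\<And>z. j z \<in> carrier G" "\<And>x y. j (x + y) = j x \<otimes> j y"
  shows "hyperbolic_norm (\<lambda>z. D \<one> (j z)) k"
    and "D (j x) (j y) = D \<one> (j (y - x))"
proof -
  have one: "j 0 = \<one>" using j(2)[of 0 0] j(1)[of 0] by (simp add: l_cancel_one')
  have dist: "D (j x) (j y) = D \<one> (j (y - x))" for x y
    using D_inv[of "j x" \<one> "j (y - x)"] j by (simp flip: j(2))
  then show "D (j x) (j y) = D \<one> (j (y - x))" .
  have m: "D \<one> (j (- x)) = D \<one> (j x)" for x
    using dist[of x 0] D_sym[of "j x" \<one>] j(1) one by simp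
  show "hyperbolic_norm (\<lambda>z. D \<one> (j z)) k"
  proof
    fix x y z w
    show "D \<one> (j (x + y)) \<le> D \<one> (j x) + D \<one> (j y)"
      using D_tri[of \<one> "j x" "j (x + y)"] dist[of x "x + y"] j(1) by simp
    show "D \<one> (j (x - y)) + D \<one> (j (z - w))
        \<le> max (D \<one> (j (x - z)) + D \<one> (j (y - w))) (D \<one> (j (x - w)) + D \<one> (j (y - z))) + k"
      using D_four[of "j y" "j x" "j w" "j z"] j(1) m[of "y - w"] m[of "y - z"] m[of "x - z"] m[of "x - w"]
      by (simp add: dist add.commute)
  qed (auto simp: D_nonneg j m k_nonneg)
qed

text \<open>
  The point \<open>h\<close> lies at distance \<open>R\<close> from \<open>\<one>\<close> on a geodesic from \<open>\<one>\<close> to a long element \<open>a\<close>.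
  Ultrametricity forces the geodesics between points of the lattice to run together towards one
  point at infinity, so the lattice moves \<open>h\<close> by \<open>2 R\<close> less than it moves \<open>\<one>\<close>.
\<close>

lemma conjugate_contracts:
  assumes a: "a \<in> carrier G" and b: "b \<in> carrier G" and h: "h \<in> carrier G"
    and ab: "a \<otimes> b = b \<otimes> a"
    and ultra: "D \<one> (a \<otimes> b) \<le> max (D \<one> a) (D \<one> b) + 2 * k" "D a b \<le> max (D \<one> a) (D \<one> b) + 2 * k"
    and R: "0 \<le> R" "2 * R \<le> D \<one> a"
    and hd: "D \<one> h \<le> R + c" "D h a \<le> D \<one> a - R + c"
  shows "D \<one> (inv h \<otimes> b \<otimes> h) \<le> max (D \<one> b - 2 * R) 0 + (2 * c + 4 * k)"
proof -
  note cl = a b h m_closed[OF a b] m_closed[OF b h]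
  have d1: "D a (a \<otimes> b) = D \<one> b" "D b (a \<otimes> b) = D \<one> a" "D (b \<otimes> h) (a \<otimes> b) = D h a"
      "D (b \<otimes> h) b = D h \<one>"
    using D_inv[of a \<one> b] D_inv[of b \<one> a] D_inv[of b h a] D_inv[of b h \<one>] cl ab by simp_all
  have d2: "D h \<one> = D \<one> h" "D a h = D h a" "D b h = D h b" "D (a \<otimes> b) h = D h (a \<otimes> b)"
    "D (b \<otimes> h) h = D h (b \<otimes> h)" "D a \<one> = D \<one> a"
    using D_sym cl by simp_all
  have e1: "D h b \<le> max R (D \<one> b - R) + c + 3 * k"
  proof -
    have "D h b + D \<one> a \<le> max (D h \<one> + D b a) (D h a + D b \<one>) + k"
      using D_four[of h b \<one> a] cl by simp
    moreover have "D b a = D a b" "D b \<one> = D \<one> b" using D_sym cl by simp_all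
    ultimately show ?thesis using ultra(2) R hd d2 k_nonneg by (simp add: max_def split: if_splits)
  qed
  have e2: "D h (a \<otimes> b) \<le> max (D \<one> a) (D \<one> b) - R + c + 3 * k"
  proof -
    have "D h (a \<otimes> b) + D \<one> a \<le> max (D h \<one> + D (a \<otimes> b) a) (D h a + D (a \<otimes> b) \<one>) + k"
      using D_four[of h "a \<otimes> b" \<one> a] cl by simp
    moreover have "D (a \<otimes> b) a = D \<one> b" "D (a \<otimes> b) \<one> = D \<one> (a \<otimes> b)"
      using D_sym cl d1 by simp_all
    ultimately show ?thesis using ultra(1) R hd d2 k_nonneg by (simp add: max_def split: if_splits)
  qed
  \<comment> \<open>Subtracting \<open>D b (a \<otimes> b) = D \<one> a\<close> leaves the drop by
    \<open>2 R\<close>. In the second alternative what remains is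
    \<open>D \<one> b - D \<one> a\<close>, and \<open>2 R \<le> D \<one> a\<close> turns it into
    the same bound.\<close>
  have "D h (b \<otimes> h) + D b (a \<otimes> b) \<le>
      max (D h b + D (b \<otimes> h) (a \<otimes> b)) (D h (a \<otimes> b) + D (b \<otimes> h) b) + k"
    using D_four[of h "b \<otimes> h" b "a \<otimes> b"] cl by simp
  then have "D h (b \<otimes> h) \<le> max (D \<one> b - 2 * R) 0 + (2 * c + 4 * k)"
    using e1 e2 R hd d1 d2 k_nonneg by (simp add: max_def split: if_splits)
  moreover have "D h (b \<otimes> h) = D \<one> (inv h \<otimes> b \<otimes> h)"
    using D_inv[of h \<one> "inv h \<otimes> b \<otimes> h"] cl by (simp add: m_assoc[symmetric])
  ultimately show ?thesis by simp
qed

text \<open>\<open>r\<close> acts as the rotation \<open>w / n\<close>, away from the axes, and so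
  kills the stable norm; \<open>conj\<close> makes every conjugation a rotation up to
  commensuration; \<open>mid\<close> replaces points of geodesics by orbit points up to
  \<open>c\<close>.\<close>

theorem commensurated_lattice_bounded:
  fixes j :: "gint \<Rightarrow> 'a"
  assumes j: "\<And>z. j z \<in> carrier G" "\<And>x y. j (x + y) = j x \<otimes> j y"
    and conj: "\<And>h. h \<in> carrier G \<Longrightarrow> \<exists>M B. M > 0 \<and> gnorm B > 0 \<and>
      (\<forall>z. inv h \<otimes> j (of_int M * (gcnj B * z)) \<otimes> h = j (of_int M * (B * z)))"
    and r: "r \<in> carrier G" "gnorm w = n\<^sup>2" "n > 0" "gre w \<noteq> 0" "gim w \<noteq> 0"
      "\<And>z. r \<otimes> j (of_int n * z) = j (w * z) \<otimes> r"
    and mid: "\<And>g R. g \<in> carrier G \<Longrightarrow> 0 \<le> R \<Longrightarrow> R \<le> D \<one> g \<Longrightarrow>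
      \<exists>h \<in> carrier G. D \<one> h \<le> R + c \<and> D h g \<le> D \<one> g - R + c"
  shows "\<exists>b. \<forall>z. D \<one> (j z) \<le> b"
proof (rule ccontr)
  assume unb: "\<not> ?thesis"
  interpret hyperbolic_norm "\<lambda>z. D \<one> (j z)" k
    by (rule hyperbolic_norm_restrict(1)[of j]) (fact j)+
  note dist = hyperbolic_norm_restrict(2)[of j, OF j]
  \<comment> \<open>Conjugation by \<open>r\<close> changes a displacement by at most twice the
    displacement of \<open>r\<close>.\<close>
  have "\<bar>D \<one> (j (w * z)) - D \<one> (j (of_int n * z))\<bar> \<le> 2 * D \<one> r" for z
  proof -
    let ?a = "j (of_int n * z)" and ?b = "j (w * z)"
    have cl: "?a \<in> carrier G" "?b \<in> carrier G" using j by auto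
    have ra: "r \<otimes> ?a = ?b \<otimes> r" by (rule r(6))
    have "D r (r \<otimes> ?a) = D \<one> ?a" "D ?b (?b \<otimes> r) = D \<one> r"
      using D_inv[of r \<one> ?a] D_inv[of ?b \<one> r] cl r(1) by simp_all
    moreover have "D \<one> ?b \<le> D \<one> r + D r ?b" "D r ?b \<le> D r (r \<otimes> ?a) + D (r \<otimes> ?a) ?b"
      "D r (r \<otimes> ?a) \<le> D r ?b + D ?b (r \<otimes> ?a)" "D r ?b \<le> D r \<one> + D \<one> ?b"
      using cl r(1) by (auto intro!: D_tri)
    moreover have "D r \<one> = D \<one> r" "D (r \<otimes> ?a) ?b = D ?b (r \<otimes> ?a)" using cl r(1) by (auto intro!: D_sym)
    ultimately show ?thesis using ra by simp
  qed
  then have "stable x = 0" for x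
    using stable_eq_zero r(2-5) by blast
  note ultra = ultrametric[OF this]
  define C where "C = 2 * \<bar>c\<bar> + 4 * k"
  \<comment> \<open>Large enough that the drop \<open>2 * R\<close> beats the ultrametric defect
    \<open>2 * k\<close> together with the loss \<open>C\<close> of
    \<open>conjugate_contracts\<close>.\<close>
  define R where "R = C + 2 * k + 1"
  have C: "C \<ge> 0" using k_nonneg by (simp add: C_def)
  have Rpos: "R > 0" "2 * R > 2 * k + C" using C k_nonneg by (simp_all add: R_def)
  obtain z where z: "D \<one> (j z) > 2 * R" using unb by (meson not_le)
  obtain h where h: "h \<in> carrier G" "D \<one> h \<le> R + \<bar>c\<bar>" "D h (j z) \<le> D \<one> (j z) - R + \<bar>c\<bar>"
  proof -
    have "R \<le> D \<one> (j z)" using z Rpos by linarith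
    then obtain h where h: "h \<in> carrier G" "D \<one> h \<le> R + c" "D h (j z) \<le> D \<one> (j z) - R + c"
      using mid[of "j z" R] j(1) Rpos(1) by (meson less_imp_le)
    then show ?thesis using that[of h] abs_ge_self[of c] by linarith
  qed
  have contract: "D \<one> (inv h \<otimes> j y \<otimes> h) \<le> max (D \<one> (j y) - 2 * R) 0 + C" for y
    unfolding C_def
  proof (rule conjugate_contracts[of "j z"])
    show "j z \<otimes> j y = j y \<otimes> j z" unfolding j(2)[symmetric] by (simp add: add.commute)
    show "D \<one> (j z \<otimes> j y) \<le> max (D \<one> (j z)) (D \<one> (j y)) + 2 * k"
      using ultra[of z y] by (simp add: j(2))
    show "D (j z) (j y) \<le> max (D \<one> (j z)) (D \<one> (j y)) + 2 * k"
      using ultra[of "- z" y] by (simp add: dist minus)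
  qed (use j h z Rpos in auto)
  obtain M B where MB: "M > 0" "gnorm B > 0"
    "\<And>z. inv h \<otimes> j (of_int M * (gcnj B * z)) \<otimes> h = j (of_int M * (B * z))"
    using conj[OF h(1)] by blast
  have "\<exists>b. \<forall>z. D \<one> (j z) \<le> b"
  proof (rule ultrametric_contraction_bounded[where B = B and n = "gnorm B" and M = M and u = "2 * k"])
    show "D \<one> (j (of_int M * (B * z))) \<le> max (D \<one> (j (of_int M * (gcnj B * z))) - 2 * R) 0 + C" for z
      using contract[of "of_int M * (gcnj B * z)"] unfolding MB(3) .
  qed (use MB ultra Rpos in auto)
  then show False using unb by blast
qed

end

section \<open>Slim triangles and the four-point inequality\<close>

lemma mdist_metric_facts:
  "0 \<le> mdist C x y" "mdist C x y = mdist C y x"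
  "x \<in> mspace C \<Longrightarrow> y \<in> mspace C \<Longrightarrow> z \<in> mspace C \<Longrightarrow> mdist C x z \<le> mdist C x y + mdist C y z"
  "x \<in> mspace C \<Longrightarrow> mdist C x x = 0"
  by (simp_all add: mdist_commute mdist_triangle)

lemma geodesic_segmentE:
  assumes "geodesic_segment C S x y"
  obtains \<gamma> where "\<gamma> \<in> {0..mdist C x y} \<rightarrow> mspace C" "\<gamma> 0 = x" "\<gamma> (mdist C x y) = y"
    "S = \<gamma> ` {0..mdist C x y}"
    "\<And>s t. s \<in> {0..mdist C x y} \<Longrightarrow> t \<in> {0..mdist C x y} \<Longrightarrow> mdist C (\<gamma> s) (\<gamma> t) = \<bar>s - t\<bar>"
proof -
  obtain \<gamma> l where l: "l \<ge> 0" "\<gamma> \<in> {0..l} \<rightarrow> mspace C"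
    "\<And>s t. s \<in> {0..l} \<Longrightarrow> t \<in> {0..l} \<Longrightarrow> mdist C (\<gamma> s) (\<gamma> t) = \<bar>s - t\<bar>" "\<gamma> 0 = x" "\<gamma> l = y"
    "S = \<gamma> ` {0..l}"
    using assms unfolding geodesic_segment_def by blast
  have "mdist C x y = l" using l(3)[of 0 l] l by simp
  then show ?thesis using that[of \<gamma>] l by simp
qed

lemma geodesic_segment_between:
  assumes "geodesic_segment C S x y" "q \<in> S"
  shows "q \<in> mspace C" "mdist C x q + mdist C q y = mdist C x y"
proof -
  obtain \<gamma> where g: "\<gamma> \<in> {0..mdist C x y} \<rightarrow> mspace C" "\<gamma> 0 = x" "\<gamma> (mdist C x y) = y"
    "S = \<gamma> ` {0..mdist C x y}"
    "\<And>s t. s \<in> {0..mdist C x y} \<Longrightarrow> t \<in> {0..mdist C x y} \<Longrightarrow> mdist C (\<gamma> s) (\<gamma> t) = \<bar>s - t\<bar>"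
    by (rule geodesic_segmentE[OF assms(1)]) blast
  obtain s where s: "s \<in> {0..mdist C x y}" "q = \<gamma> s" using assms(2) g(4) by blast
  show "q \<in> mspace C" using s g(1) by blast
  show "mdist C x q + mdist C q y = mdist C x y"
    using g(5)[of 0 s] g(5)[of s "mdist C x y"] s g(2,3) by simp
qed

lemma geodesic_segment_ends:
  assumes "geodesic_segment C S x y"
  shows "x \<in> mspace C" "y \<in> mspace C" "x \<in> S" "y \<in> S"
proof -
  obtain \<gamma> where g: "\<gamma> \<in> {0..mdist C x y} \<rightarrow> mspace C" "\<gamma> 0 = x" "\<gamma> (mdist C x y) = y"
    "S = \<gamma> ` {0..mdist C x y}"
    using geodesic_segmentE[OF assms] by metis
  have "0 \<in> {0..mdist C x y}" "mdist C x y \<in> {0..mdist C x y}" by simp_all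
  then show "x \<in> mspace C" "y \<in> mspace C" "x \<in> S" "y \<in> S"
    using g by (metis funcset_mem image_eqI)+
qed

lemma geodesic_segment_near:
  assumes "geodesic_segment C S x y" "q \<in> S" "p \<in> mspace C" "mdist C p q \<le> r"
  shows "mdist C x p + mdist C p y \<le> mdist C x y + 2 * r"
  using geodesic_segment_between[OF assms(1,2)] geodesic_segment_ends[OF assms(1)] assms(3,4)
    mdist_metric_facts(3)[of x C q p] mdist_metric_facts(3)[of p C q y] mdist_commute[of C p q]
  by linarith

text \<open>Each point of the side from \<open>x\<close> to \<open>y\<close> is nearly between
  \<open>x\<close> and \<open>z\<close> or nearly between \<open>z\<close> and \<open>y\<close>;
  where the first kind ends, both hold approximately. Slimness for \<open>w\<close> at that same
  point yields the two alternatives of the maximum. The summand 4 allows for a supremum that is not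
  attained.\<close>

lemma hyperbolic_four_point:
  assumes C: "geodesic_space C" "hyperbolic \<delta> C" and \<delta>: "\<delta> \<ge> 0"
    and p: "x \<in> mspace C" "y \<in> mspace C" "z \<in> mspace C" "w \<in> mspace C"
  shows "mdist C x y + mdist C z w \<le>
    max (mdist C x z + mdist C y w) (mdist C x w + mdist C y z) + (4 * \<delta> + 4)"
proof -
  let ?d = "mdist C"
  obtain S where S: "geodesic_segment C S x y" using C(1) p unfolding geodesic_space_def by blast
  obtain \<gamma> where g: "\<gamma> \<in> {0..?d x y} \<rightarrow> mspace C" "\<gamma> 0 = x" "\<gamma> (?d x y) = y" "S = \<gamma> ` {0..?d x y}"
    "\<And>s t. s \<in> {0..?d x y} \<Longrightarrow> t \<in> {0..?d x y} \<Longrightarrow> mdist C (\<gamma> s) (\<gamma> t) = \<bar>s - t\<bar>"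
    by (rule geodesic_segmentE[OF S]) blast
  have slim: "?d x q + ?d q u \<le> ?d x u + 2 * \<delta> \<or> ?d u q + ?d q y \<le> ?d u y + 2 * \<delta>"
    if u: "u \<in> mspace C" and q: "q \<in> S" for u q
  proof -
    obtain S2 where S2: "geodesic_segment C S2 y u" using C(1) p u unfolding geodesic_space_def by blast
    obtain S3 where S3: "geodesic_segment C S3 u x" using C(1) p u unfolding geodesic_space_def by blast
    have "q \<in> cnbhd C \<delta> (S2 \<union> S3)" using C(2) S S2 S3 q unfolding hyperbolic_def by blast
    then obtain v where v: "v \<in> S2 \<union> S3" "?d q v \<le> \<delta>" "q \<in> mspace C" unfolding cnbhd_def by blast
    from v(1) show ?thesis
    proof
      assume "v \<in> S2"
      from geodesic_segment_near[OF S2 this v(3,2)]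
      show ?thesis using mdist_commute[of C y q] mdist_commute[of C q u] mdist_commute[of C y u] by linarith
    next
      assume "v \<in> S3"
      from geodesic_segment_near[OF S3 this v(3,2)]
      show ?thesis using mdist_commute[of C u q] mdist_commute[of C q x] mdist_commute[of C u x] by linarith
    qed
  qed
  define X where "X = {s \<in> {0..?d x y}. ?d x (\<gamma> s) + ?d (\<gamma> s) z \<le> ?d x z + 2 * \<delta>}"
  have z0: "0 \<in> X" using p g(2) \<delta> by (simp add: X_def mdist_metric_facts(4))
  have bdd: "bdd_above X" unfolding X_def by (auto intro: bdd_aboveI[of _ "?d x y"])
  define m where "m = Sup X"
  have "0 \<le> m" unfolding m_def by (rule cSup_upper[OF z0 bdd])
  moreover have "m \<le> ?d x y"
    unfolding m_def by (rule cSup_least) (use z0 in \<open>auto simp only: X_def mem_Collect_eq atLeastAtMost_iff\<close>)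
  ultimately have m: "0 \<le> m" "m \<le> ?d x y" .
  obtain s where s: "s \<in> X" "m - 1 / 2 < s"
    using less_cSup_iff[of X "m - 1 / 2"] z0 bdd m_def by auto
  have sm: "s \<le> m" unfolding m_def by (rule cSup_upper[OF s(1) bdd])
  \<comment> \<open>Just past the supremum: unless \<open>t\<close> is the end at \<open>y\<close>,
    it lies outside \<open>X\<close>, and slimness puts it near the side from \<open>z\<close> to
    \<open>y\<close>. It is within 1 of \<open>s\<close>, which costs 2 in the sum of two
    distances.\<close>
  define t where "t = min (m + 1 / 2) (?d x y)"
  have t: "0 \<le> t" "t \<le> ?d x y" "\<bar>t - s\<bar> \<le> 1" "s \<in> {0..?d x y}"
    using m sm s by (auto simp: t_def X_def)
  have tz: "?d z (\<gamma> t) + ?d (\<gamma> t) y \<le> ?d z y + 2 * \<delta>"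
  proof (cases "t = ?d x y")
    case True
    then have "\<gamma> t = y" using g(3) by (rule ssubst)
    then show ?thesis using mdist_metric_facts(4)[OF p(2)] \<delta> by simp
  next
    case False
    then have "t > m" using m unfolding t_def by linarith
    then have "t \<notin> X" using cSup_upper[OF _ bdd, of t] unfolding m_def by linarith
    then have "\<not> ?d x (\<gamma> t) + ?d (\<gamma> t) z \<le> ?d x z + 2 * \<delta>" using t by (simp add: X_def)
    moreover have tS: "\<gamma> t \<in> S" using g(4) t(1,2) by simp
    ultimately show ?thesis using disjE[OF slim[OF p(3) tS]] by metis
  qed
  have tI: "t \<in> {0..?d x y}" using t by simp
  have st: "?d (\<gamma> s) (\<gamma> t) \<le> 1" using g(5)[OF t(4) tI] t(3) by linarith
  have sS: "\<gamma> s \<in> S" "\<gamma> s \<in> mspace C" "\<gamma> t \<in> mspace C" using g(1,4) t(4) tI by blast+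
  have 1: "?d x (\<gamma> s) + ?d (\<gamma> s) z \<le> ?d x z + 2 * \<delta>" using s(1) by (simp add: X_def)
  have 2: "?d z (\<gamma> s) + ?d (\<gamma> s) y \<le> ?d z y + 2 * \<delta> + 2"
    using tz st mdist_metric_facts(3)[of z C "\<gamma> t" "\<gamma> s"] mdist_metric_facts(3)[of "\<gamma> s" C "\<gamma> t" y]
      sS p mdist_commute[of C "\<gamma> s" "\<gamma> t"] by linarith
  have 3: "?d x y \<le> ?d x (\<gamma> s) + ?d (\<gamma> s) y" "?d z w \<le> ?d z (\<gamma> s) + ?d (\<gamma> s) w"
    using sS p by (auto intro: mdist_triangle)
  have 4: "?d (\<gamma> s) z = ?d z (\<gamma> s)" "?d y w = ?d w y" "?d z y = ?d y z" "?d w (\<gamma> s) = ?d (\<gamma> s) w"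
    by (simp_all add: mdist_commute)
  from slim[OF p(4) sS(1)] show ?thesis
  proof
    assume "?d x (\<gamma> s) + ?d (\<gamma> s) w \<le> ?d x w + 2 * \<delta>"
    then have "?d x y + ?d z w \<le> (?d x w + ?d y z) + (4 * \<delta> + 4)" using 2 3 4 by linarith
    then show ?thesis by linarith
  next
    assume "?d w (\<gamma> s) + ?d (\<gamma> s) y \<le> ?d w y + 2 * \<delta>"
    then have "?d x y + ?d z w \<le> (?d x z + ?d y w) + (4 * \<delta> + 4)" using 1 3 4 by linarith
    then show ?thesis by linarith
  qed
qed

section \<open>Domains on which a lattice has unbounded projections\<close>

text \<open>The numerical content of a hierarchy: \<open>pd V\<close> measures projections to
  \<open>V\<close> and \<open>wd\<close> is the word metric. The triangle inequality for
  \<open>pd\<close> has a defect because projections are sets of bounded diameter.\<close>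

locale hierarchical_group = group G for G (structure) +
  fixes Dom :: "'i set" and nst :: "'i \<Rightarrow> 'i \<Rightarrow> bool" and \<sigma> :: "'a \<Rightarrow> 'i \<Rightarrow> 'i"
    and pd :: "'i \<Rightarrow> 'a \<Rightarrow> 'a \<Rightarrow> real" and wd :: "'a \<Rightarrow> 'a \<Rightarrow> real"
    and K \<xi> \<Lambda> E :: real and n :: nat
  assumes constants: "0 \<le> K" "0 \<le> \<xi>" "1 \<le> \<Lambda>" "0 \<le> E"
    and pd_sym: "V \<in> Dom \<Longrightarrow> x \<in> carrier G \<Longrightarrow> y \<in> carrier G \<Longrightarrow> pd V x y = pd V y x"
    and pd_tri: "V \<in> Dom \<Longrightarrow> x \<in> carrier G \<Longrightarrow> y \<in> carrier G \<Longrightarrow> z \<in> carrier G \<Longrightarrow>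
      pd V x z \<le> pd V x y + pd V y z + \<xi>"
    and pd_lip: "V \<in> Dom \<Longrightarrow> x \<in> carrier G \<Longrightarrow> y \<in> carrier G \<Longrightarrow> pd V x y \<le> K * wd x y + K"
    and pd_equiv: "V \<in> Dom \<Longrightarrow> g \<in> carrier G \<Longrightarrow> x \<in> carrier G \<Longrightarrow> y \<in> carrier G \<Longrightarrow>
      pd (\<sigma> g V) (g \<otimes> x) (g \<otimes> y) = pd V x y"
    and \<sigma>_Dom: "g \<in> carrier G \<Longrightarrow> V \<in> Dom \<Longrightarrow> \<sigma> g V \<in> Dom"
    and \<sigma>_one: "V \<in> Dom \<Longrightarrow> \<sigma> \<one> V = V"
    and \<sigma>_mult: "g \<in> carrier G \<Longrightarrow> h \<in> carrier G \<Longrightarrow> V \<in> Dom \<Longrightarrow> \<sigma> (g \<otimes> h) V = \<sigma> g (\<sigma> h V)"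
    and nst_\<sigma>: "g \<in> carrier G \<Longrightarrow> V \<in> Dom \<Longrightarrow> W \<in> Dom \<Longrightarrow> nst (\<sigma> g V) (\<sigma> g W) \<longleftrightarrow> nst V W"
    and nst_refl: "V \<in> Dom \<Longrightarrow> nst V V"
    and nst_trans: "U \<in> Dom \<Longrightarrow> V \<in> Dom \<Longrightarrow> W \<in> Dom \<Longrightarrow> nst U V \<Longrightarrow> nst V W \<Longrightarrow> nst U W"
    and nst_antisym: "V \<in> Dom \<Longrightarrow> W \<in> Dom \<Longrightarrow> nst V W \<Longrightarrow> nst W V \<Longrightarrow> V = W"
    and nst_top: "Dom = {} \<or> (\<exists>!S. S \<in> Dom \<and> (\<forall>W\<in>Dom. nst S W \<longrightarrow> W = S))"
    and complexity: "F \<subseteq> Dom \<Longrightarrow> (\<forall>V\<in>F. \<forall>W\<in>F. nst V W \<or> nst W V) \<Longrightarrow> finite F \<and> card F \<le> n"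
    and large_links: "W \<in> Dom \<Longrightarrow> x \<in> carrier G \<Longrightarrow> y \<in> carrier G \<Longrightarrow>
      \<exists>\<T>. \<T> \<subseteq> {T \<in> Dom. nst T W \<and> T \<noteq> W} \<and> finite \<T> \<and> int (card \<T>) \<le> \<lfloor>\<Lambda> * pd W x y + \<Lambda>\<rfloor> \<and>
        (\<forall>T\<in>Dom. nst T W \<and> T \<noteq> W \<longrightarrow> (\<exists>T'\<in>\<T>. nst T T') \<or> pd T x y < E)"
    and uniqueness: "\<kappa> \<ge> 0 \<Longrightarrow> \<exists>\<theta>. \<forall>x\<in>carrier G. \<forall>y\<in>carrier G. wd x y \<ge> \<theta> \<longrightarrow> (\<exists>V\<in>Dom. pd V x y \<ge> \<kappa>)"
    and wd_inv: "g \<in> carrier G \<Longrightarrow> x \<in> carrier G \<Longrightarrow> y \<in> carrier G \<Longrightarrow> wd (g \<otimes> x) (g \<otimes> y) = wd x y"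
    and wd_finite: "finite {g \<in> carrier G. wd \<one> g \<le> r}"
begin

lemma \<sigma>_inv [simp]:
  assumes "g \<in> carrier G" "V \<in> Dom"
  shows "\<sigma> (inv g) (\<sigma> g V) = V" "\<sigma> g (\<sigma> (inv g) V) = V"
  using \<sigma>_mult[of "inv g" g V] \<sigma>_mult[of g "inv g" V] assms \<sigma>_one by simp_all

section \<open>Depth in the nesting order\<close>

definition chains_above :: "'i \<Rightarrow> 'i set set" where
  "chains_above V = {F. F \<subseteq> Dom \<and> (\<forall>W\<in>F. \<forall>W'\<in>F. nst W W' \<or> nst W' W) \<and> (\<forall>W\<in>F. nst V W)}"

text \<open>Counted upwards, so that larger domains have smaller depth and large links lead to
  greater depth. The depth is invariant under the group.\<close>

definition depth :: "'i \<Rightarrow> nat" where "depth V = Max (card ` chains_above V)"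

lemma chains_above_card: "F \<in> chains_above V \<Longrightarrow> finite F \<and> card F \<le> n"
  unfolding chains_above_def using complexity by blast

lemma finite_card_chains: "finite (card ` chains_above V)"
  by (rule finite_subset[of _ "{..n}"]) (use chains_above_card in auto)

lemma chains_above_nonempty: "chains_above V \<noteq> {}"
  by (auto simp: chains_above_def intro!: exI[of _ "{}"])

lemma card_le_depth: "F \<in> chains_above V \<Longrightarrow> card F \<le> depth V"
  unfolding depth_def by (intro Max_ge finite_card_chains) auto

lemma depth_attained: obtains F where "F \<in> chains_above V" "card F = depth V"
proof -
  have "depth V \<in> card ` chains_above V"
    unfolding depth_def using chains_above_nonempty by (intro Max_in finite_card_chains) auto
  then show ?thesis using that by auto
qed

lemma depth_le: "depth V \<le> n"
  using depth_attained[of V] chains_above_card by metis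

lemma depth_less:
  assumes "V \<in> Dom" "W \<in> Dom" "nst V W" "V \<noteq> W"
  shows "depth W < depth V"
proof -
  obtain F where F: "F \<in> chains_above W" "card F = depth W" using depth_attained .
  have fin: "finite F" using chains_above_card[OF F(1)] by simp
  have F': "F \<subseteq> Dom" "\<And>U. U \<in> F \<Longrightarrow> nst W U" "\<forall>W\<in>F. \<forall>W'\<in>F. nst W W' \<or> nst W' W"
    using F(1) by (auto simp: chains_above_def)
  have V: "nst V U" if "U \<in> F" for U using nst_trans[of V W U] F' that assms by blast
  have "V \<notin> F" using F'(2) nst_antisym[OF assms(1,2,3)] assms(4) by blast
  moreover have "insert V F \<in> chains_above V"
    unfolding chains_above_def using F' V nst_refl assms(1) by auto
  ultimately show ?thesis using card_le_depth[of "insert V F" V] F(2) fin by simp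
qed

lemma depth_\<sigma>:
  assumes "g \<in> carrier G" "V \<in> Dom"
  shows "depth (\<sigma> g V) = depth V"
proof -
  have le: "depth U \<le> depth (\<sigma> h U)" if h: "h \<in> carrier G" "U \<in> Dom" for h U
  proof -
    obtain F where F: "F \<in> chains_above U" "card F = depth U" using depth_attained .
    have F': "F \<subseteq> Dom" using F(1) by (auto simp: chains_above_def)
    have "inj_on (\<sigma> h) F"
      by (rule inj_on_inverseI[where g = "\<sigma> (inv h)"]) (use F' h in auto)
    then have "card (\<sigma> h ` F) = depth U" using F(2) card_image by metis
    moreover have "\<sigma> h ` F \<in> chains_above (\<sigma> h U)"
      using F(1) h by (auto simp: chains_above_def nst_\<sigma> subset_iff \<sigma>_Dom)
    ultimately show ?thesis using card_le_depth by metis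
  qed
  show ?thesis using le[OF assms] le[of "inv g" "\<sigma> g V"] assms \<sigma>_Dom by simp
qed

text \<open>The nesting axiom gives only a unique maximal element. A domain of least depth among
  those above \<open>V\<close> is maximal, hence equal to it, so finite complexity makes it the
  greatest element.\<close>

lemma top_domain:
  assumes "Dom \<noteq> {}"
  obtains S where "S \<in> Dom" "\<And>V. V \<in> Dom \<Longrightarrow> nst V S"
proof -
  obtain S where S: "S \<in> Dom" "\<And>T. T \<in> Dom \<Longrightarrow> (\<forall>W\<in>Dom. nst T W \<longrightarrow> W = T) \<Longrightarrow> T = S"
    using nst_top assms by metis
  have "nst V S" if V: "V \<in> Dom" for V
  proof -
    let ?P = "\<lambda>W. W \<in> Dom \<and> nst V W"
    obtain W where W: "?P W" "\<And>W'. ?P W' \<Longrightarrow> depth W \<le> depth W'"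
      using ex_has_least_nat[of ?P V depth] V nst_refl by blast
    have "W' = W" if "W' \<in> Dom" "nst W W'" for W'
    proof (rule ccontr)
      assume "W' \<noteq> W"
      then have "depth W' < depth W" using depth_less[of W W'] W that by auto
      moreover have "?P W'" using nst_trans[of V W W'] W that V by blast
      ultimately show False using W(2)[of W'] by simp
    qed
    then show ?thesis using S(2)[of W] W(1) by blast
  qed
  then show ?thesis using that S(1) by blast
qed

section \<open>Counting domains with large projections\<close>

definition relevant :: "nat \<Rightarrow> 'a \<Rightarrow> 'a \<Rightarrow> 'i set" where
  "relevant l x y = {V \<in> Dom. depth V = l \<and> pd V x y \<ge> E}"

lemma relevant_below_bound:
  assumes xy: "x \<in> carrier G" "y \<in> carrier G"
    and C: "\<And>W. W \<in> Dom \<Longrightarrow> depth W < l \<Longrightarrow> pd W x y \<le> C"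
    and M: "\<Lambda> * C + \<Lambda> \<le> real M" "1 \<le> M"
  shows "T \<in> Dom \<Longrightarrow> l \<le> depth T + i \<Longrightarrow>
    finite {V \<in> relevant l x y. nst V T} \<and> card {V \<in> relevant l x y. nst V T} \<le> M ^ i"
proof (induction i arbitrary: T)
  case 0
  have "{V \<in> relevant l x y. nst V T} \<subseteq> {T}"
    using depth_less[of _ T] 0 by (force simp: relevant_def)
  then show ?case using card_mono[of "{T}"] finite_subset[of _ "{T}"] by auto
next
  case (Suc i)
  let ?R = "\<lambda>T. {V \<in> relevant l x y. nst V T}"
  have M1: "1 \<le> M ^ Suc i" using M(2) by simp
  show ?case
  proof (cases "l \<le> depth T")
    case True
    have "?R T \<subseteq> {T}"
      using depth_less[of _ T] Suc.prems True by (force simp: relevant_def)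
    then show ?thesis using card_mono[of "{T}" "?R T"] finite_subset[of _ "{T}"] order_trans[OF _ M1] by simp
  next
    case False
    obtain \<T> where \<T>: "\<T> \<subseteq> {T' \<in> Dom. nst T' T \<and> T' \<noteq> T}" "finite \<T>"
      "int (card \<T>) \<le> \<lfloor>\<Lambda> * pd T x y + \<Lambda>\<rfloor>"
      "\<And>V. V \<in> Dom \<Longrightarrow> nst V T \<and> V \<noteq> T \<Longrightarrow> (\<exists>T'\<in>\<T>. nst V T') \<or> pd V x y < E"
      using large_links[OF Suc.prems(1) xy] by blast
    have "\<Lambda> * pd T x y + \<Lambda> \<le> real M"
      using mult_left_mono[of "pd T x y" C \<Lambda>] C[OF Suc.prems(1)] False M(1) constants by linarith
    then have cT: "card \<T> \<le> M" using \<T>(3) by linarith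
    have sub: "?R T \<subseteq> (\<Union>T'\<in>\<T>. ?R T')"
    proof
      fix V assume V: "V \<in> ?R T"
      then have "V \<noteq> T" using False by (auto simp: relevant_def)
      then show "V \<in> (\<Union>T'\<in>\<T>. ?R T')" using \<T>(4)[of V] V by (auto simp: relevant_def)
    qed
    have IH: "finite (?R T') \<and> card (?R T') \<le> M ^ i" if "T' \<in> \<T>" for T'
    proof (rule Suc.IH)
      show "T' \<in> Dom" using \<T>(1) that by auto
      show "l \<le> depth T' + i"
        using depth_less[of T' T] \<T>(1) that Suc.prems by fastforce
    qed
    then have fin: "finite (\<Union>T'\<in>\<T>. ?R T')" using \<T>(2) by blast
    have "card (?R T) \<le> card (\<Union>T'\<in>\<T>. ?R T')" by (rule card_mono[OF fin sub])
    also have "\<dots> \<le> (\<Sum>T'\<in>\<T>. card (?R T'))" by (rule card_UN_le[OF \<T>(2)])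
    also have "\<dots> \<le> card \<T> * M ^ i" using sum_bounded_above[of \<T> "\<lambda>T'. card (?R T')" "M ^ i"] IH by simp
    also have "\<dots> \<le> M * M ^ i" using cT by simp
    finally show ?thesis using finite_subset[OF sub fin] by simp
  qed
qed

lemma relevant_bound:
  assumes "x \<in> carrier G" "y \<in> carrier G"
    and "\<And>W. W \<in> Dom \<Longrightarrow> depth W < l \<Longrightarrow> pd W x y \<le> C"
    and "\<Lambda> * C + \<Lambda> \<le> real M" "1 \<le> M"
  shows "finite (relevant l x y) \<and> card (relevant l x y) \<le> M ^ l"
proof (cases "Dom = {}")
  case True
  then have "relevant l x y = {}" unfolding relevant_def by blast
  then show ?thesis by simp
next
  case False
  then obtain S where S: "S \<in> Dom" "\<And>V. V \<in> Dom \<Longrightarrow> nst V S" using top_domain by metis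
  have "{V \<in> relevant l x y. nst V S} = relevant l x y" using S by (auto simp: relevant_def)
  then show ?thesis using relevant_below_bound[of x y l C M S l] assms S(1) by simp
qed

end

lemma card_half_of_pairing:
  assumes "finite A" "R \<subseteq> A" "inj_on f (A - R)" "f ` (A - R) \<subseteq> R"
  shows "card A \<le> 2 * card R"
proof -
  have "card (A - R) \<le> card R"
    using card_inj_on_le[OF assms(3,4)] assms(1,2) finite_subset by blast
  moreover have "card (A - R) = card A - card R"
    using assms(1,2) by (simp add: card_Diff_subset finite_subset)
  ultimately show ?thesis by simp
qed

locale hierarchical_group_lattice = hierarchical_group +
  fixes j :: "gint \<Rightarrow> 'a"
  assumes j_closed: "j z \<in> carrier G"
    and j_add: "j (x + y) = j x \<otimes> j y"
    and j_inj: "inj j"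
    and j_commensurated: "g \<in> carrier G \<Longrightarrow> \<exists>M > 0. \<forall>z. \<exists>z'. g \<otimes> j (of_int M * z) = j z' \<otimes> g"
begin

lemma j_zero: "j 0 = \<one>"
  using j_add[of 0 0] j_closed[of 0] by (simp add: l_cancel_one')

lemma j_minus: "j (- z) = inv j z"
  using j_add[of "- z" z] j_closed j_zero by (intro inv_equality[symmetric]) auto

lemma j_commute: "j x \<otimes> j y = j y \<otimes> j x"
  by (simp add: j_add[symmetric] add.commute)

text \<open>As the lattice is abelian, \<open>j b\<close> moves \<open>\<one>\<close> and
  \<open>j z\<close> by the same word distance. Hence moving the domain changes the projection
  distance by a bound independent of \<open>z\<close>.\<close>

lemma pd_translate:
  assumes "V \<in> Dom"
  shows "pd (\<sigma> (j b) V) \<one> (j z) \<ge> pd V \<one> (j z) - 2 * (K * wd \<one> (j b) + K + \<xi>)"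
proof -
  let ?V = "\<sigma> (j b) V"
  have V: "?V \<in> Dom" using \<sigma>_Dom j_closed assms by blast
  have "pd ?V (j b \<otimes> \<one>) (j b \<otimes> j z) = pd V \<one> (j z)"
    by (rule pd_equiv) (use assms j_closed in auto)
  moreover have "pd ?V (j b) (j b \<otimes> j z) \<le> pd ?V (j b) \<one> + pd ?V \<one> (j b \<otimes> j z) + \<xi>"
    "pd ?V \<one> (j b \<otimes> j z) \<le> pd ?V \<one> (j z) + pd ?V (j z) (j b \<otimes> j z) + \<xi>"
    using V j_closed by (auto intro!: pd_tri)
  moreover have "pd ?V (j b) \<one> = pd ?V \<one> (j b)" by (rule pd_sym) (use V j_closed in auto)
  moreover have "pd ?V \<one> (j b) \<le> K * wd \<one> (j b) + K" by (rule pd_lip) (use V j_closed in auto)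
  moreover have "pd ?V (j z) (j b \<otimes> j z) \<le> K * wd (j z) (j b \<otimes> j z) + K"
    by (rule pd_lip) (use V j_closed in auto)
  moreover have "wd (j z) (j b \<otimes> j z) = wd \<one> (j b)"
    using wd_inv[of "j z" \<one> "j b"] j_closed by (simp add: j_commute[of b z])
  ultimately show ?thesis using j_closed by simp
qed

lemma stabilises_multiple:
  assumes "V \<in> Dom" "\<sigma> (j b) V = V"
  shows "\<sigma> (j (of_int m * b)) V = V"
proof -
  have nat: "\<sigma> (j (of_nat m * b)) V = V" for m
    by (induction m) (simp_all add: j_zero \<sigma>_one assms j_add distrib_right \<sigma>_mult j_closed)
  show ?thesis
  proof (cases m)
    case (nonneg k)
    then show ?thesis using nat[of k] by simp
  next
    case (neg k)
    let ?g = "j (of_nat (Suc k) * b)"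
    have "\<sigma> (inv ?g) (\<sigma> ?g V) = V" by (rule \<sigma>_inv) (use assms j_closed in auto)
    then have "\<sigma> (inv ?g) V = V" unfolding nat .
    moreover have "inv ?g = j (of_int m * b)" unfolding j_minus[symmetric] neg by (simp add: algebra_simps)
    ultimately show ?thesis by simp
  qed
qed

text \<open>Remainders modulo \<open>M\<close> form a finite set, so one loss \<open>c\<close>
  serves all domains: the sublattice has unbounded projections wherever the lattice has.\<close>

lemma pd_multiple:
  assumes "M > 0"
  shows "\<exists>c. \<forall>V\<in>Dom. \<forall>z. \<exists>q. pd V \<one> (j z) \<le> pd V \<one> (j (of_int M * q)) + c"
proof -
  define c where "c = Max ((\<lambda>d. K * wd \<one> (j d) + K) ` {d. gnorm d \<le> 2 * M\<^sup>2}) + \<xi>"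
  have "\<exists>q. pd V \<one> (j z) \<le> pd V \<one> (j (of_int M * q)) + c" if V: "V \<in> Dom" for V z
  proof -
    obtain q d where qd: "z = of_int M * q + d" "gnorm d \<le> 2 * M\<^sup>2"
      using gint_trunc_div[OF assms, of z] by blast
    let ?q = "j (of_int M * q)"
    have "K * wd \<one> (j d) + K \<le> c - \<xi>"
      unfolding c_def using qd(2) by (auto intro!: Max_ge finite_imageI finite_gnorm_le)
    moreover have "pd V \<one> (j z) \<le> pd V \<one> ?q + pd V ?q (j z) + \<xi>" using V j_closed by (auto intro!: pd_tri)
    moreover have "pd V ?q (j z) \<le> K * wd ?q (j z) + K" using V j_closed by (auto intro!: pd_lip)
    moreover have "wd ?q (j z) = wd \<one> (j d)"
      using wd_inv[of ?q \<one> "j d"] j_closed by (simp add: qd(1) j_add)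
    ultimately show ?thesis by (intro exI[of _ q]) simp
  qed
  then show ?thesis by blast
qed

section \<open>Domains that see the lattice\<close>

definition unbounded_at where
  "unbounded_at V \<longleftrightarrow> (\<forall>b. \<exists>z. b \<le> pd V \<one> (j z))"

text \<open>Conjugation by \<open>g\<close> carries a sublattice of multiples into the lattice, and
  by \<open>pd_multiple\<close> that sublattice is already unbounded at \<open>V\<close>.\<close>

lemma unbounded_at_\<sigma>:
  assumes V: "V \<in> Dom" "unbounded_at V" and g: "g \<in> carrier G"
  shows "unbounded_at (\<sigma> g V)"
  unfolding unbounded_at_def
proof
  fix b
  obtain M where M: "M > 0" "\<And>z. \<exists>z'. g \<otimes> j (of_int M * z) = j z' \<otimes> g"
    using j_commensurated[OF g] by blast
  obtain c where c: "\<And>z. \<exists>q. pd V \<one> (j z) \<le> pd V \<one> (j (of_int M * q)) + c"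
    using pd_multiple[OF M(1)] V(1) by blast
  let ?B = "2 * (K * wd \<one> g + K + \<xi>)"
  obtain z where "b + ?B + c \<le> pd V \<one> (j z)" using V(2) unfolding unbounded_at_def by blast
  then obtain q where q: "b + ?B \<le> pd V \<one> (j (of_int M * q))" using c[of z] by (metis add_le_cancel_right order_trans)
  obtain z' where z': "g \<otimes> j (of_int M * q) = j z' \<otimes> g" using M(2) by blast
  let ?V = "\<sigma> g V"
  have W: "?V \<in> Dom" using \<sigma>_Dom g V by blast
  have "pd ?V (g \<otimes> \<one>) (g \<otimes> j (of_int M * q)) = pd V \<one> (j (of_int M * q))"
    by (rule pd_equiv) (use V g j_closed in auto)
  moreover have "pd ?V g (j z' \<otimes> g) \<le> pd ?V g \<one> + pd ?V \<one> (j z' \<otimes> g) + \<xi>"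
    "pd ?V \<one> (j z' \<otimes> g) \<le> pd ?V \<one> (j z') + pd ?V (j z') (j z' \<otimes> g) + \<xi>"
    using W j_closed g by (auto intro!: pd_tri)
  moreover have "pd ?V g \<one> = pd ?V \<one> g" by (rule pd_sym) (use W g in auto)
  moreover have "pd ?V \<one> g \<le> K * wd \<one> g + K" by (rule pd_lip) (use W g in auto)
  moreover have "pd ?V (j z') (j z' \<otimes> g) \<le> K * wd (j z') (j z' \<otimes> g) + K"
    by (rule pd_lip) (use W g j_closed in auto)
  moreover have "wd (j z') (j z' \<otimes> g) = wd \<one> g"
    using wd_inv[of "j z'" \<one> g] j_closed g by simp
  ultimately have "b \<le> pd ?V \<one> (j z')" using q g by (simp add: z')
  then show "\<exists>z. b \<le> pd ?V \<one> (j z)" by blast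
qed

lemma long_lattice_element: "\<exists>z. wd \<one> (j z) \<ge> r"
proof (rule ccontr)
  assume "\<not> ?thesis"
  then have "range j \<subseteq> {g \<in> carrier G. wd \<one> g \<le> r}" using j_closed by (auto simp: not_le intro: less_imp_le)
  then have "finite (range j)" using wd_finite finite_subset by blast
  then have "finite (UNIV :: gint set)" using j_inj finite_image_iff by blast
  then have "finite (range (\<lambda>n. GI n 0))" by (rule rev_finite_subset) simp
  moreover have "inj (\<lambda>n. GI n 0)" by (auto intro: injI)
  ultimately show False using finite_image_iff infinite_UNIV_int by blast
qed

definition active where
  "active l b = {V \<in> Dom. depth V = l \<and> (\<exists>z. b \<le> pd V \<one> (j z))}"

text \<open>The least depth at which lattice projections are unbounded. Uniqueness provides such a
  depth, as only depths up to \<open>n\<close> occur; minimality bounds the projections to all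
  domains of smaller depth by one constant.\<close>

lemma active_level:
  obtains l where "\<And>b. active l b \<noteq> {}"
    and "\<exists>C. \<forall>W\<in>Dom. \<forall>z. depth W < l \<longrightarrow> pd W \<one> (j z) \<le> C"
proof -
  let ?P = "\<lambda>l. \<forall>b. active l b \<noteq> {}"
  have "\<exists>l. ?P l"
  proof (rule ccontr)
    assume "\<not> ?thesis"
    then obtain b where b: "\<And>l. active l (b l) = {}" by metis
    define \<kappa> where "\<kappa> = max 0 (Max (b ` {..n}))"
    have \<kappa>: "b l \<le> \<kappa>" if "l \<le> n" for l
    proof -
      have "b l \<le> Max (b ` {..n})" by (rule Max_ge) (use that in auto)
      then show ?thesis by (simp add: \<kappa>_def)
    qed
    obtain \<theta> where \<theta>: "\<And>x y. x \<in> carrier G \<Longrightarrow> y \<in> carrier G \<Longrightarrow> wd x y \<ge> \<theta> \<Longrightarrow> \<exists>V\<in>Dom. pd V x y \<ge> \<kappa>"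
      using uniqueness[of \<kappa>] by (auto simp: \<kappa>_def)
    obtain z where "wd \<one> (j z) \<ge> \<theta>" using long_lattice_element by blast
    then obtain V where V: "V \<in> Dom" "pd V \<one> (j z) \<ge> \<kappa>" using \<theta>[of \<one> "j z"] j_closed by auto
    then have "V \<in> active (depth V) (b (depth V))"
      unfolding active_def using \<kappa>[OF depth_le[of V]] by (auto intro: order_trans)
    then show False using b by auto
  qed
  then have P: "?P (LEAST l. ?P l)" by (rule LeastI_ex)
  define l where "l = (LEAST l. ?P l)"
  have "\<exists>b. active i b = {}" if "i < l" for i
    using not_less_Least[of i ?P] that unfolding l_def by blast
  then obtain b where b: "\<And>i. i < l \<Longrightarrow> active i (b i) = {}" by metis
  have "pd W \<one> (j z) \<le> Max (b ` {..<l})" if W: "W \<in> Dom" "depth W < l" for W z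
  proof -
    have "pd W \<one> (j z) < b (depth W)"
      using b[OF W(2)] W(1) by (auto simp: active_def not_le)
    also have "b (depth W) \<le> Max (b ` {..<l})" using W(2) by (intro Max_ge) auto
    finally show ?thesis by simp
  qed
  then show ?thesis using that[of l] P unfolding l_def by blast
qed

text \<open>Pigeonhole: the translates of \<open>V\<close> by \<open>0\<close>, \<open>u\<close>,
  ..., \<open>P u\<close> are all relevant for one pair, which has at most \<open>P\<close> relevant
  domains. So some \<open>d u\<close> with \<open>0 < d \<le> P\<close> fixes \<open>V\<close>, and
  \<open>d\<close> divides \<open>fact P\<close>.\<close>

lemma active_stabiliser:
  assumes R: "\<And>z. finite (relevant l \<one> (j z)) \<and> card (relevant l \<one> (j z)) \<le> P"
  shows "\<exists>c. \<forall>V\<in>active l c. \<forall>z. \<sigma> (j (of_nat (fact P) * z)) V = V"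
proof -
  let ?I = "GI 0 1"
  \<comment> \<open>The largest loss in \<open>pd_translate\<close> over the translations used; the
    threshold \<open>E + m\<close> then keeps all translates relevant.\<close>
  define m where "m = Max ((\<lambda>b. 2 * (K * wd \<one> (j b) + K + \<xi>)) ` (\<lambda>(i, u). of_nat i * u) ` ({..P} \<times> {1, ?I}))"
  have m: "2 * (K * wd \<one> (j (of_nat i * u)) + K + \<xi>) \<le> m" if "i \<le> P" "u \<in> {1, ?I}" for i u
    unfolding m_def by (rule Max_ge) (use that in auto)
  have fix1: "\<sigma> (j (of_nat (fact P) * u)) V = V" if V: "V \<in> active l (E + m)" and u: "u \<in> {1, ?I}" for V u
  proof -
    obtain z where z: "E + m \<le> pd V \<one> (j z)" and VD: "V \<in> Dom" "depth V = l"
      using V by (auto simp: active_def)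
    let ?f = "\<lambda>i. \<sigma> (j (of_nat i * u)) V"
    have "?f i \<in> relevant l \<one> (j z)" if "i \<le> P" for i
      using pd_translate[OF VD(1), of z "of_nat i * u"] z m[OF that u] VD \<sigma>_Dom[OF j_closed VD(1)]
        depth_\<sigma>[OF j_closed VD(1)] by (simp add: relevant_def)
    then have sub: "?f ` {..P} \<subseteq> relevant l \<one> (j z)" by auto
    have "\<not> inj_on ?f {..P}"
    proof
      assume "inj_on ?f {..P}"
      then have "card {..P} \<le> card (relevant l \<one> (j z))" using card_inj_on_le[OF _ sub] R by blast
      then show False using R[of z] by simp
    qed
    then obtain a b where ab: "a \<le> P" "b \<le> P" "a < b" "?f a = ?f b"
      unfolding inj_on_def by (metis atMost_iff nat_neq_iff)
    have "of_nat b * u = of_nat a * u + of_nat (b - a) * u"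
      using ab(3) by (simp add: of_nat_diff algebra_simps)
    then have "?f b = \<sigma> (j (of_nat a * u)) (?f (b - a))"
      by (simp add: j_add \<sigma>_mult j_closed VD)
    then have "V = ?f (b - a)"
      using ab(4) \<sigma>_inv(1)[OF j_closed, of _ "of_nat a * u"] VD(1) \<sigma>_Dom[OF j_closed VD(1)] by metis
    then have st: "\<sigma> (j (of_int q * (of_nat (b - a) * u))) V = V" for q
      using stabilises_multiple[OF VD(1), of "of_nat (b - a) * u"] by simp
    have "b - a dvd fact P" by (rule dvd_fact) (use ab in auto)
    then obtain q where "fact P = (b - a) * q" by blast
    then have "of_nat (fact P) * u = of_int (int q) * (of_nat (b - a) * u)"
      by (simp add: of_nat_mult[symmetric] mult_ac del: of_nat_fact of_nat_mult)
    then show ?thesis using st[of "int q"] by simp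
  qed
  have "\<sigma> (j (of_nat (fact P) * z)) V = V" if V: "V \<in> active l (E + m)" for V z
  proof -
    have VD: "V \<in> Dom" using V by (simp add: active_def)
    have "of_nat (fact P) * z = of_int (gre z) * (of_nat (fact P) * 1) + of_int (gim z) * (of_nat (fact P) * ?I)"
      by (auto simp: gint_eq_iff algebra_simps)
    then have "\<sigma> (j (of_nat (fact P) * z)) V =
        \<sigma> (j (of_int (gre z) * (of_nat (fact P) * 1))) (\<sigma> (j (of_int (gim z) * (of_nat (fact P) * ?I))) V)"
      by (simp only: j_add \<sigma>_mult[OF j_closed j_closed VD])
    also have "\<dots> = V"
      using stabilises_multiple[OF VD fix1[OF V, of 1], of "gre z"]
        stabilises_multiple[OF VD fix1[OF V, of ?I], of "gim z"] by simp
    finally show ?thesis .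
  qed
  then show ?thesis by blast
qed

text \<open>
  Each \<open>V\<close> in \<open>\<W>\<close> pairs the subset sums of the \<open>a V\<close> so that one of each pair makes \<open>V\<close> relevant.
  Averaging over all subsets, some subset sum makes half of \<open>\<W>\<close> relevant.
\<close>

lemma card_active_le:
  assumes R: "\<And>z. finite (relevant l \<one> (j z)) \<and> card (relevant l \<one> (j z)) \<le> P"
    and fin: "finite \<W>" and \<W>: "\<And>V. V \<in> \<W> \<Longrightarrow> V \<in> Dom \<and> depth V = l \<and>
      (\<forall>z. \<sigma> (j (of_int F * z)) V = V) \<and> (\<exists>z. 2 * E + \<xi> \<le> pd V \<one> (j (of_int F * z)))"
  shows "card \<W> \<le> 2 * P"
proof -
  obtain a where a: "\<And>V. V \<in> \<W> \<Longrightarrow> 2 * E + \<xi> \<le> pd V \<one> (j (of_int F * a V))" using \<W> by metis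
  define s where "s X = j (of_int F * (\<Sum>V\<in>X. a V))" for X
  have s: "s X \<in> carrier G" for X by (simp add: s_def j_closed)
  define R where "R V = {X \<in> Pow \<W>. E \<le> pd V \<one> (s X)}" for V
  \<comment> \<open>\<open>s X\<close> stabilises \<open>V\<close>, so the two sums project at least
    \<open>2 * E + \<xi>\<close> apart, and one of them projects at least \<open>E\<close> away from
    \<open>\<one>\<close>.\<close>
  have pair: "E \<le> pd V \<one> (s X) \<or> E \<le> pd V \<one> (s (insert V X))"
    if V: "V \<in> \<W>" and X: "X \<subseteq> \<W>" "V \<notin> X" for V X
  proof -
    have "finite X" using X fin finite_subset by blast
    then have "s (insert V X) = s X \<otimes> j (of_int F * a V)"
      using X(2) by (simp add: s_def j_add[symmetric] algebra_simps)
    moreover have "pd V (s X \<otimes> \<one>) (s X \<otimes> j (of_int F * a V)) = pd V \<one> (j (of_int F * a V))"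
      using pd_equiv[of V "s X" \<one> "j (of_int F * a V)"] \<W>[OF V] s j_closed by (simp add: s_def)
    moreover have "pd V (s X) (s (insert V X)) \<le> pd V (s X) \<one> + pd V \<one> (s (insert V X)) + \<xi>"
      using \<W>[OF V] s by (auto intro!: pd_tri)
    moreover have "pd V (s X) \<one> = pd V \<one> (s X)" using \<W>[OF V] s by (auto intro!: pd_sym)
    ultimately show ?thesis using a[OF V] s by fastforce
  qed
  have half: "2 ^ card \<W> \<le> 2 * card (R V)" if V: "V \<in> \<W>" for V
  proof -
    let ?f = "\<lambda>X. if V \<in> X then X - {V} else insert V X"
    have "card (Pow \<W>) \<le> 2 * card (R V)"
    proof (rule card_half_of_pairing)
      show "inj_on ?f (Pow \<W> - R V)"
      proof (rule inj_onI)
        fix X Y assume "?f X = ?f Y"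
        then show "X = Y" by (auto split: if_splits)
      qed
      show "?f ` (Pow \<W> - R V) \<subseteq> R V"
      proof
        fix Y assume "Y \<in> ?f ` (Pow \<W> - R V)"
        then obtain X where "X \<in> Pow \<W> - R V" "Y = ?f X" by blast
        then have X: "X \<subseteq> \<W>" "\<not> E \<le> pd V \<one> (s X)" "Y = ?f X" by (auto simp: R_def)
        show "Y \<in> R V"
        proof (cases "V \<in> X")
          case True
          then have "insert V Y = X" "V \<notin> Y" "Y \<subseteq> \<W>" using X by auto
          then show ?thesis using pair[of V Y] V X(2) by (auto simp: R_def)
        next
          case False
          then show ?thesis using pair[of V X] V X by (auto simp: R_def)
        qed
      qed
    qed (use fin in \<open>auto simp: R_def\<close>)
    then show ?thesis using fin by (simp add: card_Pow)
  qed
  have "card \<W> * 2 ^ card \<W> = (\<Sum>V\<in>\<W>. 2 ^ card \<W>)" by simp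
  also have "\<dots> \<le> (\<Sum>V\<in>\<W>. 2 * card (R V))" by (intro sum_mono half)
  also have "\<dots> = 2 * (\<Sum>V\<in>\<W>. card (R V))" by (simp add: sum_distrib_left)
  also have "(\<Sum>V\<in>\<W>. card (R V)) = (\<Sum>X\<in>Pow \<W>. card {V \<in> \<W>. E \<le> pd V \<one> (s X)})"
    unfolding R_def card_eq_sum by (rule sum.swap_restrict) (use fin in auto)
  also have "\<dots> \<le> (\<Sum>X\<in>Pow \<W>. P)"
  proof (rule sum_mono)
    fix X assume "X \<in> Pow \<W>"
    have "{V \<in> \<W>. E \<le> pd V \<one> (s X)} \<subseteq> relevant l \<one> (s X)"
      using \<W> by (auto simp: relevant_def)
    then show "card {V \<in> \<W>. E \<le> pd V \<one> (s X)} \<le> P"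
      using R[of "of_int F * (\<Sum>V\<in>X. a V)"] card_mono[of "relevant l \<one> (s X)"] le_trans
      unfolding s_def by blast
  qed
  also have "\<dots> = 2 ^ card \<W> * P" using fin by (simp add: card_Pow)
  finally have "card \<W> * 2 ^ card \<W> \<le> (2 * P) * 2 ^ card \<W>" by (simp add: mult_ac)
  then show ?thesis by simp
qed

text \<open>Finite sets of sufficiently active domains have bounded size, so there are finitely many
  such domains. One of them must be unbounded, and its orbit stays among them since translates keep
  depth and unboundedness.\<close>

theorem unbounded_domain:
  obtains U F where "U \<in> Dom" "unbounded_at U" "F > 0" "\<And>z. \<sigma> (j (of_int F * z)) U = U"
    "finite ((\<lambda>g. \<sigma> g U) ` carrier G)"
proof -
  obtain l C where l: "\<And>b. active l b \<noteq> {}"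
    "\<And>W z. W \<in> Dom \<Longrightarrow> depth W < l \<Longrightarrow> pd W \<one> (j z) \<le> C"
    using active_level by metis
  obtain M :: nat where "max 1 (\<Lambda> * C + \<Lambda>) \<le> M" using real_arch_simple by blast
  then have M: "\<Lambda> * C + \<Lambda> \<le> real M" "1 \<le> M" by auto
  define P where "P = M ^ l"
  have R: "finite (relevant l \<one> (j z)) \<and> card (relevant l \<one> (j z)) \<le> P" for z
    unfolding P_def by (rule relevant_bound[OF _ _ _ M]) (use j_closed l in auto)
  define F where "F = int (fact P)"
  have F: "F > 0" "of_int F = (of_nat (fact P) :: gint)" by (simp_all add: F_def del: of_nat_fact)
  obtain c where c: "\<And>V z. V \<in> active l c \<Longrightarrow> \<sigma> (j (of_int F * z)) V = V"
    using active_stabiliser[OF R] unfolding F(2)[symmetric] by auto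
  obtain d where d: "\<And>V z. V \<in> Dom \<Longrightarrow> \<exists>q. pd V \<one> (j z) \<le> pd V \<one> (j (of_int F * q)) + d"
    using pd_multiple[OF F(1)] by blast
  define b where "b = max c (2 * E + \<xi> + d)"
  have mono: "active l x \<subseteq> active l y" if "y \<le> x" for x y
    using that by (auto simp: active_def intro: order_trans)
  have "card \<W> \<le> 2 * P" if "\<W> \<subseteq> active l b" "finite \<W>" for \<W>
  proof (rule card_active_le[OF R that(2)])
    fix V assume "V \<in> \<W>"
    then have V: "V \<in> active l b" "V \<in> active l c" using that mono[of c b] by (auto simp: b_def)
    then obtain z where z: "b \<le> pd V \<one> (j z)" "V \<in> Dom" "depth V = l" by (auto simp: active_def)
    obtain q where "pd V \<one> (j z) \<le> pd V \<one> (j (of_int F * q)) + d" using d z by blast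
    then have "2 * E + \<xi> \<le> pd V \<one> (j (of_int F * q))" using z(1) by (simp add: b_def)
    then show "V \<in> Dom \<and> depth V = l \<and> (\<forall>z. \<sigma> (j (of_int F * z)) V = V) \<and>
        (\<exists>z. 2 * E + \<xi> \<le> pd V \<one> (j (of_int F * z)))"
      using z c[OF V(2)] by blast
  qed
  then have fin: "finite (active l b)"
    using finite_if_finite_subsets_card_bdd by metis
  have "\<exists>U\<in>active l b. unbounded_at U"
  proof (rule ccontr)
    assume "\<not> ?thesis"
    then obtain B where B: "\<And>U z. U \<in> active l b \<Longrightarrow> pd U \<one> (j z) < B U"
      unfolding unbounded_at_def by (metis not_le)
    \<comment> \<open>A threshold above the bounds of all the finitely many active domains; level
      \<open>l\<close> still has a domain exceeding it.\<close>
    define m where "m = max b (Max (B ` active l b))"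
    obtain U where U: "U \<in> active l m" using l(1) by blast
    then have Ub: "U \<in> active l b" using mono[of b m] by (auto simp: m_def)
    have "B U \<le> m" unfolding m_def using fin Ub by (intro max.coboundedI2 Max_ge) auto
    moreover obtain z where "m \<le> pd U \<one> (j z)" using U by (auto simp: active_def)
    ultimately show False using B[OF Ub, of z] by simp
  qed
  then obtain U where U: "U \<in> active l b" "unbounded_at U" by blast
  have UD: "U \<in> Dom" "depth U = l" using U by (auto simp: active_def)
  have "(\<lambda>g. \<sigma> g U) ` carrier G \<subseteq> active l b"
    using unbounded_at_\<sigma>[OF UD(1) U(2)] \<sigma>_Dom UD depth_\<sigma> by (auto simp: active_def unbounded_at_def)
  then have "finite ((\<lambda>g. \<sigma> g U) ` carrier G)" using fin finite_subset by blast
  then show ?thesis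
    using that[OF UD(1) U(2) F(1)] c[of U] U(1) mono[of c b] by (auto simp: b_def)
qed

end

section \<open>Hierarchically hyperbolic groups contain no rotating lattice\<close>

lemma set_mdist_le: "x \<in> S \<Longrightarrow> y \<in> T \<Longrightarrow> set_mdist C S T \<le> mdist C x y"
  unfolding set_mdist_def by (rule cInf_lower) (auto intro!: bdd_belowI[of _ 0])

lemma set_mdist_ge:
  assumes "S \<subseteq> mspace C" "T \<subseteq> mspace C" "diam_le C S \<xi>" "diam_le C T \<xi>" "x \<in> S" "y \<in> T"
  shows "mdist C x y \<le> set_mdist C S T + 2 * \<xi>"
proof -
  have "mdist C x y - 2 * \<xi> \<le> set_mdist C S T"
    unfolding set_mdist_def
  proof (rule cInf_greatest)
    fix d assume "d \<in> {mdist C x y |x y. x \<in> S \<and> y \<in> T}"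
    then obtain x' y' where d: "d = mdist C x' y'" "x' \<in> S" "y' \<in> T" by blast
    have "mdist C x x' \<le> \<xi>" "mdist C y' y \<le> \<xi>" using assms d by (auto simp: diam_le_def)
    moreover have "mdist C x y \<le> mdist C x x' + mdist C x' y" "mdist C x' y \<le> mdist C x' y' + mdist C y' y"
      using assms d by (auto intro!: mdist_triangle)
    ultimately show "mdist C x y - 2 * \<xi> \<le> d" unfolding d(1) by linarith
  qed (use assms in blast)
  then show ?thesis by simp
qed

lemma set_mdist_commute: "set_mdist C S T = set_mdist C T S"
  unfolding set_mdist_def by (rule arg_cong[where f = Inf]) (metis mdist_commute)

lemma set_mdist_image:
  assumes "\<And>p q. p \<in> S \<Longrightarrow> q \<in> T \<Longrightarrow> mdist C' (f p) (f q) = mdist C p q"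
  shows "set_mdist C' (f ` S) (f ` T) = set_mdist C S T"
proof -
  have "{mdist C' x y |x y. x \<in> f ` S \<and> y \<in> f ` T} = {mdist C' (f p) (f q) |p q. p \<in> S \<and> q \<in> T}"
    by blast
  also have "\<dots> = {mdist C p q |p q. p \<in> S \<and> q \<in> T}"
    by (intro Collect_cong iff_exI) (use assms in auto)
  finally show ?thesis unfolding set_mdist_def by (rule arg_cong)
qed

context group
begin

lemma word_dist_translate:
  assumes "g \<in> carrier G" "x \<in> carrier G" "y \<in> carrier G"
  shows "word_dist G A (g \<otimes> x) (g \<otimes> y) = word_dist G A x y"
proof -
  have "inv (g \<otimes> x) \<otimes> (g \<otimes> y) = inv x \<otimes> y"
  proof -
    have "inv g \<otimes> (g \<otimes> y) = y" using assms by (simp add: m_assoc[symmetric])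
    then show ?thesis using assms by (simp add: inv_mult_group m_assoc)
  qed
  then show ?thesis using assms by (simp add: word_dist_def)
qed

lemma finite_word_ball:
  assumes "finite_generating_set G A"
  shows "finite {g \<in> carrier G. word_dist G A \<one> g \<le> r}"
proof (rule finite_subset)
  have A: "finite A" "A \<subseteq> carrier G" "generate G A = carrier G"
    using assms by (auto simp: finite_generating_set_def)
  let ?L = "{ws. set ws \<subseteq> A \<union> m_inv G ` A \<and> length ws \<le> nat \<lfloor>r\<rfloor>}"
  show "finite ((\<lambda>ws. foldr (\<otimes>) ws \<one>) ` ?L)"
    using A(1) by (intro finite_imageI finite_lists_length_le) auto
  show "{g \<in> carrier G. word_dist G A \<one> g \<le> r} \<subseteq> (\<lambda>ws. foldr (\<otimes>) ws \<one>) ` ?L"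
  proof
    fix g assume g: "g \<in> {g \<in> carrier G. word_dist G A \<one> g \<le> r}"
    then obtain ws where ws: "set ws \<subseteq> A \<union> m_inv G ` A" "foldr (\<otimes>) ws \<one> = g"
      "length ws = word_norm G A g"
      using word_norm_ex[OF A(2), of g] A(3) by auto
    have "real (word_norm G A g) \<le> r" using g by (auto simp: word_dist_def)
    then have "length ws \<le> nat \<lfloor>r\<rfloor>" using ws(3) by linarith
    then show "g \<in> (\<lambda>ws. foldr (\<otimes>) ws \<one>) ` ?L" using ws by auto
  qed
qed

end

text \<open>\<open>rot\<close> asks for rotations by all powers of \<open>r\<close>, because the
  hyperbolic space found in the hierarchy is preserved only by a finite index subgroup, which need
  contain only some power of \<open>r\<close>.\<close>

theorem HHG_no_rotating_lattice:
  fixes H :: "('a, 'b) monoid_scheme" (structure) and j :: "gint \<Rightarrow> 'a"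
  assumes HHG: "HHG TYPE('i) TYPE('p) H"
    and j: "\<And>z. j z \<in> carrier H" "\<And>x y. j (x + y) = j x \<otimes> j y" "inj j"
    and conj: "\<And>h. h \<in> carrier H \<Longrightarrow> \<exists>M B. M > 0 \<and> gnorm B > 0 \<and>
      (\<forall>z. inv h \<otimes> j (of_int M * (gcnj B * z)) \<otimes> h = j (of_int M * (B * z)))"
    and rot: "r \<in> carrier H" "\<And>m::nat. m > 0 \<Longrightarrow> \<exists>w n. gnorm w = n\<^sup>2 \<and> n > 0 \<and> gre w \<noteq> 0 \<and> gim w \<noteq> 0 \<and>
      (\<forall>z. r [^] m \<otimes> j (of_int n * z) = j (w * z) \<otimes> r [^] m)"
  shows False
proof -
  interpret group H using HHG by (simp add: HHG_def)
  obtain A and \<HH> :: "('a, 'i, 'p) hhs_data" and \<sigma> \<tau> where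
    A: "finite_generating_set H A" and S: "hhg_structure H A \<HH> \<sigma> \<tau>"
    using HHG unfolding HHG_def by blast
  note X = word_metric_simps[OF A]
  interpret X: Metric_space "carrier H" "word_dist H A" by (rule Metric_space_word_dist[OF A])
  let ?D = "domains \<HH>" and ?pr = "proj \<HH>" and ?C = "hspace \<HH>"
  have hhs: "hhs_structure (word_metric H A) \<HH>" and act: "group_action H ?D \<sigma>"
    and nest_eq: "\<And>g U V. g \<in> carrier H \<Longrightarrow> U \<in> ?D \<Longrightarrow> V \<in> ?D \<Longrightarrow> nest \<HH> (\<sigma> g U) (\<sigma> g V) \<longleftrightarrow> nest \<HH> U V"
    and bij: "\<And>g U. g \<in> carrier H \<Longrightarrow> U \<in> ?D \<Longrightarrow> bij_betw (\<tau> g U) (mspace (?C U)) (mspace (?C (\<sigma> g U)))"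
    and iso: "\<And>g U p q. g \<in> carrier H \<Longrightarrow> U \<in> ?D \<Longrightarrow> p \<in> mspace (?C U) \<Longrightarrow> q \<in> mspace (?C U) \<Longrightarrow>
      mdist (?C (\<sigma> g U)) (\<tau> g U p) (\<tau> g U q) = mdist (?C U) p q"
    and \<tau>_mult: "\<And>g h U p. g \<in> carrier H \<Longrightarrow> h \<in> carrier H \<Longrightarrow> U \<in> ?D \<Longrightarrow> p \<in> mspace (?C U) \<Longrightarrow>
      \<tau> (g \<otimes> h) U p = \<tau> g (\<sigma> h U) (\<tau> h U p)"
    and \<tau>_proj: "\<And>g U x. g \<in> carrier H \<Longrightarrow> U \<in> ?D \<Longrightarrow> x \<in> carrier H \<Longrightarrow>
      \<tau> g U ` ?pr U x = ?pr (\<sigma> g U) (g \<otimes> x)"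
    by (insert S, unfold hhg_structure_def, (elim conjE, blast)+)
  interpret act: group_action H ?D \<sigma> by (rule act)
  obtain \<delta> \<xi> K \<kappa> where \<delta>: "\<delta> \<ge> 0" "\<And>W. W \<in> ?D \<Longrightarrow> geodesic_space (?C W) \<and> hyperbolic \<delta> (?C W)"
    and \<xi>: "\<xi> \<ge> 0" "\<kappa> \<ge> 0"
    and pr: "hhs_projections (word_metric H A) \<HH> \<xi> K" and ne: "hhs_nesting \<HH> \<xi>"
    and fc: "hhs_finite_complexity \<HH>" and ll: "hhs_large_links (word_metric H A) \<HH> \<xi> \<kappa>"
    and un: "hhs_uniqueness (word_metric H A) \<HH>"
    using hhs unfolding hhs_structure_def by blast
  have prC: "?pr W x \<subseteq> mspace (?C W)" "?pr W x \<noteq> {}" "diam_le (?C W) (?pr W x) \<xi>"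
    if "W \<in> ?D" "x \<in> carrier H" for W x
    using pr that unfolding hhs_projections_def X by blast+
  have qc: "quasiconvex K (?C W) (\<Union>x\<in>carrier H. ?pr W x)" if "W \<in> ?D" for W
    using pr that unfolding hhs_projections_def X by blast
  define pd where "pd V x y = set_mdist (?C V) (?pr V x) (?pr V y)" for V x y
  have pd_le: "pd V x y \<le> mdist (?C V) p q" if "p \<in> ?pr V x" "q \<in> ?pr V y" for V x y p q
    unfolding pd_def using that by (rule set_mdist_le)
  have pd_ge: "mdist (?C V) p q \<le> pd V x y + 2 * \<xi>"
    if "V \<in> ?D" "x \<in> carrier H" "y \<in> carrier H" "p \<in> ?pr V x" "q \<in> ?pr V y" for V x y p q
    unfolding pd_def using that prC by (intro set_mdist_ge) auto
  obtain \<Lambda> E where \<Lambda>: "\<Lambda> \<ge> 1" "E \<ge> max \<xi> \<kappa>" and L: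
    "\<forall>W\<in>?D. \<forall>x\<in>carrier H. \<forall>y\<in>carrier H.
      \<exists>\<T> \<subseteq> below \<HH> W - {W}. finite \<T> \<and> int (card \<T>) \<le> \<lfloor>\<Lambda> * pd W x y + \<Lambda>\<rfloor> \<and>
        (\<forall>T \<in> below \<HH> W - {W}. (\<exists>T' \<in> \<T>. T \<in> below \<HH> T') \<or> pd T x y < E) \<and>
        (\<forall>T' \<in> \<T>. dW \<HH> W (?pr W x) (rho \<HH> T' W) \<le> \<Lambda> * pd W x y + \<Lambda>)"
    using ll unfolding hhs_large_links_def X Let_def pd_def[symmetric] by (elim exE conjE) (rule that)
  have ll': "\<exists>\<T> \<subseteq> below \<HH> W - {W}. finite \<T> \<and> int (card \<T>) \<le> \<lfloor>\<Lambda> * pd W x y + \<Lambda>\<rfloor> \<and>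
        (\<forall>T \<in> below \<HH> W - {W}. (\<exists>T' \<in> \<T>. T \<in> below \<HH> T') \<or> pd T x y < E)"
    if "W \<in> ?D" "x \<in> carrier H" "y \<in> carrier H" for W x y
    using L[rule_format, OF that] by (elim exE conjE) (intro exI conjI)
  obtain n where n: "\<And>F. F \<subseteq> ?D \<Longrightarrow> \<forall>V \<in> F. \<forall>W \<in> F. nest \<HH> V W \<or> nest \<HH> W V \<Longrightarrow> finite F \<and> card F \<le> n"
    using fc unfolding hhs_finite_complexity_def by blast
  \<comment> \<open>In the triangle inequality each of the two summands costs
    \<open>2 * \<xi>\<close> when set distances replace point distances, whence
    \<open>4 * \<xi>\<close>.\<close>
  interpret hierarchical_group H ?D "nest \<HH>" \<sigma> pd "word_dist H A" "max K 0" "4 * \<xi>" \<Lambda> E n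
  proof
    fix V x y z assume V: "V \<in> ?D" and x: "x \<in> carrier H" and y: "y \<in> carrier H"
    show "pd V x y = pd V y x" unfolding pd_def by (rule set_mdist_commute)
    have "pd V x y \<le> K * word_dist H A x y + K"
      using pr V x y unfolding hhs_projections_def X pd_def by blast
    also have "\<dots> \<le> max K 0 * word_dist H A x y + max K 0"
      by (intro add_mono mult_right_mono) auto
    finally show "pd V x y \<le> max K 0 * word_dist H A x y + max K 0" .
    assume z: "z \<in> carrier H"
    obtain p q s where p: "p \<in> ?pr V x" "q \<in> ?pr V y" "s \<in> ?pr V z"
      using prC(2)[OF V x] prC(2)[OF V y] prC(2)[OF V z] by blast
    have "mdist (?C V) p s \<le> mdist (?C V) p q + mdist (?C V) q s"
      using prC(1)[OF V x] prC(1)[OF V y] prC(1)[OF V z] p by (intro mdist_triangle) blast+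
    then show "pd V x z \<le> pd V x y + pd V y z + 4 * \<xi>"
      using pd_le[OF p(1,3)] pd_ge[OF V x y p(1,2)] pd_ge[OF V y z p(2,3)] by linarith
  next
    fix V g x y assume V: "V \<in> ?D" and g: "g \<in> carrier H" and x: "x \<in> carrier H" and y: "y \<in> carrier H"
    show "pd (\<sigma> g V) (g \<otimes> x) (g \<otimes> y) = pd V x y"
      unfolding pd_def \<tau>_proj[OF g V x, symmetric] \<tau>_proj[OF g V y, symmetric]
    proof (rule set_mdist_image)
      fix p q assume "p \<in> ?pr V x" "q \<in> ?pr V y"
      then show "mdist (?C (\<sigma> g V)) (\<tau> g V p) (\<tau> g V q) = mdist (?C V) p q"
        using prC(1)[OF V x] prC(1)[OF V y] by (intro iso[OF g V]) blast+
    qed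
  next
    fix W x y assume W: "W \<in> ?D" and x: "x \<in> carrier H" and y: "y \<in> carrier H"
    show "\<exists>\<T>. \<T> \<subseteq> {T \<in> ?D. nest \<HH> T W \<and> T \<noteq> W} \<and> finite \<T> \<and> int (card \<T>) \<le> \<lfloor>\<Lambda> * pd W x y + \<Lambda>\<rfloor> \<and>
        (\<forall>T\<in>?D. nest \<HH> T W \<and> T \<noteq> W \<longrightarrow> (\<exists>T'\<in>\<T>. nest \<HH> T T') \<or> pd T x y < E)"
    proof -
      from ll'[OF W x y] obtain \<T> where \<T>: "\<T> \<subseteq> below \<HH> W - {W}" "finite \<T>"
        "int (card \<T>) \<le> \<lfloor>\<Lambda> * pd W x y + \<Lambda>\<rfloor>"
        and T: "\<forall>T \<in> below \<HH> W - {W}. (\<exists>T' \<in> \<T>. T \<in> below \<HH> T') \<or> pd T x y < E"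
        by (elim exE conjE) (rule that)
      have "\<T> \<subseteq> {T \<in> ?D. nest \<HH> T W \<and> T \<noteq> W}" using \<T>(1) by (auto simp: below_def)
      moreover have "(\<exists>T'\<in>\<T>. nest \<HH> T T') \<or> pd T x y < E" if "T \<in> ?D" "nest \<HH> T W \<and> T \<noteq> W" for T
      proof -
        have "T \<in> below \<HH> W - {W}" using that by (simp add: below_def)
        from T[rule_format, OF this] show ?thesis by (auto simp: below_def)
      qed
      ultimately show ?thesis using \<T>(2,3) by (intro exI[of _ \<T>]) simp
    qed
  next
    fix \<kappa> :: real assume "0 \<le> \<kappa>"
    then show "\<exists>\<theta>. \<forall>x\<in>carrier H. \<forall>y\<in>carrier H. \<theta> \<le> word_dist H A x y \<longrightarrow> (\<exists>V\<in>?D. \<kappa> \<le> pd V x y)"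
      using un unfolding hhs_uniqueness_def X pd_def by blast
  next
    fix g V assume "g \<in> carrier H" "V \<in> ?D"
    then show "\<sigma> g V \<in> ?D" by (rule act.element_image[OF _ _ HOL.refl])
  next
    fix V assume "V \<in> ?D"
    then show "\<sigma> \<one> V = V" using act.id_eq_one by (metis restrict_apply')
  next
    fix g h V assume "g \<in> carrier H" "h \<in> carrier H" "V \<in> ?D"
    then show "\<sigma> (g \<otimes> h) V = \<sigma> g (\<sigma> h V)" by (intro act.composition_rule)
  next
    show "?D = {} \<or> (\<exists>!S. S \<in> ?D \<and> (\<forall>W\<in>?D. nest \<HH> S W \<longrightarrow> W = S))"
      using ne unfolding hhs_nesting_def by blast
  next
    fix r show "finite {g \<in> carrier H. word_dist H A \<one> g \<le> r}" by (rule finite_word_ball[OF A])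
  qed (use \<xi> \<Lambda> nest_eq ne n word_dist_translate in
      \<open>auto simp: hhs_nesting_def dest: reflp_onD antisymp_onD intro: transp_onD\<close>)
  interpret hierarchical_group_lattice H ?D "nest \<HH>" \<sigma> pd "word_dist H A" "max K 0" "4 * \<xi>" \<Lambda> E n j
  proof
    fix g assume g: "g \<in> carrier H"
    then obtain M B where MB: "M > 0" "gnorm B > 0"
      "\<And>z. inv (inv g) \<otimes> j (of_int M * (gcnj B * z)) \<otimes> inv g = j (of_int M * (B * z))"
      using conj[of "inv g"] by auto
    \<comment> \<open>With \<open>B * z\<close> in place of \<open>z\<close>, the factor
      \<open>gcnj B * (B * z)\<close> in \<open>conj\<close> becomes the integer multiple
      \<open>gnorm B * z\<close>.\<close>
    have "g \<otimes> j (of_int (M * gnorm B) * z) = j (of_int M * (B * (B * z))) \<otimes> g" for z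
    proof -
      have e: "of_int (M * gnorm B) * z = of_int M * (gcnj B * (B * z))"
        using mult_gcnj[of B] by (metis mult.assoc mult.commute of_int_mult)
      have "j (of_int M * (B * (B * z))) \<otimes> g = g \<otimes> j (of_int (M * gnorm B) * z) \<otimes> inv g \<otimes> g"
        unfolding MB(3)[symmetric] e using g by simp
      then show ?thesis using g j(1) by (simp add: m_assoc)
    qed
    then show "\<exists>M>0. \<forall>z. \<exists>z'. g \<otimes> j (of_int M * z) = j z' \<otimes> g"
      using MB(1,2) by (intro exI[of _ "M * gnorm B"]) auto
  qed (use j in auto)
  obtain U F where U: "U \<in> ?D" "unbounded_at U" and F: "F > 0" "\<And>z. \<sigma> (j (of_int F * z)) U = U"
    and orb: "finite ((\<lambda>g. \<sigma> g U) ` carrier H)"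
    by (rule unbounded_domain) blast
  \<comment> \<open>The stabiliser of \<open>U\<close> acts on the single space \<open>CU\<close>;
    it has finite index because the orbit of \<open>U\<close> is finite.\<close>
  define G0 where "G0 = {g \<in> carrier H. \<sigma> g U = U}"
  have sub: "subgroup G0 H"
  proof
    fix x assume "x \<in> G0"
    then show "inv x \<in> G0" using \<sigma>_inv(1)[of x U] U(1) by (simp add: G0_def)
  qed (auto simp: G0_def \<sigma>_mult \<sigma>_one U(1))
  let ?H0 = "H\<lparr>carrier := G0\<rparr>"
  interpret H0: group ?H0 using sub by (rule subgroup_imp_group)
  have inv0: "inv\<^bsub>?H0\<^esub> x = inv x" if "x \<in> G0" for x using m_inv_consistent[OF sub that] by simp
  have G0: "g \<in> carrier H" "\<sigma> g U = U" if "g \<in> G0" for g using that by (auto simp: G0_def)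
  obtain bp where bp: "bp \<in> ?pr U \<one>" using prC(2)[OF U(1)] by blast
  have oC: "bp \<in> mspace (?C U)" using bp prC(1)[OF U(1)] by blast
  define pt where "pt g = \<tau> g U bp" for g
  have pt_proj: "pt g \<in> ?pr U g" if "g \<in> G0" for g
    using \<tau>_proj[OF G0(1)[OF that] U(1), of \<one>] G0[OF that] bp by (auto simp: pt_def)
  have ptC: "pt g \<in> mspace (?C U)" if "g \<in> G0" for g
    using pt_proj[OF that] prC(1)[OF U(1) G0(1)[OF that]] by blast
  define D where "D g h = mdist (?C U) (pt g) (pt h)" for g h
  note four = hyperbolic_four_point[OF _ _ \<delta>(1), of "?C U"]
  interpret hyperbolic_length ?H0 D "4 * \<delta> + 4"
  proof
    fix g x y assume g: "g \<in> carrier ?H0" and x: "x \<in> carrier ?H0" and y: "y \<in> carrier ?H0"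
    have "pt (g \<otimes> h) = \<tau> g U (pt h)" if "h \<in> G0" for h
      unfolding pt_def using \<tau>_mult[of g h U bp] g that U(1) oC by (simp add: G0_def)
    then show "D (g \<otimes>\<^bsub>?H0\<^esub> x) (g \<otimes>\<^bsub>?H0\<^esub> y) = D x y"
      using iso[of g U "pt x" "pt y"] g x y ptC U(1) by (simp add: D_def G0_def)
  qed (use four \<delta> U(1) ptC in \<open>auto simp: D_def mdist_commute mdist_metric_facts intro: mdist_triangle\<close>)
  \<comment> \<open>By quasiconvexity a point on a geodesic between orbit points is
    \<open>K\<close>-close to some projection, and finitely many coset representatives of
    \<open>G0\<close> bring that projection within \<open>m\<close> of the orbit of
    \<open>bp\<close>.\<close>
  have mid: "\<exists>c. \<forall>g\<in>G0. \<forall>R. 0 \<le> R \<longrightarrow> R \<le> D \<one> g \<longrightarrow>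
      (\<exists>h\<in>G0. D \<one> h \<le> R + c \<and> D h g \<le> D \<one> g - R + c)"
  proof -
    have "\<forall>W\<in>(\<lambda>g. \<sigma> g U) ` carrier H. \<exists>c\<in>carrier H. W = \<sigma> (inv c) U"
    proof
      fix W assume "W \<in> (\<lambda>g. \<sigma> g U) ` carrier H"
      then obtain g where "g \<in> carrier H" "W = \<sigma> g U" by blast
      then show "\<exists>c\<in>carrier H. W = \<sigma> (inv c) U" by (intro bexI[of _ "inv g"]) auto
    qed
    then obtain cr where cr: "\<And>W. W \<in> (\<lambda>g. \<sigma> g U) ` carrier H \<Longrightarrow> cr W \<in> carrier H \<and> W = \<sigma> (inv (cr W)) U"
      by metis
    define m where "m = Max ((\<lambda>W. pd U (cr W) \<one> + 2 * \<xi>) ` (\<lambda>g. \<sigma> g U) ` carrier H)"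
    have near: "\<exists>h\<in>G0. mdist (?C U) q (pt h) \<le> m" if x: "x \<in> carrier H" and q: "q \<in> ?pr U x" for x q
    proof -
      let ?W = "\<sigma> (inv x) U"
      have W: "?W \<in> (\<lambda>g. \<sigma> g U) ` carrier H" using x by auto
      let ?c = "cr ?W"
      have c: "?c \<in> carrier H" "\<sigma> (inv ?c) U = ?W" using cr[OF W] by auto
      \<comment> \<open>\<open>c\<close> represents the domain \<open>\<sigma> (inv x) U\<close>, so
        \<open>x \<otimes> inv c\<close> stabilises \<open>U\<close> and carries the projection of
        \<open>c\<close> to that of \<open>x\<close>.\<close>
      let ?h = "x \<otimes> inv ?c"
      have h: "?h \<in> G0" using x c U(1) by (simp add: G0_def \<sigma>_mult)
      have "?h \<otimes> ?c = x" using x c(1) by (simp add: m_assoc)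
      then have "q \<in> \<tau> ?h U ` ?pr U ?c"
        using \<tau>_proj[OF G0(1)[OF h] U(1) c(1)] G0(2)[OF h] q by simp
      then obtain q' where q': "q' \<in> ?pr U ?c" "q = \<tau> ?h U q'" by blast
      have "mdist (?C U) q (pt ?h) = mdist (?C U) q' bp"
        using iso[OF G0(1)[OF h] U(1), of q' bp] q' prC(1)[OF U(1) c(1)] oC G0(2)[OF h] by (auto simp: pt_def)
      also have "\<dots> \<le> pd U ?c \<one> + 2 * \<xi>" by (rule pd_ge) (use U(1) c q' bp in auto)
      also have "\<dots> \<le> m" unfolding m_def by (rule Max_ge) (use orb W in auto)
      finally show ?thesis using h by blast
    qed
    have one: "\<one> \<in> G0" using sub by (rule subgroup.one_closed)
    have "\<exists>h\<in>G0. D \<one> h \<le> R + (K + m) \<and> D h g \<le> D \<one> g - R + (K + m)"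
      if g: "g \<in> G0" and R: "0 \<le> R" "R \<le> D \<one> g" for g R
    proof -
      obtain S where S: "geodesic_segment (?C U) S (pt \<one>) (pt g)"
        using \<delta>(2)[OF U(1)] ptC one g unfolding geodesic_space_def by blast
      obtain \<gamma> where \<gamma>: "\<gamma> \<in> {0..D \<one> g} \<rightarrow> mspace (?C U)" "\<gamma> 0 = pt \<one>" "\<gamma> (D \<one> g) = pt g" "S = \<gamma> ` {0..D \<one> g}"
        "\<And>s t. s \<in> {0..D \<one> g} \<Longrightarrow> t \<in> {0..D \<one> g} \<Longrightarrow> mdist (?C U) (\<gamma> s) (\<gamma> t) = \<bar>s - t\<bar>"
        unfolding D_def by (rule geodesic_segmentE[OF S]) blast
      have RI: "R \<in> {0..D \<one> g}" "0 \<in> {0..D \<one> g}" "D \<one> g \<in> {0..D \<one> g}" using R by auto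
      have p: "mdist (?C U) (pt \<one>) (\<gamma> R) = R" "mdist (?C U) (\<gamma> R) (pt g) = D \<one> g - R"
        using \<gamma>(5)[OF RI(2,1)] \<gamma>(5)[OF RI(1,3)] \<gamma>(2,3) R by simp_all
      have pC: "\<gamma> R \<in> mspace (?C U)" "\<gamma> R \<in> S" using \<gamma>(1,4) RI(1) by blast+
      have "pt \<one> \<in> (\<Union>x\<in>carrier H. ?pr U x)" "pt g \<in> (\<Union>x\<in>carrier H. ?pr U x)"
        using pt_proj g one G0(1) by blast+
      then have "S \<subseteq> cnbhd (?C U) K (\<Union>x\<in>carrier H. ?pr U x)"
        using qc[OF U(1)] S unfolding quasiconvex_def by blast
      then obtain x q where xq: "x \<in> carrier H" "q \<in> ?pr U x" "mdist (?C U) (\<gamma> R) q \<le> K"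
        using pC(2) unfolding cnbhd_def by blast
      obtain h where h: "h \<in> G0" "mdist (?C U) q (pt h) \<le> m" using near[OF xq(1,2)] by blast
      have qC: "q \<in> mspace (?C U)" using prC(1)[OF U(1) xq(1)] xq(2) by blast
      have ph: "mdist (?C U) (\<gamma> R) (pt h) \<le> K + m"
        using mdist_triangle[OF pC(1) qC ptC[OF h(1)]] xq(3) h(2) by linarith
      have "D \<one> h \<le> R + (K + m)"
        unfolding D_def using mdist_triangle[OF ptC[OF one] pC(1) ptC[OF h(1)]] p(1) ph by linarith
      moreover have "D h g \<le> D \<one> g - R + (K + m)"
        using mdist_triangle[OF ptC[OF h(1)] pC(1) ptC[OF g]] p(2) ph
          mdist_commute[of "?C U" "pt h" "\<gamma> R"] unfolding D_def by linarith
      ultimately show ?thesis using h(1) by blast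
    qed
    then show ?thesis by blast
  qed
  then obtain c where mid: "\<And>g R. g \<in> G0 \<Longrightarrow> 0 \<le> R \<Longrightarrow> R \<le> D \<one> g \<Longrightarrow>
      \<exists>h\<in>G0. D \<one> h \<le> R + c \<and> D h g \<le> D \<one> g - R + c" by blast
  let ?j = "\<lambda>z. j (of_int F * z)"
  have jF: "?j z \<in> G0" for z using F(2) j(1) by (simp add: G0_def)
  \<comment> \<open>Pigeonhole on the finite orbit of \<open>U\<close> under powers of
    \<open>r\<close>.\<close>
  obtain m :: nat where m: "m > 0" "r [^] m \<in> G0"
  proof -
    have "\<not> inj_on (\<lambda>k::nat. \<sigma> (r [^] k) U) UNIV"
    proof
      assume "inj_on (\<lambda>k::nat. \<sigma> (r [^] k) U) UNIV"
      moreover have "finite ((\<lambda>k::nat. \<sigma> (r [^] k) U) ` UNIV)"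
        using rot(1) by (intro finite_subset[OF _ orb]) auto
      ultimately show False using finite_image_iff infinite_UNIV_nat by blast
    qed
    then obtain a b :: nat where ab: "a < b" "\<sigma> (r [^] a) U = \<sigma> (r [^] b) U"
      unfolding inj_on_def by (metis nat_neq_iff)
    have "r [^] b = r [^] a \<otimes> r [^] (b - a)" using rot(1) ab(1) by (simp add: nat_pow_mult)
    then have "\<sigma> (r [^] a) U = \<sigma> (r [^] a) (\<sigma> (r [^] (b - a)) U)"
      using ab(2) rot(1) U(1) by (simp add: \<sigma>_mult)
    then have "U = \<sigma> (r [^] (b - a)) U"
      using \<sigma>_inv(1)[of "r [^] a"] rot(1) U(1) \<sigma>_Dom by (metis nat_pow_closed)
    then have "r [^] (b - a) \<in> G0" using rot(1) by (simp add: G0_def)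
    then show ?thesis using that[of "b - a"] ab(1) by simp
  qed
  obtain w n' where w: "gnorm w = n'\<^sup>2" "n' > 0" "gre w \<noteq> 0" "gim w \<noteq> 0"
    "\<And>z. r [^] m \<otimes> j (of_int n' * z) = j (w * z) \<otimes> r [^] m"
    using rot(2)[OF m(1)] by blast
  have "\<exists>b. \<forall>z. D \<one>\<^bsub>?H0\<^esub> (?j z) \<le> b"
  proof (rule commensurated_lattice_bounded[where r = "r [^] m" and c = c])
    fix h assume h: "h \<in> carrier ?H0"
    then obtain M B where MB: "M > 0" "gnorm B > 0"
      "\<And>z. inv h \<otimes> j (of_int M * (gcnj B * z)) \<otimes> h = j (of_int M * (B * z))"
      using conj[of h] G0(1) by auto
    have "inv h \<otimes> ?j (of_int M * (gcnj B * z)) \<otimes> h = ?j (of_int M * (B * z))" for z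
      using MB(3)[of "of_int F * z"] by (simp add: mult_ac)
    then show "\<exists>M B. 0 < M \<and> 0 < gnorm B \<and>
        (\<forall>z. inv\<^bsub>?H0\<^esub> h \<otimes>\<^bsub>?H0\<^esub> ?j (of_int M * (gcnj B * z)) \<otimes>\<^bsub>?H0\<^esub> h = ?j (of_int M * (B * z)))"
      using MB(1,2) h inv0 by auto
  next
    show "r [^] m \<otimes>\<^bsub>?H0\<^esub> ?j (of_int n' * z) = ?j (w * z) \<otimes>\<^bsub>?H0\<^esub> r [^] m" for z
      using w(5)[of "of_int F * z"] by (simp add: mult_ac)
  qed (use jF m w(1-4) mid in \<open>auto simp: distrib_left j(2)\<close>)
  then obtain b where b: "\<And>z. D \<one> (?j z) \<le> b" by auto
  \<comment> \<open>The bound holds on multiples of \<open>F\<close>, which stabilise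
    \<open>U\<close>; up to the loss \<open>d\<close> it extends to the whole lattice.\<close>
  obtain d where d: "\<And>z. \<exists>q. pd U \<one> (j z) \<le> pd U \<one> (?j q) + d"
    using pd_multiple[OF F(1)] U(1) by blast
  have "pd U \<one> (j z) \<le> b + d" for z
  proof -
    obtain q where q: "pd U \<one> (j z) \<le> pd U \<one> (?j q) + d" using d by blast
    have "pd U \<one> (?j q) \<le> D \<one> (?j q)"
      unfolding D_def using pt_proj jF sub by (intro pd_le) (auto intro: subgroup.one_closed)
    then show ?thesis using q b[of q] by linarith
  qed
  moreover obtain z where "b + d + 1 \<le> pd U \<one> (j z)" using U(2) unfolding unbounded_at_def by blast
  ultimately show False by (metis add_le_same_cancel1 not_one_le_zero order_trans)
qed

section \<open>Actions of presented groups\<close>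

definition word_act :: "('g \<Rightarrow> bool \<Rightarrow> 'x \<Rightarrow> 'x) \<Rightarrow> 'g word \<Rightarrow> 'x \<Rightarrow> 'x" where
  "word_act f w = foldr (\<lambda>(x, b). f x b) w"

lemma word_act_simps [simp]:
  "word_act f [] n = n" "word_act f ((x, b) # w) n = f x b (word_act f w n)"
  "word_act f (u @ v) n = word_act f u (word_act f v n)"
  by (simp_all add: word_act_def)

lemma word_act_pres_rel:
  assumes closed: "\<And>x b n. n \<in> X \<Longrightarrow> f x b n \<in> X"
    and inverse: "\<And>x b n. n \<in> X \<Longrightarrow> f x b (f x (\<not> b) n) = n"
    and rel: "\<And>l r n. (l, r) \<in> R \<Longrightarrow> n \<in> X \<Longrightarrow> word_act f l n = word_act f r n"
    and uv: "(u, v) \<in> pres_rel S R"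
  shows "n \<in> X \<Longrightarrow> word_act f u n = word_act f v n"
proof -
  have cl: "word_act f w n \<in> X" if "n \<in> X" for w n
    using that by (induction w) (auto intro: closed)
  show "n \<in> X \<Longrightarrow> word_act f u n = word_act f v n"
    using uv by (induction arbitrary: n) (auto simp: inverse rel cl)
qed

text \<open>The value depends on the chosen representative only when \<open>f\<close> does not respect the relations.\<close>

definition pres_act :: "('g \<Rightarrow> bool \<Rightarrow> 'x \<Rightarrow> 'x) \<Rightarrow> 'g word set \<Rightarrow> 'x \<Rightarrow> 'x" where
  "pres_act f P = word_act f (SOME w. w \<in> P)"

lemma carrier_presented_group:
  "P \<in> carrier (presented_group S R) \<longleftrightarrow> (\<exists>w\<in>words_over S. P = pres_rel S R `` {w})"
  by (auto simp: presented_group_def quotient_def)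

lemma presented_group_one: "\<one>\<^bsub>presented_group S R\<^esub> = pres_rel S R `` {[]}"
  by (simp add: presented_group_def)

text \<open>Letters that permute \<open>X\<close> and respect the relators make the presented group
  act. This is used for normal forms, vertices of the tree, points of the plane, and left
  multiplication in another group.\<close>

locale presented_action =
  fixes S :: "'g set" and R :: "('g word \<times> 'g word) set" and X :: "'x set"
    and f :: "'g \<Rightarrow> bool \<Rightarrow> 'x \<Rightarrow> 'x"
  assumes closed: "n \<in> X \<Longrightarrow> f x b n \<in> X"
    and inverse: "n \<in> X \<Longrightarrow> f x b (f x (\<not> b) n) = n"
    and relator: "(l, r) \<in> R \<Longrightarrow> n \<in> X \<Longrightarrow> word_act f l n = word_act f r n"
begin

lemma word_act_closed: "n \<in> X \<Longrightarrow> word_act f w n \<in> X"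
  by (induction w) (auto intro: closed)

lemma pres_act_class:
  assumes "w \<in> words_over S" "n \<in> X"
  shows "pres_act f (pres_rel S R `` {w}) n = word_act f w n"
proof -
  have "(w, w) \<in> pres_rel S R" using assms(1) by (rule pres_rel.refl)
  then have "(SOME v. v \<in> pres_rel S R `` {w}) \<in> pres_rel S R `` {w}"
    by (intro someI[of "\<lambda>v. v \<in> pres_rel S R `` {w}" w]) simp
  then have "(w, SOME v. v \<in> pres_rel S R `` {w}) \<in> pres_rel S R" by simp
  from word_act_pres_rel[of X f, OF closed inverse relator this assms(2)]
  show ?thesis by (simp add: pres_act_def)
qed

lemma pres_act_closed: "P \<in> carrier (presented_group S R) \<Longrightarrow> n \<in> X \<Longrightarrow> pres_act f P n \<in> X"
  unfolding pres_act_def by (rule word_act_closed)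

lemma pres_act_one: "n \<in> X \<Longrightarrow> pres_act f \<one>\<^bsub>presented_group S R\<^esub> n = n"
  unfolding presented_group_one by (subst pres_act_class) auto

lemma pres_act_mult:
  assumes "P \<in> carrier (presented_group S R)" "Q \<in> carrier (presented_group S R)" "n \<in> X"
  shows "pres_act f (P \<otimes>\<^bsub>presented_group S R\<^esub> Q) n = pres_act f P (pres_act f Q n)"
proof -
  obtain u v where "u \<in> words_over S" "P = pres_rel S R `` {u}" "v \<in> words_over S" "Q = pres_rel S R `` {v}"
    using assms(1,2) unfolding carrier_presented_group by blast
  moreover from this have "u @ v \<in> words_over S" by auto
  ultimately show ?thesis
    using assms(3) by (simp add: presented_group_mult pres_act_class word_act_closed del: in_lists_conv_set)
qed

end

section \<open>Two HNN extensions of the Gaussian integers\<close>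

text \<open>
  \<open>hnn True\<close> is the Leary-Minasyan group: writing \<open>\<iota> (x + y i) = a\<^sup>x b\<^sup>y\<close>, its stable letter conjugates
  \<open>\<iota> ((2 - i) z)\<close> to \<open>\<iota> ((2 + i) z)\<close>. In \<open>hnn False\<close> the stable letter centralises every \<open>\<iota> ((2 - i) z)\<close>.
\<close>

definition hnn_relations :: "bool \<Rightarrow> (lm_gen word \<times> lm_gen word) set" where
  "hnn_relations s =
    {([(GA, True), (GB, True), (GA, False), (GB, False)], []),
     ([(GT, True), (GA, True), (GA, True), (GB, False), (GT, False)], [(GA, True), (GA, True), (GB, s)]),
     ([(GT, True), (GA, True), (GB, True), (GB, True), (GT, False)], [(GA, \<not> s), (GB, True), (GB, True)])}"

definition hnn :: "bool \<Rightarrow> lm_gen word set monoid" where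
  "hnn s = presented_group UNIV (hnn_relations s)"

lemma leary_minasyan_hnn: "leary_minasyan = hnn True"
  by (simp add: leary_minasyan_def lm_relations_def Let_def hnn_def hnn_relations_def)

lemma gint_numeral_simps [simp]: "gre (numeral n) = numeral n" "gim (numeral n) = 0"
  using of_int_gint_simps[of "numeral n"] by simp_all

text \<open>The sign \<open>e\<close> stands for \<open>t\<close> or its inverse, which conjugates
  multiples of \<open>modulus s (\<not> e)\<close> to multiples of \<open>modulus s e\<close>. For
  \<open>s = False\<close> both moduli are \<open>2 - i\<close>.\<close>

definition modulus :: "bool \<Rightarrow> bool \<Rightarrow> gint" where
  "modulus s e = GI 2 (if s \<and> e then 1 else - 1)"

definition gsgn :: "bool \<Rightarrow> int" where "gsgn b = (if b then 1 else - 1)"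

text \<open>With modulus \<open>2 + u i\<close>, this is the ring homomorphism onto the integers
  modulo 5 that sends \<open>i\<close> to \<open>-2 u\<close>, a square root of \<open>-1\<close>;
  it kills \<open>2 + u i\<close>, since \<open>u\<close> is a sign.\<close>

definition res :: "bool \<Rightarrow> bool \<Rightarrow> gint \<Rightarrow> int" where
  "res s e z = (gre z - 2 * gsgn (s \<and> e) * gim z) mod 5"

text \<open>Exact division by \<open>2 + u i\<close> after removal of the residue: multiply by
  \<open>2 - u i\<close> and divide by the norm 5.\<close>

definition quo :: "bool \<Rightarrow> bool \<Rightarrow> gint \<Rightarrow> gint" where
  "quo s e z = (let x = gre z - res s e z; y = gim z; u = gsgn (s \<and> e) in
    GI ((2 * x + u * y) div 5) ((2 * y - u * x) div 5))"

lemma gnorm_modulus [simp]: "gnorm (modulus s e) = 5"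
  by (simp add: modulus_def gnorm_def)

lemma res_range: "0 \<le> res s e z" "res s e z < 5"
  by (simp_all add: res_def)

lemma res_quo: "z = of_int (res s e z) + modulus s e * quo s e z"
proof -
  define u where "u = gsgn (s \<and> e)"
  have u: "u * u = 1" "modulus s e = GI 2 u" by (auto simp: u_def gsgn_def modulus_def)
  have uu: "u * (u * x) = x" for x using u(1) by (simp flip: mult.assoc)
  define x where "x = gre z - res s e z"
  define y where "y = gim z"
  have "5 dvd x - 2 * u * y"
    unfolding x_def y_def res_def u_def[symmetric] using mod_eq_dvd_iff by (metis mod_mod_trivial diff_diff_add add.commute diff_diff_eq mod_diff_eq dvd_minus_mod diff_right_commute)
  then obtain k where k: "x = 2 * u * y + 5 * k" by (metis add_diff_cancel_left' diff_add_cancel dvdE add.commute)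
  have d: "(2 * x + u * y) div 5 = u * y + 2 * k" "(2 * y - u * x) div 5 = - u * k"
  proof -
    have "2 * x + u * y = 5 * (u * y + 2 * k)" "2 * y - u * x = 5 * (- u * k)"
      using uu[of y] by (simp_all add: k algebra_simps)
    then show "(2 * x + u * y) div 5 = u * y + 2 * k" "(2 * y - u * x) div 5 = - u * k" by simp_all
  qed
  have "quo s e z = GI (u * y + 2 * k) (- u * k)"
    unfolding quo_def Let_def u_def[symmetric] x_def[symmetric] y_def[symmetric] d ..
  then have "modulus s e * quo s e z = GI x y"
    using uu by (simp add: u(2) gint_eq_iff k algebra_simps)
  then show ?thesis by (simp add: gint_eq_iff x_def y_def)
qed

lemma res_unique:
  assumes "z = of_int c + modulus s e * k" "0 \<le> c" "c < 5"
  shows "res s e z = c" "quo s e z = k"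
proof -
  have "gre z - 2 * gsgn (s \<and> e) * gim z = c + 5 * (- gsgn (s \<and> e) * gim k)"
    unfolding assms(1) by (auto simp: modulus_def gsgn_def)
  then show c: "res s e z = c"
    unfolding res_def using assms(2,3) by (simp only: mod_mult_self2 mod_pos_pos_trivial)
  have "modulus s e * quo s e z = modulus s e * k"
    using res_quo[of z s e] assms(1) c by (metis add_left_cancel)
  then have "of_int 5 * quo s e z = of_int 5 * k"
    using mult_gcnj[of "modulus s e"] by (metis gnorm_modulus mult.assoc mult.commute)
  then show "quo s e z = k" by (simp add: gint_eq_iff)
qed

type_synonym vertex = "(int \<times> bool) list"

text \<open>
  Vertices of the Bass-Serre tree: \<open>(c\<^sub>1, e\<^sub>1) \<dots> (c\<^sub>n, e\<^sub>n)\<close> stands for the coset of \<open>a\<^bsup>c\<^sub>1\<^esup> t\<^bsup>e\<^sub>1\<^esup> \<dots> a\<^bsup>c\<^sub>n\<^esup> t\<^bsup>e\<^sub>n\<^esup>\<close>.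
  Since \<open>0, \<dots>, 4\<close> represent the residues modulo both moduli, the set does not depend on \<open>s\<close>.
\<close>

fun reduced :: "vertex \<Rightarrow> bool" where
  "reduced [] = True"
| "reduced ((c, e) # w) = (0 \<le> c \<and> c < 5 \<and> reduced w \<and> (case w of [] \<Rightarrow> True | (c', e') # _ \<Rightarrow> \<not> (c' = 0 \<and> e' = (\<not> e))))"

text \<open>Once the residue is split off, the multiple \<open>modulus s e * q\<close> crosses the
  stable letter and reappears as \<open>modulus s (\<not> e) * q\<close>.\<close>

definition carry :: "bool \<Rightarrow> bool \<Rightarrow> gint \<Rightarrow> gint" where
  "carry s e z = modulus s (\<not> e) * quo s e z"

text \<open>Left multiplication by \<open>z\<close> as an odometer: digits are renormalised from
  left to right, and the carry surviving the last letter is collected by \<open>zrem\<close>. The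
  matching identity in the group is \<open>lat_vel\<close>.\<close>

fun zlist :: "bool \<Rightarrow> gint \<Rightarrow> vertex \<Rightarrow> vertex" where
  "zlist s z [] = []"
| "zlist s z ((c, e) # w) = (res s e (z + of_int c), e) # zlist s (carry s e (z + of_int c)) w"

fun zrem :: "bool \<Rightarrow> gint \<Rightarrow> vertex \<Rightarrow> gint" where
  "zrem s z [] = z"
| "zrem s z ((c, e) # w) = zrem s (carry s e (z + of_int c)) w"

definition tact :: "bool \<Rightarrow> vertex \<Rightarrow> vertex" where
  "tact e w = (case w of [] \<Rightarrow> [(0, e)] | (c, e') # w' \<Rightarrow> if c = 0 \<and> e' = (\<not> e) then w' else (0, e) # w)"

lemma res_quo_modulus:
  assumes "0 \<le> c" "c < 5"
  shows "res s e (modulus s e * k + of_int c) = c" "quo s e (modulus s e * k + of_int c) = k"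
  using res_unique[of "modulus s e * k + of_int c" c s e k] assms by (simp_all add: add.commute)

lemma carry_modulus:
  assumes "0 \<le> c" "c < 5"
  shows "carry s e (modulus s e * k + of_int c) = modulus s (\<not> e) * k"
  using res_quo_modulus[OF assms] by (simp add: carry_def)

lemma zlist_zrem_zero:
  assumes "reduced w"
  shows "zlist s 0 w = w" "zrem s 0 w = 0"
  using assms
proof (induction w rule: reduced.induct)
  case (2 c e w)
  { case 1 then show ?case using 2 res_quo_modulus[of c s e 0] carry_modulus[of c s e 0] by simp }
  { case 2 then show ?case using 2 "2.IH" carry_modulus[of c s e 0] by simp }
qed auto

lemma res_carry_add:
  "res s e (x + y + of_int c) = res s e (x + of_int (res s e (y + of_int c)))"
  "carry s e (x + y + of_int c) = carry s e (x + of_int (res s e (y + of_int c))) + carry s e (y + of_int c)"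
proof -
  let ?r = "res s e (y + of_int c)" and ?q = "quo s e (y + of_int c)"
  let ?z = "x + of_int ?r"
  have "x + y + of_int c = of_int (res s e ?z) + modulus s e * (quo s e ?z + ?q)"
    using res_quo[of "y + of_int c" s e] res_quo[of ?z s e] by (simp add: algebra_simps)
  from res_unique[OF this res_range]
  show "res s e (x + y + of_int c) = res s e ?z"
    "carry s e (x + y + of_int c) = carry s e ?z + carry s e (y + of_int c)"
    by (simp_all add: carry_def distrib_left)
qed

text \<open>\<open>zlist\<close> is an action of the lattice and \<open>zrem\<close> a cocycle over
  it; together they make \<open>zact\<close> additive.\<close>

lemma zlist_zrem_add:
  "zlist s (x + y) w = zlist s x (zlist s y w)"
  "zrem s (x + y) w = zrem s x (zlist s y w) + zrem s y w"
proof (induction w arbitrary: x y)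
  case (Cons a w)
  obtain c e where a: "a = (c, e)" by (cases a)
  { case 1 then show ?case using Cons.IH(1) by (simp add: a res_carry_add) }
  { case 2 then show ?case using Cons.IH(2) by (simp add: a res_carry_add) }
qed auto

lemma zlist_starts:
  "(zlist s (modulus s e * k) w = (0, e) # w' \<and> reduced w) \<Longrightarrow> \<exists>w''. w = (0, e) # w''"
  by (cases w) (auto simp: res_quo_modulus)

text \<open>A forbidden pair needs the digit 0 before a reversed stable letter. The carry arriving
  there is a multiple of that letter's modulus and leaves its digit alone, so no new forbidden pair
  arises.\<close>

lemma reduced_zlist: "reduced w \<Longrightarrow> reduced (zlist s z w)"
proof (induction w arbitrary: z)
  case (Cons a w)
  obtain c e where a: "a = (c, e)" by (cases a)
  show ?case
  proof (cases w)
    case Nil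
    then show ?thesis using res_range by (simp add: a)
  next
    case (Cons b w')
    obtain c' e' where b: "b = (c', e')" by (cases b)
    have "reduced (zlist s (carry s e (z + of_int c)) w)" using Cons.prems by (intro Cons.IH) (simp add: a)
    moreover have "res s (\<not> e) (carry s e (z + of_int c) + of_int c') = c'"
      unfolding carry_def using Cons.prems by (intro res_quo_modulus) (simp_all add: a b Cons)
    ultimately show ?thesis using Cons.prems res_range by (cases "e' = (\<not> e)") (auto simp: a b Cons)
  qed
qed auto

lemma reduced_tact: "reduced w \<Longrightarrow> reduced (tact e w)"
  by (cases w rule: reduced.cases) (auto simp: tact_def)

lemma tact_tact:
  assumes "reduced w"
  shows "tact e (tact (\<not> e) w) = w"
proof (cases w rule: reduced.cases)
  case (2 c e' v)
  show ?thesis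
  proof (cases "c = 0 \<and> e' = e")
    case True
    then have "\<nexists>v'. v = (0, \<not> e) # v'" using assms 2 by auto
    then have "tact e v = (0, e) # v" by (cases v rule: reduced.cases) (auto simp: tact_def)
    then show ?thesis using True 2 by (simp add: tact_def)
  next
    case False
    then show ?thesis using 2 by (auto simp: tact_def)
  qed
qed (simp add: tact_def)

text \<open>The conjugation relation of the stable letter, read on normal forms. A multiple of the
  modulus keeps the first digit, so \<open>tact\<close> cancels on both sides or on neither.\<close>

lemma tact_modulus:
  assumes "reduced w"
  shows "zlist s (modulus s e * k) (tact e w) = tact e (zlist s (modulus s (\<not> e) * k) w)"
    "zrem s (modulus s e * k) (tact e w) = zrem s (modulus s (\<not> e) * k) w"
proof -
  note rq = res_quo_modulus[of 0, simplified] carry_modulus[of 0, simplified]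
  consider w' where "w = (0, \<not> e) # w'" | "\<nexists>w'. w = (0, \<not> e) # w'" by blast
  then have "zlist s (modulus s e * k) (tact e w) = tact e (zlist s (modulus s (\<not> e) * k) w) \<and>
    zrem s (modulus s e * k) (tact e w) = zrem s (modulus s (\<not> e) * k) w"
  proof cases
    case 1
    then show ?thesis using rq[of s "\<not> e" k] by (simp add: tact_def)
  next
    case 2
    have t: "tact e v = (0, e) # v" if "\<nexists>w'. v = (0, \<not> e) # w'" for v
      using that by (cases v rule: reduced.cases) (auto simp: tact_def)
    have "\<nexists>w'. zlist s (modulus s (\<not> e) * k) w = (0, \<not> e) # w'"
      using 2 zlist_starts assms by blast
    then show ?thesis using rq[of s e k] t 2 by simp
  qed
  then show "zlist s (modulus s e * k) (tact e w) = tact e (zlist s (modulus s (\<not> e) * k) w)"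
    "zrem s (modulus s e * k) (tact e w) = zrem s (modulus s (\<not> e) * k) w" by auto
qed

definition nf_space :: "(vertex \<times> gint) set" where "nf_space = {n. reduced (fst n)}"

definition zact :: "bool \<Rightarrow> gint \<Rightarrow> vertex \<times> gint \<Rightarrow> vertex \<times> gint" where
  "zact s z n = (zlist s z (fst n), zrem s z (fst n) + snd n)"

definition gen_value :: "lm_gen \<Rightarrow> gint" where
  "gen_value x = (case x of GT \<Rightarrow> 0 | GA \<Rightarrow> 1 | GB \<Rightarrow> GI 0 1)"

definition nf_act :: "bool \<Rightarrow> lm_gen \<Rightarrow> bool \<Rightarrow> vertex \<times> gint \<Rightarrow> vertex \<times> gint" where
  "nf_act s x b n = (if x = GT then (tact b (fst n), snd n) else zact s (of_int (gsgn b) * gen_value x) n)"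

lemma zact_add: "zact s (x + y) n = zact s x (zact s y n)"
  by (simp add: zact_def zlist_zrem_add)

lemma zact_zero: "n \<in> nf_space \<Longrightarrow> zact s 0 n = n"
  by (simp add: zact_def zlist_zrem_zero nf_space_def)

lemma zact_closed: "n \<in> nf_space \<Longrightarrow> zact s z n \<in> nf_space"
  by (simp add: zact_def reduced_zlist nf_space_def)

lemma nf_act_modulus:
  assumes "n \<in> nf_space"
  shows "zact s (modulus s e * k) (nf_act s GT e n) = nf_act s GT e (zact s (modulus s (\<not> e) * k) n)"
  using tact_modulus[of "fst n" s e k] assms by (simp add: nf_act_def zact_def nf_space_def)

lemma nf_act_closed: "n \<in> nf_space \<Longrightarrow> nf_act s x b n \<in> nf_space"
  by (auto simp: nf_act_def zact_closed) (simp add: nf_space_def reduced_tact)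

lemma nf_act_inverse: "n \<in> nf_space \<Longrightarrow> nf_act s x b (nf_act s x (\<not> b) n) = n"
proof (cases "x = GT")
  case True
  then show "n \<in> nf_space \<Longrightarrow> ?thesis" using tact_tact[of "fst n" b] by (simp add: nf_act_def nf_space_def)
next
  case False
  then show "n \<in> nf_space \<Longrightarrow> ?thesis"
    by (simp add: nf_act_def zact_add[symmetric] zact_zero gsgn_def)
qed

lemma nf_act_values:
  "nf_act s GA b n = zact s (GI (gsgn b) 0) n" "nf_act s GB b n = zact s (GI 0 (gsgn b)) n"
proof -
  have "of_int (gsgn b) * gen_value GA = GI (gsgn b) 0" "of_int (gsgn b) * gen_value GB = GI 0 (gsgn b)"
    by (simp_all add: gint_eq_iff gen_value_def)
  then show "nf_act s GA b n = zact s (GI (gsgn b) 0) n" "nf_act s GB b n = zact s (GI 0 (gsgn b)) n"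
    by (simp_all add: nf_act_def)
qed

lemma stable_letter_relation:
  assumes "n \<in> nf_space"
  shows "nf_act s GT True (zact s (modulus s False * k) (nf_act s GT False n)) = zact s (modulus s True * k) n"
  using nf_act_modulus[of "nf_act s GT False n" s True k] nf_act_inverse[of n s GT True] nf_act_closed[OF assms] assms
  by simp

interpretation nf: presented_action UNIV "hnn_relations s" nf_space "nf_act s" for s
proof
  fix l r n assume lr: "(l, r) \<in> hnn_relations s" and n: "n \<in> nf_space"
  \<comment> \<open>The words in the second and third relators spell the two moduli multiplied by
    \<open>1\<close> and by \<open>i\<close>; the sums are bracketed in the order in which the
    letters act.\<close>
  have m: "modulus s False * 1 = GI 1 0 + (GI 1 0 + GI 0 (- 1))" "modulus s True * 1 = GI 1 0 + (GI 1 0 + GI 0 (gsgn s))"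
    "modulus s False * GI 0 1 = GI 1 0 + (GI 0 1 + GI 0 1)" "modulus s True * GI 0 1 = GI (gsgn (\<not> s)) 0 + (GI 0 1 + GI 0 1)"
    by (auto simp: gint_eq_iff modulus_def gsgn_def)
  have v: "gsgn True = 1" "gsgn False = - 1" by (simp_all add: gsgn_def)
  have z: "GI 1 0 + (GI 0 1 + (GI (- 1) 0 + GI 0 (- 1))) = 0" by (simp add: gint_eq_iff)
  consider "(l, r) = ([(GA, True), (GB, True), (GA, False), (GB, False)], [])"
    | "(l, r) = ([(GT, True), (GA, True), (GA, True), (GB, False), (GT, False)], [(GA, True), (GA, True), (GB, s)])"
    | "(l, r) = ([(GT, True), (GA, True), (GB, True), (GB, True), (GT, False)], [(GA, \<not> s), (GB, True), (GB, True)])"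
    using lr unfolding hnn_relations_def by blast
  then show "word_act (nf_act s) l n = word_act (nf_act s) r n"
  proof cases
    case 1
    then show ?thesis using n z by (simp add: nf_act_values v zact_add[symmetric] zact_zero)
  next
    case 2
    then show ?thesis using stable_letter_relation[OF n, of s 1] unfolding m zact_add
      by (simp add: nf_act_values v)
  next
    case 3
    then show ?thesis using stable_letter_relation[OF n, of s "GI 0 1"] unfolding m zact_add
      by (simp add: nf_act_values v)
  qed
qed (auto simp: nf_act_closed nf_act_inverse)

section \<open>Normal forms\<close>

context group
begin

lemma commute_inv:
  assumes "x \<in> carrier G" "y \<in> carrier G" "x \<otimes> y = y \<otimes> x"
  shows "inv x \<otimes> y = y \<otimes> inv x"
proof -
  have "y \<otimes> inv x = inv x \<otimes> (x \<otimes> y) \<otimes> inv x" using assms(1,2) by (simp add: m_assoc[symmetric])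
  also have "\<dots> = inv x \<otimes> y" unfolding assms(3) using assms(1,2) by (simp add: m_assoc)
  finally show ?thesis ..
qed

lemma conj_mult:
  assumes "t \<in> carrier G" "u \<in> carrier G" "v \<in> carrier G" "u' \<in> carrier G" "v' \<in> carrier G"
    and "t \<otimes> u = v \<otimes> t" "t \<otimes> u' = v' \<otimes> t"
  shows "t \<otimes> (u \<otimes> u') = v \<otimes> v' \<otimes> t"
  using assms by (metis m_assoc m_closed)

lemma conj_inv:
  assumes "t \<in> carrier G" "u \<in> carrier G" "v \<in> carrier G" "t \<otimes> u = v \<otimes> t"
  shows "t \<otimes> inv u = inv v \<otimes> t" "inv t \<otimes> v = u \<otimes> inv t"
proof -
  have "inv v \<otimes> t = inv v \<otimes> (t \<otimes> u) \<otimes> inv u" using assms(1-3) by (simp add: m_assoc)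
  also have "\<dots> = t \<otimes> inv u" unfolding assms(4) using assms(1-3) by (simp add: m_assoc[symmetric])
  finally show "t \<otimes> inv u = inv v \<otimes> t" ..
  have "inv t \<otimes> v = inv t \<otimes> (v \<otimes> t) \<otimes> inv t" using assms(1-3) by (simp add: m_assoc)
  also have "\<dots> = u \<otimes> inv t" unfolding assms(4)[symmetric] using assms(1-3) by (simp add: m_assoc[symmetric])
  finally show "inv t \<otimes> v = u \<otimes> inv t" .
qed

lemma commute_int_pow:
  assumes "x \<in> carrier G" "y \<in> carrier G" "x \<otimes> y = y \<otimes> x"
  shows "x [^] (i::int) \<otimes> y = y \<otimes> x [^] i"
proof -
  have nat: "x [^] (n::nat) \<otimes> y = y \<otimes> x [^] n" for n
    using group_commutes_pow[OF assms(3,1,2)] .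
  show ?thesis
  proof (cases i rule: int_cases2)
    case (nonneg n)
    then show ?thesis using nat[of n] by (simp only: int_pow_int)
  next
    case (nonpos n)
    then show ?thesis using commute_inv[OF _ assms(2) nat[of n]] assms(1)
      by (simp only: int_pow_neg_int nat_pow_closed)
  qed
qed

lemma finite_index_power:
  assumes H: "subgroup H G" "finite (rcosets H)" and g: "g \<in> carrier G"
  obtains m :: nat where "m > 0" "g [^] m \<in> H"
proof -
  have "\<not> inj_on (\<lambda>k::nat. H #> g [^] k) UNIV"
  proof
    assume "inj_on (\<lambda>k::nat. H #> g [^] k) UNIV"
    moreover have "finite (range (\<lambda>k::nat. H #> g [^] k))"
      by (rule finite_subset[OF _ H(2)]) (use g subgroup.subset[OF H(1)] in \<open>auto simp: RCOSETS_def\<close>)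
    ultimately show False using finite_image_iff infinite_UNIV_nat by blast
  qed
  then obtain a b :: nat where ab: "a < b" "H #> g [^] a = H #> g [^] b"
    unfolding inj_on_def by (metis nat_neq_iff)
  have "g [^] b \<in> H #> g [^] b" using rcos_self[OF _ H(1)] g by simp
  then have "g [^] b \<in> H #> g [^] a" by (simp only: ab(2))
  then obtain h where h: "h \<in> H" "g [^] b = h \<otimes> g [^] a" by (auto simp: r_coset_def)
  have "g [^] b = g [^] (b - a) \<otimes> g [^] a" using g ab(1) by (simp add: nat_pow_mult)
  then have "g [^] (b - a) = h" using h g subgroup.mem_carrier[OF H(1) h(1)] by simp
  then show ?thesis using that[of "b - a"] ab(1) h(1) by simp
qed

end

interpretation hnn: group "hnn s" for s
  by (simp add: hnn_def group_presented_group)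

definition cls :: "bool \<Rightarrow> lm_gen word \<Rightarrow> lm_gen word set" where
  "cls s w = pres_rel UNIV (hnn_relations s) `` {w}"

lemma carrier_hnn: "g \<in> carrier (hnn s) \<longleftrightarrow> (\<exists>w. g = cls s w)"
  by (simp add: hnn_def carrier_presented_group cls_def)

lemma cls_closed [simp]: "cls s w \<in> carrier (hnn s)"
  by (auto simp: carrier_hnn)

lemma cls_append: "cls s (u @ v) = cls s u \<otimes>\<^bsub>hnn s\<^esub> cls s v"
  unfolding hnn_def cls_def by (simp add: presented_group_mult)

lemma cls_Nil: "cls s [] = \<one>\<^bsub>hnn s\<^esub>"
  by (simp add: hnn_def cls_def presented_group_one)

lemma cls_Cons: "w \<noteq> [] \<Longrightarrow> cls s (a # w) = cls s [a] \<otimes>\<^bsub>hnn s\<^esub> cls s w"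
  using cls_append[of s "[a]" w] by simp

lemma cls_eqI: "(u, v) \<in> pres_rel UNIV (hnn_relations s) \<Longrightarrow> cls s u = cls s v"
  unfolding cls_def by (rule equiv_class_eq[OF equiv_pres_rel])

lemma cls_relation: "(l, r) \<in> hnn_relations s \<Longrightarrow> cls s l = cls s r"
  using pres_rel.relation[of l r "hnn_relations s" UNIV "[]" "[]"] by (intro cls_eqI) simp

lemma cls_cancel: "cls s [(x, b)] \<otimes>\<^bsub>hnn s\<^esub> cls s [(x, \<not> b)] = \<one>\<^bsub>hnn s\<^esub>"
  using pres_rel.cancel[of x UNIV "[]" "[]" b "hnn_relations s"]
  by (simp add: cls_append[symmetric] cls_Nil[symmetric] cls_eqI)

lemma cls_inv: "inv\<^bsub>hnn s\<^esub> cls s [(x, b)] = cls s [(x, \<not> b)]"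
  using cls_cancel[of s x "\<not> b"] by (intro hnn.inv_equality) auto

definition lat :: "bool \<Rightarrow> gint \<Rightarrow> lm_gen word set" where
  "lat s z = cls s [(GA, True)] [^]\<^bsub>hnn s\<^esub> gre z \<otimes>\<^bsub>hnn s\<^esub> cls s [(GB, True)] [^]\<^bsub>hnn s\<^esub> gim z"

lemma lat_closed [simp]: "lat s z \<in> carrier (hnn s)"
  by (simp add: lat_def)

lemma generators_commute:
  "cls s [(GA, True)] \<otimes>\<^bsub>hnn s\<^esub> cls s [(GB, True)] = cls s [(GB, True)] \<otimes>\<^bsub>hnn s\<^esub> cls s [(GA, True)]"
proof -
  let ?a = "cls s [(GA, True)]" and ?b = "cls s [(GB, True)]"
  have "cls s [(GA, True), (GB, True), (GA, False), (GB, False)] = cls s []"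
    by (rule cls_relation) (simp add: hnn_relations_def)
  then have "?a \<otimes>\<^bsub>hnn s\<^esub> (?b \<otimes>\<^bsub>hnn s\<^esub> (inv\<^bsub>hnn s\<^esub> ?a \<otimes>\<^bsub>hnn s\<^esub> inv\<^bsub>hnn s\<^esub> ?b)) = \<one>\<^bsub>hnn s\<^esub>"
    by (simp add: cls_Cons cls_Nil cls_inv)
  then have "(?a \<otimes>\<^bsub>hnn s\<^esub> ?b) \<otimes>\<^bsub>hnn s\<^esub> inv\<^bsub>hnn s\<^esub> (?b \<otimes>\<^bsub>hnn s\<^esub> ?a) = \<one>\<^bsub>hnn s\<^esub>"
    by (simp add: hnn.inv_mult_group hnn.m_assoc)
  then show ?thesis
    using hnn.inv_solve_right[of "\<one>\<^bsub>hnn s\<^esub>" s "?a \<otimes>\<^bsub>hnn s\<^esub> ?b" "?b \<otimes>\<^bsub>hnn s\<^esub> ?a"] by simp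
qed

lemma lat_add: "lat s (x + y) = lat s x \<otimes>\<^bsub>hnn s\<^esub> lat s y"
proof -
  let ?a = "cls s [(GA, True)]" and ?b = "cls s [(GB, True)]"
  have "?b [^]\<^bsub>hnn s\<^esub> gim x \<otimes>\<^bsub>hnn s\<^esub> ?a = ?a \<otimes>\<^bsub>hnn s\<^esub> ?b [^]\<^bsub>hnn s\<^esub> gim x"
    using generators_commute[of s] by (intro hnn.commute_int_pow) auto
  then have "?a [^]\<^bsub>hnn s\<^esub> gre y \<otimes>\<^bsub>hnn s\<^esub> ?b [^]\<^bsub>hnn s\<^esub> gim x = ?b [^]\<^bsub>hnn s\<^esub> gim x \<otimes>\<^bsub>hnn s\<^esub> ?a [^]\<^bsub>hnn s\<^esub> gre y"
    by (intro hnn.commute_int_pow) auto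
  then have "?a [^]\<^bsub>hnn s\<^esub> gre y \<otimes>\<^bsub>hnn s\<^esub> (?b [^]\<^bsub>hnn s\<^esub> gim x \<otimes>\<^bsub>hnn s\<^esub> ?b [^]\<^bsub>hnn s\<^esub> gim y) =
      ?b [^]\<^bsub>hnn s\<^esub> gim x \<otimes>\<^bsub>hnn s\<^esub> (?a [^]\<^bsub>hnn s\<^esub> gre y \<otimes>\<^bsub>hnn s\<^esub> ?b [^]\<^bsub>hnn s\<^esub> gim y)"
    by (simp add: hnn.m_assoc[symmetric])
  then show ?thesis
    by (simp add: lat_def hnn.int_pow_mult hnn.m_assoc)
qed

lemma lat_zero [simp]: "lat s 0 = \<one>\<^bsub>hnn s\<^esub>"
  by (simp add: lat_def)

lemma lat_minus: "lat s (- z) = inv\<^bsub>hnn s\<^esub> lat s z"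
  using lat_add[of s "- z" z] by (intro hnn.inv_equality[symmetric]) auto

lemma lat_gen: "x \<noteq> GT \<Longrightarrow> lat s (of_int (gsgn b) * gen_value x) = cls s [(x, b)]"
  by (cases x; cases b) (auto simp: lat_def gsgn_def gen_value_def hnn.int_pow_neg cls_inv)

lemma lat_gen_values: "cls s [(GA, b)] = lat s (GI (gsgn b) 0)" "cls s [(GB, b)] = lat s (GI 0 (gsgn b))"
proof -
  have "of_int (gsgn b) * gen_value GA = GI (gsgn b) 0" "of_int (gsgn b) * gen_value GB = GI 0 (gsgn b)"
    by (simp_all add: gint_eq_iff gen_value_def)
  then show "cls s [(GA, b)] = lat s (GI (gsgn b) 0)" "cls s [(GB, b)] = lat s (GI 0 (gsgn b))"
    using lat_gen[of GA s b] lat_gen[of GB s b] by simp_all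
qed

lemma gint_additive_induct:
  assumes add: "\<And>x y. P x \<Longrightarrow> P y \<Longrightarrow> P (x + y)" and minus: "\<And>x. P x \<Longrightarrow> P (- x)"
    and base: "P 1" "P (GI 0 1)"
  shows "P z"
proof -
  have zero: "P 0" using add[OF base(1) minus[OF base(1)]] by simp
  have nat: "P (of_nat n * x)" if "P x" for n x
    by (induction n) (simp_all add: zero add that distrib_right)
  have int: "P (of_int n * x)" if "P x" for n x
    using nat[OF that] minus[OF nat[OF that]] by (cases n rule: int_cases2) simp_all
  have "z = of_int (gre z) * 1 + of_int (gim z) * GI 0 1" by (simp add: gint_eq_iff)
  then show ?thesis using add int base by metis
qed

text \<open>The \<open>z\<close> satisfying the relation form a subgroup; it contains
  \<open>1\<close> and \<open>i\<close>, where the statement is a defining relation. The case of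
  \<open>e = False\<close> comes from inverting \<open>t\<close>.\<close>

lemma stable_letter_lat:
  "cls s [(GT, e)] \<otimes>\<^bsub>hnn s\<^esub> lat s (modulus s (\<not> e) * z) = lat s (modulus s e * z) \<otimes>\<^bsub>hnn s\<^esub> cls s [(GT, e)]"
proof -
  let ?t = "cls s [(GT, True)]" and ?t' = "cls s [(GT, False)]"
  let ?P = "\<lambda>z. ?t \<otimes>\<^bsub>hnn s\<^esub> lat s (modulus s False * z) = lat s (modulus s True * z) \<otimes>\<^bsub>hnn s\<^esub> ?t"
  have P: "?P z" for z
  proof (rule gint_additive_induct[of ?P])
    fix x y assume "?P x" "?P y"
    then show "?P (x + y)"
      by (simp add: distrib_left lat_add hnn.conj_mult)
  next
    fix x assume "?P x"
    then show "?P (- x)" by (simp add: lat_minus hnn.conj_inv)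
  next
    have tt: "?t \<otimes>\<^bsub>hnn s\<^esub> g = h \<otimes>\<^bsub>hnn s\<^esub> ?t"
      if "?t \<otimes>\<^bsub>hnn s\<^esub> (g \<otimes>\<^bsub>hnn s\<^esub> ?t') = h" "g \<in> carrier (hnn s)" for g h
      using that cls_cancel[of s GT False] by (auto simp: hnn.m_assoc)
    have m: "modulus s False * 1 = GI 1 0 + (GI 1 0 + GI 0 (- 1))" "modulus s True * 1 = GI 1 0 + (GI 1 0 + GI 0 (gsgn s))"
      "modulus s False * GI 0 1 = GI 1 0 + (GI 0 1 + GI 0 1)" "modulus s True * GI 0 1 = GI (gsgn (\<not> s)) 0 + (GI 0 1 + GI 0 1)"
      by (auto simp: gint_eq_iff modulus_def gsgn_def)
    have v: "gsgn True = 1" "gsgn False = - 1" by (simp_all add: gsgn_def)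
    have "cls s [(GT, True), (GA, True), (GA, True), (GB, False), (GT, False)] = cls s [(GA, True), (GA, True), (GB, s)]"
      by (rule cls_relation) (simp add: hnn_relations_def)
    then show "?P 1" unfolding m lat_add
      by (intro tt) (simp_all add: cls_Cons lat_gen_values v hnn.m_assoc)
    have "cls s [(GT, True), (GA, True), (GB, True), (GB, True), (GT, False)] = cls s [(GA, \<not> s), (GB, True), (GB, True)]"
      by (rule cls_relation) (simp add: hnn_relations_def)
    then show "?P (GI 0 1)" unfolding m lat_add
      by (intro tt) (simp_all add: cls_Cons lat_gen_values v hnn.m_assoc)
  qed
  show ?thesis
  proof (cases e)
    case True
    then show ?thesis using P by simp
  next
    case False
    then show ?thesis
      using hnn.conj_inv(2)[OF _ _ _ P[of z]] by (simp add: cls_inv)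
  qed
qed

definition vel :: "bool \<Rightarrow> vertex \<Rightarrow> lm_gen word set" where
  "vel s w = foldr (\<lambda>(c, e) g. lat s (of_int c) \<otimes>\<^bsub>hnn s\<^esub> (cls s [(GT, e)] \<otimes>\<^bsub>hnn s\<^esub> g)) w \<one>\<^bsub>hnn s\<^esub>"

lemma vel_simps [simp]:
  "vel s [] = \<one>\<^bsub>hnn s\<^esub>"
  "vel s ((c, e) # w) = lat s (of_int c) \<otimes>\<^bsub>hnn s\<^esub> (cls s [(GT, e)] \<otimes>\<^bsub>hnn s\<^esub> vel s w)"
  by (simp_all add: vel_def)

lemma vel_closed [simp]: "vel s w \<in> carrier (hnn s)"
  by (induction w) auto

definition nel :: "bool \<Rightarrow> vertex \<times> gint \<Rightarrow> lm_gen word set" where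
  "nel s n = vel s (fst n) \<otimes>\<^bsub>hnn s\<^esub> lat s (snd n)"

lemma nel_closed [simp]: "nel s n \<in> carrier (hnn s)"
  by (simp add: nel_def)

lemma lat_vel: "lat s z \<otimes>\<^bsub>hnn s\<^esub> vel s w = vel s (zlist s z w) \<otimes>\<^bsub>hnn s\<^esub> lat s (zrem s z w)"
proof (induction w arbitrary: z)
  case (Cons a w)
  obtain c e where a: "a = (c, e)" by (cases a)
  let ?r = "res s e (z + of_int c)" and ?q = "quo s e (z + of_int c)"
  let ?t = "cls s [(GT, e)]"
  have "lat s z \<otimes>\<^bsub>hnn s\<^esub> vel s (a # w) = lat s (z + of_int c) \<otimes>\<^bsub>hnn s\<^esub> (?t \<otimes>\<^bsub>hnn s\<^esub> vel s w)"
    by (simp add: a lat_add hnn.m_assoc)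
  also have "lat s (z + of_int c) = lat s (of_int ?r) \<otimes>\<^bsub>hnn s\<^esub> lat s (modulus s e * ?q)"
    using res_quo[of "z + of_int c" s e] by (metis lat_add)
  also have "\<dots> \<otimes>\<^bsub>hnn s\<^esub> (?t \<otimes>\<^bsub>hnn s\<^esub> vel s w) =
      lat s (of_int ?r) \<otimes>\<^bsub>hnn s\<^esub> ((lat s (modulus s e * ?q) \<otimes>\<^bsub>hnn s\<^esub> ?t) \<otimes>\<^bsub>hnn s\<^esub> vel s w)"
    by (simp add: hnn.m_assoc)
  also have "\<dots> = lat s (of_int ?r) \<otimes>\<^bsub>hnn s\<^esub> (?t \<otimes>\<^bsub>hnn s\<^esub> (lat s (carry s e (z + of_int c)) \<otimes>\<^bsub>hnn s\<^esub> vel s w))"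
    unfolding stable_letter_lat[symmetric] by (simp add: hnn.m_assoc carry_def)
  also have "\<dots> = vel s (zlist s z (a # w)) \<otimes>\<^bsub>hnn s\<^esub> lat s (zrem s z (a # w))"
    unfolding Cons.IH by (simp add: a hnn.m_assoc)
  finally show ?case .
qed simp

lemma stable_letter_vel: "cls s [(GT, e)] \<otimes>\<^bsub>hnn s\<^esub> vel s w = vel s (tact e w)"
proof (cases w rule: reduced.cases)
  case (2 c e' w')
  show ?thesis
  proof (cases "c = 0 \<and> e' = (\<not> e)")
    case True
    then show ?thesis using 2 by (simp add: tact_def hnn.m_assoc[symmetric] cls_cancel)
  next
    case False
    then show ?thesis using 2 by (auto simp: tact_def)
  qed
qed (simp add: tact_def)

lemma gen_nel: "cls s [(x, b)] \<otimes>\<^bsub>hnn s\<^esub> nel s n = nel s (nf_act s x b n)"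
proof (cases "x = GT")
  case True
  then show ?thesis by (simp add: nel_def nf_act_def hnn.m_assoc[symmetric] stable_letter_vel)
next
  case False
  then show ?thesis
    by (simp add: nel_def nf_act_def zact_def lat_gen[symmetric] lat_add hnn.m_assoc[symmetric] lat_vel)
qed

text \<open>Existence of normal forms: the action on normal forms computes left multiplication in
  the group.\<close>

lemma cls_eq_nel: "cls s u = nel s (word_act (nf_act s) u ([], 0))"
proof -
  have "cls s u \<otimes>\<^bsub>hnn s\<^esub> nel s n = nel s (word_act (nf_act s) u n)" for n
  proof (induction u)
    case Nil
    then show ?case by (simp add: cls_Nil)
  next
    case (Cons a u)
    obtain x b where a: "a = (x, b)" by (cases a)
    show ?case using Cons cls_append[of s "[a]" u] by (simp add: a hnn.m_assoc gen_nel)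
  qed
  from this[of "([], 0)"] show ?thesis by (simp add: nel_def)
qed

definition nf :: "bool \<Rightarrow> lm_gen word set \<Rightarrow> vertex \<times> gint" where
  "nf s g = pres_act (nf_act s) g ([], 0)"

lemma nf_act_stable: "nf_act s GT b (w, y) = (tact b w, y)"
  by (simp add: nf_act_def)

lemma base_nf_space [simp]: "([], z) \<in> nf_space"
  by (simp add: nf_space_def)

lemma pres_act_cls: "n \<in> nf_space \<Longrightarrow> pres_act (nf_act s) (cls s w) n = word_act (nf_act s) w n"
  unfolding cls_def by (rule nf.pres_act_class) auto

lemma pres_act_nf_mult:
  "g \<in> carrier (hnn s) \<Longrightarrow> h \<in> carrier (hnn s) \<Longrightarrow> n \<in> nf_space \<Longrightarrow>
    pres_act (nf_act s) (g \<otimes>\<^bsub>hnn s\<^esub> h) n = pres_act (nf_act s) g (pres_act (nf_act s) h n)"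
  unfolding hnn_def by (rule nf.pres_act_mult)

lemma nf_closed: "g \<in> carrier (hnn s) \<Longrightarrow> nf s g \<in> nf_space"
  unfolding hnn_def nf_def by (rule nf.pres_act_closed) auto

lemma nel_nf: "g \<in> carrier (hnn s) \<Longrightarrow> nel s (nf s g) = g"
  by (auto simp: carrier_hnn nf_def pres_act_cls cls_eq_nel[symmetric])

lemma pres_act_lat: "n \<in> nf_space \<Longrightarrow> pres_act (nf_act s) (lat s z) n = zact s z n"
proof -
  have "\<forall>n\<in>nf_space. pres_act (nf_act s) (lat s z) n = zact s z n"
  proof (rule gint_additive_induct[of "\<lambda>z. \<forall>n\<in>nf_space. pres_act (nf_act s) (lat s z) n = zact s z n"])
    fix x assume x: "\<forall>n\<in>nf_space. pres_act (nf_act s) (lat s x) n = zact s x n"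
    show "\<forall>n\<in>nf_space. pres_act (nf_act s) (lat s (- x)) n = zact s (- x) n"
    proof
      fix n :: "vertex \<times> gint" assume n: "n \<in> nf_space"
      have "pres_act (nf_act s) (lat s (- x) \<otimes>\<^bsub>hnn s\<^esub> lat s x) (zact s (- x) n) = zact s (- x) n"
        using n nf.pres_act_one[of "zact s (- x) n" s] by (simp add: lat_add[symmetric] zact_closed hnn_def[symmetric])
      then show "pres_act (nf_act s) (lat s (- x)) n = zact s (- x) n"
        using n x by (simp add: pres_act_nf_mult zact_closed zact_add[symmetric] zact_zero)
    qed
  next
    have e: "lat s 1 = cls s [(GA, True)]" "lat s (GI 0 1) = cls s [(GB, True)]"
      using lat_gen_values[of s True] by (simp_all add: gsgn_def one_gint_def)
    show "\<forall>n\<in>nf_space. pres_act (nf_act s) (lat s 1) n = zact s 1 n"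
      unfolding e by (simp add: pres_act_cls nf_act_values gsgn_def one_gint_def)
    show "\<forall>n\<in>nf_space. pres_act (nf_act s) (lat s (GI 0 1)) n = zact s (GI 0 1) n"
      unfolding e by (simp add: pres_act_cls nf_act_values gsgn_def)
  qed (auto simp: lat_add pres_act_nf_mult zact_add zact_closed)
  then show "n \<in> nf_space \<Longrightarrow> ?thesis" by blast
qed

text \<open>Uniqueness of normal forms: acting on the base point, the letters of \<open>w\<close>
  rebuild \<open>w\<close> one by one, since reducedness keeps \<open>tact\<close> from cancelling
  and the digits are already residues.\<close>

lemma nf_nel:
  assumes "n \<in> nf_space"
  shows "nf s (nel s n) = n"
proof -
  have "pres_act (nf_act s) (vel s w) ([], y) = (w, y)" if "reduced w" for w y
    using that
  proof (induction w)
    case Nil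
    then show ?case using nf.pres_act_one[of "([], y)" s] by (simp add: hnn_def[symmetric])
  next
    case (Cons a w)
    obtain c e where a: "a = (c, e)" by (cases a)
    have w: "reduced w" "0 \<le> c" "c < 5" "\<nexists>v. w = (0, \<not> e) # v" using Cons.prems by (auto simp: a)
    have t: "tact e w = (0, e) # w" using w(4) by (cases w rule: reduced.cases) (auto simp: tact_def)
    have r: "reduced ((0, e) # w)" using w by (auto split: list.splits)
    have "pres_act (nf_act s) (vel s (a # w)) ([], y) = zact s (of_int c) ((0, e) # w, y)"
      using Cons.IH w r by (simp add: a pres_act_nf_mult pres_act_cls pres_act_lat nf_act_stable t nf_space_def)
    moreover have "res s e (of_int c) = c" "carry s e (of_int c) = 0"
      using res_quo_modulus[OF w(2,3), of s e 0] carry_modulus[OF w(2,3), of s e 0] by simp_all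
    ultimately show ?case using w by (simp add: zact_def a zlist_zrem_zero)
  qed
  then show ?thesis
    using assms by (cases n) (simp add: nf_def nel_def pres_act_nf_mult pres_act_lat zact_def nf_space_def)
qed

lemma nf_lat: "nf s (lat s z) = ([], z)"
  by (simp add: nf_def pres_act_lat zact_def)

lemma lat_inj: "lat s x = lat s y \<Longrightarrow> x = y"
  by (metis nf_lat prod.inject)

section \<open>The Leary-Minasyan group is a generalised Baumslag-Solitar group\<close>

definition gen_act :: "('h, 'b) monoid_scheme \<Rightarrow> ('g \<Rightarrow> 'h) \<Rightarrow> 'g \<Rightarrow> bool \<Rightarrow> 'h \<Rightarrow> 'h" where
  "gen_act H val x b n = (if b then val x else inv\<^bsub>H\<^esub> val x) \<otimes>\<^bsub>H\<^esub> n"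

definition weval :: "('h, 'b) monoid_scheme \<Rightarrow> ('g \<Rightarrow> 'h) \<Rightarrow> 'g word \<Rightarrow> 'h" where
  "weval H val w = word_act (gen_act H val) w \<one>\<^bsub>H\<^esub>"

lemma weval_simps [simp]:
  "weval H val [] = \<one>\<^bsub>H\<^esub>" "weval H val ((x, b) # w) = (if b then val x else inv\<^bsub>H\<^esub> val x) \<otimes>\<^bsub>H\<^esub> weval H val w"
  by (simp_all add: weval_def gen_act_def)

lemma (in group) weval_closed:
  assumes "\<And>x. val x \<in> carrier G"
  shows "weval G val w \<in> carrier G"
proof (induction w)
  case (Cons a w)
  then show ?case using assms by (cases a) auto
qed simp

lemma (in group) weval_append:
  assumes "\<And>x. val x \<in> carrier G"
  shows "weval G val (u @ v) = weval G val u \<otimes> weval G val v"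
proof (induction u)
  case (Cons a u)
  then show ?case using assms weval_closed[of val, OF assms] by (cases a) (simp add: m_assoc)
qed (simp add: weval_closed assms)

text \<open>Von Dyck's theorem, obtained by letting the presented group act on \<open>G\<close> by
  left multiplication and evaluating at \<open>\<one>\<close>.\<close>

lemma (in group) presented_group_hom:
  assumes val: "\<And>x. val x \<in> carrier G"
    and rel: "\<And>l r. (l, r) \<in> R \<Longrightarrow> weval G val l = weval G val r"
  obtains \<phi> where "\<phi> \<in> hom (presented_group S R) G"
    "\<And>w. w \<in> words_over S \<Longrightarrow> \<phi> (pres_rel S R `` {w}) = weval G val w"
proof -
  have wa: "word_act (gen_act G val) w n = weval G val w \<otimes> n" if "n \<in> carrier G" for w n
  proof (induction w)
    case (Cons a w)
    then show ?case using val weval_closed[of val, OF val] that by (cases a) (simp add: gen_act_def m_assoc)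
  qed (use that in simp)
  interpret presented_action S R "carrier G" "gen_act G val"
  proof
    fix l r n assume "(l, r) \<in> R" "n \<in> carrier G"
    then show "word_act (gen_act G val) l n = word_act (gen_act G val) r n" using rel[of l r] by (simp add: wa)
  qed (use val in \<open>auto simp: gen_act_def m_assoc[symmetric]\<close>)
  define \<phi> where "\<phi> P = pres_act (gen_act G val) P \<one>" for P
  have cl: "\<phi> (pres_rel S R `` {w}) = weval G val w" if "w \<in> words_over S" for w
    using pres_act_class[OF that, of \<one>] weval_closed[of val, OF val] by (simp add: \<phi>_def wa)
  have "\<phi> \<in> hom (presented_group S R) G"
  proof (rule homI)
    fix P Q assume "P \<in> carrier (presented_group S R)" "Q \<in> carrier (presented_group S R)"
    then obtain u v where uv: "u \<in> words_over S" "P = pres_rel S R `` {u}" "v \<in> words_over S" "Q = pres_rel S R `` {v}"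
      unfolding carrier_presented_group by blast
    have app: "u @ v \<in> words_over S" using uv(1,3) by auto
    show "\<phi> P \<in> carrier G" unfolding uv(2) cl[OF uv(1)] by (rule weval_closed[OF val])
    show "\<phi> (P \<otimes>\<^bsub>presented_group S R\<^esub> Q) = \<phi> P \<otimes> \<phi> Q"
      unfolding uv(2,4) presented_group_mult[OF uv(1,3)] cl[OF uv(1)] cl[OF uv(3)] cl[OF app]
      by (rule weval_append[OF val])
  qed
  then show ?thesis using that cl by blast
qed

text \<open>In coordinates, multiplication by \<open>2 - i\<close> for the arc 0 and by
  \<open>2 + i\<close> for its reverse.\<close>

definition gog_emb :: "nat \<Rightarrow> int \<times> int \<Rightarrow> int \<times> int" where
  "gog_emb e z = (if e = 0 then (2 * fst z + snd z, 2 * snd z - fst z) else (2 * fst z - snd z, 2 * snd z + fst z))"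

definition lm_graph :: "(nat, nat, int \<times> int, int \<times> int) graph_of_groups" where
  "lm_graph = \<lparr>base_graph = \<lparr>verts = {0}, arcs = {0, 1}, tail = \<lambda>_. 0, head = \<lambda>_. 0\<rparr>,
    edge_rev = (\<lambda>e. if e = 0 then 1 else if e = 1 then 0 else e),
    vertex_group = \<lambda>_. Z2_group, edge_group = \<lambda>_. Z2_group, edge_emb = gog_emb\<rparr>"

lemma lm_graph_simps [simp]:
  "verts (base_graph lm_graph) = {0}" "arcs (base_graph lm_graph) = {0, 1}"
  "tail (base_graph lm_graph) e = 0" "head (base_graph lm_graph) e = 0"
  "edge_rev lm_graph e = (if e = 0 then 1 else if e = 1 then 0 else e)"
  "vertex_group lm_graph v = Z2_group" "edge_group lm_graph e = Z2_group" "edge_emb lm_graph = gog_emb"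
  by (simp_all add: lm_graph_def)

lemma group_Z2: "group Z2_group"
  by (intro DirProd_group group_integer_group)

lemma Z2_simps [simp]: "carrier Z2_group = UNIV" "x \<otimes>\<^bsub>Z2_group\<^esub> y = (fst x + fst y, snd x + snd y)"
  by (auto simp: DirProd_def integer_group_def split: prod.splits)

lemma gog_emb_mon: "gog_emb e \<in> mon Z2_group Z2_group"
proof -
  have "inj (gog_emb e)" by (rule injI) (auto simp: gog_emb_def prod_eq_iff split: if_splits)
  then show ?thesis by (auto simp: mon_def hom_def gog_emb_def)
qed

lemma connected_lm_graph: "connected_graph_of_groups lm_graph" and fin_lm_graph: "fin_digraph (base_graph lm_graph)"
proof -
  have wf: "wf_digraph (base_graph lm_graph)" by unfold_locales auto
  then have bd: "bidirected_digraph (base_graph lm_graph) (edge_rev lm_graph)"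
    by (rule wf_digraph.bidirected_digraphI) auto
  have "strongly_connected (base_graph lm_graph)"
    unfolding strongly_connected_def using wf_digraph.reachable_refl[OF wf] by auto
  then show "connected_graph_of_groups lm_graph"
    using bd group_Z2 gog_emb_mon by (auto simp: connected_graph_of_groups_def)
  interpret wf_digraph "base_graph lm_graph" by (rule wf)
  show "fin_digraph (base_graph lm_graph)" by unfold_locales auto
qed

section \<open>Serre's group of a single loop\<close>

abbreviation "SG \<equiv> path_group_gens lm_graph"
abbreviation "RG \<equiv> path_group_rels lm_graph"
abbreviation "PG \<equiv> presented_group SG RG"

lemma SG_eq: "SG = insert (Inr 0) (insert (Inr 1) (range (\<lambda>z. Inl (0, z))))"
  by (auto simp: path_group_gens_def)

lemma RG_mult: "([(Inl (0, x), True), (Inl (0, y), True)], [(Inl (0, (fst x + fst y, snd x + snd y)), True)]) \<in> RG"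
  by (cases x; cases y) (auto simp: path_group_rels_def)

lemma RG_rev: "([(Inr 1, True)], [(Inr 0, False)]) \<in> RG" "([(Inr 0, True)], [(Inr 1, False)]) \<in> RG"
  by (auto simp: path_group_rels_def intro!: exI[of _ "1::nat"])

lemma RG_edge: "([(Inr 0, True), (Inl (0, gog_emb 0 c), True), (Inr 0, False)], [(Inl (0, gog_emb 1 c), True)]) \<in> RG"
  by (cases c) (auto simp: path_group_rels_def intro!: exI[of _ "0::nat"])

lemma RG_cases:
  assumes "(l, r) \<in> RG"
  obtains x y where "l = [(Inl (0, x), True), (Inl (0, y), True)]" "r = [(Inl (0, (fst x + fst y, snd x + snd y)), True)]"
    | "l = [(Inr 1, True)]" "r = [(Inr 0, False)]"
    | "l = [(Inr 0, True)]" "r = [(Inr 1, False)]"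
    | c where "l = [(Inr 0, True), (Inl (0, gog_emb 0 c), True), (Inr 0, False)]" "r = [(Inl (0, gog_emb 1 c), True)]"
    | c where "l = [(Inr 1, True), (Inl (0, gog_emb 1 c), True), (Inr 1, False)]" "r = [(Inl (0, gog_emb 0 c), True)]"
  using assms unfolding path_group_rels_def by (auto split: if_splits)

interpretation PG: group PG by (rule group_presented_group)

definition pcl :: "(nat \<times> (int \<times> int) + nat) word \<Rightarrow> (nat \<times> (int \<times> int) + nat) word set" where
  "pcl w = pres_rel SG RG `` {w}"

lemma pcl_closed: "w \<in> words_over SG \<Longrightarrow> pcl w \<in> carrier PG"
  unfolding pcl_def carrier_presented_group by blast

lemma pcl_append: "u \<in> words_over SG \<Longrightarrow> v \<in> words_over SG \<Longrightarrow> pcl (u @ v) = pcl u \<otimes>\<^bsub>PG\<^esub> pcl v"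
  unfolding pcl_def by (rule presented_group_mult[symmetric])

lemma pcl_Nil: "pcl [] = \<one>\<^bsub>PG\<^esub>"
  by (simp add: pcl_def presented_group_one)

lemma pcl_relation: "(l, r) \<in> RG \<Longrightarrow> l \<in> words_over SG \<Longrightarrow> r \<in> words_over SG \<Longrightarrow> pcl l = pcl r"
  unfolding pcl_def using pres_rel.relation[of l r RG SG "[]" "[]"] by (intro equiv_class_eq[OF equiv_pres_rel]) simp

lemma pcl_inv: "x \<in> SG \<Longrightarrow> inv\<^bsub>PG\<^esub> pcl [(x, b)] = pcl [(x, \<not> b)]"
proof (rule PG.inv_equality)
  assume x: "x \<in> SG"
  then have "pcl ([(x, \<not> b)] @ [(x, b)]) = pcl []"
    unfolding pcl_def using pres_rel.cancel[of x SG "[]" "[]" "\<not> b" RG] by (intro equiv_class_eq[OF equiv_pres_rel]) simp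
  then show "pcl [(x, \<not> b)] \<otimes>\<^bsub>PG\<^esub> pcl [(x, b)] = \<one>\<^bsub>PG\<^esub>"
    using x pcl_append[of "[(x, \<not> b)]" "[(x, b)]"] by (simp add: pcl_Nil)
qed (auto intro!: pcl_closed)

definition al :: "int \<times> int \<Rightarrow> (nat \<times> (int \<times> int) + nat) word set" where "al z = pcl [(Inl (0, z), True)]"
definition tt :: "(nat \<times> (int \<times> int) + nat) word set" where "tt = pcl [(Inr 0, True)]"

lemma gens_SG [simp]: "Inl (0, z) \<in> SG" "Inr 0 \<in> SG" "Inr (Suc 0) \<in> SG"
  by (auto simp: SG_eq)

lemma al_closed [simp]: "al z \<in> carrier PG" and tt_closed [simp]: "tt \<in> carrier PG"
  unfolding al_def tt_def by (auto intro!: pcl_closed)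

lemma al_mult: "al x \<otimes>\<^bsub>PG\<^esub> al y = al (fst x + fst y, snd x + snd y)"
  using pcl_relation[OF RG_mult[of x y]] pcl_append[of "[(Inl (0, x), True)]" "[(Inl (0, y), True)]"]
  by (simp add: al_def)

lemma al_zero: "al (0, 0) = \<one>\<^bsub>PG\<^esub>"
  using al_mult[of "(0, 0)" "(0, 0)"] by (simp add: PG.l_cancel_one')

lemma al_inv: "inv\<^bsub>PG\<^esub> al (x, y) = al (- x, - y)"
  using al_mult[of "(- x, - y)" "(x, y)"] by (intro PG.inv_equality) (simp_all add: al_zero)

lemma tt_rev: "pcl [(Inr 1, True)] = inv\<^bsub>PG\<^esub> tt"
  using pcl_relation[OF RG_rev(1)] pcl_inv[of "Inr 0" True] by (simp add: tt_def)

lemma tt_al: "tt \<otimes>\<^bsub>PG\<^esub> (al (gog_emb 0 c) \<otimes>\<^bsub>PG\<^esub> inv\<^bsub>PG\<^esub> tt) = al (gog_emb 1 c)"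
  using pcl_relation[OF RG_edge[of c]] pcl_inv[of "Inr 0" True]
    pcl_append[of "[(Inr 0, True)]" "[(Inl (0, gog_emb 0 c), True), (Inr 0, False)]"]
    pcl_append[of "[(Inl (0, gog_emb 0 c), True)]" "[(Inr 0, False)]"]
  by (simp add: al_def tt_def)

definition to_PG :: "lm_gen \<Rightarrow> (nat \<times> (int \<times> int) + nat) word set" where
  "to_PG x = (case x of GT \<Rightarrow> tt | GA \<Rightarrow> al (1, 0) | GB \<Rightarrow> al (0, 1))"

definition of_PG :: "(nat \<times> (int \<times> int) + nat) \<Rightarrow> lm_gen word set" where
  "of_PG x = (case x of Inl (v, z) \<Rightarrow> lat True (GI (fst z) (snd z)) | Inr e \<Rightarrow> cls True [(GT, e = 0)])"

lemma to_PG_closed: "to_PG x \<in> carrier PG"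
  by (cases x) (simp_all add: to_PG_def)

lemma of_PG_closed: "of_PG x \<in> carrier (hnn True)"
  by (auto simp: of_PG_def split: sum.split)

lemma to_PG_relations:
  assumes "(l, r) \<in> hnn_relations True"
  shows "weval PG to_PG l = weval PG to_PG r"
proof -
  have e: "gog_emb 0 (1, 0) = (2, - 1)" "gog_emb 1 (1, 0) = (2, 1)" "gog_emb 0 (0, 1) = (1, 2)" "gog_emb 1 (0, 1) = (- 1, 2)"
    by (simp_all add: gog_emb_def)
  consider "(l, r) = ([(GA, True), (GB, True), (GA, False), (GB, False)], [])"
    | "(l, r) = ([(GT, True), (GA, True), (GA, True), (GB, False), (GT, False)], [(GA, True), (GA, True), (GB, True)])"
    | "(l, r) = ([(GT, True), (GA, True), (GB, True), (GB, True), (GT, False)], [(GA, False), (GB, True), (GB, True)])"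
    using assms unfolding hnn_relations_def by auto
  then show ?thesis
  proof cases
    case 1
    then show ?thesis by (simp add: to_PG_def al_inv al_mult al_zero)
  next
    case 2
    have "al (1, 0) \<otimes>\<^bsub>PG\<^esub> (al (1, 0) \<otimes>\<^bsub>PG\<^esub> (inv\<^bsub>PG\<^esub> al (0, 1) \<otimes>\<^bsub>PG\<^esub> inv\<^bsub>PG\<^esub> tt)) = al (2, - 1) \<otimes>\<^bsub>PG\<^esub> inv\<^bsub>PG\<^esub> tt"
      by (simp add: al_inv al_mult PG.m_assoc[symmetric])
    then show ?thesis using 2 tt_al[of "(1, 0)"] unfolding e by (simp add: to_PG_def al_mult)
  next
    case 3
    have "al (1, 0) \<otimes>\<^bsub>PG\<^esub> (al (0, 1) \<otimes>\<^bsub>PG\<^esub> (al (0, 1) \<otimes>\<^bsub>PG\<^esub> inv\<^bsub>PG\<^esub> tt)) = al (1, 2) \<otimes>\<^bsub>PG\<^esub> inv\<^bsub>PG\<^esub> tt"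
      by (simp add: al_mult PG.m_assoc[symmetric])
    then show ?thesis using 3 tt_al[of "(0, 1)"] unfolding e by (simp add: to_PG_def al_mult al_inv)
  qed
qed

lemma gog_emb_modulus:
  "GI (fst (gog_emb 0 c)) (snd (gog_emb 0 c)) = modulus True False * GI (fst c) (snd c)"
  "GI (fst (gog_emb 1 c)) (snd (gog_emb 1 c)) = modulus True True * GI (fst c) (snd c)"
  by (simp_all add: gint_eq_iff gog_emb_def modulus_def)

lemma of_PG_relations:
  assumes "(l, r) \<in> RG"
  shows "weval (hnn True) of_PG l = weval (hnn True) of_PG r"
proof -
  have sl: "cls True [(GT, e)] \<otimes>\<^bsub>hnn True\<^esub> (lat True (modulus True (\<not> e) * z) \<otimes>\<^bsub>hnn True\<^esub> inv\<^bsub>hnn True\<^esub> cls True [(GT, e)])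
      = lat True (modulus True e * z)" for e z
  proof -
    have "cls True [(GT, e)] \<otimes>\<^bsub>hnn True\<^esub> (lat True (modulus True (\<not> e) * z) \<otimes>\<^bsub>hnn True\<^esub> inv\<^bsub>hnn True\<^esub> cls True [(GT, e)])
      = cls True [(GT, e)] \<otimes>\<^bsub>hnn True\<^esub> lat True (modulus True (\<not> e) * z) \<otimes>\<^bsub>hnn True\<^esub> inv\<^bsub>hnn True\<^esub> cls True [(GT, e)]"
      by (simp add: hnn.m_assoc)
    also have "\<dots> = lat True (modulus True e * z)"
      unfolding stable_letter_lat by (simp add: hnn.m_assoc)
    finally show ?thesis .
  qed
  from assms show ?thesis
  proof (cases rule: RG_cases)
    case (1 x y)
    have "GI (fst x) (snd x) + GI (fst y) (snd y) = GI (fst x + fst y) (snd x + snd y)" by (simp add: gint_eq_iff)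
    then show ?thesis by (simp add: 1 of_PG_def lat_add[symmetric])
  next
    case (4 c)
    then show ?thesis using sl[of True "GI (fst c) (snd c)"] by (simp add: of_PG_def gog_emb_modulus gog_emb_modulus[unfolded One_nat_def])
  next
    case (5 c)
    then show ?thesis using sl[of False "GI (fst c) (snd c)"] by (simp add: of_PG_def gog_emb_modulus gog_emb_modulus[unfolded One_nat_def])
  qed (simp_all add: of_PG_def cls_inv)
qed

text \<open>Both directions come from \<open>presented_group_hom\<close>; that they are inverse to
  each other is checked on single letters and extended along words.\<close>

lemma hnn_iso_PG: "hnn True \<cong> PG"
proof -
  obtain \<phi> where \<phi>: "\<phi> \<in> hom (hnn True) PG" "\<And>w. \<phi> (cls True w) = weval PG to_PG w"
    using PG.presented_group_hom[where S = UNIV and R = "hnn_relations True", OF to_PG_closed to_PG_relations] unfolding hnn_def cls_def by auto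
  obtain \<psi> where \<psi>: "\<psi> \<in> hom PG (hnn True)" "\<And>w. w \<in> words_over SG \<Longrightarrow> \<psi> (pcl w) = weval (hnn True) of_PG w"
    using hnn.presented_group_hom[where S = SG and R = RG, OF of_PG_closed of_PG_relations] unfolding pcl_def by blast
  interpret \<phi>: group_hom "hnn True" PG \<phi> using \<phi>(1) PG.is_group hnn.is_group by (simp add: group_hom_def group_hom_axioms_def)
  interpret \<psi>: group_hom PG "hnn True" \<psi> using \<psi>(1) PG.is_group hnn.is_group by (simp add: group_hom_def group_hom_axioms_def)
  have \<psi>_al: "\<psi> (al z) = lat True (GI (fst z) (snd z))" for z
    using \<psi>(2)[of "[(Inl (0, z), True)]"] by (simp add: al_def of_PG_def)
  have \<psi>_tt: "\<psi> tt = cls True [(GT, True)]"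
    using \<psi>(2)[of "[(Inr 0, True)]"] by (simp add: tt_def of_PG_def)
  have l1: "\<psi> (to_PG x) = cls True [(x, True)]" for x
    by (cases x) (simp_all add: to_PG_def \<psi>_al \<psi>_tt lat_gen_values gsgn_def)
  have id1: "\<psi> (\<phi> (cls True w)) = cls True w" for w
  proof (induction w)
    case Nil
    then show ?case by (simp add: cls_Nil)
  next
    case (Cons a w)
    obtain x b where a: "a = (x, b)" by (cases a)
    have "\<phi> (cls True (a # w)) = (if b then to_PG x else inv\<^bsub>PG\<^esub> to_PG x) \<otimes>\<^bsub>PG\<^esub> \<phi> (cls True w)"
      by (simp add: \<phi>(2) a)
    then have "\<psi> (\<phi> (cls True (a # w))) = cls True [(x, b)] \<otimes>\<^bsub>hnn True\<^esub> cls True w"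
      using to_PG_closed[of x] Cons by (simp add: l1 cls_inv)
    then show ?case using cls_append[of True "[a]" w] by (simp add: a)
  qed
  \<comment> \<open>In Serre's group every lattice element is a generator, so \<open>\<phi>\<close>
    has to be known on all of them and not just on \<open>a\<close> and \<open>b\<close>.\<close>
  have lat_al: "\<phi> (lat True z) = al (gre z, gim z)" for z
  proof (rule gint_additive_induct[of "\<lambda>z. \<phi> (lat True z) = al (gre z, gim z)"])
    have e: "lat True 1 = cls True [(GA, True)]" "lat True (GI 0 1) = cls True [(GB, True)]"
      by (simp_all add: lat_gen_values gsgn_def one_gint_def)
    show "\<phi> (lat True 1) = al (gre 1, gim 1)" "\<phi> (lat True (GI 0 1)) = al (gre (GI 0 1), gim (GI 0 1))"
      unfolding e \<phi>(2) by (simp_all add: to_PG_def)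
  qed (simp_all add: lat_add lat_minus al_mult al_inv)
  have tr: "\<phi> (cls True [(GT, True)]) = tt" "\<phi> (cls True [(GT, False)]) = inv\<^bsub>PG\<^esub> tt"
    by (simp_all add: \<phi>(2) to_PG_def)
  have l2: "\<phi> (of_PG x) = pcl [(x, True)]" if xS: "x \<in> SG" for x
  proof -
    consider "x = Inr 0" | "x = Inr 1" | z where "x = Inl (0, z)" using xS unfolding SG_eq by blast
    then show ?thesis
    proof cases
      case 1
      have "of_PG x = cls True [(GT, True)]" by (simp add: 1 of_PG_def)
      then show ?thesis by (simp only: tr 1 tt_def)
    next
      case 2
      have "of_PG x = cls True [(GT, False)]" by (simp add: 2 of_PG_def)
      then show ?thesis by (simp only: tr 2 tt_rev)
    next
      case 3
      have "of_PG x = lat True (GI (fst z) (snd z))" by (simp add: 3 of_PG_def)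
      then show ?thesis by (simp add: lat_al al_def 3)
    qed
  qed
  have id2: "\<phi> (\<psi> (pcl w)) = pcl w" if "w \<in> words_over SG" for w
    using that
  proof (induction w)
    case Nil
    then show ?case by (simp add: pcl_Nil)
  next
    case (Cons a w)
    obtain x b where a: "a = (x, b)" by (cases a)
    have x: "x \<in> SG" using Cons.hyps by (simp add: a)
    have "\<psi> (pcl (a # w)) = (if b then of_PG x else inv\<^bsub>hnn True\<^esub> of_PG x) \<otimes>\<^bsub>hnn True\<^esub> \<psi> (pcl w)"
      using Cons.hyps by (simp add: \<psi>(2) a)
    moreover have "\<psi> (pcl w) \<in> carrier (hnn True)" using pcl_closed[OF Cons.hyps(2)] by simp
    ultimately have "\<phi> (\<psi> (pcl (a # w))) = pcl [(x, b)] \<otimes>\<^bsub>PG\<^esub> pcl w"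
      using of_PG_closed[of x] Cons.IH by (simp add: l2[OF x] pcl_inv[OF x])
    then show ?case using pcl_append[of "[a]" w] Cons.hyps by (simp add: a)
  qed
  have "bij_betw \<phi> (carrier (hnn True)) (carrier PG)"
  proof (rule bij_betw_byWitness[where f' = \<psi>])
    show "\<forall>g\<in>carrier (hnn True). \<psi> (\<phi> g) = g" using id1 by (auto simp: carrier_hnn)
    show "\<forall>p\<in>carrier PG. \<phi> (\<psi> p) = p" 
    proof
      fix p assume "p \<in> carrier PG"
      then obtain w where "w \<in> words_over SG" "p = pcl w" unfolding carrier_presented_group pcl_def by blast
      then show "\<phi> (\<psi> p) = p" using id2 by blast
    qed
  qed auto
  then show ?thesis using \<phi>(1) unfolding is_iso_def iso_def by blast
qed

lemma gog_path_words: "gog_path lm_graph v w u \<Longrightarrow> w \<in> words_over SG"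
  by (induction rule: gog_path.induct) (auto simp: SG_eq)

text \<open>With a single vertex every word becomes a loop after inserting trivial vertex elements
  between arcs and rewriting an inverse arc as the reversed arc. Hence the fundamental group is all
  of Serre's group.\<close>

lemma pcl_gog_path:
  assumes "w \<in> words_over SG"
  shows "\<exists>w'. gog_path lm_graph 0 w' 0 \<and> pcl w' = pcl w"
  using assms
proof (induction w)
  case Nil
  have "gog_path lm_graph 0 [(Inl (0, (0, 0)), True)] 0" by (rule gog_path.base) auto
  moreover have "pcl [(Inl (0, (0, 0)), True)] = pcl []" using al_zero by (simp add: al_def pcl_Nil)
  ultimately show ?case by blast
next
  case (Cons a w)
  obtain w' where w': "gog_path lm_graph 0 w' 0" "pcl w' = pcl w" using Cons.IH by blast
  have w'S: "w' \<in> words_over SG" by (rule gog_path_words[OF w'(1)])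
  obtain x b where a: "a = (x, b)" by (cases a)
  have x: "x \<in> SG" using Cons.hyps by (simp add: a)
  have split: "pcl (a # w) = pcl [(x, b)] \<otimes>\<^bsub>PG\<^esub> pcl w'"
    using pcl_append[of "[a]" w] Cons.hyps w'(2) by (simp add: a)
  have vertex: "\<exists>w''. gog_path lm_graph 0 w'' 0 \<and> pcl w'' = al z \<otimes>\<^bsub>PG\<^esub> pcl w'" for z
    using w'(1)
  proof cases
    case (base g)
    let ?w = "[(Inl (0, (fst z + fst g, snd z + snd g)), True)]"
    have "gog_path lm_graph 0 ?w 0" by (rule gog_path.base) auto
    moreover have "pcl ?w = al z \<otimes>\<^bsub>PG\<^esub> pcl w'" unfolding base(1) al_def[symmetric] by (simp add: al_mult)
    ultimately show ?thesis by blast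
  next
    case (step e g v)
    let ?g = "(fst z + fst g, snd z + snd g)"
    let ?w = "[(Inl (0, ?g), True), (Inr e, True)] @ v"
    have "gog_path lm_graph (tail (base_graph lm_graph) e) ([(Inl (tail (base_graph lm_graph) e, ?g), True), (Inr e, True)] @ v) 0"
      using step by (intro gog_path.step) auto
    then have p: "gog_path lm_graph 0 ?w 0" by simp
    have e: "(Inr e, True) # v \<in> words_over SG" using w'S step(2) by simp
    have "pcl ?w = al ?g \<otimes>\<^bsub>PG\<^esub> pcl ((Inr e, True) # v)"
      using pcl_append[of "[(Inl (0, ?g), True)]" "(Inr e, True) # v"] e by (simp add: al_def)
    also have "\<dots> = al z \<otimes>\<^bsub>PG\<^esub> (al g \<otimes>\<^bsub>PG\<^esub> pcl ((Inr e, True) # v))"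
      using pcl_closed[OF e] by (simp add: al_mult[symmetric] PG.m_assoc)
    also have "al g \<otimes>\<^bsub>PG\<^esub> pcl ((Inr e, True) # v) = pcl w'"
      using pcl_append[of "[(Inl (0, g), True)]" "(Inr e, True) # v"] e step(2) by (simp add: al_def)
    finally show ?thesis using p by blast
  qed
  have edge: "\<exists>w''. gog_path lm_graph 0 w'' 0 \<and> pcl w'' = pcl [(Inr e, True)] \<otimes>\<^bsub>PG\<^esub> pcl w'" if e: "e \<in> {0, 1}" for e
  proof -
    let ?w = "[(Inl (0, (0, 0)), True), (Inr e, True)] @ w'"
    have "gog_path lm_graph (tail (base_graph lm_graph) e) ([(Inl (tail (base_graph lm_graph) e, (0, 0)), True), (Inr e, True)] @ w') 0"
      using e w'(1) by (intro gog_path.step) auto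
    then have p: "gog_path lm_graph 0 ?w 0" by simp
    have eS: "[(Inr e, True)] \<in> words_over SG" using e by (auto simp: SG_eq)
    have "pcl ?w = al (0, 0) \<otimes>\<^bsub>PG\<^esub> (pcl [(Inr e, True)] \<otimes>\<^bsub>PG\<^esub> pcl w')"
      using pcl_append[of "[(Inl (0, (0, 0)), True)]" "(Inr e, True) # w'"] pcl_append[OF eS w'S] eS w'S by (simp add: al_def)
    then show ?thesis using p pcl_closed[OF eS] pcl_closed[OF w'S] by (auto simp: al_zero)
  qed
  have inv_edge: "pcl [(Inr 0, False)] = pcl [(Inr 1, True)]" "pcl [(Inr 1, False)] = pcl [(Inr 0, True)]"
    using pcl_relation[OF RG_rev(1)] pcl_relation[OF RG_rev(2)] by simp_all
  have "\<exists>w''. gog_path lm_graph 0 w'' 0 \<and> pcl w'' = pcl [(x, b)] \<otimes>\<^bsub>PG\<^esub> pcl w'"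
  proof (cases x)
    case (Inl y)
    then obtain z where z: "x = Inl (0, z)" using x by (auto simp: SG_eq)
    have "pcl [(x, b)] = al (if b then z else (- fst z, - snd z))"
      using al_inv[of "fst z" "snd z"] pcl_inv[of x True] x by (auto simp: z al_def)
    then show ?thesis using vertex by simp
  next
    case (Inr e)
    then have "e \<in> {0, 1}" using x by (auto simp: SG_eq)
    then show ?thesis using edge inv_edge Inr by (cases b) auto
  qed
  then show ?case unfolding split .
qed

theorem GBS2_leary_minasyan: "GBS2 leary_minasyan"
proof -
  have "{pcl w | w. gog_path lm_graph 0 w 0} = carrier PG"
  proof (intro equalityI subsetI)
    fix P assume "P \<in> {pcl w | w. gog_path lm_graph 0 w 0}"
    then show "P \<in> carrier PG" using gog_path_words pcl_closed by blast
  next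
    fix P assume "P \<in> carrier PG"
    then obtain w where "w \<in> words_over SG" "P = pcl w" unfolding carrier_presented_group pcl_def by blast
    then show "P \<in> {pcl w | w. gog_path lm_graph 0 w 0}" using pcl_gog_path[of w] by auto
  qed
  then have "gog_fundamental_group lm_graph 0 = PG"
    by (simp add: gog_fundamental_group_def pcl_def)
  then have "leary_minasyan \<cong> gog_fundamental_group lm_graph 0"
    using hnn_iso_PG by (simp add: leary_minasyan_hnn)
  then show ?thesis
    unfolding GBS2_def using connected_lm_graph fin_lm_graph
    by (intro conjI exI[of _ lm_graph] exI[of _ 0]) (auto simp: leary_minasyan_hnn hnn.is_group intro: iso_refl)
qed

section \<open>The Leary-Minasyan group is not virtually hierarchically hyperbolic\<close>

lemma gcnj_modulus: "gcnj (modulus True e) = modulus True (\<not> e)"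
  by (auto simp: gint_eq_iff modulus_def)

lemma gcnj_one [simp]: "gcnj 1 = 1"
  by (simp add: gint_eq_iff)

text \<open>Each letter conjugates in this way, a stable letter with a modulus as multiplier, and
  multipliers of a product multiply because \<open>gcnj\<close> is multiplicative. Conjugation thus
  acts through \<open>B / gcnj B\<close>, of absolute value 1.\<close>

lemma conjugated_lattice:
  assumes "h \<in> carrier (hnn True)"
  shows "\<exists>B. gnorm B > 0 \<and> (\<forall>z. lat True (gcnj B * z) \<otimes>\<^bsub>hnn True\<^esub> h = h \<otimes>\<^bsub>hnn True\<^esub> lat True (B * z))"
proof -
  obtain w where w: "h = cls True w" using assms by (auto simp: carrier_hnn)
  show ?thesis unfolding w
  proof (induction w)
    case Nil
    show ?case by (rule exI[of _ 1]) (simp add: cls_Nil)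
  next
    case (Cons a w)
    obtain x b where a: "a = (x, b)" by (cases a)
    let ?g = "cls True [(x, b)]"
    obtain B where B: "gnorm B > 0"
      "\<And>z. lat True (gcnj B * z) \<otimes>\<^bsub>hnn True\<^esub> cls True w = cls True w \<otimes>\<^bsub>hnn True\<^esub> lat True (B * z)"
      using Cons.IH by blast
    have "\<exists>C. gnorm C > 0 \<and> (\<forall>z. lat True (gcnj C * z) \<otimes>\<^bsub>hnn True\<^esub> ?g = ?g \<otimes>\<^bsub>hnn True\<^esub> lat True (C * z))"
    proof (cases "x = GT")
      case True
      then show ?thesis
        using stable_letter_lat[of True b] by (intro exI[of _ "modulus True (\<not> b)"]) (simp add: gcnj_modulus)
    next
      case False
      have "lat True z \<otimes>\<^bsub>hnn True\<^esub> ?g = ?g \<otimes>\<^bsub>hnn True\<^esub> lat True z" for z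
        unfolding lat_gen[OF False, symmetric] by (simp add: lat_add[symmetric] add.commute)
      then show ?thesis by (intro exI[of _ 1]) simp
    qed
    then obtain C where C: "gnorm C > 0"
      "\<And>z. lat True (gcnj C * z) \<otimes>\<^bsub>hnn True\<^esub> ?g = ?g \<otimes>\<^bsub>hnn True\<^esub> lat True (C * z)"
      by blast
    have "lat True (gcnj (C * B) * z) \<otimes>\<^bsub>hnn True\<^esub> (?g \<otimes>\<^bsub>hnn True\<^esub> cls True w) =
        ?g \<otimes>\<^bsub>hnn True\<^esub> cls True w \<otimes>\<^bsub>hnn True\<^esub> lat True (C * B * z)" for z
    proof -
      have "lat True (gcnj (C * B) * z) \<otimes>\<^bsub>hnn True\<^esub> (?g \<otimes>\<^bsub>hnn True\<^esub> cls True w) =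
          lat True (gcnj C * (gcnj B * z)) \<otimes>\<^bsub>hnn True\<^esub> ?g \<otimes>\<^bsub>hnn True\<^esub> cls True w"
        by (simp add: gcnj_mult mult.assoc hnn.m_assoc)
      also have "\<dots> = ?g \<otimes>\<^bsub>hnn True\<^esub> (lat True (gcnj B * (C * z)) \<otimes>\<^bsub>hnn True\<^esub> cls True w)"
        unfolding C(2) by (simp add: hnn.m_assoc mult.left_commute)
      also have "\<dots> = ?g \<otimes>\<^bsub>hnn True\<^esub> cls True w \<otimes>\<^bsub>hnn True\<^esub> lat True (C * B * z)"
        unfolding B(2) by (simp add: hnn.m_assoc mult_ac)
      finally show ?thesis .
    qed
    moreover have "gnorm (C * B) > 0" using B(1) C(1) by (simp add: gnorm_mult)
    moreover have "cls True (a # w) = ?g \<otimes>\<^bsub>hnn True\<^esub> cls True w" using cls_append[of True "[a]" w] by (simp add: a)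
    ultimately show ?case by (intro exI[of _ "C * B"]) simp
  qed
qed

lemma stable_letter_power:
  "cls True [(GT, True)] [^]\<^bsub>hnn True\<^esub> n \<otimes>\<^bsub>hnn True\<^esub> lat True (modulus True False ^ n * z) =
    lat True (modulus True True ^ n * z) \<otimes>\<^bsub>hnn True\<^esub> cls True [(GT, True)] [^]\<^bsub>hnn True\<^esub> (n :: nat)"
proof (induction n arbitrary: z)
  case (Suc n)
  let ?t = "cls True [(GT, True)]"
  let ?L = "lat True" and ?P = "modulus True False" and ?Q = "modulus True True"
  have "?t [^]\<^bsub>hnn True\<^esub> Suc n \<otimes>\<^bsub>hnn True\<^esub> ?L (?P ^ Suc n * z) =
      ?t [^]\<^bsub>hnn True\<^esub> n \<otimes>\<^bsub>hnn True\<^esub> (?t \<otimes>\<^bsub>hnn True\<^esub> ?L (?P * (?P ^ n * z)))"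
    by (simp add: hnn.m_assoc mult_ac)
  also have "\<dots> = ?t [^]\<^bsub>hnn True\<^esub> n \<otimes>\<^bsub>hnn True\<^esub> ?L (?P ^ n * (?Q * z)) \<otimes>\<^bsub>hnn True\<^esub> ?t"
    using stable_letter_lat[of True True "?P ^ n * z"] by (simp add: hnn.m_assoc mult_ac)
  also have "\<dots> = ?L (?Q ^ Suc n * z) \<otimes>\<^bsub>hnn True\<^esub> ?t [^]\<^bsub>hnn True\<^esub> Suc n"
    unfolding Suc.IH by (simp add: hnn.m_assoc mult_ac)
  finally show ?case .
qed simp

text \<open>Powers of \<open>(2 + i)\<^sup>2 = 3 + 4 i\<close> stay congruent to \<open>3 + 4 i\<close> modulo \<open>5\<close>, so their arguments avoid the axes.\<close>

lemma rotation_powers: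
  assumes "n > 0"
  shows "gre ((modulus True True ^ 2) ^ n) \<noteq> 0" "gim ((modulus True True ^ 2) ^ n) \<noteq> 0"
proof -
  have "gre ((modulus True True ^ 2) ^ n) mod 5 = 3 \<and> gim ((modulus True True ^ 2) ^ n) mod 5 = 4"
    using assms
  proof (induction n rule: nat_induct_non_zero)
    case (Suc n)
    let ?w = "(modulus True True ^ 2) ^ n"
    have m: "modulus True True ^ 2 = GI 3 4" by (simp add: power2_eq_square modulus_def gint_eq_iff)
    have "(3 * gre ?w - 4 * gim ?w) mod 5 = 3" "(3 * gim ?w + 4 * gre ?w) mod 5 = 4"
      using Suc.IH by presburger+
    then show ?case by (simp add: m algebra_simps)
  qed (simp add: power2_eq_square modulus_def)
  then show "gre ((modulus True True ^ 2) ^ n) \<noteq> 0" "gim ((modulus True True ^ 2) ^ n) \<noteq> 0" by auto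
qed

theorem leary_minasyan_not_virtually_HHG: "\<not> virtually_HHG TYPE('i) TYPE('p) leary_minasyan"
proof
  let ?L = "hnn True"
  assume "virtually_HHG TYPE('i) TYPE('p) leary_minasyan"
  then obtain H where H: "subgroup H ?L" "finite (rcosets\<^bsub>?L\<^esub> H)" "HHG TYPE('i) TYPE('p) (?L\<lparr>carrier := H\<rparr>)"
    unfolding virtually_HHG_def leary_minasyan_hnn by blast
  let ?H = "?L\<lparr>carrier := H\<rparr>"
  note HL = subgroup.mem_carrier[OF H(1)]
  have inv: "inv\<^bsub>?H\<^esub> h = inv\<^bsub>?L\<^esub> h" if "h \<in> H" for h using hnn.m_inv_consistent[OF H(1) that] by simp
  have pow: "h [^]\<^bsub>?H\<^esub> (n::nat) = h [^]\<^bsub>?L\<^esub> n" for h n by (rule hnn.nat_pow_consistent[symmetric])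
  obtain k :: nat where k: "k > 0" "cls True [(GT, True)] [^]\<^bsub>?L\<^esub> k \<in> H"
    using hnn.finite_index_power[OF H(1,2), of "cls True [(GT, True)]"] cls_closed by blast
  obtain p :: nat where p: "p > 0" "lat True 1 [^]\<^bsub>?L\<^esub> p \<in> H"
    using hnn.finite_index_power[OF H(1,2), of "lat True 1"] lat_closed by blast
  obtain q :: nat where q: "q > 0" "lat True (GI 0 1) [^]\<^bsub>?L\<^esub> q \<in> H"
    using hnn.finite_index_power[OF H(1,2), of "lat True (GI 0 1)"] lat_closed by blast
  \<comment> \<open>A common multiple of \<open>p\<close> and \<open>q\<close>: the lattice elements
    of \<open>N\<close> and \<open>N i\<close> lie in \<open>H\<close>, hence those of all multiples
    of \<open>N\<close>.\<close>
  define N where "N = p * q"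
  have lat_pow: "lat True z [^]\<^bsub>?L\<^esub> (n::nat) = lat True (of_nat n * z)" for z n
    by (induction n) (simp_all add: lat_add[symmetric] algebra_simps)
  have pow_H: "h [^]\<^bsub>?L\<^esub> (n::nat) \<in> H" if "h \<in> H" for h n
    using that H(1) by (induction n) (auto intro: subgroup.one_closed subgroup.m_closed)
  have latH: "lat True (of_nat N * z) \<in> H" for z
  proof (rule gint_additive_induct[of "\<lambda>z. lat True (of_nat N * z) \<in> H"])
    show "lat True (of_nat N * 1) \<in> H" using pow_H[OF p(2), of q] by (simp add: lat_pow N_def mult_ac)
    show "lat True (of_nat N * GI 0 1) \<in> H" using pow_H[OF q(2), of p] by (simp add: lat_pow N_def mult_ac)
  qed (auto simp: distrib_left lat_add lat_minus intro: subgroup.m_closed[OF H(1)] subgroup.m_inv_closed[OF H(1)])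
  have N: "N > 0" using p(1) q(1) by (simp add: N_def)
  show False
  proof (rule HHG_no_rotating_lattice[OF H(3), of "\<lambda>z. lat True (of_nat N * z)" "cls True [(GT, True)] [^]\<^bsub>?L\<^esub> k"])
    show "lat True (of_nat N * z) \<in> carrier ?H" for z using latH by simp
    show "lat True (of_nat N * (x + y)) = lat True (of_nat N * x) \<otimes>\<^bsub>?H\<^esub> lat True (of_nat N * y)" for x y
      by (simp add: distrib_left lat_add)
    show "inj (\<lambda>z. lat True (of_nat N * z))"
    proof (rule injI)
      fix x y assume "lat True (of_nat N * x) = lat True (of_nat N * y)"
      then have "of_nat N * x = of_nat N * y" by (rule lat_inj)
      then show "x = y" using N by (simp add: gint_eq_iff of_nat_gint)
    qed
    show "\<exists>M B. 0 < M \<and> 0 < gnorm B \<and> (\<forall>z. inv\<^bsub>?H\<^esub> h \<otimes>\<^bsub>?H\<^esub> lat True (of_nat N * (of_int M * (gcnj B * z))) \<otimes>\<^bsub>?H\<^esub> h =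
        lat True (of_nat N * (of_int M * (B * z))))" if h: "h \<in> carrier ?H" for h
    proof -
      have hL: "h \<in> carrier ?L" using h HL by simp
      obtain B where B: "gnorm B > 0" "\<And>z. lat True (gcnj B * z) \<otimes>\<^bsub>?L\<^esub> h = h \<otimes>\<^bsub>?L\<^esub> lat True (B * z)"
        using conjugated_lattice[OF hL] by blast
      have "inv\<^bsub>?L\<^esub> h \<otimes>\<^bsub>?L\<^esub> lat True (gcnj B * z) \<otimes>\<^bsub>?L\<^esub> h = lat True (B * z)" for z
        using B(2)[of z] hL by (simp add: hnn.m_assoc) (simp add: hnn.m_assoc[symmetric])
      from this[of "of_nat N * z" for z] show ?thesis
        using B(1) h inv by (intro exI[of _ 1] exI[of _ B]) (simp add: mult_ac)
    qed
    show "cls True [(GT, True)] [^]\<^bsub>?L\<^esub> k \<in> carrier ?H" using k(2) by simp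
    fix m :: nat assume m: "m > 0"
    let ?t = "cls True [(GT, True)]" and ?n = "k * m" and ?P = "modulus True False" and ?Q = "modulus True True"
    have n: "?n > 0" using k(1) m by simp
    \<comment> \<open>The power of \<open>t\<close> conjugates \<open>P ^ n * z\<close> to
      \<open>Q ^ n * z\<close>. Taking \<open>z\<close> to be a multiple of \<open>Q ^ n\<close>
      makes the first factor the integer \<open>5 ^ n\<close> and the second
      \<open>(Q ^ 2) ^ n\<close>.\<close>
    have PQ: "?P ^ ?n * ?Q ^ ?n = of_int (5 ^ ?n)"
      using mult_gcnj[of ?P] by (simp add: gcnj_modulus power_mult_distrib[symmetric])
    have "?t [^]\<^bsub>?L\<^esub> ?n \<otimes>\<^bsub>?L\<^esub> lat True (of_nat N * (of_int (5 ^ ?n) * z)) =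
        lat True (of_nat N * ((?Q ^ 2) ^ ?n * z)) \<otimes>\<^bsub>?L\<^esub> ?t [^]\<^bsub>?L\<^esub> ?n" for z
    proof -
      have 1: "of_nat N * (of_int (5 ^ ?n) * z) = ?P ^ ?n * (?Q ^ ?n * (of_nat N * z))"
        unfolding PQ[symmetric] by (simp only: mult_ac)
      have 2: "of_nat N * ((?Q ^ 2) ^ ?n * z) = ?Q ^ ?n * (?Q ^ ?n * (of_nat N * z))"
        by (simp only: power2_eq_square power_mult_distrib mult_ac)
      show ?thesis unfolding 1 2 by (rule stable_letter_power)
    qed
    moreover have "gnorm ((?Q ^ 2) ^ ?n) = (5 ^ ?n)\<^sup>2"
      by (simp add: gnorm_power power_mult[symmetric] mult.commute)
    moreover have "(?t [^]\<^bsub>?L\<^esub> k) [^]\<^bsub>?H\<^esub> m = ?t [^]\<^bsub>?L\<^esub> ?n"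
      unfolding pow by (simp add: hnn.nat_pow_pow)
    ultimately show "\<exists>w n. gnorm w = n\<^sup>2 \<and> 0 < n \<and> gre w \<noteq> 0 \<and> gim w \<noteq> 0 \<and>
        (\<forall>z. (?t [^]\<^bsub>?L\<^esub> k) [^]\<^bsub>?H\<^esub> m \<otimes>\<^bsub>?H\<^esub> lat True (of_nat N * (of_int n * z)) =
          lat True (of_nat N * (w * z)) \<otimes>\<^bsub>?H\<^esub> (?t [^]\<^bsub>?L\<^esub> k) [^]\<^bsub>?H\<^esub> m)"
      using rotation_powers[OF n] by (intro exI[of _ "(?Q ^ 2) ^ ?n"] exI[of _ "5 ^ ?n"]) simp
  qed
qed

section \<open>The tree and the plane\<close>

fun lcp :: "'a list \<Rightarrow> 'a list \<Rightarrow> nat" where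
  "lcp (x # xs) (y # ys) = (if x = y then Suc (lcp xs ys) else 0)"
| "lcp _ _ = 0"

lemma lcp_Nil [simp]: "lcp [] ys = 0" "lcp xs [] = 0"
  by (cases xs; simp)+

lemma lcp_commute: "lcp xs ys = lcp ys xs"
  by (induction xs ys rule: lcp.induct) auto

lemma lcp_le: "lcp xs ys \<le> length xs" "lcp xs ys \<le> length ys"
  by (induction xs ys rule: lcp.induct) auto

lemma lcp_same [simp]: "lcp xs xs = length xs"
  by (induction xs) auto

lemma lcp_ultrametric: "min (lcp xs ys) (lcp ys zs) \<le> lcp xs zs"
proof (induction xs ys arbitrary: zs rule: lcp.induct)
  case (1 x xs y ys)
  show ?case using "1.IH" by (cases zs) auto
qed auto

lemma lcp_take: "lcp (take m xs) (take n ys) = min (min m n) (lcp xs ys)"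
proof (induction xs ys arbitrary: m n rule: lcp.induct)
  case (1 x xs y ys)
  then show ?case by (cases m; cases n) auto
qed auto

lemma lcp_eq_length:
  assumes "lcp xs ys = length xs" "length ys = length xs"
  shows "xs = ys"
  using assms
proof (induction xs arbitrary: ys)
  case (Cons x xs)
  then obtain y zs where ys: "ys = y # zs" by (cases ys) auto
  have "x = y" using Cons.prems(1) by (rule contrapos_pp) (simp add: ys)
  then have "lcp xs zs = length xs" "length zs = length xs" using Cons.prems by (simp_all add: ys)
  then show ?case using Cons.IH[of zs] \<open>x = y\<close> ys by blast
qed simp

text \<open>Path distance in the rooted tree where the parent of a word is obtained by dropping its
  last letter.\<close>

definition vdist :: "vertex \<Rightarrow> vertex \<Rightarrow> real" where
  "vdist u v = real (length u) + real (length v) - 2 * real (lcp u v)"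

lemma vdist_commute: "vdist u v = vdist v u"
  by (simp add: vdist_def lcp_commute)

lemma vdist_same [simp]: "vdist u u = 0"
  by (simp add: vdist_def)

lemma vdist_Nil [simp]: "vdist [] u = length u"
  by (simp add: vdist_def)

lemma length_zlist [simp]: "length (zlist s z w) = length w"
  by (induction w arbitrary: z) auto

lemma res_shift_inj:
  assumes "0 \<le> c" "c < 5" "0 \<le> d" "d < 5" "res s e (z + of_int c) = res s e (z + of_int d)"
  shows "c = d"
proof -
  define u where "u = gre z - 2 * gsgn (s \<and> e) * gim z"
  have "(u + c) mod 5 = (u + d) mod 5" using assms(5) by (simp add: res_def u_def algebra_simps)
  then show ?thesis using assms(1-4) by presburger
qed

text \<open>\<open>zlist\<close> acts as an automorphism of the rooted tree: the carry depends only
  on the prefix already read, and at each node a shift permutes the five digits.\<close>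

lemma lcp_zlist:
  "reduced w \<Longrightarrow> reduced w' \<Longrightarrow> lcp (zlist s z w) (zlist s z w') = lcp w w'"
proof (induction w w' arbitrary: z rule: lcp.induct)
  case (1 x xs y ys)
  obtain c e d e' where xy: "x = (c, e)" "y = (d, e')" by (cases x; cases y)
  have r: "reduced xs" "reduced ys" "0 \<le> c" "c < 5" "0 \<le> d" "d < 5"
    using "1.prems" by (simp_all add: xy)
  show ?case
  proof (cases "x = y")
    case True
    then show ?thesis using "1.IH"[OF True r(1,2)] by (simp add: xy)
  next
    case False
    have "(res s e (z + of_int c), e) \<noteq> (res s e' (z + of_int d), e')"
    proof
      assume "(res s e (z + of_int c), e) = (res s e' (z + of_int d), e')"
      then have "e = e'" "c = d" using res_shift_inj[OF r(3-6), of s e z] by blast+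
      then show False using False xy by blast
    qed
    then show ?thesis using False by (simp only: xy zlist.simps lcp.simps if_False)
  qed
qed (simp_all only: zlist.simps lcp_Nil)

definition vgen :: "bool \<Rightarrow> lm_gen \<Rightarrow> bool \<Rightarrow> vertex \<Rightarrow> vertex" where
  "vgen s x b w = (if x = GT then tact b w else zlist s (of_int (gsgn b) * gen_value x) w)"

lemma fst_nf_act: "fst (nf_act s x b n) = vgen s x b (fst n)"
  by (simp add: nf_act_def vgen_def zact_def)

lemma fst_word_act: "fst (word_act (nf_act s) u n) = word_act (vgen s) u (fst n)"
  by (induction u) (auto simp: fst_nf_act)

interpretation vt: presented_action UNIV "hnn_relations s" "{w. reduced w}" "vgen s" for s
proof
  fix x b w assume w: "w \<in> {w. reduced w}"
  then have n: "(w, 0) \<in> nf_space" by (simp add: nf_space_def)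
  show "vgen s x b w \<in> {w. reduced w}"
    using nf_act_closed[OF n, of s x b] fst_nf_act[of s x b "(w, 0)"] by (simp add: nf_space_def)
  show "vgen s x b (vgen s x (\<not> b) w) = w"
    using nf_act_inverse[OF n, of s x b] fst_nf_act[of s x b "nf_act s x (\<not> b) (w, 0)"]
      fst_nf_act[of s x "\<not> b" "(w, 0)"] by simp
next
  fix l r w assume "(l, r) \<in> hnn_relations s" "w \<in> {w. reduced w}"
  then show "word_act (vgen s) l w = word_act (vgen s) r w"
    using nf.relator[of l r s "(w, 0)"] fst_word_act[of s l "(w, 0)"] fst_word_act[of s r "(w, 0)"]
    by (simp add: nf_space_def)
qed

text \<open>The stable letter moves the root. The delicate case is \<open>mixed\<close>: one word
  loses its first letter, the other gains one, and neither before nor after do they share a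
  prefix.\<close>

lemma vdist_tact:
  assumes "reduced w" "reduced w'"
  shows "vdist (tact e w) (tact e w') = vdist w w'"
proof -
  have cons: "tact e v = (0, e) # v" if "\<nexists>v'. v = (0, \<not> e) # v'" for v
    using that by (cases v rule: reduced.cases) (auto simp: tact_def)
  have mixed: "vdist (tact e ((0, \<not> e) # v)) (tact e v') = vdist ((0, \<not> e) # v) v'"
    if "reduced ((0, \<not> e) # v)" "\<nexists>u. v' = (0, \<not> e) # u" for v v'
  proof -
    have "lcp v ((0, e) # v') = 0" using that(1) by (cases v rule: reduced.cases) auto
    moreover have "lcp ((0, \<not> e) # v) v' = 0" using that(2) by (cases v') auto
    ultimately show ?thesis using cons[OF that(2)] by (simp add: vdist_def tact_def)
  qed
  consider v v' where "w = (0, \<not> e) # v" "w' = (0, \<not> e) # v'"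
    | v where "w = (0, \<not> e) # v" "\<nexists>u. w' = (0, \<not> e) # u"
    | v where "w' = (0, \<not> e) # v" "\<nexists>u. w = (0, \<not> e) # u"
    | "\<nexists>u. w = (0, \<not> e) # u" "\<nexists>u. w' = (0, \<not> e) # u" by blast
  then show ?thesis
  proof cases
    case 1
    then show ?thesis by (simp add: tact_def vdist_def)
  next
    case 2
    then show ?thesis using mixed assms by simp
  next
    case 3
    then show ?thesis using mixed[of v w] assms by (simp add: vdist_commute)
  next
    case 4
    then show ?thesis by (simp add: cons vdist_def)
  qed
qed

lemma vdist_vgen: "reduced w \<Longrightarrow> reduced w' \<Longrightarrow> vdist (vgen s x b w) (vgen s x b w') = vdist w w'"
  by (simp add: vgen_def vdist_tact) (simp add: vdist_def lcp_zlist)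

lemma vdist_word_act:
  assumes "reduced w" "reduced w'"
  shows "vdist (word_act (vgen s) u w) (word_act (vgen s) u w') = vdist w w'"
proof (induction u)
  case (Cons a u)
  have "reduced (word_act (vgen s) u w)" "reduced (word_act (vgen s) u w')"
    using vt.word_act_closed[of w s u] vt.word_act_closed[of w' s u] assms by auto
  then show ?case using Cons by (cases a) (simp add: vdist_vgen)
qed simp

section \<open>The action on the plane\<close>

definition cx :: "gint \<Rightarrow> complex" where "cx z = Complex (gre z) (gim z)"

lemma cx_simps: "cx 0 = 0" "cx (x + y) = cx x + cx y" "cx (x * y) = cx x * cx y" "cx (of_int n) = of_int n"
  by (simp_all add: cx_def complex_eq_iff)

lemma norm_cx: "cmod (cx z) = sqrt (gnorm z)"
  by (simp add: cx_def cmod_def gnorm_def)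

text \<open>The linear part of the stable letter on the plane where the lattice acts by
  translations: \<open>(2 + i) / (2 - i) = (3 + 4 i) / 5\<close> for \<open>s = True\<close>, and 1
  for \<open>s = False\<close>.\<close>

definition rotation :: "bool \<Rightarrow> complex" where
  "rotation s = cx (modulus s True) / cx (modulus s False)"

lemma cx_modulus_nonzero: "cx (modulus s e) \<noteq> 0"
  by (simp add: cx_def modulus_def complex_eq_iff)

lemma norm_rotation: "cmod (rotation s) = 1"
  by (simp add: rotation_def norm_divide norm_cx)

definition plane :: "bool \<Rightarrow> lm_gen \<Rightarrow> bool \<Rightarrow> complex \<Rightarrow> complex" where
  "plane s x b p = (if x = GT then (if b then rotation s * p else p / rotation s)
    else p + cx (of_int (gsgn b) * gen_value x))"

lemma rotation_nonzero: "rotation s \<noteq> 0"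
  using norm_rotation[of s] by auto

lemma plane_relation:
  "plane s GT True (plane s GT False p + cx (modulus s False * k)) = p + cx (modulus s True * k)"
  using rotation_nonzero[of s] cx_modulus_nonzero[of s False]
  by (simp add: plane_def cx_simps distrib_left) (simp add: rotation_def)

lemma plane_values: "plane s GA b p = p + cx (GI (gsgn b) 0)" "plane s GB b p = p + cx (GI 0 (gsgn b))"
  by (simp_all add: plane_def gen_value_def times_gint_def)

interpretation pl: presented_action UNIV "hnn_relations s" UNIV "plane s" for s
proof
  fix x b p
  show "plane s x b (plane s x (\<not> b) p) = p"
    using rotation_nonzero[of s] by (auto simp: plane_def cx_def gsgn_def complex_eq_iff)
next
  fix l r and p :: complex assume lr: "(l, r) \<in> hnn_relations s"
  have m: "modulus s False * 1 = GI 1 0 + (GI 1 0 + GI 0 (- 1))" "modulus s True * 1 = GI 1 0 + (GI 1 0 + GI 0 (gsgn s))"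
    "modulus s False * GI 0 1 = GI 1 0 + (GI 0 1 + GI 0 1)" "modulus s True * GI 0 1 = GI (gsgn (\<not> s)) 0 + (GI 0 1 + GI 0 1)"
    by (auto simp: gint_eq_iff modulus_def gsgn_def)
  have v: "gsgn True = 1" "gsgn False = - 1" by (simp_all add: gsgn_def)
  consider "(l, r) = ([(GA, True), (GB, True), (GA, False), (GB, False)], [])"
    | "(l, r) = ([(GT, True), (GA, True), (GA, True), (GB, False), (GT, False)], [(GA, True), (GA, True), (GB, s)])"
    | "(l, r) = ([(GT, True), (GA, True), (GB, True), (GB, True), (GT, False)], [(GA, \<not> s), (GB, True), (GB, True)])"
    using lr unfolding hnn_relations_def by blast
  then show "word_act (plane s) l p = word_act (plane s) r p"
  proof cases
    case 1
    then show ?thesis by (simp add: plane_values v cx_def complex_eq_iff)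
  next
    case 2
    then show ?thesis using plane_relation[of s p 1] unfolding m cx_simps
      by (simp add: plane_values v add_ac)
  next
    case 3
    then show ?thesis using plane_relation[of s p "GI 0 1"] unfolding m cx_simps
      by (simp add: plane_values v add_ac)
  qed
qed auto

lemma norm_plane: "cmod (plane s x b p - plane s x b q) = cmod (p - q)"
  by (simp add: plane_def norm_rotation norm_mult norm_divide flip: right_diff_distrib diff_divide_distrib)

lemma norm_word_act_plane: "cmod (word_act (plane s) u p - word_act (plane s) u q) = cmod (p - q)"
  by (induction u) (auto simp: norm_plane)

section \<open>Groups acting on the tree and the plane\<close>

text \<open>The orbit map to the product of tree and plane is a quasi-isometry: word norms are
  compared with displacements of the base point, and by \<open>dense\<close> the orbit meets every
  unit disc over every vertex. The factor 13 is computed in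
  \<open>tree_plane_group_hnn\<close>.\<close>

locale tree_plane_group = group G for G (structure) +
  fixes A :: "'a set" and va :: "'a \<Rightarrow> vertex \<Rightarrow> vertex" and pa :: "'a \<Rightarrow> complex \<Rightarrow> complex"
  assumes generating: "finite_generating_set G A"
    and va_closed: "g \<in> carrier G \<Longrightarrow> reduced w \<Longrightarrow> reduced (va g w)"
    and va_one: "reduced w \<Longrightarrow> va \<one> w = w"
    and va_mult: "g \<in> carrier G \<Longrightarrow> h \<in> carrier G \<Longrightarrow> reduced w \<Longrightarrow> va (g \<otimes> h) w = va g (va h w)"
    and va_dist: "g \<in> carrier G \<Longrightarrow> reduced w \<Longrightarrow> reduced w' \<Longrightarrow> vdist (va g w) (va g w') = vdist w w'"
    and pa_one: "pa \<one> p = p"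
    and pa_mult: "g \<in> carrier G \<Longrightarrow> h \<in> carrier G \<Longrightarrow> pa (g \<otimes> h) p = pa g (pa h p)"
    and pa_dist: "g \<in> carrier G \<Longrightarrow> cmod (pa g p - pa g q) = cmod (p - q)"
    and word_norm_ge: "g \<in> carrier G \<Longrightarrow> length (va g []) + cmod (pa g 0) \<le> word_norm G A g"
    and word_norm_le': "g \<in> carrier G \<Longrightarrow> word_norm G A g \<le> 13 * (length (va g []) + cmod (pa g 0))"
    and dense: "reduced w \<Longrightarrow> \<exists>g \<in> carrier G. va g [] = w \<and> cmod (pa g 0 - p) \<le> 1"
begin

definition tp_dist :: "'a \<Rightarrow> 'a \<Rightarrow> real" where
  "tp_dist g h = vdist (va g []) (va h []) + cmod (pa g 0 - pa h 0)"

lemma tp_dist_word_dist: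
  assumes "g \<in> carrier G" "h \<in> carrier G"
  shows "tp_dist g h \<le> word_dist G A g h" "word_dist G A g h \<le> 13 * tp_dist g h"
proof -
  let ?k = "inv g \<otimes> h"
  have k: "?k \<in> carrier G" "h = g \<otimes> ?k" using assms by (simp_all add: m_assoc[symmetric])
  have "va h [] = va g (va ?k [])" "pa h 0 = pa g (pa ?k 0)"
    using va_mult[of g ?k "[]"] pa_mult[of g ?k 0] k assms by auto
  then have "tp_dist g h = length (va ?k []) + cmod (pa ?k 0)"
    using va_dist[of g "[]" "va ?k []"] va_closed[OF k(1), of "[]"] pa_dist[OF assms(1), of 0 "pa ?k 0"] assms(1)
    by (simp add: tp_dist_def norm_minus_commute)
  then show "tp_dist g h \<le> word_dist G A g h" "word_dist G A g h \<le> 13 * tp_dist g h"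
    using word_norm_ge[OF k(1)] word_norm_le'[OF k(1)] assms by (simp_all add: word_dist_def)
qed

end

text \<open>Each element is sent to one with the same vertex and a plane point at distance at most
  1. This changes \<open>tp_dist\<close> by at most 2, and 26 is 13 times 2.\<close>

lemma quasi_isometric_tree_plane_groups:
  assumes "tree_plane_group G A va pa" "tree_plane_group H B vb pb"
  shows "quasi_isometric_groups G H"
proof -
  interpret G: tree_plane_group G A va pa by fact
  interpret H: tree_plane_group H B vb pb by fact
  note X = G.word_metric_simps[OF G.generating] and Y = H.word_metric_simps[OF H.generating]
  have "\<forall>g\<in>carrier G. \<exists>h. h \<in> carrier H \<and> vb h [] = va g [] \<and> cmod (pb h 0 - pa g 0) \<le> 1"
    using H.dense G.va_closed by (metis reduced.simps(1))
  then obtain f where f: "\<And>g. g \<in> carrier G \<Longrightarrow> f g \<in> carrier H"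
    "\<And>g. g \<in> carrier G \<Longrightarrow> vb (f g) [] = va g []" "\<And>g. g \<in> carrier G \<Longrightarrow> cmod (pb (f g) 0 - pa g 0) \<le> 1"
    by metis
  have tri: "cmod (a - d) \<le> cmod (a - b) + cmod (b - c) + cmod (c - d)" for a b c d
    using norm_triangle_ineq[of "a - b" "b - c"] norm_triangle_ineq[of "a - c" "c - d"] by simp
  have close: "\<bar>H.tp_dist (f g) (f h) - G.tp_dist g h\<bar> \<le> 2" if "g \<in> carrier G" "h \<in> carrier G" for g h
  proof -
    have "cmod (pb (f g) 0 - pb (f h) 0) \<le> cmod (pb (f g) 0 - pa g 0) + cmod (pa g 0 - pa h 0) + cmod (pa h 0 - pb (f h) 0)"
      "cmod (pa g 0 - pa h 0) \<le> cmod (pa g 0 - pb (f g) 0) + cmod (pb (f g) 0 - pb (f h) 0) + cmod (pb (f h) 0 - pa h 0)"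
      using tri by blast+
    then show ?thesis
      using f(3)[OF that(1)] f(3)[OF that(2)]
        norm_minus_commute[of "pa h 0" "pb (f h) 0"] norm_minus_commute[of "pa g 0" "pb (f g) 0"]
      unfolding G.tp_dist_def H.tp_dist_def f(2)[OF that(1)] f(2)[OF that(2)] abs_le_iff by linarith
  qed
  have "quasi_isometric (word_metric G A) (word_metric H B)"
    unfolding quasi_isometric_def X Y
  proof (intro exI[of _ f] exI[of _ "26::real"] conjI ballI)
    fix g h assume gh: "g \<in> carrier G" "h \<in> carrier G"
    have nn: "0 \<le> word_dist G A g h" by (simp add: word_dist_def)
    note b = G.tp_dist_word_dist[OF gh] H.tp_dist_word_dist[OF f(1)[OF gh(1)] f(1)[OF gh(2)]] close[OF gh]
    show "word_dist G A g h / 26 - 26 \<le> word_dist H B (f g) (f h)"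
      using b nn unfolding abs_le_iff by linarith
    show "word_dist H B (f g) (f h) \<le> 26 * word_dist G A g h + 26"
      using b nn unfolding abs_le_iff by linarith
  next
    fix h assume h: "h \<in> carrier H"
    obtain g where g: "g \<in> carrier G" "va g [] = vb h []" "cmod (pa g 0 - pb h 0) \<le> 1"
      using G.dense[of "vb h []" "pb h 0"] H.va_closed[OF h, of "[]"] by auto
    have "cmod (pb (f g) 0 - pb h 0) \<le> 2"
      using norm_diff_triangle_le[OF f(3)[OF g(1)] g(3)] by simp
    then have "H.tp_dist (f g) h \<le> 2" by (simp add: H.tp_dist_def f(2) g)
    then have "word_dist H B (f g) h \<le> 26" using H.tp_dist_word_dist[OF f(1)[OF g(1)] h] by linarith
    then show "\<exists>g\<in>carrier G. word_dist H B (f g) h \<le> 26" using g(1) by blast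
  qed (use f in auto)
  then show ?thesis using G.generating H.generating by (auto simp: quasi_isometric_groups_def)
qed

section \<open>Word norms in the two groups\<close>

context group
begin

lemma word_norm_mult:
  assumes "A \<subseteq> carrier G" "g \<in> generate G A" "h \<in> generate G A"
  shows "word_norm G A (g \<otimes> h) \<le> word_norm G A g + word_norm G A h"
proof -
  obtain us where us: "set us \<subseteq> A \<union> m_inv G ` A" "foldr (\<otimes>) us \<one> = g" "length us = word_norm G A g"
    using word_norm_ex[OF assms(1,2)] .
  obtain vs where vs: "set vs \<subseteq> A \<union> m_inv G ` A" "foldr (\<otimes>) vs \<one> = h" "length vs = word_norm G A h"
    using word_norm_ex[OF assms(1,3)] .
  have sub: "A \<union> m_inv G ` A \<subseteq> carrier G" using assms(1) by auto
  have "foldr (\<otimes>) (us @ vs) \<one> = g \<otimes> h"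
    using foldr_mult_append(2)[of us vs] us vs sub by auto
  then show ?thesis using word_norm_le[of "us @ vs" A "g \<otimes> h"] us vs by simp
qed

lemma word_norm_one: "word_norm G A \<one> = 0"
  using word_norm_le[of "[]" A \<one>] by simp

lemma word_norm_int_pow:
  assumes "A \<subseteq> carrier G" "g \<in> generate G A"
  shows "real (word_norm G A (g [^] (n::int))) \<le> real_of_int \<bar>n\<bar> * real (word_norm G A g)"
proof -
  have g: "g \<in> carrier G" using generate_incl[OF assms(1)] assms(2) by blast
  have cl: "g [^] (m::nat) \<in> generate G A" for m
    using assms(2) by (induction m) (auto intro: generate.one generate.eng)
  have nat: "word_norm G A (g [^] (m::nat)) \<le> m * word_norm G A g" for m
  proof (induction m)
    case (Suc m)
    then show ?case using word_norm_mult[OF assms(1) cl[of m] assms(2)] by simp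
  qed (simp add: word_norm_one)
  show ?thesis
  proof (cases n rule: int_cases2)
    case (nonneg m)
    have "real (word_norm G A (g [^] m)) \<le> real (m * word_norm G A g)" using nat[of m] by (simp only: of_nat_le_iff)
    then show ?thesis by (simp add: nonneg int_pow_int)
  next
    case (nonpos m)
    have "word_norm G A (inv (g [^] m)) \<le> word_norm G A (g [^] m)" by (rule word_norm_inv_le[OF assms(1) cl])
    then have "real (word_norm G A (inv (g [^] m))) \<le> real (m * word_norm G A g)" using nat[of m] by (simp only: of_nat_le_iff)
    then show ?thesis using g by (simp add: nonpos int_pow_neg_int)
  qed
qed

end

definition gens :: "bool \<Rightarrow> lm_gen word set set" where
  "gens s = (\<lambda>x. cls s [(x, True)]) ` {GT, GA, GB}"

lemma gens_iff: "cls s [(x, True)] \<in> gens s"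
  by (cases x) (auto simp: gens_def)

lemma gens_generate: "cls s u \<in> generate (hnn s) (gens s)"
proof (induction u)
  case Nil
  show ?case by (simp add: cls_Nil generate.one)
next
  case (Cons a u)
  obtain x b where a: "a = (x, b)" by (cases a)
  have "cls s [(x, b)] \<in> generate (hnn s) (gens s)"
    using generate.incl[OF gens_iff, of s x "hnn s"] generate.inv[OF gens_iff, of "hnn s" s x]
    by (cases b) (auto simp: cls_inv)
  then show ?case using Cons cls_append[of s "[a]" u] by (simp add: a generate.eng)
qed

lemma gens_carrier: "gens s \<subseteq> carrier (hnn s)"
  by (auto simp: gens_def)

lemma generate_gens: "generate (hnn s) (gens s) = carrier (hnn s)"
  using gens_generate hnn.generate_incl[OF gens_carrier] by (auto simp: carrier_hnn)

lemma finite_generating_set_gens: "finite_generating_set (hnn s) (gens s)"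
  unfolding finite_generating_set_def by (auto simp: generate_gens gens_carrier) (auto simp: gens_def)

lemma word_of_generators:
  assumes "set ws \<subseteq> gens s \<union> m_inv (hnn s) ` gens s"
  obtains u where "length u = length ws" "foldr (\<otimes>\<^bsub>hnn s\<^esub>) ws \<one>\<^bsub>hnn s\<^esub> = cls s u"
  using assms
proof (induction ws arbitrary: thesis)
  case Nil
  then show ?case using cls_Nil[of s] by simp
next
  case (Cons a ws)
  obtain u where u: "length u = length ws" "foldr (\<otimes>\<^bsub>hnn s\<^esub>) ws \<one>\<^bsub>hnn s\<^esub> = cls s u"
    using Cons.IH Cons.prems(2) by auto
  have "a \<in> gens s \<or> a \<in> m_inv (hnn s) ` gens s" using Cons.prems(2) by simp
  then obtain l where "a = cls s [l]" unfolding gens_def using cls_inv by fast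
  then show ?case using Cons.prems(1)[of "l # u"] u cls_append[of s "[l]" u] by simp
qed

definition va :: "bool \<Rightarrow> lm_gen word set \<Rightarrow> vertex \<Rightarrow> vertex" where "va s = pres_act (vgen s)"
definition pa :: "bool \<Rightarrow> lm_gen word set \<Rightarrow> complex \<Rightarrow> complex" where "pa s = pres_act (plane s)"

lemma va_cls: "reduced w \<Longrightarrow> va s (cls s u) w = word_act (vgen s) u w"
  unfolding va_def cls_def by (rule vt.pres_act_class) auto

lemma pa_cls: "pa s (cls s u) p = word_act (plane s) u p"
  unfolding pa_def cls_def by (rule pl.pres_act_class) auto

lemma va_nf: "g \<in> carrier (hnn s) \<Longrightarrow> va s g [] = fst (nf s g)"
  by (auto simp: carrier_hnn va_cls nf_def pres_act_cls fst_word_act)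

lemma pa_mult: "g \<in> carrier (hnn s) \<Longrightarrow> h \<in> carrier (hnn s) \<Longrightarrow> pa s (g \<otimes>\<^bsub>hnn s\<^esub> h) p = pa s g (pa s h p)"
  unfolding hnn_def pa_def by (rule pl.pres_act_mult) auto

lemma pa_one: "pa s \<one>\<^bsub>hnn s\<^esub> p = p"
  unfolding hnn_def pa_def by (rule pl.pres_act_one) auto

lemma pa_dist: "g \<in> carrier (hnn s) \<Longrightarrow> cmod (pa s g p - pa s g q) = cmod (p - q)"
  by (auto simp: carrier_hnn pa_cls norm_word_act_plane)

lemma pa_lat: "pa s (lat s z) p = p + cx z"
proof -
  have "\<forall>p. pa s (lat s z) p = p + cx z"
  proof (rule gint_additive_induct[of "\<lambda>z. \<forall>p. pa s (lat s z) p = p + cx z"])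
    fix x assume x: "\<forall>p. pa s (lat s x) p = p + cx x"
    show "\<forall>p. pa s (lat s (- x)) p = p + cx (- x)"
    proof
      fix p
      have "pa s (lat s x \<otimes>\<^bsub>hnn s\<^esub> lat s (- x)) p = p" by (simp add: lat_add[symmetric] pa_one)
      then have "pa s (lat s (- x)) p + cx x = p" using x by (simp add: pa_mult)
      moreover have "cx (- x) = - cx x" by (simp add: cx_def complex_eq_iff)
      ultimately show "pa s (lat s (- x)) p = p + cx (- x)" by (simp add: algebra_simps)
    qed
  next
    have e: "lat s 1 = cls s [(GA, True)]" "lat s (GI 0 1) = cls s [(GB, True)]"
      using lat_gen_values[of s True] by (simp_all add: gsgn_def one_gint_def)
    show "\<forall>p. pa s (lat s 1) p = p + cx 1" unfolding e by (simp add: pa_cls plane_values gsgn_def one_gint_def)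
    show "\<forall>p. pa s (lat s (GI 0 1)) p = p + cx (GI 0 1)" unfolding e by (simp add: pa_cls plane_values gsgn_def)
  qed (auto simp: lat_add pa_mult cx_simps)
  then show ?thesis by blast
qed

text \<open>Each letter turns the plane about 0 and then shifts it by a digit of size at most
  4.\<close>

lemma norm_pa_vel: "reduced w \<Longrightarrow> cmod (pa s (vel s w) 0) \<le> 4 * length w"
proof (induction w)
  case (Cons a w)
  obtain c e where a: "a = (c, e)" by (cases a)
  have c: "0 \<le> c" "c < 5" "reduced w" using Cons.prems by (simp_all add: a)
  let ?q = "pa s (cls s [(GT, e)]) (pa s (vel s w) 0)"
  have "pa s (vel s (a # w)) 0 = ?q + of_int c" by (simp add: a pa_mult pa_lat cx_simps)
  moreover have "cmod ?q = cmod (pa s (vel s w) 0)"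
    using norm_plane[of s GT e "pa s (vel s w) 0" 0] by (simp add: pa_cls plane_def split: if_splits)
  moreover have "cmod (of_int c) \<le> 4" using c by simp
  ultimately show ?case using norm_triangle_ineq[of ?q "of_int c"] Cons.IH[OF c(3)] by simp
qed (simp add: pa_one)

lemma word_norm_cls: "word_norm (hnn s) (gens s) (cls s [(x, b)]) \<le> 1"
proof -
  have "cls s [(x, b)] \<in> gens s \<union> m_inv (hnn s) ` gens s"
    using gens_iff[of s x] cls_inv[of s x True] by (cases b) (force intro: image_eqI)+
  then show ?thesis using hnn.word_norm_le[of "[cls s [(x, b)]]" "gens s" s "cls s [(x, b)]"] by simp
qed

lemma word_norm_lat: "word_norm (hnn s) (gens s) (lat s z) \<le> real_of_int (\<bar>gre z\<bar> + \<bar>gim z\<bar>)"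
proof -
  let ?n = "\<lambda>g. real (word_norm (hnn s) (gens s) g)"
  let ?a = "cls s [(GA, True)]" and ?b = "cls s [(GB, True)]"
  have "word_norm (hnn s) (gens s) (lat s z) \<le> word_norm (hnn s) (gens s) (?a [^]\<^bsub>hnn s\<^esub> gre z) + word_norm (hnn s) (gens s) (?b [^]\<^bsub>hnn s\<^esub> gim z)"
    unfolding lat_def by (rule hnn.word_norm_mult) (auto simp: generate_gens gens_carrier)
  then have 1: "?n (lat s z) \<le> ?n (?a [^]\<^bsub>hnn s\<^esub> gre z) + ?n (?b [^]\<^bsub>hnn s\<^esub> gim z)"
    by (simp only: of_nat_add[symmetric] of_nat_le_iff)
  have p: "?n (cls s [(x, True)] [^]\<^bsub>hnn s\<^esub> i) \<le> \<bar>i\<bar>" for x and i :: int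
  proof -
    have "?n (cls s [(x, True)] [^]\<^bsub>hnn s\<^esub> i) \<le> real_of_int \<bar>i\<bar> * ?n (cls s [(x, True)])"
      by (rule hnn.word_norm_int_pow) (auto simp: generate_gens gens_carrier)
    also have "\<dots> \<le> real_of_int \<bar>i\<bar> * 1" using word_norm_cls[of s x True] by (intro mult_left_mono) auto
    finally show ?thesis by simp
  qed
  show ?thesis using 1 p[of GA "gre z"] p[of GB "gim z"] by simp
qed

lemma word_norm_vel: "reduced w \<Longrightarrow> word_norm (hnn s) (gens s) (vel s w) \<le> 5 * length w"
proof (induction w)
  case Nil
  then show ?case by (simp add: hnn.word_norm_one)
next
  case (Cons a w)
  obtain c e where a: "a = (c, e)" by (cases a)
  have c: "0 \<le> c" "c < 5" "reduced w" using Cons.prems by (simp_all add: a)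
  let ?n = "word_norm (hnn s) (gens s)"
  have "?n (vel s (a # w)) \<le> ?n (lat s (of_int c)) + (?n (cls s [(GT, e)]) + ?n (vel s w))"
    using hnn.word_norm_mult[OF gens_carrier, of "lat s (of_int c)" s "cls s [(GT, e)] \<otimes>\<^bsub>hnn s\<^esub> vel s w"]
      hnn.word_norm_mult[OF gens_carrier, of "cls s [(GT, e)]" s "vel s w"]
    by (simp add: a generate_gens)
  moreover have "?n (lat s (of_int c)) \<le> 4" using word_norm_lat[of s "of_int c"] c by simp
  ultimately show ?case using Cons.IH[OF c(3)] word_norm_cls[of s GT e] by simp
qed

lemma round_gint: "\<exists>z. cmod (cx z - p) \<le> 1"
proof (rule exI[of _ "GI (round (Re p)) (round (Im p))"])
  let ?d = "cx (GI (round (Re p)) (round (Im p))) - p"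
  have "\<bar>Re ?d\<bar> \<le> 1 / 2" "\<bar>Im ?d\<bar> \<le> 1 / 2"
    using of_int_round_abs_le[of "Re p"] of_int_round_abs_le[of "Im p"] by (simp_all add: cx_def)
  then show "cmod ?d \<le> 1" using cmod_le[of ?d] by linarith
qed

text \<open>The elements over \<open>w\<close> include \<open>vel s w\<close> followed by any
  lattice element. The lattice meets every unit disc, and the isometry \<open>pa s (vel s w)\<close>
  moves the centre to \<open>p\<close>.\<close>

lemma hnn_dense:
  assumes "reduced w"
  shows "\<exists>g \<in> carrier (hnn s). va s g [] = w \<and> cmod (pa s g 0 - p) \<le> 1"
proof -
  let ?v = "vel s w"
  obtain z where z: "cmod (cx z - pa s (inv\<^bsub>hnn s\<^esub> ?v) p) \<le> 1" using round_gint by blast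
  have "pa s ?v (pa s (inv\<^bsub>hnn s\<^esub> ?v) p) = p" by (simp add: pa_mult[symmetric] pa_one)
  then have "cmod (pa s ?v (cx z) - p) \<le> 1"
    using pa_dist[of ?v s "cx z" "pa s (inv\<^bsub>hnn s\<^esub> ?v) p"] z by simp
  moreover have "pa s (nel s (w, z)) 0 = pa s ?v (cx z)" by (simp add: nel_def pa_mult pa_lat)
  moreover have "va s (nel s (w, z)) [] = w" using nf_nel[of "(w, z)" s] assms by (simp add: va_nf nf_space_def)
  ultimately show ?thesis by (intro bexI[of _ "nel s (w, z)"]) auto
qed

text \<open>One letter raises the sum by at most 1: a stable letter turns the plane about 0 and
  changes the length by 1, a lattice letter keeps the length and translates by a unit.\<close>

lemma word_act_length_le: "length (word_act (vgen s) u []) + cmod (word_act (plane s) u 0) \<le> length u"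
proof (induction u)
  case (Cons a u)
  obtain x b where a: "a = (x, b)" by (cases a)
  let ?w = "word_act (vgen s) u []" and ?p = "word_act (plane s) u 0"
  show ?case
  proof (cases "x = GT")
    case True
    have "length (tact b ?w) \<le> length ?w + 1" by (cases ?w rule: reduced.cases) (auto simp: tact_def)
    moreover have "cmod (plane s GT b ?p) = cmod ?p"
      by (simp add: plane_def norm_mult norm_divide norm_rotation)
    moreover have "vgen s GT b ?w = tact b ?w" by (simp add: vgen_def)
    ultimately show ?thesis using Cons by (simp add: a True)
  next
    case False
    have "gnorm (gen_value x) = 1" using False by (cases x) (simp_all add: gen_value_def gnorm_def)
    then have "cmod (cx (of_int (gsgn b) * gen_value x)) = 1" by (simp add: norm_cx gnorm_mult gsgn_def)
    then have "cmod (plane s x b ?p) \<le> cmod ?p + 1"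
      using False norm_triangle_ineq[of ?p "cx (of_int (gsgn b) * gen_value x)"] by (simp add: plane_def)
    moreover have "length (vgen s x b ?w) = length ?w" using False by (simp add: vgen_def)
    ultimately show ?thesis using Cons by (simp add: a)
  qed
qed simp

theorem tree_plane_group_hnn: "tree_plane_group (hnn s) (gens s) (va s) (pa s)"
proof
  show "finite_generating_set (hnn s) (gens s)" by (rule finite_generating_set_gens)
next
  fix w assume "reduced w"
  then show "va s \<one>\<^bsub>hnn s\<^esub> w = w" unfolding hnn_def va_def by (intro vt.pres_act_one) auto
next
  fix g h w assume "g \<in> carrier (hnn s)" "h \<in> carrier (hnn s)" "reduced w"
  then show "va s (g \<otimes>\<^bsub>hnn s\<^esub> h) w = va s g (va s h w)" unfolding hnn_def va_def by (intro vt.pres_act_mult) auto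
next
  fix g w w' assume "g \<in> carrier (hnn s)" "reduced w"
  then show "reduced (va s g w)" unfolding hnn_def va_def using vt.pres_act_closed[of g s w] by auto
  assume "reduced w'"
  then show "vdist (va s g w) (va s g w') = vdist w w'"
    using \<open>g \<in> carrier (hnn s)\<close> \<open>reduced w\<close> by (auto simp: carrier_hnn va_cls vdist_word_act)
next
  fix g assume g: "g \<in> carrier (hnn s)"
  obtain ws where ws: "set ws \<subseteq> gens s \<union> m_inv (hnn s) ` gens s" "foldr (\<otimes>\<^bsub>hnn s\<^esub>) ws \<one>\<^bsub>hnn s\<^esub> = g"
    "length ws = word_norm (hnn s) (gens s) g"
    using hnn.word_norm_ex[OF gens_carrier, of g s] g unfolding generate_gens by blast
  obtain u where "length u = length ws" "g = cls s u"
    using word_of_generators[OF ws(1)] ws(2) by metis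
  then show "length (va s g []) + cmod (pa s g 0) \<le> word_norm (hnn s) (gens s) g"
    using word_act_length_le[of s u] ws(3) by (simp add: va_cls pa_cls)
next
  fix g assume g: "g \<in> carrier (hnn s)"
  obtain w y where wy: "nf s g = (w, y)" by (cases "nf s g")
  have w: "reduced w" using nf_closed[OF g] by (simp add: wy nf_space_def)
  have gv: "g = vel s w \<otimes>\<^bsub>hnn s\<^esub> lat s y" using nel_nf[OF g] by (simp add: wy nel_def)
  have pg: "pa s g 0 = pa s (vel s w) (cx y)" by (simp add: gv pa_mult pa_lat)
  have "cmod (cx y) = cmod (pa s (vel s w) (cx y) - pa s (vel s w) 0)" using pa_dist[of "vel s w" s "cx y" 0] by simp
  also have "\<dots> \<le> cmod (pa s g 0) + 4 * length w"
    using norm_triangle_ineq4[of "pa s g 0" "pa s (vel s w) 0"] norm_pa_vel[OF w, of s] unfolding pg by linarith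
  finally have y: "cmod (cx y) \<le> cmod (pa s g 0) + 4 * length w" .
  have "\<bar>gre y\<bar> \<le> cmod (cx y)" "\<bar>gim y\<bar> \<le> cmod (cx y)"
    using abs_Re_le_cmod[of "cx y"] abs_Im_le_cmod[of "cx y"] by (simp_all add: cx_def)
  then have 1: "real (word_norm (hnn s) (gens s) (lat s y)) \<le> 2 * cmod (cx y)" using word_norm_lat[of s y] by simp
  have "word_norm (hnn s) (gens s) g \<le> word_norm (hnn s) (gens s) (vel s w) + word_norm (hnn s) (gens s) (lat s y)"
    unfolding gv by (rule hnn.word_norm_mult) (auto simp: generate_gens gens_carrier)
  then have 2: "real (word_norm (hnn s) (gens s) g) \<le> word_norm (hnn s) (gens s) (vel s w) + real (word_norm (hnn s) (gens s) (lat s y))"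
    by (simp only: of_nat_add[symmetric] of_nat_le_iff)
  have 3: "real (length (va s g [])) = real (length w)" using va_nf[OF g] by (simp add: wy)
  have 4: "real (word_norm (hnn s) (gens s) (vel s w)) \<le> 5 * real (length w)"
    using word_norm_vel[OF w, of s] by linarith
  have 5: "cmod (cx y) \<le> cmod (pa s g 0) + 4 * real (length w)" using y by simp
  \<comment> \<open>The vertex word costs \<open>5 l\<close> and the lattice part
    \<open>2 (p + 4 l)\<close>, together \<open>13 l + 2 p\<close>.\<close>
  have "x \<le> 13 * (l' + p)"
    if "z \<le> 2 * c" "x \<le> v + z" "l' = l" "v \<le> 5 * l" "c \<le> p + 4 * l" "0 \<le> p" for x z c v l l' p :: real
    using that by argo
  from this[OF 1 2 3 4 5 norm_ge_zero]
  show "word_norm (hnn s) (gens s) g \<le> 13 * (length (va s g []) + cmod (pa s g 0))" .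
qed (auto simp: pa_mult pa_one pa_dist hnn_dense)

lemma pa_translation:
  assumes "g \<in> carrier (hnn False)"
  shows "pa False g p = p + pa False g 0"
proof -
  have "modulus False True = modulus False False" by (simp add: modulus_def)
  then have r: "rotation False = 1" by (simp add: rotation_def cx_modulus_nonzero)
  have "word_act (plane False) u p = p + word_act (plane False) u 0" for u
    by (induction u) (auto simp: plane_def r)
  then show ?thesis using assms by (auto simp: carrier_hnn pa_cls)
qed

section \<open>A copy on the natural numbers\<close>

lemma word_norm_hom_le:
  assumes "group_hom G H h" "A \<subseteq> carrier G" "g \<in> generate G A"
  shows "word_norm H (h ` A) (h g) \<le> word_norm G A g"
proof -
  interpret group_hom G H h by fact
  obtain ws where ws: "set ws \<subseteq> A \<union> m_inv G ` A" "foldr (\<otimes>\<^bsub>G\<^esub>) ws \<one>\<^bsub>G\<^esub> = g" "length ws = word_norm G A g"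
    using G.word_norm_ex[OF assms(2,3)] .
  have sub: "A \<union> m_inv G ` A \<subseteq> carrier G" using assms(2) by auto
  have "foldr (\<otimes>\<^bsub>H\<^esub>) (map h vs) \<one>\<^bsub>H\<^esub> = h (foldr (\<otimes>\<^bsub>G\<^esub>) vs \<one>\<^bsub>G\<^esub>) \<and> foldr (\<otimes>\<^bsub>G\<^esub>) vs \<one>\<^bsub>G\<^esub> \<in> carrier G"
    if "set vs \<subseteq> carrier G" for vs
    using that by (induction vs) auto
  then have "foldr (\<otimes>\<^bsub>H\<^esub>) (map h ws) \<one>\<^bsub>H\<^esub> = h g" using ws sub by blast
  moreover have "set (map h ws) \<subseteq> h ` A \<union> m_inv H ` h ` A"
  proof
    fix x assume "x \<in> set (map h ws)"
    then obtain a where "x = h a" "a \<in> A \<union> m_inv G ` A" using ws(1) by auto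
    then show "x \<in> h ` A \<union> m_inv H ` h ` A" using assms(2) hom_inv by auto
  qed
  ultimately show ?thesis using H.word_norm_le[of "map h ws" "h ` A" "h g"] ws(3) by simp
qed

text \<open>Word norms do not change under transport: \<open>word_norm_hom_le\<close> applies to
  \<open>f\<close> and to its inverse \<open>d\<close>.\<close>

lemma (in tree_plane_group) tree_plane_group_image:
  assumes inj: "inj_on f (carrier G)"
  defines "d \<equiv> inv_into (carrier G) f"
  shows "tree_plane_group (image_group f G) (f ` A) (va \<circ> d) (pa \<circ> d)"
proof -
  let ?Q = "image_group f G"
  have d [simp]: "d (f g) = g" if "g \<in> carrier G" for g using inj that by (simp add: d_def)
  have grp: "group ?Q" using inj by (rule inj_imp_image_group_is_group)
  have car: "carrier ?Q = f ` carrier G" and one: "\<one>\<^bsub>?Q\<^esub> = f \<one>"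
    and mult: "\<And>g h. g \<in> carrier G \<Longrightarrow> h \<in> carrier G \<Longrightarrow> f g \<otimes>\<^bsub>?Q\<^esub> f h = f (g \<otimes> h)"
    using d by (auto simp: image_group_def d_def)
  have "f \<in> hom G ?Q" by (rule homI) (simp_all add: car mult)
  then interpret f: group_hom G ?Q f using grp is_group by (simp add: group_hom_def group_hom_axioms_def)
  have "d \<in> hom ?Q G"
  proof (rule homI)
    fix x y assume "x \<in> carrier ?Q" "y \<in> carrier ?Q"
    then obtain g h where gh: "g \<in> carrier G" "x = f g" "h \<in> carrier G" "y = f h" unfolding car by blast
    then show "d x \<in> carrier G" by simp
    show "d (x \<otimes>\<^bsub>?Q\<^esub> y) = d x \<otimes> d y"
      unfolding gh(2,4) mult[OF gh(1,3)] d[OF gh(1)] d[OF gh(3)] by (rule d) (use gh in simp)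
  qed
  then interpret dh: group_hom ?Q G d using grp is_group by (simp add: group_hom_def group_hom_axioms_def)
  have A: "finite A" "A \<subseteq> carrier G" "generate G A = carrier G"
    using generating by (auto simp: finite_generating_set_def)
  have gen: "finite_generating_set ?Q (f ` A)"
    using A f.generate_img[OF A(2)] by (auto simp: finite_generating_set_def car)
  have dA: "d ` f ` A = A" using A(2) d by (force simp: image_image)
  have norm: "word_norm ?Q (f ` A) (f g) = word_norm G A g" if "g \<in> carrier G" for g
  proof (rule antisym)
    show "word_norm ?Q (f ` A) (f g) \<le> word_norm G A g"
      using A that by (intro word_norm_hom_le[OF f.group_hom_axioms]) auto
    have "word_norm G (d ` f ` A) (d (f g)) \<le> word_norm ?Q (f ` A) (f g)"
      using A that gen by (intro word_norm_hom_le[OF dh.group_hom_axioms]) (auto simp: finite_generating_set_def car)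
    then show "word_norm G A g \<le> word_norm ?Q (f ` A) (f g)" using that by (simp add: dA)
  qed
  interpret Q: group ?Q by (rule grp)
  show ?thesis
  proof
    fix w p assume "reduced w"
    then obtain g where "g \<in> carrier G" "va g [] = w" "cmod (pa g 0 - p) \<le> 1" using dense by blast
    then show "\<exists>g\<in>carrier ?Q. (va \<circ> d) g [] = w \<and> cmod ((pa \<circ> d) g 0 - p) \<le> 1"
      by (intro bexI[of _ "f g"]) (auto simp: car)
  next
    show "finite_generating_set ?Q (f ` A)" by (rule gen)
    show "(va \<circ> d) \<one>\<^bsub>?Q\<^esub> w = w" if "reduced w" for w using va_one[OF that] by (simp only: one o_apply d one_closed)
    show "(pa \<circ> d) \<one>\<^bsub>?Q\<^esub> p = p" for p using pa_one by (simp only: one o_apply d one_closed)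
  next
    fix x y w p assume "x \<in> carrier ?Q" "y \<in> carrier ?Q"
    then obtain g h where g: "g \<in> carrier G" "x = f g" and h: "h \<in> carrier G" "y = f h" unfolding car by blast
    have xy: "d (x \<otimes>\<^bsub>?Q\<^esub> y) = g \<otimes> h" "d x = g" "d y = h"
      using g(1) h(1) by (simp_all only: g(2) h(2) mult d m_closed)
    show "(va \<circ> d) (x \<otimes>\<^bsub>?Q\<^esub> y) w = (va \<circ> d) x ((va \<circ> d) y w)" if "reduced w"
      using va_mult[OF g(1) h(1) that] by (simp only: o_apply xy)
    show "(pa \<circ> d) (x \<otimes>\<^bsub>?Q\<^esub> y) p = (pa \<circ> d) x ((pa \<circ> d) y p)"
      using pa_mult[OF g(1) h(1)] by (simp only: o_apply xy)
  next
    fix x w w' p q assume "x \<in> carrier ?Q"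
    then obtain g where g: "g \<in> carrier G" "x = f g" unfolding car by blast
    have x: "d x = g" using g(1) by (simp only: g(2) d)
    show "reduced ((va \<circ> d) x w)" if "reduced w" using va_closed[OF g(1) that] by (simp only: o_apply x)
    show "vdist ((va \<circ> d) x w) ((va \<circ> d) x w') = vdist w w'" if "reduced w" "reduced w'"
      using va_dist[OF g(1) that] by (simp only: o_apply x)
    show "cmod ((pa \<circ> d) x p - (pa \<circ> d) x q) = cmod (p - q)"
      using pa_dist[OF g(1)] by (simp only: o_apply x)
    show "length ((va \<circ> d) x []) + cmod ((pa \<circ> d) x 0) \<le> word_norm ?Q (f ` A) x"
      using word_norm_ge[OF g(1)] norm[OF g(1)] by (simp only: o_apply x g(2)[symmetric])
    show "word_norm ?Q (f ` A) x \<le> 13 * (length ((va \<circ> d) x []) + cmod ((pa \<circ> d) x 0))"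
      using word_norm_le'[OF g(1)] norm[OF g(1)] by (simp only: o_apply x g(2)[symmetric])
  qed
qed

section \<open>Spaces with the tree inequality\<close>

text \<open>By the inequality for \<open>p\<close>, \<open>z\<close>, \<open>x\<close>,
  \<open>y\<close>, a point \<open>p\<close> of the side from \<open>x\<close> to \<open>y\<close>
  is metrically between the ends of one of the other sides. By the same inequality such a point is
  at distance 0 from that side.\<close>

lemma hyperbolic_zeroI:
  assumes four: "\<And>x y z w. x \<in> mspace C \<Longrightarrow> y \<in> mspace C \<Longrightarrow> z \<in> mspace C \<Longrightarrow> w \<in> mspace C \<Longrightarrow>
    mdist C x y + mdist C z w \<le> max (mdist C x z + mdist C y w) (mdist C x w + mdist C y z)"
  shows "hyperbolic 0 C"
proof -
  have on_side: "p \<in> cnbhd C 0 S"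
    if S: "geodesic_segment C S a b" and p: "p \<in> mspace C" and le: "mdist C p a + mdist C p b \<le> mdist C a b" for S a b p
  proof -
    have ab: "a \<in> mspace C" "b \<in> mspace C" using geodesic_segment_ends[OF S] by auto
    obtain \<gamma> where g: "\<gamma> \<in> {0..mdist C a b} \<rightarrow> mspace C" "\<gamma> 0 = a" "\<gamma> (mdist C a b) = b"
      "S = \<gamma> ` {0..mdist C a b}"
      "\<And>s t. s \<in> {0..mdist C a b} \<Longrightarrow> t \<in> {0..mdist C a b} \<Longrightarrow> mdist C (\<gamma> s) (\<gamma> t) = \<bar>s - t\<bar>"
      by (rule geodesic_segmentE[OF S]) blast
    have nn: "0 \<le> mdist C p a" "0 \<le> mdist C p b" by simp_all
    then have "mdist C p a \<le> mdist C a b" using le by linarith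
    then have I: "mdist C p a \<in> {0..mdist C a b}" "0 \<in> {0..mdist C a b}" "mdist C a b \<in> {0..mdist C a b}"
      by simp_all
    let ?q = "\<gamma> (mdist C p a)"
    have q: "?q \<in> mspace C" "?q \<in> S" using g(1,4) I(1) by blast+
    have qa: "mdist C ?q a = mdist C p a" using g(5)[OF I(1,2)] nn unfolding g(2) by simp
    have qb: "mdist C ?q b = mdist C a b - mdist C p a" using g(5)[OF I(1,3)] I(1) unfolding g(3) by simp
    have "mdist C p ?q + mdist C a b \<le> max (mdist C p a + mdist C ?q b) (mdist C p b + mdist C ?q a)"
      using p q(1) ab by (rule four)
    also have "\<dots> \<le> mdist C a b" using le unfolding qa qb by simp
    finally have "mdist C p ?q \<le> 0" by simp
    then show ?thesis using p q(2) unfolding cnbhd_def by blast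
  qed
  show ?thesis
    unfolding hyperbolic_def
  proof (intro allI impI subsetI, elim conjE)
    fix x y z S1 S2 S3 p
    assume S: "geodesic_segment C S1 x y" "geodesic_segment C S2 y z" "geodesic_segment C S3 z x" and p: "p \<in> S1"
    have c: "x \<in> mspace C" "y \<in> mspace C" "z \<in> mspace C" "p \<in> mspace C"
      using geodesic_segment_ends[OF S(1)] geodesic_segment_ends[OF S(2)] geodesic_segment_between[OF S(1) p] by auto
    have b: "mdist C x p + mdist C p y = mdist C x y" by (rule geodesic_segment_between[OF S(1) p])
    have "mdist C p z + mdist C x y \<le> max (mdist C p x + mdist C z y) (mdist C p y + mdist C z x)"
      using c by (intro four)
    then have "mdist C p y + mdist C p z \<le> mdist C y z \<or> mdist C p z + mdist C p x \<le> mdist C z x"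
      using b mdist_commute[of C p x] mdist_commute[of C z y] by (auto simp: le_max_iff_disj)
    then show "p \<in> cnbhd C 0 (S2 \<union> S3)"
      using on_side[OF S(2) c(4)] on_side[OF S(3) c(4)] unfolding cnbhd_def by blast
  qed
qed

section \<open>The metric tree, coded by real numbers\<close>

text \<open>
  The point at height \<open>h\<close> above the root on the edge below the vertex \<open>w\<close> is coded as the code of \<open>w\<close>
  plus the distance from \<open>w\<close>.
\<close>

definition mk :: "vertex \<Rightarrow> real \<Rightarrow> real" where "mk w h = real (to_nat w) + (real (length w) - h)"

text \<open>\<open>length w < h + 1\<close> makes edges half-open: the end nearer to the root is
  coded by its own vertex. Thus codes are unique and the floor recovers the vertex.\<close>

definition tree_pts :: "real set" where
  "tree_pts = {mk w h | w (h::real). reduced w \<and> 0 \<le> h \<and> h \<le> length w \<and> length w < h + 1}"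

definition wt :: "real \<Rightarrow> vertex" where "wt x = from_nat (nat \<lfloor>x\<rfloor>)"
definition ht :: "real \<Rightarrow> real" where "ht x = real (length (wt x)) - frac x"

lemma wt_ht_mk:
  fixes h :: real
  assumes "h \<le> length w" "length w < h + 1"
  shows "wt (mk w h) = w" "ht (mk w h) = h"
proof -
  have "\<lfloor>mk w h\<rfloor> = int (to_nat w)" unfolding mk_def using assms by (intro floor_unique) auto
  then show 1: "wt (mk w h) = w" by (simp add: wt_def)
  have "frac (mk w h) = real (length w) - h"
    using \<open>\<lfloor>mk w h\<rfloor> = int (to_nat w)\<close> by (simp add: frac_def mk_def)
  then show "ht (mk w h) = h" by (simp add: ht_def 1)
qed

lemma tree_ptsE:
  assumes "x \<in> tree_pts"
  shows "reduced (wt x)" "0 \<le> ht x" "ht x \<le> length (wt x)" "length (wt x) < ht x + 1" "mk (wt x) (ht x) = x"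
  using assms wt_ht_mk by (auto simp: tree_pts_def)

lemma mk_tree_pts:
  fixes h :: real
  shows "reduced w \<Longrightarrow> 0 \<le> h \<Longrightarrow> h \<le> length w \<Longrightarrow> length w < h + 1 \<Longrightarrow> mk w h \<in> tree_pts"
  by (auto simp: tree_pts_def)

text \<open>The height at which the paths from the root to \<open>x\<close> and \<open>y\<close>
  separate, which is their Gromov product based at the root. Its exact ultrametric inequality is the
  source of the four-point inequality with constant 0.\<close>

definition meet :: "real \<Rightarrow> real \<Rightarrow> real" where
  "meet x y = min (min (ht x) (ht y)) (real (lcp (wt x) (wt y)))"

definition td :: "real \<Rightarrow> real \<Rightarrow> real" where "td x y = ht x + ht y - 2 * meet x y"

lemma meet_commute: "meet x y = meet y x"
  by (simp add: meet_def lcp_commute min.commute)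

lemma meet_ultrametric: "min (meet x y) (meet y z) \<le> meet x z"
proof -
  have "min (real (lcp (wt x) (wt y))) (real (lcp (wt y) (wt z))) \<le> real (lcp (wt x) (wt z))"
    using lcp_ultrametric[of "wt x" "wt y" "wt z"] by (simp add: min_le_iff_disj)
  then show ?thesis unfolding meet_def by (simp add: min_le_iff_disj) linarith
qed

lemma td_commute: "td x y = td y x"
  by (simp add: td_def meet_commute)

lemma td_same: "x \<in> tree_pts \<Longrightarrow> td x x = 0"
  using tree_ptsE[of x] by (simp add: td_def meet_def)

lemma td_nonneg: "0 \<le> td x y"
  by (simp add: td_def meet_def min_def)

lemma td_zero:
  assumes "x \<in> tree_pts" "y \<in> tree_pts" "td x y = 0"
  shows "x = y"
proof -
  note X = tree_ptsE[OF assms(1)] and Y = tree_ptsE[OF assms(2)]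
  have m: "meet x y \<le> ht x" "meet x y \<le> ht y" "meet x y \<le> lcp (wt x) (wt y)" by (simp_all add: meet_def)
  then have h: "ht x = ht y" "ht x \<le> lcp (wt x) (wt y)" using assms(3) unfolding td_def by linarith+
  have l: "length (wt x) = length (wt y)" using X(3,4) Y(3,4) h(1) by linarith
  have "lcp (wt x) (wt y) = length (wt x)" using lcp_le(1)[of "wt x" "wt y"] h(2) X(4) by linarith
  then have "wt x = wt y" using l by (intro lcp_eq_length) simp_all
  then show ?thesis using X(5) Y(5) h(1) by metis
qed

lemma td_triangle: "td x z \<le> td x y + td y z"
proof -
  have "meet x y + meet y z \<le> ht y + meet x z"
    using meet_ultrametric[of x y z] by (auto simp: meet_def min_le_iff_disj)
  then show ?thesis by (simp add: td_def)
qed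

lemma td_four_point: "td x y + td z w \<le> max (td x z + td y w) (td x w + td y z)"
proof -
  have u: "meet x z \<le> meet x y \<or> meet z y \<le> meet x y" "meet x w \<le> meet x y \<or> meet w y \<le> meet x y"
    "meet z x \<le> meet z w \<or> meet x w \<le> meet z w" "meet z y \<le> meet z w \<or> meet y w \<le> meet z w"
    using meet_ultrametric[of x z y] meet_ultrametric[of x w y] meet_ultrametric[of z x w] meet_ultrametric[of z y w]
    by (auto simp: min_le_iff_disj)
  have "meet x z + meet y w \<le> meet x y + meet z w \<or> meet x w + meet y z \<le> meet x y + meet z w"
    using u unfolding meet_commute[of z x] meet_commute[of z y] meet_commute[of w y] by argo
  then show ?thesis unfolding td_def le_max_iff_disj by argo
qed

interpretation tree: Metric_space tree_pts td
proof
  fix x y assume "x \<in> tree_pts" "y \<in> tree_pts"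
  then show "td x y = 0 \<longleftrightarrow> x = y" using td_zero td_same by metis
qed (auto simp: td_nonneg td_commute td_triangle)

definition tree_metric :: "real metric" where "tree_metric = metric (tree_pts, td)"

lemma tree_metric_simps [simp]: "mspace tree_metric = tree_pts" "mdist tree_metric = td"
  unfolding tree_metric_def by (rule tree.mspace_metric tree.mdist_metric)+

lemma hyperbolic_tree_metric: "hyperbolic 0 tree_metric"
  by (rule hyperbolic_zeroI) (use td_four_point in auto)

lemma reduced_take: "reduced w \<Longrightarrow> reduced (take n w)"
proof (induction w arbitrary: n rule: reduced.induct)
  case (2 c e w)
  show ?case
  proof (cases n)
    case (Suc m)
    have w: "0 \<le> c" "c < 5" "reduced w" "\<nexists>v. w = (0, \<not> e) # v" using "2.prems" by auto
    have "\<nexists>v. take m w = (0, \<not> e) # v" using w(4) by (cases w; cases m) auto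
    moreover have "reduced (take m w)" by (rule "2.IH"[OF w(3)])
    ultimately show ?thesis using w(1,2) Suc by (auto split: list.split)
  qed simp
qed simp

text \<open>The point at height \<open>h\<close> on the path from the root to \<open>w\<close>. Its
  edge is named by the end farther from the root, the prefix of length
  \<open>\<lceil>h\<rceil>\<close>.\<close>

definition anc :: "vertex \<Rightarrow> real \<Rightarrow> real" where "anc w h = mk (take (nat \<lceil>h\<rceil>) w) h"

lemma anc_facts:
  fixes h :: real
  assumes "reduced w" "0 \<le> h" "h \<le> length w"
  shows "anc w h \<in> tree_pts" "wt (anc w h) = take (nat \<lceil>h\<rceil>) w" "ht (anc w h) = h"
proof -
  have l: "real (length (take (nat \<lceil>h\<rceil>) w)) = of_int \<lceil>h\<rceil>"
  proof -
    have c: "0 \<le> \<lceil>h\<rceil>" "\<lceil>h\<rceil> \<le> int (length w)" using assms(2,3) by (simp_all add: ceiling_le_iff)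
    then have "length (take (nat \<lceil>h\<rceil>) w) = nat \<lceil>h\<rceil>" by simp
    then show ?thesis using c(1) by simp
  qed
  have b: "h \<le> length (take (nat \<lceil>h\<rceil>) w)" "length (take (nat \<lceil>h\<rceil>) w) < h + 1" unfolding l by linarith+
  show "anc w h \<in> tree_pts" unfolding anc_def using assms b by (intro mk_tree_pts reduced_take) auto
  show "wt (anc w h) = take (nat \<lceil>h\<rceil>) w" "ht (anc w h) = h"
    unfolding anc_def using wt_ht_mk[OF b] by auto
qed

lemma td_anc:
  fixes h h' :: real
  assumes "reduced w" "0 \<le> h" "h \<le> length w" "reduced w'" "0 \<le> h'" "h' \<le> length w'"
  shows "td (anc w h) (anc w' h') = h + h' - 2 * min (min h h') (lcp w w')"
proof -
  have "min (min h h') (min (min a b) c) = min (min h h') c" if "h \<le> a" "h' \<le> b" for a b c :: real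
    using that by (auto simp: min_def)
  from this[OF real_nat_ceiling_ge real_nat_ceiling_ge]
  have "min (min h h') (real (lcp (take (nat \<lceil>h\<rceil>) w) (take (nat \<lceil>h'\<rceil>) w'))) = min (min h h') (lcp w w')"
    by (simp only: lcp_take of_nat_min)
  then show ?thesis using anc_facts[OF assms(1-3)] anc_facts[OF assms(4-6)] by (simp add: td_def meet_def)
qed

lemma anc_self:
  assumes "x \<in> tree_pts"
  shows "anc (wt x) (ht x) = x"
proof -
  note X = tree_ptsE[OF assms]
  have "\<lceil>ht x\<rceil> = int (length (wt x))" using X(3,4) by (intro ceiling_unique) auto
  then show ?thesis using X(5) by (simp add: anc_def)
qed

lemma geodesic_tree_metric: "geodesic_space tree_metric"
  unfolding geodesic_space_def
proof (intro ballI)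
  fix x y assume "x \<in> mspace tree_metric" "y \<in> mspace tree_metric"
  then have xy: "x \<in> tree_pts" "y \<in> tree_pts" by simp_all
  note X = tree_ptsE[OF xy(1)] and Y = tree_ptsE[OF xy(2)]
  define m where "m = meet x y"
  define l where "l = td x y"
  have l: "l = (ht x - m) + (ht y - m)" by (simp add: l_def td_def m_def)
  have m: "0 \<le> m" "m \<le> ht x" "m \<le> ht y" "m \<le> lcp (wt x) (wt y)"
    using X(2) Y(2) by (simp_all add: m_def meet_def)
  have m5: "m = ht x \<or> m = ht y \<or> m = lcp (wt x) (wt y)" by (auto simp: m_def meet_def min_def)
  \<comment> \<open>Down from \<open>x\<close> to the branch point at height \<open>m\<close>, then
    up to \<open>y\<close>.\<close>
  define \<gamma> where "\<gamma> s = (if s \<le> ht x - m then anc (wt x) (ht x - s) else anc (wt y) (m + (s - (ht x - m))))" for s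
  have lower: "td (\<gamma> s) (\<gamma> t) = t - s" if "0 \<le> s" "s \<le> t" "t \<le> l" for s t
  proof -
    consider "t \<le> ht x - m" | "s \<le> ht x - m" "\<not> t \<le> ht x - m" | "\<not> s \<le> ht x - m" by linarith
    then show ?thesis
    proof cases
      case 1
      have b: "0 \<le> ht x - s" "ht x - s \<le> length (wt x)" "0 \<le> ht x - t" "ht x - t \<le> length (wt x)"
        using that X(3) m(1) 1 by linarith+
      have "\<gamma> s = anc (wt x) (ht x - s)" "\<gamma> t = anc (wt x) (ht x - t)" using 1 that by (simp_all add: \<gamma>_def)
      then show ?thesis using td_anc[OF X(1) b(1,2) X(1) b(3,4)] b that by (simp add: min_def)
    next
      case 2
      let ?h = "ht x - s" and ?k = "m + (t - (ht x - m))"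
      have b: "0 \<le> ?h" "?h \<le> length (wt x)" "0 \<le> ?k" "?k \<le> length (wt y)"
        using that X(3) Y(3) m(1) 2 l by linarith+
      have "\<gamma> s = anc (wt x) ?h" "\<gamma> t = anc (wt y) ?k" using 2 by (simp_all add: \<gamma>_def)
      then have "td (\<gamma> s) (\<gamma> t) = ?h + ?k - 2 * min (min ?h ?k) (lcp (wt x) (wt y))"
        using td_anc[OF X(1) b(1,2) Y(1) b(3,4)] by simp
      moreover have "m \<le> ?h" "m \<le> ?k" "?h \<le> ht x" "?k \<le> ht y" using that 2 l by linarith+
      then have "min (min ?h ?k) (lcp (wt x) (wt y)) = m" using m(4) m5 unfolding min_def by argo
      ultimately show ?thesis by simp
    next
      case 3
      let ?h = "m + (s - (ht x - m))" and ?k = "m + (t - (ht x - m))"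
      have b: "0 \<le> ?h" "?h \<le> length (wt y)" "0 \<le> ?k" "?k \<le> length (wt y)"
        using that Y(3) m(1) 3 l by linarith+
      have "\<gamma> s = anc (wt y) ?h" "\<gamma> t = anc (wt y) ?k" using 3 that by (simp_all add: \<gamma>_def)
      then show ?thesis using td_anc[OF Y(1) b(1,2) Y(1) b(3,4)] b that by (simp add: min_def)
    qed
  qed
  have "geodesic_segment tree_metric (\<gamma> ` {0..l}) x y"
    unfolding geodesic_segment_def
  proof (intro exI[of _ \<gamma>] exI[of _ l] conjI ballI)
    show "0 \<le> l" unfolding l_def by (rule td_nonneg)
    show "\<gamma> \<in> {0..l} \<rightarrow> mspace tree_metric"
    proof
      fix s assume s: "s \<in> {0..l}"
      show "\<gamma> s \<in> mspace tree_metric"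
      proof (cases "s \<le> ht x - m")
        case True
        then have "0 \<le> ht x - s" "ht x - s \<le> length (wt x)" using s X(3) m(1) by simp_all
        then show ?thesis using anc_facts(1)[OF X(1)] True by (simp add: \<gamma>_def)
      next
        case False
        then have "0 \<le> m + (s - (ht x - m))" "m + (s - (ht x - m)) \<le> length (wt y)" using s Y(3) m(1) l by simp_all
        then show ?thesis using anc_facts(1)[OF Y(1)] False by (simp add: \<gamma>_def)
      qed
    qed
    show "mdist tree_metric (\<gamma> s) (\<gamma> t) = \<bar>s - t\<bar>" if "s \<in> {0..l}" "t \<in> {0..l}" for s t
      using lower[of s t] lower[of t s] that td_commute[of "\<gamma> s" "\<gamma> t"] by (cases "s \<le> t") auto
    show "\<gamma> 0 = x" using m anc_self[OF xy(1)] by (simp add: \<gamma>_def)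
    \<comment> \<open>If \<open>y\<close> is itself the branch point, \<open>\<gamma>\<close> ends
      in its first branch, as a point on the path to \<open>x\<close>; the two descriptions of this
      point are then identified by \<open>td_zero\<close>.\<close>
    have "\<gamma> l = anc (wt y) (ht y)"
    proof (cases "l \<le> ht x - m")
      case True
      then have e: "ht y = m" using l m(3) by simp
      have le: "m \<le> length (wt x)" "m \<le> length (wt y)" using X(3) Y(3) m by linarith+
      have "td (anc (wt x) m) (anc (wt y) m) = m + m - 2 * min (min m m) (lcp (wt x) (wt y))"
        using X(1) Y(1) m(1) le by (intro td_anc) auto
      then have "td (anc (wt x) m) (anc (wt y) m) = 0" using m(4) by simp
      then have "anc (wt x) m = anc (wt y) m"
        by (rule td_zero[OF anc_facts(1)[OF X(1) m(1) le(1)] anc_facts(1)[OF Y(1) m(1) le(2)]])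
      then show ?thesis using True e l by (simp add: \<gamma>_def)
    next
      case False
      then show ?thesis using l by (simp add: \<gamma>_def)
    qed
    then show "\<gamma> l = y" using anc_self[OF xy(2)] by simp
  qed simp
  then show "\<exists>S. geodesic_segment tree_metric S x y" by blast
qed

section \<open>Extending vertex isometries to the metric tree\<close>

definition vtx :: "vertex \<Rightarrow> real" where "vtx w = mk w (length w)"

lemma vtx_facts [simp]:
  "wt (vtx w) = w" "ht (vtx w) = length w" "reduced w \<Longrightarrow> vtx w \<in> tree_pts"
  using wt_ht_mk[of "length w" w] mk_tree_pts[of w "length w"] by (simp_all add: vtx_def)

lemma td_vtx [simp]: "td (vtx v) (vtx w) = vdist v w"
  using lcp_le[of v w] by (simp add: td_def meet_def vdist_def min_def)

lemma tree_pt_on_edge: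
  assumes "x \<in> tree_pts"
  obtains "x = vtx []"
  | v w where "reduced v" "reduced w" "vdist v w = 1" "td x (vtx v) + td x (vtx w) = 1" "td x (vtx v) < 1"
proof -
  note X = tree_ptsE[OF assms]
  show ?thesis
  proof (cases "wt x = []")
    case True
    then have "ht x = 0" using X(2,3) by simp
    then show ?thesis using that(1) X(5) True by (simp add: vtx_def)
  next
    case False
    let ?v = "wt x" and ?w = "butlast (wt x)"
    have bt: "?w = take (length ?v - 1) ?v" by (rule butlast_conv_take)
    have rw: "reduced ?w" unfolding bt by (rule reduced_take[OF X(1)])
    have lw: "real (length ?w) = real (length ?v) - 1" using False by (simp add: of_nat_diff Suc_leI)
    have lc: "lcp ?v ?w = length ?w" using lcp_take[of "length ?v" ?v "length ?v - 1" ?v] bt by simp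
    have 1: "vdist ?v ?w = 1" unfolding vdist_def lc using lw by linarith
    have 2: "td x (vtx ?v) = real (length ?v) - ht x" using X(3) by (simp add: td_def meet_def)
    have "meet x (vtx ?w) = length ?w" unfolding meet_def vtx_facts lc using X(3,4) lw by linarith
    then have 3: "td x (vtx ?w) = ht x - real (length ?w)" by (simp add: td_def)
    have "td x (vtx ?v) + td x (vtx ?w) = 1" "td x (vtx ?v) < 1" using 2 3 lw X(4) by linarith+
    then show ?thesis by (rule that(2)[OF X(1) rw 1])
  qed
qed

text \<open>Prolong the geodesic from \<open>x\<close> to \<open>y\<close> as far as an end of the
  edge containing \<open>y\<close>. Consequently a point is determined by its distances to the
  vertices, and these distances also detect \<open>td x y\<close>.\<close>

lemma td_dominated_by_vertex:
  assumes "x \<in> tree_pts" "y \<in> tree_pts"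
  shows "\<exists>w. reduced w \<and> td x y \<le> td x (vtx w) - td y (vtx w)"
  using assms(2)
proof (cases rule: tree_pt_on_edge)
  case 1
  then show ?thesis by (intro exI[of _ "[]"]) simp
next
  case (2 v w)
  have "td x y + td (vtx v) (vtx w) \<le> max (td x (vtx v) + td y (vtx w)) (td x (vtx w) + td y (vtx v))"
    by (rule td_four_point)
  then have "td x y \<le> td x (vtx v) - td y (vtx v) \<or> td x y \<le> td x (vtx w) - td y (vtx w)"
    unfolding td_vtx 2(3) le_max_iff_disj using 2(4) by linarith
  then show ?thesis using 2(1,2) by blast
qed

text \<open>The tree is bipartite: adjacent vertices have distances to \<open>w\<close> of different
  parity, and these differ by at most 1.\<close>

lemma vdist_parity: "vdist u w = vdist v w + 1 \<or> vdist v w = vdist u w + 1" if "vdist u v = 1"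
proof -
  define a where "a = int (length u) + int (length w) - 2 * int (lcp u w)"
  define b where "b = int (length v) + int (length w) - 2 * int (lcp v w)"
  have ab: "vdist u w = of_int a" "vdist v w = of_int b" by (simp_all add: vdist_def a_def b_def)
  have "real_of_int (int (length u) + int (length v) - 2 * int (lcp u v)) = 1" using that by (simp add: vdist_def)
  then have c: "int (length u) + int (length v) - 2 * int (lcp u v) = 1" by linarith
  have "a - b = 1 + 2 * (int (lcp u v) - int (length v) - int (lcp u w) + int (lcp v w))"
    using c by (simp add: a_def b_def)
  then have odd: "odd (a - b)" by presburger
  have "vdist u w \<le> vdist u v + vdist v w" "vdist v w \<le> vdist u v + vdist u w"
    using td_triangle[of "vtx u" "vtx w" "vtx v"] td_triangle[of "vtx v" "vtx w" "vtx u"] vdist_commute[of u v] by simp_all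
  then have "a \<le> b + 1" "b \<le> a + 1" using that unfolding ab by linarith+
  then have "a = b + 1 \<or> b = a + 1" using odd by presburger
  then show ?thesis unfolding ab by auto
qed

text \<open>A path from a point of an edge to a vertex leaves through one of the two ends; parity
  decides the comparison.\<close>

lemma td_on_edge:
  assumes "vdist u v = 1" "td x (vtx u) + td x (vtx v) = 1"
  shows "td x (vtx w) = min (vdist u w + td x (vtx u)) (vdist v w + td x (vtx v))"
proof -
  have "td x (vtx w) \<le> td x (vtx u) + vdist u w" "td x (vtx w) \<le> td x (vtx v) + vdist v w"
    "vdist u w \<le> td x (vtx u) + td x (vtx w)" "vdist v w \<le> td x (vtx v) + td x (vtx w)"
    using td_triangle[of x "vtx w" "vtx u"] td_triangle[of x "vtx w" "vtx v"]
      td_triangle[of "vtx u" "vtx w" x] td_triangle[of "vtx v" "vtx w" x] td_commute[of x] by simp_all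
  then show ?thesis using vdist_parity[OF assms(1), of w] assms(2) by (auto simp: min_def)
qed

context tree_plane_group
begin

text \<open>The image sits at the same parameter on the image of the edge, and
  \<open>td_on_edge\<close> then gives its distance to every vertex.\<close>

lemma ex_image_point:
  assumes g: "g \<in> carrier G" and x: "x \<in> tree_pts"
  shows "\<exists>y\<in>tree_pts. \<forall>w. reduced w \<longrightarrow> td y (vtx (va g w)) = td x (vtx w)"
  using x
proof (cases rule: tree_pt_on_edge)
  case 1
  then show ?thesis
    using va_dist[OF g, of "[]"] va_closed[OF g, of "[]"] by (intro bexI[of _ "vtx (va g [])"]) auto
next
  case (2 u v)
  let ?u = "va g u" and ?v = "va g v"
  have uv: "vdist ?u ?v = 1" using va_dist[OF g 2(1,2)] 2(3) by simp
  obtain S where S: "geodesic_segment tree_metric S (vtx ?u) (vtx ?v)"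
    using geodesic_tree_metric va_closed[OF g 2(1)] va_closed[OF g 2(2)] unfolding geodesic_space_def by force
  obtain \<gamma> where \<gamma>: "\<gamma> \<in> {0..1} \<rightarrow> tree_pts" "\<gamma> 0 = vtx ?u" "\<gamma> 1 = vtx ?v"
    "\<And>s t. s \<in> {0..1} \<Longrightarrow> t \<in> {0..1} \<Longrightarrow> td (\<gamma> s) (\<gamma> t) = \<bar>s - t\<bar>"
    by (rule geodesic_segmentE[OF S]) (simp add: uv)
  define s where "s = td x (vtx u)"
  have s: "s \<in> {0..1}" "0 \<in> {0..1::real}" "1 \<in> {0..1::real}" using 2(5) td_nonneg by (simp_all add: s_def)
  have d: "td (\<gamma> s) (vtx ?u) = td x (vtx u)" "td (\<gamma> s) (vtx ?v) = td x (vtx v)"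
    using \<gamma>(4)[OF s(1,2)] \<gamma>(4)[OF s(1,3)] s(1) 2(4) unfolding \<gamma>(2,3) by (simp_all add: s_def)
  have "td (\<gamma> s) (vtx (va g w)) = td x (vtx w)" if w: "reduced w" for w
  proof -
    have "td (\<gamma> s) (vtx (va g w)) = min (vdist ?u (va g w) + td x (vtx u)) (vdist ?v (va g w) + td x (vtx v))"
      using td_on_edge[OF uv, of "\<gamma> s" "va g w"] 2(4) unfolding d by simp
    also have "\<dots> = td x (vtx w)"
      using td_on_edge[OF 2(3,4), of w] va_dist[OF g 2(1) w] va_dist[OF g 2(2) w] by simp
    finally show ?thesis .
  qed
  moreover have "\<gamma> s \<in> tree_pts" using \<gamma>(1) s(1) by blast
  ultimately show ?thesis by blast
qed

text \<open>The image is described through distances to vertices and not through heights, since the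
  group moves the root and may exchange which end of an edge is nearer to it.\<close>

definition tree_act :: "'a \<Rightarrow> real \<Rightarrow> real" where
  "tree_act g x = (SOME y. y \<in> tree_pts \<and> (\<forall>w. reduced w \<longrightarrow> td y (vtx (va g w)) = td x (vtx w)))"

lemma tree_act:
  assumes "g \<in> carrier G" "x \<in> tree_pts"
  shows "tree_act g x \<in> tree_pts" "\<And>w. reduced w \<Longrightarrow> td (tree_act g x) (vtx (va g w)) = td x (vtx w)"
proof -
  have "\<exists>y. y \<in> tree_pts \<and> (\<forall>w. reduced w \<longrightarrow> td y (vtx (va g w)) = td x (vtx w))"
    using ex_image_point[OF assms] by blast
  from someI_ex[OF this, folded tree_act_def]
  show "tree_act g x \<in> tree_pts" "\<And>w. reduced w \<Longrightarrow> td (tree_act g x) (vtx (va g w)) = td x (vtx w)" by blast+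
qed

lemma va_inv:
  assumes "g \<in> carrier G" "reduced w"
  shows "reduced (va (inv g) w)" "va g (va (inv g) w) = w"
  using va_closed[of "inv g" w] va_mult[of g "inv g" w] va_one[of w] assms by simp_all

lemma tree_act_unique:
  assumes g: "g \<in> carrier G" and x: "x \<in> tree_pts" and y: "y \<in> tree_pts"
    and eq: "\<And>w. reduced w \<Longrightarrow> td y (vtx (va g w)) = td x (vtx w)"
  shows "tree_act g x = y"
proof -
  note z = tree_act[OF g x]
  obtain w where w: "reduced w" "td (tree_act g x) y \<le> td (tree_act g x) (vtx w) - td y (vtx w)"
    using td_dominated_by_vertex[OF z(1) y] by blast
  have "td (tree_act g x) (vtx w) = td y (vtx w)"
    using z(2)[OF va_inv(1)[OF g w(1)]] eq[OF va_inv(1)[OF g w(1)]] unfolding va_inv(2)[OF g w(1)] by simp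
  then have "td (tree_act g x) y = 0" using w(2) td_nonneg[of "tree_act g x" y] by simp
  then show ?thesis using td_zero[OF z(1) y] by blast
qed

lemma tree_act_dist:
  assumes g: "g \<in> carrier G" and x: "x \<in> tree_pts" and y: "y \<in> tree_pts"
  shows "td (tree_act g x) (tree_act g y) = td x y"
proof (rule antisym)
  note X = tree_act[OF g x] and Y = tree_act[OF g y]
  obtain w where w: "reduced w" "td (tree_act g x) (tree_act g y) \<le> td (tree_act g x) (vtx w) - td (tree_act g y) (vtx w)"
    using td_dominated_by_vertex[OF X(1) Y(1)] by blast
  let ?v = "va (inv g) w"
  have "td (tree_act g x) (vtx w) - td (tree_act g y) (vtx w) = td x (vtx ?v) - td y (vtx ?v)"
    using X(2)[OF va_inv(1)[OF g w(1)]] Y(2)[OF va_inv(1)[OF g w(1)]] unfolding va_inv(2)[OF g w(1)] by simp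
  then show "td (tree_act g x) (tree_act g y) \<le> td x y" using w(2) td_triangle[of x "vtx ?v" y] by simp
  obtain w where w: "reduced w" "td x y \<le> td x (vtx w) - td y (vtx w)"
    using td_dominated_by_vertex[OF x y] by blast
  then show "td x y \<le> td (tree_act g x) (tree_act g y)"
    using X(2)[OF w(1)] Y(2)[OF w(1)] td_triangle[of "tree_act g x" "vtx (va g w)" "tree_act g y"] by simp
qed

lemma tree_act_vtx: "g \<in> carrier G \<Longrightarrow> reduced w \<Longrightarrow> tree_act g (vtx w) = vtx (va g w)"
  by (rule tree_act_unique) (simp_all add: va_closed va_dist)

lemma tree_act_one: "x \<in> tree_pts \<Longrightarrow> tree_act \<one> x = x"
  by (rule tree_act_unique) (simp_all add: va_one)

lemma tree_act_mult:
  assumes "g \<in> carrier G" "h \<in> carrier G" "x \<in> tree_pts"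
  shows "tree_act (g \<otimes> h) x = tree_act g (tree_act h x)"
  using tree_act[OF assms(2,3)] tree_act[OF assms(1)] assms va_closed va_mult
  by (intro tree_act_unique) simp_all

end

section \<open>The model group is hierarchically hyperbolic\<close>

definition line_metric :: "real set \<Rightarrow> real metric" where
  "line_metric S = metric (S, \<lambda>x y. \<bar>x - y\<bar>)"

lemma line_metric_simps [simp]: "mspace (line_metric S) = S" "mdist (line_metric S) = (\<lambda>x y. \<bar>x - y\<bar>)"
proof -
  interpret Metric_space S "\<lambda>x y. \<bar>x - y\<bar>" by standard auto
  show "mspace (line_metric S) = S" "mdist (line_metric S) = (\<lambda>x y. \<bar>x - y\<bar>)"
    unfolding line_metric_def by (rule mspace_metric mdist_metric)+
qed

lemma hyperbolic_line_metric: "hyperbolic 0 (line_metric S)"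
proof (rule hyperbolic_zeroI)
  fix x y z w :: real
  have "\<bar>x - y\<bar> + \<bar>z - w\<bar> \<le> \<bar>x - z\<bar> + \<bar>y - w\<bar> \<or> \<bar>x - y\<bar> + \<bar>z - w\<bar> \<le> \<bar>x - w\<bar> + \<bar>y - z\<bar>"
    by linarith
  then show "mdist (line_metric S) x y + mdist (line_metric S) z w \<le>
      max (mdist (line_metric S) x z + mdist (line_metric S) y w) (mdist (line_metric S) x w + mdist (line_metric S) y z)"
    by (simp add: le_max_iff_disj)
qed

lemma geodesic_line_metric:
  assumes "\<And>x y. x \<in> S \<Longrightarrow> y \<in> S \<Longrightarrow> {min x y..max x y} \<subseteq> S"
  shows "geodesic_space (line_metric S)"
  unfolding geodesic_space_def
proof (intro ballI)
  fix x y assume "x \<in> mspace (line_metric S)" "y \<in> mspace (line_metric S)"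
  then have xy: "{min x y..max x y} \<subseteq> S" using assms by simp
  let ?l = "\<bar>x - y\<bar>" and ?g = "\<lambda>s. if x \<le> y then x + s else x - s"
  have "geodesic_segment (line_metric S) (?g ` {0..?l}) x y"
    unfolding geodesic_segment_def
  proof (intro exI[of _ ?g] exI[of _ ?l] conjI ballI)
    show "?g \<in> {0..?l} \<rightarrow> mspace (line_metric S)"
    proof
      fix s assume "s \<in> {0..?l}"
      then have "?g s \<in> {min x y..max x y}" by auto
      then show "?g s \<in> mspace (line_metric S)" using xy by auto
    qed
  qed auto
  then show "\<exists>S'. geodesic_segment (line_metric S) S' x y" by blast
qed

context group
begin

lemma foldr_mult_closed: "set ws \<subseteq> carrier G \<Longrightarrow> foldr (\<otimes>) ws \<one> \<in> carrier G"
  by (induction ws) auto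

lemma quasigeodesic_word_metric:
  assumes A: "finite_generating_set G A"
  shows "quasigeodesic_space (word_metric G A)"
  unfolding quasigeodesic_space_def word_metric_simps[OF A]
proof (rule exI[of _ 1], rule exI[of _ 1], intro conjI ballI)
  fix x y assume xy: "x \<in> carrier G" "y \<in> carrier G"
  have A': "A \<subseteq> carrier G" "generate G A = carrier G" using A by (auto simp: finite_generating_set_def)
  obtain ws where ws: "set ws \<subseteq> A \<union> m_inv G ` A" "foldr (\<otimes>) ws \<one> = inv x \<otimes> y"
    "length ws = word_norm G A (inv x \<otimes> y)"
    using word_norm_ex[OF A'(1), of "inv x \<otimes> y"] xy A'(2) by auto
  have sub: "A \<union> m_inv G ` A \<subseteq> carrier G" using A'(1) by auto
  interpret W: Metric_space "carrier G" "word_dist G A" by (rule Metric_space_word_dist[OF A])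
  define n where "n = length ws"
  define p where "p k = x \<otimes> foldr (\<otimes>) (take k ws) \<one>" for k
  have tk: "set (take k ws) \<subseteq> carrier G" "set (drop k ws) \<subseteq> carrier G" for k
    using ws(1) sub set_take_subset[of k ws] set_drop_subset[of k ws] by blast+
  have pc: "p k \<in> carrier G" for k using foldr_mult_closed[OF tk(1)] xy(1) by (simp add: p_def)
  have step: "word_dist G A (p i) (p k) \<le> real k - real i" if "i \<le> k" for i k
  proof -
    let ?v = "drop i (take k ws)"
    have v: "set ?v \<subseteq> A \<union> m_inv G ` A" "length ?v \<le> k - i"
      using ws(1) set_drop_subset[of i "take k ws"] set_take_subset[of k ws] by auto
    have vs: "set ?v \<subseteq> carrier G" using v(1) sub by blast
    then have vc: "foldr (\<otimes>) ?v \<one> \<in> carrier G" by (rule foldr_mult_closed)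
    have "take i ws @ ?v = take k ws"
      using that append_take_drop_id[of i "take k ws"] by (simp add: min_def)
    then have "foldr (\<otimes>) (take k ws) \<one> = foldr (\<otimes>) (take i ws) \<one> \<otimes> foldr (\<otimes>) ?v \<one>"
      using foldr_mult_append(2)[OF tk(1)[of i] vs] by simp
    then have "p k = p i \<otimes> foldr (\<otimes>) ?v \<one>"
      using foldr_mult_closed[OF tk(1)] xy(1) vc by (simp add: p_def m_assoc)
    then have "inv (p i) \<otimes> p k = foldr (\<otimes>) ?v \<one>"
      using pc vc by (simp add: m_assoc[symmetric])
    then have "word_norm G A (inv (p i) \<otimes> p k) \<le> length ?v" by (intro word_norm_le v) simp
    then have "word_norm G A (inv (p i) \<otimes> p k) \<le> k - i" using v(2) by linarith
    then show ?thesis using pc that by (simp add: word_dist_def)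
  qed
  have ends: "p 0 = x" "p n = y" using xy ws(2) by (simp_all add: p_def n_def m_assoc[symmetric])
  have dxy: "word_dist G A x y = n" using xy ws(3) by (simp add: word_dist_def n_def)
  have exact: "word_dist G A (p i) (p k) = real k - real i" if "i \<le> k" "k \<le> n" for i k
  proof -
    have "word_dist G A x y \<le> word_dist G A (p 0) (p i) + word_dist G A (p i) (p k) + word_dist G A (p k) (p n)"
      using W.triangle[of x "p i" y] W.triangle[of "p i" "p k" y] pc xy unfolding ends by fastforce
    then show ?thesis using step[of 0 i] step[of i k] step[of k n] that unfolding dxy by simp
  qed
  show "\<exists>\<gamma> l. 0 \<le> l \<and> \<gamma> \<in> {0..l} \<rightarrow> carrier G \<and> \<gamma> 0 = x \<and> \<gamma> l = y \<and>
      (\<forall>s\<in>{0..l}. \<forall>t\<in>{0..l}. \<bar>s - t\<bar> / 1 - 1 \<le> word_dist G A (\<gamma> s) (\<gamma> t) \<and> word_dist G A (\<gamma> s) (\<gamma> t) \<le> 1 * \<bar>s - t\<bar> + 1)"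
  \<comment> \<open>A shortest word traversed at unit speed with the parameter rounded down; the
    rounding accounts for the additive constant 1.\<close>
  proof (intro exI[of _ "\<lambda>s. p (nat \<lfloor>s\<rfloor>)"] exI[of _ "real n"] conjI)
    have le: "\<bar>s - t\<bar> - 1 \<le> word_dist G A (p (nat \<lfloor>s\<rfloor>)) (p (nat \<lfloor>t\<rfloor>)) \<and>
        word_dist G A (p (nat \<lfloor>s\<rfloor>)) (p (nat \<lfloor>t\<rfloor>)) \<le> \<bar>s - t\<bar> + 1" if "0 \<le> s" "s \<le> t" "t \<le> real n" for s t
    proof -
      have "nat \<lfloor>s\<rfloor> \<le> nat \<lfloor>t\<rfloor>" "nat \<lfloor>t\<rfloor> \<le> n" using that by (auto simp: floor_mono nat_mono) linarith
      from exact[OF this] have "word_dist G A (p (nat \<lfloor>s\<rfloor>)) (p (nat \<lfloor>t\<rfloor>)) = of_int \<lfloor>t\<rfloor> - of_int \<lfloor>s\<rfloor>"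
        using that by simp
      then show ?thesis using that by linarith
    qed
    show "\<forall>s\<in>{0..real n}. \<forall>t\<in>{0..real n}. \<bar>s - t\<bar> / 1 - 1 \<le> word_dist G A (p (nat \<lfloor>s\<rfloor>)) (p (nat \<lfloor>t\<rfloor>)) \<and>
        word_dist G A (p (nat \<lfloor>s\<rfloor>)) (p (nat \<lfloor>t\<rfloor>)) \<le> 1 * \<bar>s - t\<bar> + 1"
    proof (intro ballI)
      fix s t assume "s \<in> {0..real n}" "t \<in> {0..real n}"
      then show "\<bar>s - t\<bar> / 1 - 1 \<le> word_dist G A (p (nat \<lfloor>s\<rfloor>)) (p (nat \<lfloor>t\<rfloor>)) \<and>
          word_dist G A (p (nat \<lfloor>s\<rfloor>)) (p (nat \<lfloor>t\<rfloor>)) \<le> 1 * \<bar>s - t\<bar> + 1"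
        using le[of s t] le[of t s] W.commute abs_minus_commute[of s t] by (cases "s \<le> t") auto
    qed
  qed (use pc ends in auto)
qed auto

end

text \<open>The plane splits into two lines on which the group acts by translations. In
  \<open>hnn True\<close> the stable letter rotates the plane and mixes them.\<close>

locale tree_plane_translations = tree_plane_group +
  assumes translation: "g \<in> carrier G \<Longrightarrow> pa g p = p + pa g 0"
begin

text \<open>
  The domains are the numbers coding the nonempty subsets of \<open>{0, 1, 2}\<close>: the singletons carry the
  tree and the two coordinate lines of the plane, all other domains a single point.
\<close>

definition doms :: "nat set" where "doms = {n. set_decode n \<noteq> {} \<and> set_decode n \<subseteq> {0, 1, 2}}"

definition spc :: "nat \<Rightarrow> real metric" where
  "spc n = (if set_decode n = {0} then tree_metric
    else line_metric (if set_decode n = {1} \<or> set_decode n = {2} then UNIV else {0}))"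

definition prj :: "nat \<Rightarrow> 'a \<Rightarrow> real" where
  "prj n g = (if set_decode n = {0} then vtx (va g []) else if set_decode n = {1} then Re (pa g 0)
    else if set_decode n = {2} then Im (pa g 0) else 0)"

definition move :: "'a \<Rightarrow> nat \<Rightarrow> real \<Rightarrow> real" where
  "move g n p = (if set_decode n = {0} then tree_act g p else p + prj n g)"

text \<open>A domain that properly contains another or is transverse to one has at least two
  elements, so its space is the point 0 and \<open>{0}\<close> is the right value of
  \<open>rho\<close>. The empty \<open>rho_map\<close> has images of diameter at most any
  bound.\<close>

definition struct :: "('a, nat, real) hhs_data" where
  "struct = \<lparr>domains = doms, hspace = spc, proj = (\<lambda>n g. {prj n g}),
    nest = (\<lambda>m n. set_decode m \<subseteq> set_decode n), orth = (\<lambda>m n. set_decode m \<inter> set_decode n = {}),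
    rho = (\<lambda>_ _. {0}), rho_map = (\<lambda>_ _ _. {})\<rparr>"

lemma struct_simps [simp]:
  "domains struct = doms" "hspace struct = spc" "proj struct n g = {prj n g}"
  "nest struct m n \<longleftrightarrow> set_decode m \<subseteq> set_decode n" "orth struct m n \<longleftrightarrow> set_decode m \<inter> set_decode n = {}"
  "rho struct m n = {0}" "rho_map struct m n p = {}"
  by (simp_all add: struct_def)

lemma set_decode_inject: "set_decode m = set_decode n \<longleftrightarrow> m = n"
  by (metis set_decode_inverse)

lemma pnest_struct: "pnest struct m n \<longleftrightarrow> set_decode m \<subset> set_decode n"
  by (auto simp: pnest_def set_decode_inject psubset_eq)

lemma doms_code: "I \<noteq> {} \<Longrightarrow> I \<subseteq> {0, 1, 2} \<Longrightarrow> \<exists>n\<in>doms. set_decode n = I"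
  using finite_subset[of I "{0, 1, 2}"] by (intro bexI[of _ "set_encode I"]) (auto simp: doms_def)

lemma finite_doms: "finite doms" and card_doms: "card doms \<le> 8"
proof -
  have sub: "doms \<subseteq> set_encode ` Pow {0, 1, 2}"
  proof
    fix n assume "n \<in> doms"
    then show "n \<in> set_encode ` Pow {0, 1, 2}"
      by (intro image_eqI[of _ _ "set_decode n"]) (auto simp: doms_def)
  qed
  then show "finite doms" by (rule finite_subset) auto
  have "card doms \<le> card (set_encode ` Pow {0, 1, 2})" by (rule card_mono[OF _ sub]) auto
  also have "\<dots> \<le> card (Pow {0::nat, 1, 2})" by (rule card_image_le) auto
  also have "\<dots> = 8" by (simp add: card_Pow)
  finally show "card doms \<le> 8" .
qed

lemma set_mdist_singletons [simp]: "set_mdist C {x} {y} = mdist C x y"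
  by (simp add: set_mdist_def)

definition trivial_dom :: "nat \<Rightarrow> bool" where
  "trivial_dom n \<longleftrightarrow> spc n = line_metric {0} \<and> (\<forall>g. prj n g = 0) \<and> (\<forall>g p. move g n p = p)"

lemma trivial_dom_card: "\<not> (\<exists>i\<in>{0, 1, 2}. set_decode n = {i}) \<Longrightarrow> trivial_dom n"
  by (auto simp: trivial_dom_def spc_def prj_def move_def)

lemma trivial_if_pnest: "m \<in> doms \<Longrightarrow> pnest struct m n \<Longrightarrow> trivial_dom n"
  by (rule trivial_dom_card) (auto simp: pnest_struct doms_def)

lemma trivial_if_transverse:
  assumes "m \<in> doms" "transverse struct m n \<or> transverse struct n m"
  shows "trivial_dom n"
  using assms by (intro trivial_dom_card) (auto simp: transverse_def doms_def)

lemma prj_space: "g \<in> carrier G \<Longrightarrow> prj n g \<in> mspace (spc n)"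
  using va_closed[of g "[]"] by (auto simp: prj_def spc_def)

lemma spc_cases:
  assumes "n \<in> doms"
  obtains "set_decode n = {0}" | "set_decode n = {1}" | "set_decode n = {2}" | "trivial_dom n"
  using trivial_dom_card[of n] by blast

lemma geodesic_hyperbolic_spc: "geodesic_space (spc n) \<and> hyperbolic 0 (spc n)"
proof -
  have "geodesic_space (line_metric UNIV)" "geodesic_space (line_metric {0})"
    by (rule geodesic_line_metric; auto)+
  then show ?thesis
    unfolding spc_def using hyperbolic_line_metric hyperbolic_tree_metric geodesic_tree_metric by auto
qed

lemma prj_dense:
  assumes n: "n \<in> doms" and p: "p \<in> mspace (spc n)"
  shows "\<exists>g\<in>carrier G. mdist (spc n) p (prj n g) \<le> 1"
  using n
proof (cases rule: spc_cases)
  case 1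
  then have pt: "p \<in> tree_pts" using p by (simp add: spc_def)
  note P = tree_ptsE[OF pt]
  obtain g where g: "g \<in> carrier G" "va g [] = wt p" using dense[OF P(1), of 0] by blast
  have "td p (vtx (wt p)) \<le> 1" using P(3,4) by (simp add: td_def meet_def)
  then show ?thesis using g 1 by (intro bexI[of _ g]) (auto simp: spc_def prj_def)
next
  case 2
  obtain g where g: "g \<in> carrier G" "cmod (pa g 0 - Complex p 0) \<le> 1" using dense[of "[]" "Complex p 0"] by auto
  have "\<bar>Re (pa g 0 - Complex p 0)\<bar> \<le> 1" using abs_Re_le_cmod g(2) order_trans by blast
  then show ?thesis using g(1) 2 by (intro bexI[of _ g]) (auto simp: spc_def prj_def)
next
  case 3
  obtain g where g: "g \<in> carrier G" "cmod (pa g 0 - Complex 0 p) \<le> 1" using dense[of "[]" "Complex 0 p"] by auto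
  have "\<bar>Im (pa g 0 - Complex 0 p)\<bar> \<le> 1" using abs_Im_le_cmod g(2) order_trans by blast
  then show ?thesis using g(1) 3 by (intro bexI[of _ g]) (auto simp: spc_def prj_def)
next
  case 4
  then show ?thesis using p by (intro bexI[of _ \<one>]) (auto simp: trivial_dom_def)
qed

lemma prj_lipschitz:
  assumes "n \<in> doms" "g \<in> carrier G" "h \<in> carrier G"
  shows "mdist (spc n) (prj n g) (prj n h) \<le> tp_dist g h"
  using assms(1)
proof (cases rule: spc_cases)
  case 1
  then show ?thesis by (simp add: spc_def prj_def tp_dist_def)
next
  case 2
  have "0 \<le> vdist (va g []) (va h [])" using td_nonneg[of "vtx (va g [])" "vtx (va h [])"] by simp
  then show ?thesis using 2 abs_Re_le_cmod[of "pa g 0 - pa h 0"] by (simp add: spc_def prj_def tp_dist_def)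
next
  case 3
  have "0 \<le> vdist (va g []) (va h [])" using td_nonneg[of "vtx (va g [])" "vtx (va h [])"] by simp
  then show ?thesis using 3 abs_Im_le_cmod[of "pa g 0 - pa h 0"] by (simp add: spc_def prj_def tp_dist_def)
next
  case 4
  have "0 \<le> vdist (va g []) (va h [])" using td_nonneg[of "vtx (va g [])" "vtx (va h [])"] by simp
  then show ?thesis using 4 by (simp add: trivial_dom_def tp_dist_def)
qed

section \<open>The axioms for the product of a tree and two lines\<close>

lemmas simps_X = word_metric_simps[OF generating]

lemma struct_projections: "hhs_projections (word_metric G A) struct 0 1"
  unfolding hhs_projections_def simps_X
proof (intro ballI conjI)
  fix n x assume n: "n \<in> domains struct" and x: "x \<in> carrier G"
  show "proj struct n x \<subseteq> mspace (hspace struct n)" using prj_space[OF x] by simp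
  show "proj struct n x \<noteq> {}" by simp
  have "mdist (spc n) (prj n x) (prj n x) = 0" using prj_space[OF x] by simp
  then show "diam_le (hspace struct n) (proj struct n x) 0" by (simp add: diam_le_def)
  fix y assume y: "y \<in> carrier G"
  show "dW struct n (proj struct n x) (proj struct n y) \<le> 1 * word_dist G A x y + 1"
    using prj_lipschitz[of n x y] tp_dist_word_dist(1)[OF x y] n x y by simp
next
  fix n assume n: "n \<in> domains struct"
  show "quasiconvex 1 (hspace struct n) (\<Union>x\<in>carrier G. proj struct n x)"
    unfolding quasiconvex_def
  proof (intro ballI allI impI subsetI)
    fix x y S p assume S: "geodesic_segment (hspace struct n) S x y" and p: "p \<in> S"
    have pC: "p \<in> mspace (spc n)" using geodesic_segment_between(1)[OF S p] by simp
    then show "p \<in> cnbhd (hspace struct n) 1 (\<Union>x\<in>carrier G. proj struct n x)"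
      using prj_dense[of n p] n by (auto simp: cnbhd_def)
  qed
qed

lemma struct_nesting: "hhs_nesting struct 0"
  unfolding hhs_nesting_def
proof (intro conjI ballI impI)
  show "reflp_on (domains struct) (nest struct)" by (auto intro!: reflp_onI)
  show "transp_on (domains struct) (nest struct)" by (auto intro!: transp_onI)
  show "antisymp_on (domains struct) (nest struct)"
    by (intro antisymp_onI) (simp add: set_decode_inject[symmetric])
  obtain t where t: "t \<in> doms" "set_decode t = {0, 1, 2}" using doms_code[of "{0, 1, 2}"] by blast
  have "\<exists>!S. S \<in> domains struct \<and> (\<forall>W\<in>domains struct. nest struct S W \<longrightarrow> W = S)"
  proof (rule ex1I[of _ t])
    have "W = t" if "W \<in> doms" "set_decode t \<subseteq> set_decode W" for W
      using that t(2) set_decode_inject[of W t] by (auto simp: doms_def)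
    then show "t \<in> domains struct \<and> (\<forall>W\<in>domains struct. nest struct t W \<longrightarrow> W = t)" using t(1) by simp
    fix S assume S: "S \<in> domains struct \<and> (\<forall>W\<in>domains struct. nest struct S W \<longrightarrow> W = S)"
    then have "set_decode S \<subseteq> set_decode t" using t(2) by (simp add: doms_def)
    then have "t = S" using S t(1) by simp
    then show "S = t" ..
  qed
  then show "domains struct = {} \<or> (\<exists>!S. S \<in> domains struct \<and> (\<forall>W\<in>domains struct. nest struct S W \<longrightarrow> W = S))" ..
  fix V W assume "V \<in> domains struct" "pnest struct V W"
  then have W: "trivial_dom W" using trivial_if_pnest by simp
  show "rho struct V W \<noteq> {}" "rho struct V W \<subseteq> mspace (hspace struct W)" "diam_le (hspace struct W) (rho struct V W) 0"
    using W by (auto simp: trivial_dom_def diam_le_def)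
  show "rho_map struct W V p \<subseteq> mspace (hspace struct V)" for p by simp
qed

lemma struct_orthogonality: "hhs_orthogonality struct"
  unfolding hhs_orthogonality_def
proof (intro conjI ballI impI)
  show "symp_on (domains struct) (orth struct)" by (auto intro!: symp_onI)
  show "irreflp_on (domains struct) (orth struct)" by (auto intro!: irreflp_onI simp: doms_def)
  show "orth struct V U" if "nest struct V W \<and> orth struct W U" for U V W using that by auto
  show "\<not> nest struct V W" "\<not> nest struct W V" if "V \<in> domains struct" "W \<in> domains struct" "orth struct V W" for V W
    using that by (auto simp: doms_def)
  fix T U assume T: "T \<in> domains struct" and U: "U \<in> below struct T" and ne: "{V \<in> below struct T. orth struct V U} \<noteq> {}"
  \<comment> \<open>The complement of \<open>U\<close> in \<open>T\<close> is the container for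
    orthogonality; it differs from \<open>T\<close> because \<open>U\<close> is nonempty.\<close>
  let ?I = "set_decode T - set_decode U"
  have "?I \<noteq> {}" "?I \<subseteq> {0, 1, 2}" using T ne by (auto simp: below_def doms_def)
  from doms_code[OF this] obtain W where W: "W \<in> doms" "set_decode W = ?I" by auto
  have "W \<in> below struct T - {T}" using W U by (auto simp: below_def doms_def)
  moreover have "nest struct V W" if "orth struct V U \<and> nest struct V T" for V using that W(2) by auto
  ultimately show "\<exists>W\<in>below struct T - {T}. \<forall>V\<in>domains struct. orth struct V U \<and> nest struct V T \<longrightarrow> nest struct V W"
    by blast
qed

lemma struct_consistency: "hhs_consistency (word_metric G A) struct 0 0"
  unfolding hhs_consistency_def
proof (intro conjI ballI impI)
  fix V W assume V: "V \<in> domains struct" and W: "W \<in> domains struct" and t: "transverse struct V W"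
  have VW: "trivial_dom V" "trivial_dom W" using trivial_if_transverse[of V W] trivial_if_transverse[of W V] V W t by auto
  show "rho struct V W \<noteq> {}" "rho struct V W \<subseteq> mspace (hspace struct W)" "diam_le (hspace struct W) (rho struct V W) 0"
    "rho struct W V \<noteq> {}" "rho struct W V \<subseteq> mspace (hspace struct V)" "diam_le (hspace struct V) (rho struct W V) 0"
    using VW by (auto simp: trivial_dom_def diam_le_def)
  show "min (dW struct W (proj struct W x) (rho struct V W)) (dW struct V (proj struct V x) (rho struct W V)) \<le> 0" for x
    using VW by (simp add: trivial_dom_def)
next
  fix V W x assume "V \<in> domains struct" "pnest struct V W"
  then have "trivial_dom W" using trivial_if_pnest by simp
  then show "dW struct W (proj struct W x) (rho struct V W) \<le> 0 \<or>
      diam_le (hspace struct V) (proj struct V x \<union> (\<Union>p\<in>proj struct W x. rho_map struct W V p)) 0"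
    by (simp add: trivial_dom_def)
next
  fix U V W assume "V \<in> domains struct" "nest struct U V \<and> (pnest struct V W \<or> transverse struct V W \<and> \<not> orth struct W U)"
  then have "trivial_dom W" using trivial_if_pnest[of V W] trivial_if_transverse[of V W] by auto
  then show "dW struct W (rho struct U W) (rho struct V W) \<le> 0" by (simp add: trivial_dom_def)
qed

lemma struct_finite_complexity: "hhs_finite_complexity struct"
  unfolding hhs_finite_complexity_def
proof (intro exI[of _ 8] allI impI)
  fix F assume "F \<subseteq> domains struct"
  then show "finite F \<and> card F \<le> 8"
    using finite_doms card_doms card_mono[OF finite_doms, of F] finite_subset[OF _ finite_doms] by auto
qed

lemma struct_large_links: "hhs_large_links (word_metric G A) struct 0 0"
  unfolding hhs_large_links_def Let_def
\<comment> \<open>There are at most 8 domains and \<open>N\<close> is at least 8, so the family can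
  consist of every domain properly below \<open>W\<close>.\<close>
proof (intro exI[of _ 8] conjI ballI)
  fix W x x' assume W: "W \<in> domains struct"
  let ?N = "8 * dW struct W (proj struct W x) (proj struct W x') + 8"
  let ?T = "below struct W - {W}"
  have N: "?N \<ge> 8" by simp
  have fin: "finite ?T" using finite_doms by (simp add: below_def)
  have "?T \<subseteq> doms" by (auto simp: below_def)
  then have "card ?T \<le> 8" using card_mono[OF finite_doms] card_doms order_trans by blast
  then have card: "int (card ?T) \<le> \<lfloor>?N\<rfloor>" using N by linarith
  have near: "dW struct W (proj struct W x) (rho struct T W) \<le> ?N" if "T \<in> ?T" for T
  proof -
    have "trivial_dom W" using that by (intro trivial_if_pnest[of T]) (auto simp: below_def pnest_def)
    then show ?thesis by (simp add: trivial_dom_def)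
  qed
  show "\<exists>\<T>\<subseteq>?T. finite \<T> \<and> int (card \<T>) \<le> \<lfloor>?N\<rfloor> \<and>
      (\<forall>T\<in>?T. (\<exists>T'\<in>\<T>. T \<in> below struct T') \<or> dW struct T (proj struct T x) (proj struct T x') < 8) \<and>
      (\<forall>T'\<in>\<T>. dW struct W (proj struct W x) (rho struct T' W) \<le> ?N)"
  proof (intro exI[of _ ?T] conjI ballI)
    fix T assume "T \<in> ?T"
    then show "(\<exists>T'\<in>?T. T \<in> below struct T') \<or> dW struct T (proj struct T x) (proj struct T x') < 8"
      by (intro disjI1 bexI[of _ T]) (auto simp: below_def)
  qed (use fin card near in auto)
qed auto

lemma struct_bounded_geodesic_image: "hhs_bounded_geodesic_image struct"
  unfolding hhs_bounded_geodesic_image_def by (intro exI[of _ 1]) (simp add: diam_le_def)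

text \<open>The factors are independent: \<open>dense\<close> yields one element with prescribed
  vertex and almost prescribed point of the plane. Coordinates outside the family are filled with
  the base point.\<close>

lemma struct_partial_realization: "hhs_partial_realization (word_metric G A) struct"
  unfolding hhs_partial_realization_def simps_X
proof (intro exI[of _ 1] allI impI, elim conjE)
  fix F p assume F: "F \<subseteq> domains struct" and p: "\<forall>V\<in>F. p V \<in> (\<Union>x\<in>carrier G. proj struct V x)"
  then obtain x where x: "\<And>V. V \<in> F \<Longrightarrow> x V \<in> carrier G \<and> p V = prj V (x V)" by simp metis
  define c where "c i = (SOME n. set_decode n = {i})" for i :: nat
  have c: "n = c i" if "set_decode n = {i}" for n i
    using someI[of "\<lambda>n. set_decode n = {i}", OF that] that set_decode_inject unfolding c_def by metis
  define w where "w = (if c 0 \<in> F then va (x (c 0)) [] else [])"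
  define z where "z = Complex (if c 1 \<in> F then Re (pa (x (c 1)) 0) else 0) (if c 2 \<in> F then Im (pa (x (c 2)) 0) else 0)"
  have "reduced w" using x va_closed by (auto simp: w_def)
  then obtain g where g: "g \<in> carrier G" "va g [] = w" "cmod (pa g 0 - z) \<le> 1" using dense by blast
  have ri: "\<bar>Re (pa g 0 - z)\<bar> \<le> 1" "\<bar>Im (pa g 0 - z)\<bar> \<le> 1"
    using abs_Re_le_cmod[of "pa g 0 - z"] abs_Im_le_cmod[of "pa g 0 - z"] g(3) by linarith+
  have near: "mdist (spc V) (prj V g) (p V) \<le> 1" if V: "V \<in> F" for V
  proof -
    have "V \<in> doms" using V F by auto
    then show ?thesis
    proof (cases rule: spc_cases)
      case 1
      then show ?thesis using x[OF V] V c[OF 1] g(2) by (simp add: spc_def prj_def w_def)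
    next
      case 2
      then show ?thesis using x[OF V] V c[OF 2] ri(1) by (simp add: spc_def prj_def z_def)
    next
      case 3
      then show ?thesis using x[OF V] V c[OF 3] ri(2) by (simp add: spc_def prj_def z_def)
    next
      case 4
      then show ?thesis using x[OF V] by (simp add: trivial_dom_def)
    qed
  qed
  have "dW struct W (proj struct W g) (rho struct V W) \<le> 1"
    if "V \<in> F" "pnest struct V W \<or> transverse struct W V" for V W
  proof -
    have "V \<in> doms" using that F by auto
    then have "trivial_dom W" using that trivial_if_pnest[of V W] trivial_if_transverse[of V W] by blast
    then show ?thesis by (simp add: trivial_dom_def)
  qed
  then show "\<exists>x\<in>carrier G. (\<forall>V\<in>F. dW struct V (proj struct V x) {p V} \<le> 1) \<and>
      (\<forall>V\<in>F. \<forall>W\<in>domains struct. pnest struct V W \<or> transverse struct W V \<longrightarrow>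
        dW struct W (proj struct W x) (rho struct V W) \<le> 1)"
    using g(1) near by (intro bexI[of _ g]) simp_all
qed

lemma struct_uniqueness: "hhs_uniqueness (word_metric G A) struct"
  unfolding hhs_uniqueness_def simps_X
proof (intro allI impI)
  fix \<kappa> :: real assume "0 \<le> \<kappa>"
  obtain a b c where abc: "a \<in> doms" "set_decode a = {0}" "b \<in> doms" "set_decode b = {1}" "c \<in> doms" "set_decode c = {2}"
    using doms_code[of "{0}"] doms_code[of "{1}"] doms_code[of "{2}"] by auto
  \<comment> \<open>Three factors each contributing less than \<open>\<kappa>\<close> keep
    \<open>tp_dist\<close> below \<open>3 * \<kappa>\<close>, hence the word distance below
    \<open>13 * 3 * \<kappa>\<close>.\<close>
  have "\<exists>V\<in>doms. \<kappa> \<le> mdist (spc V) (prj V x) (prj V y)"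
    if xy: "x \<in> carrier G" "y \<in> carrier G" "39 * \<kappa> \<le> word_dist G A x y" for x y
  proof (rule ccontr)
    assume "\<not> ?thesis"
    then have "mdist (spc a) (prj a x) (prj a y) < \<kappa>" "mdist (spc b) (prj b x) (prj b y) < \<kappa>"
      "mdist (spc c) (prj c x) (prj c y) < \<kappa>" using abc(1,3,5) by (auto simp: not_le)
    then have "vdist (va x []) (va y []) < \<kappa>" "\<bar>Re (pa x 0 - pa y 0)\<bar> < \<kappa>" "\<bar>Im (pa x 0 - pa y 0)\<bar> < \<kappa>"
      by (simp_all add: spc_def prj_def abc)
    then have "tp_dist x y < 3 * \<kappa>" using cmod_le[of "pa x 0 - pa y 0"] unfolding tp_dist_def by linarith
    then show False using tp_dist_word_dist(2)[OF xy(1,2)] xy(3) by linarith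
  qed
  then show "\<exists>\<theta>. \<forall>x\<in>carrier G. \<forall>y\<in>carrier G. \<theta> \<le> word_dist G A x y \<longrightarrow>
      (\<exists>V\<in>domains struct. \<kappa> \<le> dW struct V (proj struct V x) (proj struct V y))"
    by (intro exI[of _ "39 * \<kappa>"]) simp
qed

lemma struct_hhs: "hhs_structure (word_metric G A) struct"
  unfolding hhs_structure_def
proof (intro conjI)
  show "quasigeodesic_space (word_metric G A)" by (rule quasigeodesic_word_metric[OF generating])
  show "\<exists>\<delta>\<ge>0. \<forall>W\<in>domains struct. geodesic_space (hspace struct W) \<and> hyperbolic \<delta> (hspace struct W)"
    using geodesic_hyperbolic_spc by (intro exI[of _ 0]) simp
  show "\<exists>\<xi>\<ge>0. \<exists>K. \<exists>\<kappa>\<^sub>0\<ge>0. hhs_projections (word_metric G A) struct \<xi> K \<and> hhs_nesting struct \<xi> \<and> hhs_orthogonality struct \<and>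
       hhs_consistency (word_metric G A) struct \<xi> \<kappa>\<^sub>0 \<and> hhs_finite_complexity struct \<and> hhs_large_links (word_metric G A) struct \<xi> \<kappa>\<^sub>0 \<and>
       hhs_bounded_geodesic_image struct \<and> hhs_partial_realization (word_metric G A) struct \<and> hhs_uniqueness (word_metric G A) struct"
    using struct_projections struct_nesting struct_orthogonality struct_consistency struct_finite_complexity
      struct_large_links struct_bounded_geodesic_image struct_partial_realization struct_uniqueness
    by (intro exI[of _ 0] exI[of _ 1] conjI) auto
qed

section \<open>Equivariance of the structure\<close>

lemma move_mult:
  assumes "g \<in> carrier G" "h \<in> carrier G" "p \<in> mspace (spc n)" "n \<in> doms"
  shows "move (g \<otimes> h) n p = move g n (move h n p)"
  using assms(4)
proof (cases rule: spc_cases)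
  case 1
  then show ?thesis using tree_act_mult[OF assms(1,2), of p] assms(3) by (simp add: move_def spc_def)
next
  case 2
  then show ?thesis using pa_mult[OF assms(1,2), of 0] translation[OF assms(1), of "pa h 0"] by (simp add: move_def prj_def)
next
  case 3
  then show ?thesis using pa_mult[OF assms(1,2), of 0] translation[OF assms(1), of "pa h 0"] by (simp add: move_def prj_def)
next
  case 4
  then show ?thesis by (simp add: trivial_dom_def)
qed

lemma move_one:
  assumes "p \<in> mspace (spc n)" "n \<in> doms"
  shows "move \<one> n p = p"
  using assms(2)
proof (cases rule: spc_cases)
  case 1
  then show ?thesis using assms tree_act_one[of p] by (simp add: move_def spc_def)
next
  case 2
  then show ?thesis by (simp add: move_def prj_def pa_one)
next
  case 3
  then show ?thesis by (simp add: move_def prj_def pa_one)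
next
  case 4
  then show ?thesis using assms by (simp add: trivial_dom_def)
qed

lemma move_closed:
  assumes "g \<in> carrier G" "p \<in> mspace (spc n)" "n \<in> doms"
  shows "move g n p \<in> mspace (spc n)"
  using assms(3)
proof (cases rule: spc_cases)
  case 1
  then show ?thesis using assms tree_act(1)[of g p] by (simp add: move_def spc_def)
next
  case 2
  then show ?thesis by (simp add: spc_def)
next
  case 3
  then show ?thesis by (simp add: spc_def)
next
  case 4
  then show ?thesis using assms by (simp add: trivial_dom_def)
qed

lemma move_dist:
  assumes "g \<in> carrier G" "p \<in> mspace (spc n)" "q \<in> mspace (spc n)" "n \<in> doms"
  shows "mdist (spc n) (move g n p) (move g n q) = mdist (spc n) p q"
  using assms(4)
proof (cases rule: spc_cases)
  case 1
  then show ?thesis using assms tree_act_dist[of g p q] by (simp add: move_def spc_def)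
next
  case 2
  then show ?thesis by (simp add: move_def spc_def)
next
  case 3
  then show ?thesis by (simp add: move_def spc_def)
next
  case 4
  then show ?thesis using assms by (simp add: trivial_dom_def)
qed

lemma move_prj:
  assumes "g \<in> carrier G" "x \<in> carrier G" "n \<in> doms"
  shows "move g n (prj n x) = prj n (g \<otimes> x)"
  using assms(3)
proof (cases rule: spc_cases)
  case 1
  then show ?thesis
    using tree_act_vtx[OF assms(1) va_closed[OF assms(2), of "[]"]] va_mult[OF assms(1,2), of "[]"] by (simp add: move_def prj_def)
next
  case 2
  then show ?thesis using pa_mult[OF assms(1,2), of 0] translation[OF assms(1), of "pa x 0"] by (simp add: move_def prj_def)
next
  case 3
  then show ?thesis using pa_mult[OF assms(1,2), of 0] translation[OF assms(1), of "pa x 0"] by (simp add: move_def prj_def)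
next
  case 4
  then show ?thesis by (simp add: trivial_dom_def)
qed

lemma move_bij:
  assumes g: "g \<in> carrier G" and n: "n \<in> doms"
  shows "bij_betw (move g n) (mspace (spc n)) (mspace (spc n))"
proof (rule bij_betw_byWitness[where f' = "move (inv g) n"])
  show "\<forall>p\<in>mspace (spc n). move (inv g) n (move g n p) = p" "\<forall>p\<in>mspace (spc n). move g n (move (inv g) n p) = p"
    using g n by (auto simp: move_mult[symmetric] move_one)
qed (use g n move_closed in auto)

theorem HHG: "HHG TYPE(nat) TYPE(real) G"
proof -
  \<comment> \<open>All domains are fixed; the restriction makes \<open>\<sigma> g\<close>
    extensional, as members of \<open>BijGroup\<close> are.\<close>
  define \<sigma> :: "'a \<Rightarrow> nat \<Rightarrow> nat" where "\<sigma> g = (\<lambda>n\<in>doms. n)" for g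
  have s: "\<sigma> g n = n" if "n \<in> doms" for g n using that by (simp add: \<sigma>_def)
  have act: "group_action G doms \<sigma>"
  proof -
    have bij: "(\<lambda>n\<in>doms. n) \<in> carrier (BijGroup doms)"
      by (auto simp: BijGroup_def Bij_def bij_betw_def inj_on_def)
    have "\<sigma> \<in> hom G (BijGroup doms)"
    proof (rule homI)
      fix g h
      show "\<sigma> g \<in> carrier (BijGroup doms)" using bij by (simp add: \<sigma>_def)
      show "\<sigma> (g \<otimes> h) = \<sigma> g \<otimes>\<^bsub>BijGroup doms\<^esub> \<sigma> h"
        using bij by (auto simp: \<sigma>_def BijGroup_def compose_def restrict_def fun_eq_iff)
    qed
    then show ?thesis
      unfolding group_action_def group_hom_def group_hom_axioms_def by (simp add: group_BijGroup is_group)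
  qed
  have "finite (orbits G doms \<sigma>)"
    using finite_doms by (simp add: orbits_def setcompr_eq_image)
  moreover have "move g V ` rho struct U V = rho struct (\<sigma> g U) (\<sigma> g V)"
    if "U \<in> doms" "V \<in> doms" "transverse struct U V \<or> pnest struct U V" for g U V
  proof -
    have "trivial_dom V" using that trivial_if_pnest[of U V] trivial_if_transverse[of U V] by blast
    then show ?thesis by (simp add: trivial_dom_def)
  qed
  ultimately have "hhg_structure G A struct \<sigma> move"
    unfolding hhg_structure_def using struct_hhs act
    by (auto simp: s move_bij move_dist move_mult move_prj)
  then show ?thesis unfolding HHG_def using generating is_group by blast
qed

end

theorem ex_HHG_quasi_isometric_leary_minasyan:
  "\<exists>Q :: nat monoid. HHG TYPE(nat) TYPE(real) Q \<and> quasi_isometric_groups leary_minasyan Q"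
proof -
  let ?G = "hnn False"
  \<comment> \<open>Normal forms are countable data, so coding them numbers the elements injectively
    and yields a copy on \<open>nat\<close>.\<close>
  define f where "f g = (let n = nf False g in to_nat (fst n, gre (snd n), gim (snd n)))" for g
  have inj: "inj_on f (carrier ?G)"
  proof (rule inj_onI)
    fix g h assume gh: "g \<in> carrier ?G" "h \<in> carrier ?G" "f g = f h"
    then have "nf False g = nf False h" by (simp add: f_def Let_def gint_eq_iff prod_eq_iff)
    then show "g = h" using nel_nf[OF gh(1)] nel_nf[OF gh(2)] by metis
  qed
  let ?d = "inv_into (carrier ?G) f"
  interpret G: tree_plane_group ?G "gens False" "va False" "pa False" by (rule tree_plane_group_hnn)
  have Q: "tree_plane_group (image_group f ?G) (f ` gens False) (va False \<circ> ?d) (pa False \<circ> ?d)"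
    by (rule G.tree_plane_group_image[OF inj])
  interpret Q: tree_plane_translations "image_group f ?G" "f ` gens False" "va False \<circ> ?d" "pa False \<circ> ?d"
  proof (intro tree_plane_translations.intro Q tree_plane_translations_axioms.intro)
    fix g p assume "g \<in> carrier (image_group f ?G)"
    then have "?d g \<in> carrier ?G" by (simp add: image_group_def inv_into_into)
    from pa_translation[OF this, of p] show "(pa False \<circ> ?d) g p = p + (pa False \<circ> ?d) g 0"
      by (simp only: o_apply)
  qed
  show ?thesis
    using Q.HHG quasi_isometric_tree_plane_groups[OF tree_plane_group_hnn[of True] Q]
    unfolding leary_minasyan_hnn by blast
qed

theorem corollary5p4:
  shows "GBS2 leary_minasyan \<and>
    \<not> virtually_HHG TYPE('i) TYPE('p) leary_minasyan \<and>
    (\<exists>Q :: nat monoid. HHG TYPE(nat) TYPE(real) Q \<and> quasi_isometric_groups leary_minasyan Q)"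
  using GBS2_leary_minasyan leary_minasyan_not_virtually_HHG ex_HHG_quasi_isometric_leary_minasyan by blast

end
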